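(* Let $k\in\frac12\mathbb{Z}_{>0}$ and let $\lambda$ be a partition with at most $k$ boxes. If $n\in\mathbb{C}$ is such that the partition algebra $\mathbb{C}A_k(n)$ is semisimple, then $$A_k^\lambda(n)=\mathbb{C}\otimes_{\mathbb{Z}[x]}A_{k,\mathbb{Z}}^\lambda$$ is the irreducible $\mathbb{C}A_k(n)$-module indexed by $\lambda$. Here $A_{k,\mathbb{Z}}^\lambda$ is the Specht module of the integral partition algebra $A_{k,\mathbb{Z}}$ (defined in the context), and the tensor product is formed via the homomorphism $\mathbb{Z}[x]\to\mathbb{C}$, $x\mapsto n$.
   Context: Partition algebras. For an integer $m\ge0$, $A_m$ is the set of set partitions of $\{1,\ldots,m,1',\ldots,m'\}$, and $A_{m+\frac12}$ is the set of $d\in A_{m+1}$ in which $m+1$ and $(m+1)'$ are in the same block. The composition $d_1\circ d_2$ is obtained by placing $d_1$ above $d_2$ (top row unprimed, bottom row primed), identifying bottom vertex $i'$ of $d_1$ with top vertex $i$ of $d_2$, and removing the connected components lying entirely in the middle row; let $\ell$ be the number of components removed. The partition algebra $\mathbb{C}A_k(n)$ has basis $A_k$ and product $d_1d_2=n^\ell(d_1\circ d_2)$. For an indeterminate $x$, $A_{k,\mathbb{Z}}$ is the $\mathbb{Z}[x]$-algebra that is free over $\mathbb{Z}[x]$ with basis $A_k$ and product $d_1d_2=x^\ell(d_1\circ d_2)$, so that $\mathbb{C}A_k(n)=\mathbb{C}\otimes_{\mathbb{Z}[x]}A_{k,\mathbb{Z}}$ via $x\mapsto n$. The propagating number of $d$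 is the number of blocks of $d$ containing both an unprimed and a primed element. Specht modules. Let $r=|\lambda|$ be the number of boxes of $\lambda=(\lambda_1,\lambda_2,\ldots)$ and let $\lambda'=(\lambda_1',\lambda_2',\ldots)$ be the conjugate partition. Let $S_\lambda=S_{\lambda_1}\times S_{\lambda_2}\times\cdots$ and $S_{\lambda'}=S_{\lambda'_1}\times S_{\lambda'_2}\times\cdots$ be the Young subgroups of $S_r$, put ${\bf 1}_\lambda=\sum_{w\in S_\lambda}w$ and $\varepsilon_{\lambda'}=\sum_{w\in S_{\lambda'}}(-1)^{\ell(w)}w$ (signed sum), and let $\tau\in S_r$ be the permutation that takes the row reading tableau of shape $\lambda$ to the column reading tableau of shape $\lambda$. Put $p_\lambda={\bf 1}_\lambda\,\tau\varepsilon_{\lambda'}\tau^{-1}\in\mathbb{Z}S_r$, where a permutation $w\in S_r$ is regarded as the diagram in $A_r$ with blocks $\{i,w(i)'\}$ and products are products of diagrams; equivalently, $p_\lambda$ is the sum over the row stabilizer times the signed sum over the column stabilizer of the row reading tableau of shape $\lambda$. Let $e_\lambda\in A_{k,\mathbb{Z}}$ be the image of $p_\lambda$ under the linear extension of the following map on permutation diagrams of $S_r$: if $k$ is an integer, add the singleton blocks $\{i\},\{i'\}$ for $r<i\le k$; if $k=m+\frac12$ with $m$ an integer, add the single block $\{r+1,\ldots,m+1,(r+1)',\ldots,(m+1)'\}$. Let $I_{r,\mathbb{Z}}\subseteq A_{k,\mathbb{Z}}$ be the ideal spanned over $\mathbb{Z}[x]$ by those $d\in A_k$ whose propagating number is $<r$.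 The Specht module is $$A_{k,\mathbb{Z}}^\lambda=\text{image of } A_{k,\mathbb{Z}}e_\lambda \text{ in } A_{k,\mathbb{Z}}/I_{r,\mathbb{Z}} .$$ Indexing. When $\mathbb{C}A_k(n)$ is semisimple its irreducible modules are indexed by the partitions $\mu$ with at most $k$ boxes, as follows. For integers $n\ge 2k$ let $V=\mathbb{C}^n$ be the permutation representation of $S_n$; if $k$ is an integer, the module indexed by $\mu$ is the multiplicity space of the irreducible $S_n$-module $S_n^{(n-|\mu|,\mu)}$ in $V^{\otimes k}$, and if $k=m+\frac12$ it is the multiplicity space of the irreducible $S_{n-1}$-module $S_{n-1}^{(n-1-|\mu|,\mu)}$ in $V^{\otimes m}$ (under the usual commuting action of the partition algebra on tensor space). The character values of these modules on diagrams are polynomials in $n$, and for any $n\in\mathbb{C}$ with $\mathbb{C}A_k(n)$ semisimple the module indexed by $\mu$ is the irreducible module whose character is given by these polynomials evaluated at $n$.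
   Formalization: For k=m+1/2 the ideal I_r is spanned by the diagrams of propagating number < r+1 (the block of m+1 and (m+1)' is not counted); with the bound r the claim fails, e.g. for k=3/2, λ=(1), where the Specht module would be the 5-dimensional regular module. *)

theory Defs
  imports
    Complex_Main
    "HOL-Library.Disjoint_Sets"
    "HOL-Library.Poly_Mapping"
    "HOL-Computational_Algebra.Polynomial"
    "HOL-Combinatorics.Permutations"
    "HOL-Algebra.Module"
    "HOL-Algebra.AbelCoset"
    "HOL-Algebra.Free_Abelian_Groups"
begin

section \<open>Left modules over rings that need not be commutative\<close>

text \<open>A left module is a HOL-Algebra \<^typ>\<open>('a, 'm) module\<close> record; its \<open>mult\<close> and \<open>one\<close>
  fields are irrelevant. The locale \<open>module\<close> of HOL-Algebra requires a commutative ring,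
  whereas \<open>submodule\<close> does not and is used as it stands.\<close>

definition left_module :: "('a, 'x) ring_scheme \<Rightarrow> ('a, 'm) module \<Rightarrow> bool" where
  "left_module A M \<longleftrightarrow> ring A \<and> abelian_group M \<and>
     (\<forall>a\<in>carrier A. \<forall>m\<in>carrier M. a \<odot>\<^bsub>M\<^esub> m \<in> carrier M) \<and>
     (\<forall>a\<in>carrier A. \<forall>b\<in>carrier A. \<forall>m\<in>carrier M.
        (a \<oplus>\<^bsub>A\<^esub> b) \<odot>\<^bsub>M\<^esub> m = a \<odot>\<^bsub>M\<^esub> m \<oplus>\<^bsub>M\<^esub> b \<odot>\<^bsub>M\<^esub> m) \<and>
     (\<forall>a\<in>carrier A. \<forall>m\<in>carrier M. \<forall>m'\<in>carrier M.
        a \<odot>\<^bsub>M\<^esub> (m \<oplus>\<^bsub>M\<^esub> m') = a \<odot>\<^bsub>M\<^esub> m \<oplus>\<^bsub>M\<^esub> a \<odot>\<^bsub>M\<^esub> m') \<and>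
     (\<forall>a\<in>carrier A. \<forall>b\<in>carrier A. \<forall>m\<in>carrier M.
        (a \<otimes>\<^bsub>A\<^esub> b) \<odot>\<^bsub>M\<^esub> m = a \<odot>\<^bsub>M\<^esub> (b \<odot>\<^bsub>M\<^esub> m)) \<and>
     (\<forall>m\<in>carrier M. \<one>\<^bsub>A\<^esub> \<odot>\<^bsub>M\<^esub> m = m)"

definition irreducible_module :: "('a, 'x) ring_scheme \<Rightarrow> ('a, 'm) module \<Rightarrow> bool" where
  "irreducible_module A M \<longleftrightarrow> left_module A M \<and> carrier M \<noteq> {\<zero>\<^bsub>M\<^esub>} \<and>
     (\<forall>U. submodule U A M \<longrightarrow> U = {\<zero>\<^bsub>M\<^esub>} \<or> U = carrier M)"

definition semisimple_module :: "('a, 'x) ring_scheme \<Rightarrow> ('a, 'm) module \<Rightarrow> bool" where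
  "semisimple_module A M \<longleftrightarrow> left_module A M \<and>
     (\<forall>U. submodule U A M \<longrightarrow>
        (\<exists>W. submodule W A M \<and> U \<inter> W = {\<zero>\<^bsub>M\<^esub>} \<and> U <+>\<^bsub>M\<^esub> W = carrier M))"

definition regular_module :: "'a ring \<Rightarrow> ('a, 'a) module" where
  "regular_module A = \<lparr>carrier = carrier A, mult = mult A, one = one A,
     ring.zero = \<zero>\<^bsub>A\<^esub>, ring.add = ring.add A, smult = mult A\<rparr>"

definition semisimple_ring :: "'a ring \<Rightarrow> bool" where
  "semisimple_ring A \<longleftrightarrow> semisimple_module A (regular_module A)"

definition quotient_module :: "('a, 'm) module \<Rightarrow> 'm set \<Rightarrow> ('a, 'm set) module" where
  "quotient_module M U = \<lparr>carrier = a_rcosets\<^bsub>M\<^esub> U, mult = undefined, one = undefined,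
     ring.zero = U, ring.add = set_add M,
     smult = (\<lambda>a X. \<Union>m\<in>X. U +>\<^bsub>M\<^esub> (a \<odot>\<^bsub>M\<^esub> m))\<rparr>"


section \<open>Set partition diagrams\<close>

text \<open>\<open>Whole m\<close> stands for the integer \<open>m\<close>, and \<open>Half m\<close> for \<open>m + 1/2\<close>.\<close>

datatype half_integer = Whole nat | Half nat

fun hval :: "half_integer \<Rightarrow> rat" where
  "hval (Whole m) = of_nat m"
| "hval (Half m) = of_nat m + 1 / 2"

fun strands :: "half_integer \<Rightarrow> nat" where
  "strands (Whole m) = m"
| "strands (Half m) = m + 1"

datatype vertex = Unprimed nat | Primed nat

type_synonym diagram = "vertex set set"

definition vertices :: "nat \<Rightarrow> vertex set" where
  "vertices m = Unprimed ` {1..m} \<union> Primed ` {1..m}"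

fun diagrams :: "half_integer \<Rightarrow> diagram set" where
  "diagrams (Whole m) = {d. partition_on (vertices m) d}"
| "diagrams (Half m) = {d. partition_on (vertices (m + 1)) d \<and>
     (\<exists>B\<in>d. Unprimed (m + 1) \<in> B \<and> Primed (m + 1) \<in> B)}"

definition id_diagram :: "nat \<Rightarrow> diagram" where
  "id_diagram m = (\<lambda>i. {Unprimed i, Primed i}) ` {1..m}"

text \<open>Stacking \<open>d1\<close> above \<open>d2\<close> gives a graph on three rows of vertices.\<close>

datatype stack_vertex = Top nat | Mid nat | Bot nat

fun upper :: "vertex \<Rightarrow> stack_vertex" where
  "upper (Unprimed i) = Top i"
| "upper (Primed i) = Mid i"

fun lower :: "vertex \<Rightarrow> stack_vertex" where
  "lower (Unprimed i) = Mid i"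
| "lower (Primed i) = Bot i"

definition stack :: "diagram \<Rightarrow> diagram \<Rightarrow> stack_vertex set set" where
  "stack d1 d2 = (image upper) ` d1 \<union> (image lower) ` d2"

definition components :: "diagram \<Rightarrow> diagram \<Rightarrow> stack_vertex set set" where
  "components d1 d2 = (\<Union>(stack d1 d2)) // (\<Union>B\<in>stack d1 d2. B \<times> B)\<^sup>+"

definition compose :: "diagram \<Rightarrow> diagram \<Rightarrow> diagram" where
  "compose d1 d2 = (\<lambda>C. {Unprimed i | i. Top i \<in> C} \<union> {Primed i | i. Bot i \<in> C}) `
     {C \<in> components d1 d2. \<not> C \<subseteq> range Mid}"

definition removed :: "diagram \<Rightarrow> diagram \<Rightarrow> nat" where
  "removed d1 d2 = card {C \<in> components d1 d2. C \<subseteq> range Mid}"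

definition propagating_number :: "diagram \<Rightarrow> nat" where
  "propagating_number d = card {B \<in> d. (\<exists>i. Unprimed i \<in> B) \<and> (\<exists>j. Primed j \<in> B)}"


section \<open>Partition algebras\<close>

text \<open>Formal linear combinations are finitely supported functions; the ring multiplication
  that \<open>Poly_Mapping\<close> puts on them is never used.\<close>

definition scale :: "'c::comm_ring_1 \<Rightarrow> ('b \<Rightarrow>\<^sub>0 'c) \<Rightarrow> ('b \<Rightarrow>\<^sub>0 'c)" where
  "scale c f = Poly_Mapping.map ((*) c) f"

definition lin_ext :: "('a \<Rightarrow> 'b \<Rightarrow>\<^sub>0 'c::comm_ring_1) \<Rightarrow> ('a \<Rightarrow>\<^sub>0 'c) \<Rightarrow> ('b \<Rightarrow>\<^sub>0 'c)" where
  "lin_ext F f = (\<Sum>a\<in>Poly_Mapping.keys f. scale (Poly_Mapping.lookup f a) (F a))"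

definition partition_algebra ::
    "'c::comm_ring_1 \<Rightarrow> half_integer \<Rightarrow> (diagram \<Rightarrow>\<^sub>0 'c) ring" where
  "partition_algebra q k = \<lparr>carrier = {f. Poly_Mapping.keys f \<subseteq> diagrams k},
     mult = (\<lambda>f g. lin_ext (\<lambda>d1. lin_ext (\<lambda>d2.
        Poly_Mapping.single (compose d1 d2) (q ^ removed d1 d2)) g) f),
     one = Poly_Mapping.single (id_diagram (strands k)) 1,
     ring.zero = 0, ring.add = (+)\<rparr>"

text \<open>\<open>\<int>[x]\<close> is \<^typ>\<open>int poly\<close>, with \<open>x\<close> the polynomial \<open>[:0, 1:]\<close>.\<close>

abbreviation integral_partition_algebra ::
    "half_integer \<Rightarrow> (diagram \<Rightarrow>\<^sub>0 int poly) ring" where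
  "integral_partition_algebra \<equiv> partition_algebra [:0, 1:]"

abbreviation complex_partition_algebra ::
    "half_integer \<Rightarrow> complex \<Rightarrow> (diagram \<Rightarrow>\<^sub>0 complex) ring" where
  "complex_partition_algebra k n \<equiv> partition_algebra n k"

definition restrict_to_scalars ::
    "half_integer \<Rightarrow> (diagram \<Rightarrow>\<^sub>0 'c::comm_ring_1, 'm) module \<Rightarrow> ('c, 'm) module" where
  "restrict_to_scalars k M = \<lparr>carrier = carrier M, mult = mult M, one = one M,
     ring.zero = \<zero>\<^bsub>M\<^esub>, ring.add = ring.add M,
     smult = (\<lambda>c m. Poly_Mapping.single (id_diagram (strands k)) c \<odot>\<^bsub>M\<^esub> m)\<rparr>"


section \<open>Partitions and Young symmetrizers\<close>

definition is_partition :: "nat list \<Rightarrow> bool" where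
  "is_partition lam \<longleftrightarrow> sorted_wrt (\<ge>) lam \<and> 0 \<notin> set lam"

definition conjugate :: "nat list \<Rightarrow> nat list" where
  "conjugate lam = map (\<lambda>j. length (filter (\<lambda>p. j < p) lam))
     [0..<(if lam = [] then 0 else hd lam)]"

definition young_subgroup :: "nat list \<Rightarrow> (nat \<Rightarrow> nat) set" where
  "young_subgroup lam = {w. w permutes {1..sum_list lam} \<and>
     (\<forall>i<length lam. w ` {sum_list (take i lam)<..sum_list (take (Suc i) lam)}
        = {sum_list (take i lam)<..sum_list (take (Suc i) lam)})}"

text \<open>Boxes are pairs (row, column), counted from 0; tableau entries are counted from 1.\<close>

definition boxes :: "nat list \<Rightarrow> (nat \<times> nat) set" where
  "boxes lam = {(i, j). i < length lam \<and> j < lam ! i}"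

definition row_reading :: "nat list \<Rightarrow> nat \<times> nat \<Rightarrow> nat" where
  "row_reading lam = (\<lambda>(i, j). sum_list (take i lam) + j + 1)"

definition column_reading :: "nat list \<Rightarrow> nat \<times> nat \<Rightarrow> nat" where
  "column_reading lam = (\<lambda>(i, j). sum_list (take j (conjugate lam)) + i + 1)"

definition reading_perm :: "nat list \<Rightarrow> nat \<Rightarrow> nat" where
  "reading_perm lam = (\<lambda>t. if t \<in> {1..sum_list lam}
     then column_reading lam (inv_into (boxes lam) (row_reading lam) t) else t)"

definition perm_diagram :: "nat \<Rightarrow> (nat \<Rightarrow> nat) \<Rightarrow> diagram" where
  "perm_diagram r w = (\<lambda>i. {Unprimed i, Primed (w i)}) ` {1..r}"

text \<open>Products are taken in \<open>A\<^sub>r\<close>, where \<open>perm_diagram r u\<close> times \<open>perm_diagram r v\<close> is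
  \<open>perm_diagram r (v \<circ> u)\<close>.\<close>

definition p_diagram :: "nat list \<Rightarrow> diagram \<Rightarrow>\<^sub>0 int poly" where
  "p_diagram lam =
    (let r = sum_list lam; A = integral_partition_algebra (Whole r); \<tau> = reading_perm lam
     in (\<Sum>w\<in>young_subgroup lam. Poly_Mapping.single (perm_diagram r w) 1)
        \<otimes>\<^bsub>A\<^esub> Poly_Mapping.single (perm_diagram r \<tau>) 1
        \<otimes>\<^bsub>A\<^esub> (\<Sum>w\<in>young_subgroup (conjugate lam).
               Poly_Mapping.single (perm_diagram r w) (of_int (sign w)))
        \<otimes>\<^bsub>A\<^esub> Poly_Mapping.single (perm_diagram r (inv_into UNIV \<tau>)) 1)"


section \<open>Specht modules of the integral partition algebra\<close>

fun extra_blocks :: "half_integer \<Rightarrow> nat \<Rightarrow> diagram" where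
  "extra_blocks (Whole m) r = (\<lambda>i. {Unprimed i}) ` {r<..m} \<union> (\<lambda>i. {Primed i}) ` {r<..m}"
| "extra_blocks (Half m) r = {Unprimed ` {r<..m + 1} \<union> Primed ` {r<..m + 1}}"

definition e_elem :: "half_integer \<Rightarrow> nat list \<Rightarrow> diagram \<Rightarrow>\<^sub>0 int poly" where
  "e_elem k lam = lin_ext
     (\<lambda>d. Poly_Mapping.single (d \<union> extra_blocks k (sum_list lam)) 1) (p_diagram lam)"

text \<open>If \<open>k = m + 1/2\<close>, every diagram has the propagating block that contains \<open>m + 1\<close> and
  \<open>(m + 1)'\<close>. This block must not be counted against \<open>r = |\<lambda>|\<close>: the element \<open>e\<^sub>\<lambda>\<close> has propagating
  number \<open>r + 1\<close>, and the ideal has to be spanned by the diagrams with fewer propagating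
  blocks than \<open>e\<^sub>\<lambda>\<close>. With the bound \<open>r\<close> instead, the ideal for \<open>k = 3/2\<close> and \<open>\<lambda> = (1)\<close>
  would be 0 and the Specht module would be the 5-dimensional regular module.\<close>

fun propagating_bound :: "half_integer \<Rightarrow> nat \<Rightarrow> nat" where
  "propagating_bound (Whole m) r = r"
| "propagating_bound (Half m) r = r + 1"

definition propagating_ideal :: "half_integer \<Rightarrow> nat \<Rightarrow> (diagram \<Rightarrow>\<^sub>0 int poly) set" where
  "propagating_ideal k r = {f. Poly_Mapping.keys f \<subseteq>
     {d \<in> diagrams k. propagating_number d < propagating_bound k r}}"

definition specht_module ::
    "half_integer \<Rightarrow> nat list \<Rightarrow> (diagram \<Rightarrow>\<^sub>0 int poly, (diagram \<Rightarrow>\<^sub>0 int poly) set) module" where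
  "specht_module k lam =
    (let A = integral_partition_algebra k; I = propagating_ideal k (sum_list lam)
     in (quotient_module (regular_module A) I)
        \<lparr>carrier := (\<lambda>b. I +>\<^bsub>A\<^esub> b) ` {a \<otimes>\<^bsub>A\<^esub> e_elem k lam | a. a \<in> carrier A}\<rparr>)"


section \<open>Extension of scalars\<close>

text \<open>For a homomorphism \<open>\<phi> : R \<rightarrow> S\<close> of commutative rings (given as types) and an \<open>R\<close>-module
  \<open>M\<close>, the group \<open>S \<otimes>\<^sub>R M\<close> is the free abelian group on \<open>S \<times> M\<close> modulo the bilinearity and
  balancing relations; it is written multiplicatively, as a quotient group of HOL-Algebra.\<close>

definition tensor_generators ::
    "'s::comm_ring_1 itself \<Rightarrow> ('r::comm_ring_1, 'm) module \<Rightarrow> ('s \<times> 'm \<Rightarrow>\<^sub>0 int) monoid" where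
  "tensor_generators _ M = free_Abelian_group (UNIV \<times> carrier M)"

definition tensor_relations ::
    "('r::comm_ring_1 \<Rightarrow> 's::comm_ring_1) \<Rightarrow> ('r, 'm) module \<Rightarrow> ('s \<times> 'm \<Rightarrow>\<^sub>0 int) set" where
  "tensor_relations \<phi> M = generate (tensor_generators TYPE('s) M)
     ({frag_of (s + s', m) - frag_of (s, m) - frag_of (s', m) | s s' m. m \<in> carrier M} \<union>
      {frag_of (s, m \<oplus>\<^bsub>M\<^esub> m') - frag_of (s, m) - frag_of (s, m') | s m m'.
         m \<in> carrier M \<and> m' \<in> carrier M} \<union>
      {frag_of (s * \<phi> r, m) - frag_of (s, r \<odot>\<^bsub>M\<^esub> m) | s r m. m \<in> carrier M})"

definition tensor_group ::
    "('r::comm_ring_1 \<Rightarrow> 's::comm_ring_1) \<Rightarrow> ('r, 'm) module \<Rightarrow> ('s \<times> 'm \<Rightarrow>\<^sub>0 int) set monoid" where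
  "tensor_group \<phi> M = tensor_generators TYPE('s) M Mod tensor_relations \<phi> M"

text \<open>If \<open>M\<close> is a module over the partition algebra with coefficients in \<open>R\<close>, then \<open>S \<otimes>\<^sub>R M\<close>
  is one over the partition algebra with coefficients in \<open>S\<close>: the element \<open>c d\<close>, for \<open>c\<close> in \<open>S\<close>
  and a diagram \<open>d\<close>, sends \<open>s \<otimes> m\<close> to \<open>(c s) \<otimes> (d m)\<close>.\<close>

definition tensor_action ::
    "(diagram \<Rightarrow>\<^sub>0 'r::comm_ring_1, 'm) module \<Rightarrow> (diagram \<Rightarrow>\<^sub>0 's::comm_ring_1) \<Rightarrow>
     ('s \<times> 'm \<Rightarrow>\<^sub>0 int) \<Rightarrow> ('s \<times> 'm \<Rightarrow>\<^sub>0 int)" where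
  "tensor_action M a = frag_extend (\<lambda>(s, m). \<Sum>d\<in>Poly_Mapping.keys a.
     frag_of (Poly_Mapping.lookup a d * s, Poly_Mapping.single d 1 \<odot>\<^bsub>M\<^esub> m))"

definition extend_scalars ::
    "half_integer \<Rightarrow> ('r::comm_ring_1 \<Rightarrow> 's::comm_ring_1) \<Rightarrow> (diagram \<Rightarrow>\<^sub>0 'r, 'm) module \<Rightarrow>
     (diagram \<Rightarrow>\<^sub>0 's, ('s \<times> 'm \<Rightarrow>\<^sub>0 int) set) module" where
  "extend_scalars k \<phi> M =
    (let MR = restrict_to_scalars k M; F = tensor_generators TYPE('s) MR;
         K = tensor_relations \<phi> MR; T = tensor_group \<phi> MR
     in \<lparr>carrier = carrier T, mult = undefined, one = undefined,
         ring.zero = one T, ring.add = mult T,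
         smult = (\<lambda>a X. \<Union>t\<in>X. K #>\<^bsub>F\<^esub> tensor_action M a t)\<rparr>)"

definition eval_at :: "complex \<Rightarrow> int poly \<Rightarrow> complex" where
  "eval_at n p = poly (map_poly of_int p) n"

definition specht_module_at ::
    "half_integer \<Rightarrow> nat list \<Rightarrow> complex \<Rightarrow>
     (diagram \<Rightarrow>\<^sub>0 complex, (complex \<times> (diagram \<Rightarrow>\<^sub>0 int poly) set \<Rightarrow>\<^sub>0 int) set) module" where
  "specht_module_at k lam n = extend_scalars k (eval_at n) (specht_module k lam)"


section \<open>Characters\<close>

definition is_basis :: "(complex, 'm) module \<Rightarrow> 'm set \<Rightarrow> bool" where
  "is_basis V B \<longleftrightarrow> finite B \<and> B \<subseteq> carrier V \<and>
     (\<forall>v\<in>carrier V. \<exists>!c. c \<in> extensional B \<and> v = (\<Oplus>\<^bsub>V\<^esub>b\<in>B. c b \<odot>\<^bsub>V\<^esub> b))"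

definition has_trace :: "(complex, 'm) module \<Rightarrow> ('m \<Rightarrow> 'm) \<Rightarrow> complex \<Rightarrow> bool" where
  "has_trace V T t \<longleftrightarrow> (\<exists>B c. is_basis V B \<and>
     (\<forall>b\<in>B. T b = (\<Oplus>\<^bsub>V\<^esub>b'\<in>B. c b' b \<odot>\<^bsub>V\<^esub> b')) \<and> t = (\<Sum>b\<in>B. c b b))"

definition has_character ::
    "half_integer \<Rightarrow> (diagram \<Rightarrow>\<^sub>0 complex, 'm) module \<Rightarrow> diagram \<Rightarrow> complex \<Rightarrow> bool" where
  "has_character k M d t \<longleftrightarrow>
     has_trace (restrict_to_scalars k M) (\<lambda>m. Poly_Mapping.single d 1 \<odot>\<^bsub>M\<^esub> m) t"


section \<open>Irreducible modules of symmetric groups and multiplicity spaces\<close>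

text \<open>In the group algebra \<open>\<complex>S\<^sub>g\<close>, unlike for diagrams, permutations are multiplied as
  functions. The irreducible module indexed by \<open>\<nu>\<close> is the left ideal generated by the Young
  symmetrizer (row stabilizer sum) times (signed column stabilizer sum) of the row reading
  tableau, so that the partition with one part indexes the trivial module.\<close>

definition group_mult ::
    "((nat \<Rightarrow> nat) \<Rightarrow>\<^sub>0 complex) \<Rightarrow> ((nat \<Rightarrow> nat) \<Rightarrow>\<^sub>0 complex) \<Rightarrow> ((nat \<Rightarrow> nat) \<Rightarrow>\<^sub>0 complex)" where
  "group_mult f g = lin_ext (\<lambda>u. lin_ext (\<lambda>v. Poly_Mapping.single (u \<circ> v) 1) g) f"

definition young_symmetrizer :: "nat list \<Rightarrow> (nat \<Rightarrow> nat) \<Rightarrow>\<^sub>0 complex" where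
  "young_symmetrizer nu = (let \<tau> = reading_perm nu in
     group_mult (\<Sum>u\<in>young_subgroup nu. Poly_Mapping.single u 1)
       (\<Sum>v\<in>young_subgroup (conjugate nu).
          Poly_Mapping.single (inv_into UNIV \<tau> \<circ> v \<circ> \<tau>) (of_int (sign v))))"

definition sym_irreducible :: "nat list \<Rightarrow> ((nat \<Rightarrow> nat) \<Rightarrow>\<^sub>0 complex) set" where
  "sym_irreducible nu = {group_mult a (young_symmetrizer nu) | a.
     Poly_Mapping.keys a \<subseteq> {w. w permutes {1..sum_list nu}}}"

text \<open>For \<open>V = \<complex>\<^sup>N\<close> with basis \<open>v\<^sub>1, \<dots>, v\<^sub>N\<close>, the space \<open>V\<^sup>\<otimes>\<^sup>m\<close> has as basis the words of length
  \<open>m\<close> in \<open>1, \<dots>, N\<close>.\<close>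

definition tuples :: "nat \<Rightarrow> nat \<Rightarrow> nat list set" where
  "tuples N m = {xs. length xs = m \<and> set xs \<subseteq> {1..N}}"

definition tensor_space :: "nat \<Rightarrow> nat \<Rightarrow> (nat list \<Rightarrow>\<^sub>0 complex) set" where
  "tensor_space N m = {f. Poly_Mapping.keys f \<subseteq> tuples N m}"

definition perm_action :: "(nat \<Rightarrow> nat) \<Rightarrow> (nat list \<Rightarrow>\<^sub>0 complex) \<Rightarrow> (nat list \<Rightarrow>\<^sub>0 complex)" where
  "perm_action w = lin_ext (\<lambda>xs. Poly_Mapping.single (map w xs) 1)"

text \<open>The matrix coefficient of \<open>d\<close> at words \<open>ys\<close> (top row) and \<open>xs\<close> (bottom row) is 1 if labels
  agree on every block of \<open>d\<close>, and 0 otherwise. For \<open>k = m + 1/2\<close> the space \<open>V\<^sup>\<otimes>\<^sup>m\<close> is identified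
  with \<open>V\<^sup>\<otimes>\<^sup>m \<otimes> v\<^sub>N\<close>, and its commuting group is the stabilizer \<open>S\<^bsub>N-1\<^esub>\<close> of \<open>N\<close>.\<close>

fun label :: "nat list \<Rightarrow> nat list \<Rightarrow> vertex \<Rightarrow> nat" where
  "label ys xs (Unprimed i) = ys ! (i - 1)"
| "label ys xs (Primed i) = xs ! (i - 1)"

fun complete_word :: "half_integer \<Rightarrow> nat \<Rightarrow> nat list \<Rightarrow> nat list" where
  "complete_word (Whole m) N xs = xs"
| "complete_word (Half m) N xs = xs @ [N]"

fun tensor_degree :: "half_integer \<Rightarrow> nat" where
  "tensor_degree (Whole m) = m"
| "tensor_degree (Half m) = m"

fun group_degree :: "half_integer \<Rightarrow> nat \<Rightarrow> nat" where
  "group_degree (Whole m) N = N"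
| "group_degree (Half m) N = N - 1"

definition labels_agree :: "half_integer \<Rightarrow> nat \<Rightarrow> diagram \<Rightarrow> nat list \<Rightarrow> nat list \<Rightarrow> bool" where
  "labels_agree k N d ys xs \<longleftrightarrow> (\<forall>B\<in>d. \<forall>a\<in>B. \<forall>b\<in>B.
     label (complete_word k N ys) (complete_word k N xs) a =
     label (complete_word k N ys) (complete_word k N xs) b)"

definition diagram_action ::
    "half_integer \<Rightarrow> nat \<Rightarrow> (diagram \<Rightarrow>\<^sub>0 complex) \<Rightarrow> (nat list \<Rightarrow>\<^sub>0 complex) \<Rightarrow> (nat list \<Rightarrow>\<^sub>0 complex)" where
  "diagram_action k N a v = lin_ext (\<lambda>d. lin_ext (\<lambda>xs.
     \<Sum>ys\<in>{ys \<in> tuples N (tensor_degree k). labels_agree k N d ys xs}.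
       Poly_Mapping.single ys 1) v) a"

text \<open>The multiplicity space of an irreducible module \<open>S\<close> in \<open>V\<^sup>\<otimes>\<^sup>m\<close> is the space of equivariant
  linear maps from \<open>S\<close> to \<open>V\<^sup>\<otimes>\<^sup>m\<close>, on which the partition algebra acts by composition.\<close>

definition multiplicity_space ::
    "half_integer \<Rightarrow> nat \<Rightarrow> nat list \<Rightarrow>
     (diagram \<Rightarrow>\<^sub>0 complex, ((nat \<Rightarrow> nat) \<Rightarrow>\<^sub>0 complex) \<Rightarrow> (nat list \<Rightarrow>\<^sub>0 complex)) module" where
  "multiplicity_space k N mu =
    (let g = group_degree k N; S = sym_irreducible ((g - sum_list mu) # mu)
     in \<lparr>carrier = {\<phi> \<in> S \<rightarrow>\<^sub>E tensor_space N (tensor_degree k).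
            (\<forall>s\<in>S. \<forall>t\<in>S. \<phi> (s + t) = \<phi> s + \<phi> t) \<and>
            (\<forall>c. \<forall>s\<in>S. \<phi> (scale c s) = scale c (\<phi> s)) \<and>
            (\<forall>w. w permutes {1..g} \<longrightarrow>
               (\<forall>s\<in>S. \<phi> (group_mult (Poly_Mapping.single w 1) s) = perm_action w (\<phi> s)))},
         mult = undefined, one = undefined,
         ring.zero = (\<lambda>s\<in>S. 0), ring.add = (\<lambda>\<phi> \<psi>. \<lambda>s\<in>S. \<phi> s + \<psi> s),
         smult = (\<lambda>a \<phi>. \<lambda>s\<in>S. diagram_action k N a (\<phi> s))\<rparr>)"

text \<open>The module indexed by \<open>\<mu>\<close> for the parameter \<open>n\<close> is the irreducible module whose character is
  obtained by evaluating at \<open>n\<close> the polynomials that give the characters of the multiplicity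
  spaces for all integers \<open>N \<ge> 2k\<close>. These polynomials are unique, having prescribed
  values at infinitely many points.\<close>

definition is_irreducible_indexed_by ::
    "half_integer \<Rightarrow> complex \<Rightarrow> (diagram \<Rightarrow>\<^sub>0 complex, 'm) module \<Rightarrow> nat list \<Rightarrow> bool" where
  "is_irreducible_indexed_by k n M mu \<longleftrightarrow>
     irreducible_module (complex_partition_algebra k n) M \<and>
     (\<forall>d\<in>diagrams k. \<exists>p :: complex poly.
        (\<forall>N::nat. of_nat N \<ge> 2 * hval k \<longrightarrow>
           has_character k (multiplicity_space k N mu) d (poly p (of_nat N))) \<and>
        has_character k M d (poly p n))"

end

theory Submission
  imports Defs
begin

text \<open>For an integer \<open>N \<ge> 2 k\<close> the partition algebra acts faithfully on tensor space, and the trace form of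
  this representation makes it semisimple. Let \<open>e\<close> be the element \<open>e_elem k lam\<close>. Modulo the diagrams of low
  propagating number, \<open>e a e\<close> is a multiple of \<open>e\<close> for every \<open>a\<close>, so the module generated by \<open>e\<close> is
  irreducible whenever the algebra is semisimple. The multiplicity space is \<open>y V\<^sup>\<otimes>\<^sup>m\<close> for a Young
  symmetrizer \<open>y\<close>; it is killed by the diagrams of low propagating number but not by \<open>e\<close>, and the
  algebra acts on it transitively, so for \<open>n = N\<close> it is isomorphic to the module generated by \<open>e\<close>.

  Up to powers of \<open>x\<close>, the products \<open>d e\<close> have integer coefficients that do not involve \<open>x\<close>. A basis of
  their rational span is therefore a basis of the module generated by \<open>e\<close> for every parameter \<open>n\<close>. This
  makes the character values polynomials in \<open>n\<close>, and it shows that the tensor product with \<open>\<complex>\<close> is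
  the module generated by \<open>e\<close> in the complex algebra, although the integral Specht module is only
  spanned by this basis up to division by integers.\<close>

text \<open>Three obstacles shape the argument. Connected components are awkward to compute with, so
  a diagram is replaced by its zero-one matrix on words over \<open>N\<close> letters. Once
  \<open>N\<close> reaches \<open>2 k\<close>, some pair of words separates exactly the blocks of a
  given diagram; the matrix then determines the diagram, and composites are identified by counting
  middle words. Next, a product \<open>d e\<close> may carry a power of \<open>x\<close>, which
  vanishes at parameter 0; a basis uniform in the parameter exists because every such product,
  stripped of its power, is itself some \<open>d' e\<close> without removed components. Finally, for
  \<open>k = m + 1/2\<close> the block of \<open>m + 1\<close> always propagates and carries the
  letter \<open>N\<close>, which shifts the bound on propagating numbers by one and replaces the
  symmetric group by the stabilizer of \<open>N\<close>. That \<open>e a e\<close> is a multiple of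
  \<open>e\<close> has its origin in the padding of \<open>e\<close>: it confines the middle of the
  product to the first \<open>r\<close> strands, where at sufficient propagating number only
  permutations remain and the classical property of Young symmetrizers applies.\<close>

abbreviation "lookup \<equiv> Poly_Mapping.lookup"
abbreviation "keys \<equiv> Poly_Mapping.keys"
abbreviation "single \<equiv> Poly_Mapping.single"

section \<open>Linear maps between spaces of formal linear combinations\<close>

lemma lookup_scale [simp]: "lookup (scale c f) a = c * lookup f a"
  unfolding scale_def by transfer (auto simp: when_def)

lemma scale_add_right: "scale c (f + g) = scale c f + scale c g"
  by (rule poly_mapping_eqI) (simp add: lookup_add algebra_simps)

lemma scale_add_left: "scale (c + d) f = scale c f + scale d f"
  by (rule poly_mapping_eqI) (simp add: lookup_add algebra_simps)

lemma scale_scale [simp]: "scale c (scale d f) = scale (c * d) f"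
  by (rule poly_mapping_eqI) (simp add: algebra_simps)

lemma scale_one [simp]: "scale 1 f = f"
  by (rule poly_mapping_eqI) simp

lemma scale_zero_left [simp]: "scale 0 f = 0"
  by (rule poly_mapping_eqI) simp

lemma scale_zero_right [simp]: "scale c 0 = 0"
  by (rule poly_mapping_eqI) simp

lemma scale_minus_one: "scale (- 1) f = - f"
  by (rule poly_mapping_eqI) simp

lemma scale_single [simp]: "scale c (single a d) = single a (c * d)"
  by (rule poly_mapping_eqI) (simp add: lookup_single when_def)

lemma scale_sum: "scale c (\<Sum>i\<in>I. f i) = (\<Sum>i\<in>I. scale c (f i))"
  by (rule poly_mapping_eqI) (simp add: lookup_sum sum_distrib_left)

lemma scale_sum_left: "scale (\<Sum>i\<in>I. c i) f = (\<Sum>i\<in>I. scale (c i) f)"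
  by (rule poly_mapping_eqI) (simp add: lookup_sum sum_distrib_right)

lemma keys_scale_subset: "keys (scale c f) \<subseteq> keys f"
  by (auto simp: in_keys_iff)

lemma keys_add_subset: "keys f \<subseteq> A \<Longrightarrow> keys g \<subseteq> A \<Longrightarrow> keys (f + g) \<subseteq> A"
  using keys_add[of f g] by blast

lemma keys_sum_subset: "(\<And>i. i \<in> I \<Longrightarrow> keys (f i) \<subseteq> A) \<Longrightarrow> keys (\<Sum>i\<in>I. f i) \<subseteq> A"
  using keys_sum[of f I] by blast

text \<open>Linearity on the whole type of formal combinations. Carriers enter only as key sets in
  the equality principles, so linearity of a product never has to be relativized to an algebra or a
  tensor power.\<close>

definition linear_map :: "(('a \<Rightarrow>\<^sub>0 'c::comm_ring_1) \<Rightarrow> ('b \<Rightarrow>\<^sub>0 'c)) \<Rightarrow> bool" where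
  "linear_map T \<longleftrightarrow> (\<forall>f g. T (f + g) = T f + T g) \<and> (\<forall>c f. T (scale c f) = scale c (T f))"

named_theorems linear_intros

lemma linear_mapI:
  "(\<And>f g. T (f + g) = T f + T g) \<Longrightarrow> (\<And>c f. T (scale c f) = scale c (T f)) \<Longrightarrow> linear_map T"
  by (simp add: linear_map_def)

lemma linear_map_add: "linear_map T \<Longrightarrow> T (f + g) = T f + T g"
  and linear_map_scale: "linear_map T \<Longrightarrow> T (scale c f) = scale c (T f)"
  by (simp_all add: linear_map_def)

lemma linear_map_zero: "linear_map T \<Longrightarrow> T 0 = 0"
  using linear_map_scale[of T 0 0] by simp

lemma linear_map_minus: "linear_map T \<Longrightarrow> T (- f) = - T f"
  using linear_map_scale[of T "- 1" f] by (simp add: scale_minus_one)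

lemma linear_map_diff: "linear_map T \<Longrightarrow> T (f - g) = T f - T g"
  using linear_map_add[of T f "- g"] linear_map_minus[of T g] by simp

lemma linear_map_sum: "linear_map T \<Longrightarrow> T (\<Sum>i\<in>I. f i) = (\<Sum>i\<in>I. T (f i))"
  by (induction I rule: infinite_finite_induct) (auto simp: linear_map_zero linear_map_add)

lemma linear_map_id [linear_intros]: "linear_map (\<lambda>f. f)"
  by (simp add: linear_map_def)

lemma linear_map_comp: "linear_map S \<Longrightarrow> linear_map T \<Longrightarrow> linear_map (\<lambda>f. S (T f))"
  by (simp add: linear_map_def)

lemma linear_map_scaled [linear_intros]: "linear_map T \<Longrightarrow> linear_map (\<lambda>f. scale c (T f))"
  by (simp add: linear_map_def scale_add_right mult.commute)

lemma poly_mapping_expansion: "f = (\<Sum>a\<in>keys f. scale (lookup f a) (single a 1))"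
proof (rule poly_mapping_eqI)
  fix b
  have "(\<Sum>a\<in>keys f. lookup f a * lookup (single a 1) b) = (\<Sum>a\<in>keys f. if b = a then lookup f a else 0)"
    by (intro sum.cong) (auto simp: lookup_single)
  also have "\<dots> = lookup f b" by (simp add: in_keys_iff)
  finally show "lookup f b = lookup (\<Sum>a\<in>keys f. scale (lookup f a) (single a 1)) b"
    by (simp only: lookup_sum lookup_scale)
qed

lemma linear_map_expansion:
  assumes "linear_map T"
  shows "T f = (\<Sum>a\<in>keys f. scale (lookup f a) (T (single a 1)))"
proof -
  have "T f = T (\<Sum>a\<in>keys f. scale (lookup f a) (single a 1))"
    by (rule arg_cong[OF poly_mapping_expansion])
  also have "\<dots> = (\<Sum>a\<in>keys f. scale (lookup f a) (T (single a 1)))"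
    by (simp only: linear_map_sum[OF assms] linear_map_scale[OF assms])
  finally show ?thesis .
qed

lemma linear_map_eqI:
  assumes "linear_map S" "linear_map T" "keys f \<subseteq> A"
    and "\<And>a. a \<in> A \<Longrightarrow> S (single a 1) = T (single a 1)"
  shows "S f = T f"
proof -
  have "S f = (\<Sum>a\<in>keys f. scale (lookup f a) (S (single a 1)))"
    by (rule linear_map_expansion[OF assms(1)])
  also have "\<dots> = (\<Sum>a\<in>keys f. scale (lookup f a) (T (single a 1)))"
    using assms(3,4) by (intro sum.cong) auto
  also have "\<dots> = T f" by (rule linear_map_expansion[OF assms(2), symmetric])
  finally show ?thesis .
qed

text \<open>The form in which identities for products and actions are reduced to pairs of diagrams,
  permutations or words.\<close>

lemma linear_map_eqI2:
  assumes "\<And>g. linear_map (\<lambda>f. S f g)" "\<And>f. linear_map (S f)" "\<And>g. linear_map (\<lambda>f. T f g)" "\<And>f. linear_map (T f)"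
    and "keys f \<subseteq> A" "keys g \<subseteq> B"
    and "\<And>a b. a \<in> A \<Longrightarrow> b \<in> B \<Longrightarrow> S (single a 1) (single b 1) = T (single a 1) (single b 1)"
  shows "S f g = T f g"
  using linear_map_eqI[OF assms(1,3,5)] linear_map_eqI[OF assms(2,4,6)] assms(7) by blast

lemma lin_ext_superset:
  assumes "finite A" "keys f \<subseteq> A"
  shows "lin_ext F f = (\<Sum>a\<in>A. scale (lookup f a) (F a))"
  unfolding lin_ext_def using assms by (intro sum.mono_neutral_left) (auto simp: in_keys_iff)

lemma linear_lin_ext: "linear_map (lin_ext F)"
proof (rule linear_mapI)
  fix f g :: "'a \<Rightarrow>\<^sub>0 'b"
  let ?A = "keys f \<union> keys g"
  have "lin_ext F (f + g) = (\<Sum>a\<in>?A. scale (lookup (f + g) a) (F a))"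
    by (rule lin_ext_superset) (auto simp: keys_add)
  also have "\<dots> = lin_ext F f + lin_ext F g"
    by (simp add: lookup_add scale_add_left sum.distrib lin_ext_superset[of ?A f] lin_ext_superset[of ?A g])
  finally show "lin_ext F (f + g) = lin_ext F f + lin_ext F g" .
next
  fix c and f :: "'a \<Rightarrow>\<^sub>0 'b"
  have "lin_ext F (scale c f) = (\<Sum>a\<in>keys f. scale (lookup (scale c f) a) (F a))"
    by (rule lin_ext_superset) (auto simp: keys_scale_subset)
  then show "lin_ext F (scale c f) = scale c (lin_ext F f)"
    by (simp add: lin_ext_def scale_sum)
qed

lemma lin_ext_single [simp]: "lin_ext F (single a c) = scale c (F a)"
  by (simp add: lin_ext_superset[of "{a}"])

lemmas lin_ext_sum = linear_map_sum[OF linear_lin_ext]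

lemma lookup_lin_ext: "lookup (lin_ext F f) b = (\<Sum>a\<in>keys f. lookup f a * lookup (F a) b)"
  by (simp add: lin_ext_def lookup_sum)

lemma keys_lin_ext: "(\<And>a. a \<in> keys f \<Longrightarrow> keys (F a) \<subseteq> A) \<Longrightarrow> keys (lin_ext F f) \<subseteq> A"
  unfolding lin_ext_def by (intro keys_sum_subset order_trans[OF keys_scale_subset])

lemma lin_ext_linear_fun:
  assumes "\<And>a. linear_map (\<lambda>g. F g a)"
  shows "linear_map (\<lambda>g. lin_ext (F g) f)"
proof -
  have "F (g + h) a = F g a + F h a" "F (scale c g) a = scale c (F g a)" for g h c a
    using linear_map_add[OF assms] linear_map_scale[OF assms] by blast+
  then show ?thesis unfolding lin_ext_def
    by (intro linear_mapI) (simp_all add: scale_add_right sum.distrib scale_sum mult.commute)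
qed

lemma linear_lin_ext_lin_ext: "linear_map (\<lambda>g. lin_ext (\<lambda>a. lin_ext (F a) g) f)"
  by (rule lin_ext_linear_fun) (rule linear_lin_ext)

lemma vector_space_scale: "vector_space (scale :: 'c::field \<Rightarrow> ('b \<Rightarrow>\<^sub>0 'c) \<Rightarrow> ('b \<Rightarrow>\<^sub>0 'c))"
  by (rule vector_space.intro) (simp_all only: scale_add_right scale_add_left scale_scale scale_one)

section \<open>Diagrams and labellings\<close>

lemma finite_vertices [simp]: "finite (vertices s)"
  by (simp add: vertices_def)

lemma vertex_in_vertices [simp]:
  "Unprimed i \<in> vertices s \<longleftrightarrow> i \<in> {1..s}" "Primed i \<in> vertices s \<longleftrightarrow> i \<in> {1..s}"
  by (auto simp: vertices_def)

lemma diagrams_partition_on: "d \<in> diagrams k \<Longrightarrow> partition_on (vertices (strands k)) d"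
  by (cases k) auto

lemma finite_diagrams [simp]: "finite (diagrams k)"
proof -
  have "diagrams k \<subseteq> {d. partition_on (vertices (strands k)) d}"
    using diagrams_partition_on by blast
  then show ?thesis by (rule finite_subset) (simp add: finitely_many_partition_on)
qed

text \<open>Points and labels are of arbitrary type: the same notion serves diagrams, their stacks
  and the components of a stack.\<close>

definition agrees :: "'a set set \<Rightarrow> ('a \<Rightarrow> 'b) \<Rightarrow> bool" where
  "agrees d f \<longleftrightarrow> (\<forall>B\<in>d. \<forall>a\<in>B. \<forall>b\<in>B. f a = f b)"

lemma agreesD: "agrees d f \<Longrightarrow> B \<in> d \<Longrightarrow> a \<in> B \<Longrightarrow> b \<in> B \<Longrightarrow> f a = f b"
  unfolding agrees_def by blast

lemma agreesI: "(\<And>B a b. B \<in> d \<Longrightarrow> a \<in> B \<Longrightarrow> b \<in> B \<Longrightarrow> f a = f b) \<Longrightarrow> agrees d f"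
  unfolding agrees_def by blast

abbreviation "words k N \<equiv> tuples N (tensor_degree k)"

abbreviation word_label :: "half_integer \<Rightarrow> nat \<Rightarrow> nat list \<Rightarrow> nat list \<Rightarrow> vertex \<Rightarrow> nat" where
  "word_label k N ys xs \<equiv> label (complete_word k N ys) (complete_word k N xs)"

lemma labels_agree_agrees: "labels_agree k N d ys xs \<longleftrightarrow> agrees d (word_label k N ys xs)"
  unfolding labels_agree_def agrees_def by (rule refl)

lemma agrees_cong:
  assumes "partition_on V d" "\<And>v. v \<in> V \<Longrightarrow> f v = g v"
  shows "agrees d f \<longleftrightarrow> agrees d g"
proof -
  have "f v = g v" if "B \<in> d" "v \<in> B" for v B
    using that assms(2) partition_onD1[OF assms(1)] by blast
  then show ?thesis unfolding agrees_def by metis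
qed

subsection \<open>Connected components of a stack\<close>

definition connection :: "'a set set \<Rightarrow> ('a \<times> 'a) set" where
  "connection Bs = (\<Union>B\<in>Bs. B \<times> B)\<^sup>+"

lemma equiv_connection: "equiv (\<Union>Bs) (connection Bs)"
proof (rule equivI)
  show "connection Bs \<subseteq> \<Union>Bs \<times> \<Union>Bs"
    unfolding connection_def by (rule trancl_subset_Sigma) auto
  show "refl_on (\<Union>Bs) (connection Bs)"
    unfolding connection_def by (auto simp: refl_on_def)
  show "sym (connection Bs)"
    unfolding connection_def by (rule sym_trancl) (auto simp: sym_def)
  show "trans (connection Bs)"
    unfolding connection_def by simp
qed

lemma components_alt: "components d1 d2 = \<Union>(stack d1 d2) // connection (stack d1 d2)"
  by (simp add: components_def connection_def)

lemma agrees_connection: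
  assumes "agrees Bs f" "(a, b) \<in> connection Bs"
  shows "f a = f b"
  using assms(2) unfolding connection_def
proof (induction rule: trancl_induct)
  case (base y)
  then show ?case using agreesD[OF assms(1)] by blast
next
  case (step y z)
  then obtain B where "B \<in> Bs" "y \<in> B" "z \<in> B" by blast
  then show ?case using agreesD[OF assms(1)] step.IH by metis
qed

text \<open>Labels pass along chains of overlapping blocks, and each block lies inside the component
  of any of its points. This turns connected components into something that labellings can
  count.\<close>

lemma agrees_quotient: "agrees Bs f \<longleftrightarrow> agrees (\<Union>Bs // connection Bs) f"
proof
  assume "agrees Bs f"
  show "agrees (\<Union>Bs // connection Bs) f"
  proof (rule agreesI)
    fix C a b assume "C \<in> \<Union>Bs // connection Bs" "a \<in> C" "b \<in> C"
    then have "(a, b) \<in> connection Bs"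
      using quotient_eq_iff[OF equiv_connection[of Bs], of C C a b] by simp
    then show "f a = f b" by (rule agrees_connection[OF \<open>agrees Bs f\<close>])
  qed
next
  assume *: "agrees (\<Union>Bs // connection Bs) f"
  show "agrees Bs f"
    unfolding agrees_def
  proof (intro ballI)
    fix B a b assume B: "B \<in> Bs" "a \<in> B" "b \<in> B"
    then have ab: "(a, b) \<in> connection Bs"
      unfolding connection_def by (intro r_into_trancl) auto
    then have "connection Bs `` {a} \<in> \<Union>Bs // connection Bs"
      using B by (auto intro: quotientI)
    moreover have "a \<in> connection Bs `` {a}" "b \<in> connection Bs `` {a}"
      using ab B equiv_connection[of Bs] by (auto simp: equiv_def refl_on_def)
    ultimately show "f a = f b" by (rule agreesD[OF *])
  qed
qed

text \<open>Membership in \<open>S\<close> propagates along chains of overlapping blocks. Taking for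
  \<open>S\<close> one row of a component, or a single vertex, confines the component.\<close>

lemma component_subset_closed:
  assumes C: "C \<in> \<Union>Bs // connection Bs" and S: "\<And>B. B \<in> Bs \<Longrightarrow> B \<inter> S \<noteq> {} \<Longrightarrow> B \<subseteq> S"
    and ne: "C \<inter> S \<noteq> {}"
  shows "C \<subseteq> S"
proof
  fix b assume "b \<in> C"
  obtain a where "a \<in> C" "a \<in> S" using ne by blast
  then have "(a, b) \<in> connection Bs"
    using C \<open>b \<in> C\<close> quotient_eq_iff[OF equiv_connection[of Bs] C C, of a b] by simp
  then show "b \<in> S"
    unfolding connection_def by (induction rule: trancl_induct) (use S \<open>a \<in> S\<close> in blast)+
qed

lemma block_subset_component:
  assumes "C \<in> \<Union>Bs // connection Bs" "B \<in> Bs" "B \<inter> C \<noteq> {}"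
  shows "B \<subseteq> C"
proof
  fix b assume b: "b \<in> B"
  obtain a where a: "a \<in> B" "a \<in> C" using assms(3) by blast
  then have "(a, b) \<in> connection Bs"
    using b assms(2) unfolding connection_def by (intro r_into_trancl) auto
  then show "b \<in> C"
    using in_quotient_imp_closed[OF equiv_connection assms(1) a(2)] by blast
qed

text \<open>The two rows that survive stacking. The blocks of a composite are the nonempty preimages
  of the components under this embedding, so the composite inherits the partition property from the
  components.\<close>

fun outer :: "vertex \<Rightarrow> stack_vertex" where
  "outer (Unprimed i) = Top i"
| "outer (Primed i) = Bot i"

fun stack_label :: "nat list \<Rightarrow> nat list \<Rightarrow> nat list \<Rightarrow> stack_vertex \<Rightarrow> nat" where
  "stack_label ys xs zs (Top i) = ys ! (i - 1)"
| "stack_label ys xs zs (Mid i) = xs ! (i - 1)"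
| "stack_label ys xs zs (Bot i) = zs ! (i - 1)"

lemma stack_label_simps:
  "stack_label ys xs zs (upper v) = label ys xs v"
  "stack_label ys xs zs (lower v) = label xs zs v"
  "stack_label ys xs zs (outer v) = label ys zs v"
  by (cases v; simp)+

lemma agrees_stack:
  "agrees (stack d1 d2) (stack_label ys xs zs) \<longleftrightarrow> agrees d1 (label ys xs) \<and> agrees d2 (label xs zs)"
  unfolding agrees_def stack_def ball_Un ball_simps stack_label_simps by (rule refl)

definition stack_vertices :: "nat \<Rightarrow> stack_vertex set" where
  "stack_vertices s = Top ` {1..s} \<union> Mid ` {1..s} \<union> Bot ` {1..s}"

lemma Union_stack:
  assumes "partition_on (vertices s) d1" "partition_on (vertices s) d2"
  shows "\<Union>(stack d1 d2) = stack_vertices s"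
proof -
  have "\<Union>(stack d1 d2) = upper ` \<Union>d1 \<union> lower ` \<Union>d2"
    by (auto simp: stack_def)
  also have "\<dots> = upper ` vertices s \<union> lower ` vertices s"
    using assms[THEN partition_onD1] by simp
  also have "\<dots> = stack_vertices s"
    by (auto simp: vertices_def stack_vertices_def image_Un image_image)
  finally show ?thesis .
qed

lemma partition_on_components:
  assumes "partition_on (vertices s) d1" "partition_on (vertices s) d2"
  shows "partition_on (stack_vertices s) (components d1 d2)"
  using partition_on_quotient[OF equiv_connection[of "stack d1 d2"]] Union_stack[OF assms]
  by (simp add: components_alt)

lemma outer_vimage: "outer -` C = {Unprimed i | i. Top i \<in> C} \<union> {Primed i | i. Bot i \<in> C}"
proof -
  have "v \<in> outer -` C \<longleftrightarrow> v \<in> {Unprimed i | i. Top i \<in> C} \<union> {Primed i | i. Bot i \<in> C}" for v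
    by (cases v) auto
  then show ?thesis by blast
qed

lemma outer_vimage_empty: "outer -` C = {} \<longleftrightarrow> C \<subseteq> range Mid"
proof
  assume *: "outer -` C = {}"
  show "C \<subseteq> range Mid"
  proof
    fix v assume "v \<in> C"
    then show "v \<in> range Mid"
      using * by (cases v) (auto simp: outer_vimage)
  qed
qed (auto simp: outer_vimage)

lemma compose_alt: "compose d1 d2 = (-`) outer ` {C \<in> components d1 d2. \<not> C \<subseteq> range Mid}"
  by (simp add: compose_def outer_vimage)

lemma compose_vimage: "compose d1 d2 = (-`) outer ` components d1 d2 - {{}}"
  by (auto simp: compose_alt simp flip: outer_vimage_empty)

lemma partition_on_compose:
  assumes "partition_on (vertices s) d1" "partition_on (vertices s) d2"
  shows "partition_on (vertices s) (compose d1 d2)"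
proof -
  have "outer -` stack_vertices s = vertices s"
    by (auto simp: outer_vimage stack_vertices_def vertices_def)
  then show ?thesis
    unfolding compose_vimage using partition_on_vimage[OF partition_on_components[OF assms], of outer] by simp
qed

lemma compose_closed:
  assumes "d1 \<in> diagrams k" "d2 \<in> diagrams k"
  shows "compose d1 d2 \<in> diagrams k"
proof -
  have p: "partition_on (vertices (strands k)) (compose d1 d2)"
    using assms by (intro partition_on_compose diagrams_partition_on)
  show ?thesis
  proof (cases k)
    case (Whole m)
    then show ?thesis using p by simp
  next
    case (Half m)
    obtain B1 B2 where B: "B1 \<in> d1" "Unprimed (m+1) \<in> B1" "Primed (m+1) \<in> B1"
        "B2 \<in> d2" "Unprimed (m+1) \<in> B2" "Primed (m+1) \<in> B2"
      using assms Half by auto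
    have pc: "partition_on (stack_vertices (strands k)) (components d1 d2)"
      using assms by (intro partition_on_components diagrams_partition_on)
    \<comment> \<open>The middle vertex \<open>m + 1\<close> lies in the distinguished blocks of
      both factors, so its component contains the top and the bottom copy of
      \<open>m + 1\<close>.\<close>
    have "Mid (m+1) \<in> stack_vertices (strands k)" using Half by (auto simp: stack_vertices_def)
    then obtain C where C: "C \<in> components d1 d2" "Mid (m+1) \<in> C"
      using partition_onD1[OF pc] by blast
    have "upper ` B1 \<in> stack d1 d2" "lower ` B2 \<in> stack d1 d2" using B by (auto simp: stack_def)
    moreover have "Mid (m+1) \<in> upper ` B1" "Mid (m+1) \<in> lower ` B2"
      using B by force+
    ultimately have "upper ` B1 \<subseteq> C" "lower ` B2 \<subseteq> C"
      using block_subset_component[of C "stack d1 d2"] C by (auto simp: components_alt)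
    moreover have "Top (m+1) \<in> upper ` B1" "Bot (m+1) \<in> lower ` B2" using B by force+
    ultimately have "Top (m+1) \<in> C" "Bot (m+1) \<in> C" by auto
    then have "Unprimed (m+1) \<in> outer -` C" "Primed (m+1) \<in> outer -` C" by simp_all
    moreover have "\<not> C \<subseteq> range Mid" using \<open>Top (m+1) \<in> C\<close> by auto
    then have "outer -` C \<in> compose d1 d2"
      unfolding compose_alt using C by (intro imageI) simp
    ultimately have "\<exists>B\<in>compose d1 d2. Unprimed (m+1) \<in> B \<and> Primed (m+1) \<in> B" by blast
    then show ?thesis using p Half by simp
  qed
qed

subsection \<open>Counting the labellings of the middle row\<close>

lemma finite_tuples [simp]: "finite (tuples N m)"
  unfolding tuples_def by (rule finite_subset[OF _ finite_lists_length_eq[of "{1..N}" m]]) auto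

lemma complete_word_range:
  assumes "ys \<in> words k N" "N \<ge> 1" "i \<in> {1..strands k}"
  shows "complete_word k N ys ! (i - 1) \<in> {1..N}"
proof -
  have l: "length ys = tensor_degree k" "set ys \<subseteq> {1..N}" using assms(1) by (auto simp: tuples_def)
  have "i - 1 < length (complete_word k N ys)" using assms(3) l by (cases k) auto
  then have "complete_word k N ys ! (i - 1) \<in> set (complete_word k N ys)" by (rule nth_mem)
  also have "set (complete_word k N ys) \<subseteq> {1..N}" using l assms(2) by (cases k) auto
  finally show ?thesis .
qed

lemma agrees_compose_iff:
  "agrees (compose d1 d2) (label ys zs) \<longleftrightarrow>
   (\<forall>C\<in>components d1 d2. \<forall>a\<in>C - range Mid. \<forall>b\<in>C - range Mid.
      stack_label ys xs zs a = stack_label ys xs zs b)"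
proof -
  have out: "\<exists>v. u = outer v" if "u \<notin> range Mid" for u
  proof (cases u)
    case (Top i) then show ?thesis by (intro exI[of _ "Unprimed i"]) simp
  next
    case (Bot i) then show ?thesis by (intro exI[of _ "Primed i"]) simp
  qed (use that in auto)
  have notmid: "outer v \<notin> range Mid" for v by (cases v) auto
  have sl: "label ys zs v = stack_label ys xs zs (outer v)" for v by (simp add: stack_label_simps)
  show ?thesis
    unfolding agrees_def compose_alt sl
  proof safe
    fix C a b
    assume *: "\<forall>B\<in>(-`) outer ` {C \<in> components d1 d2. \<not> C \<subseteq> range Mid}. \<forall>a\<in>B. \<forall>b\<in>B.
        stack_label ys xs zs (outer a) = stack_label ys xs zs (outer b)"
      and C: "C \<in> components d1 d2" "a \<in> C" "a \<notin> range Mid" "b \<in> C" "b \<notin> range Mid"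
    obtain v w where "a = outer v" "b = outer w" using out C by blast
    then show "stack_label ys xs zs a = stack_label ys xs zs b" using * C by blast
  qed (use notmid in auto)
qed

text \<open>A compatible middle word makes the stacked labelling constant on components. On a
  component that reaches an outer row its letter is forced, provided that the outer labels are
  consistent; on a component inside the middle row the letter is free, with \<open>N\<close>
  choices. Here the scalar of the product becomes a power of \<open>N\<close>.\<close>

lemma middle_label_count:
  assumes d: "d1 \<in> diagrams k" "d2 \<in> diagrams k"
    and ys: "ys \<in> words k N" and zs: "zs \<in> words k N" and N: "N \<ge> 1"
  shows "card {xs \<in> words k N. labels_agree k N d1 ys xs \<and> labels_agree k N d2 xs zs} =
    (if labels_agree k N (compose d1 d2) ys zs then N ^ removed d1 d2 else 0)"
proof -
  define M where "M = {xs \<in> words k N. labels_agree k N d1 ys xs \<and> labels_agree k N d2 xs zs}"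
  define cs where "cs = components d1 d2"
  define V where "V = stack_vertices (strands k)"
  define f where "f xs = stack_label (complete_word k N ys) (complete_word k N xs) (complete_word k N zs)" for xs
  have pc: "partition_on V cs"
    unfolding V_def cs_def using d by (intro partition_on_components diagrams_partition_on)
  have uniq: "C = C'" if "C \<in> cs" "C' \<in> cs" "v \<in> C" "v \<in> C'" for C C' v
    using that partition_onD2[OF pc] by (auto simp: disjoint_def)
  have M_iff: "xs \<in> M \<longleftrightarrow> xs \<in> words k N \<and> agrees cs (f xs)" for xs
    unfolding M_def labels_agree_agrees f_def cs_def components_alt
    by (subst agrees_quotient[symmetric]) (auto simp: agrees_stack)
  have top: "f xs (Top i) = complete_word k N ys ! (i - 1)" "f xs (Bot i) = complete_word k N zs ! (i - 1)"
    "f xs (Mid i) = complete_word k N xs ! (i - 1)" for xs i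
    by (simp_all add: f_def)
  have nonmid: "f xs v = f xs' v" if "v \<notin> range Mid" for v xs xs'
    using that by (cases v) (auto simp: top)
  have comp: "labels_agree k N (compose d1 d2) ys zs \<longleftrightarrow>
      (\<forall>C\<in>cs. \<forall>a\<in>C - range Mid. \<forall>b\<in>C - range Mid. f xs a = f xs b)" for xs
    unfolding labels_agree_agrees f_def cs_def by (rule agrees_compose_iff)
  show ?thesis
  proof (cases "labels_agree k N (compose d1 d2) ys zs")
    case False
    have "M = {}"
    proof (rule ccontr)
      assume "M \<noteq> {}"
      then obtain xs where "agrees cs (f xs)" using M_iff by blast
      then have "labels_agree k N (compose d1 d2) ys zs"
        unfolding comp[of xs] agrees_def by blast
      then show False using False by simp
    qed
    then show ?thesis using False by (simp add: M_def)
  next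
    case True
    define Rm where "Rm = {C \<in> cs. C \<subseteq> range Mid}"
    have finRm: "finite Rm"
      unfolding Rm_def using finite_elements[OF _ pc] by (simp add: V_def stack_vertices_def)
    define cl where "cl v = (THE C. C \<in> cs \<and> v \<in> C)" for v
    have cl: "cl v = C" if "C \<in> cs" "v \<in> C" for C v
      unfolding cl_def using that uniq by (intro the_equality) auto
    have cl_in: "cl v \<in> cs \<and> v \<in> cl v" if "v \<in> V" for v
      using that partition_onD1[OF pc] cl by (metis UnionE)
    \<comment> \<open>\<open>h\<close> chooses a letter for each removed component. On any other
      component the letter is read off at some outer vertex, which one being immaterial by the
      agreement of \<open>compose d1 d2\<close>; the dummy middle word \<open>[]\<close> is never
      consulted there.\<close>
    define g where "g h v = (let C = cl v in if C \<in> Rm then h C else f [] (SOME u. u \<in> C \<and> u \<notin> range Mid))" for h v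
    have g_const: "g h u = g h v" if "C \<in> cs" "u \<in> C" "v \<in> C" for h u v C
      using that cl[of C] by (simp add: g_def)
    have g_nonmid: "g h v = f xs v" if that: "v \<in> V" "v \<notin> range Mid" for h v xs
    proof -
      let ?C = "cl v"
      have C: "?C \<in> cs" "v \<in> ?C" using cl_in that by auto
      then have "?C \<notin> Rm" using that by (auto simp: Rm_def)
      moreover have "(SOME u. u \<in> ?C \<and> u \<notin> range Mid) \<in> ?C - range Mid"
        using someI[of "\<lambda>u. u \<in> ?C \<and> u \<notin> range Mid" v] C that by auto
      then have "f [] (SOME u. u \<in> ?C \<and> u \<notin> range Mid) = f [] v"
        using True[unfolded comp[of "[]"]] C that by blast
      ultimately show ?thesis using nonmid[OF that(2), of "[]" xs] by (simp add: g_def Let_def)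
    qed
    have f_range: "f xs v \<in> {1..N}" if "v \<in> V" "v \<notin> range Mid" for v xs
      using that complete_word_range[OF ys N] complete_word_range[OF zs N]
      by (cases v) (auto simp: V_def stack_vertices_def top)
    have g_range: "g h v \<in> {1..N}" if vV: "v \<in> V" and h: "h \<in> Rm \<rightarrow>\<^sub>E {1..N}" for h v
    proof (cases "cl v \<in> Rm")
      case True
      then show ?thesis using that by (auto simp: g_def Let_def PiE_def Pi_def)
    next
      case False
      then obtain u where u: "u \<in> cl v" "u \<notin> range Mid" using cl_in[OF vV] by (auto simp: Rm_def)
      then have "u \<in> V" using cl_in[OF vV] partition_onD1[OF pc] by auto
      have "g h v = g h u" using cl_in[OF vV] u by (intro g_const) auto
      also have "\<dots> = f [] u" using g_nonmid \<open>u \<in> V\<close> u by auto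
      finally show ?thesis using f_range \<open>u \<in> V\<close> u by auto
    qed
    define wd where "wd h = map (\<lambda>i. g h (Mid (Suc i))) [0..<tensor_degree k]" for h
    have f_wd: "f (wd h) v = g h v" if vV: "v \<in> V" for h v
    proof (cases "v \<in> range Mid")
      case False then show ?thesis using g_nonmid that by metis
    next
      case True
      then obtain i where i: "v = Mid i" "i \<in> {1..strands k}"
        using vV by (auto simp: V_def stack_vertices_def)
      show ?thesis
      proof (cases "i \<le> tensor_degree k")
        case True
        then have "complete_word k N (wd h) ! (i - 1) = wd h ! (i - 1)"
          using i by (cases k) (auto simp: wd_def nth_append)
        then show ?thesis using True i by (auto simp: top wd_def)
      next
        \<comment> \<open>The position \<open>m + 1\<close> is not a letter of the word but is
          supplied by \<open>complete_word\<close> as \<open>N\<close>. Its component contains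
          \<open>Top (m+1)\<close>, whose label is \<open>N\<close> as well.\<close>
        case False
        then obtain m where m: "k = Half m" "i = m + 1" using i by (cases k) auto
        obtain B1 where B: "B1 \<in> d1" "Unprimed (m+1) \<in> B1" "Primed (m+1) \<in> B1"
          using d m by force
        have "upper ` B1 \<in> stack d1 d2" using B by (auto simp: stack_def)
        moreover have "v \<in> upper ` B1" using B i m by force
        ultimately have "upper ` B1 \<subseteq> cl v"
          using cl_in[OF vV] block_subset_component[of "cl v" "stack d1 d2"]
          by (auto simp: cs_def components_alt)
        moreover have "Top (m+1) \<in> upper ` B1" using B by force
        ultimately have "Top (m+1) \<in> cl v" by auto
        then have "g h v = g h (Top (m+1))" using cl_in[OF vV] by (intro g_const) auto
        also have "\<dots> = f [] (Top (m+1))" using m by (intro g_nonmid) (auto simp: V_def stack_vertices_def)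
        also have "\<dots> = N" using ys m by (auto simp: top tuples_def nth_append)
        finally show ?thesis using i m by (simp add: top wd_def nth_append)
      qed
    qed
    have wd_M: "wd h \<in> M" if h: "h \<in> Rm \<rightarrow>\<^sub>E {1..N}" for h
    proof -
      have "wd h \<in> words k N"
      proof -
        have "Mid (Suc i) \<in> V" if "i < tensor_degree k" for i
          using that by (cases k) (auto simp: V_def stack_vertices_def)
        then show ?thesis unfolding tuples_def wd_def using g_range[OF _ h] by fastforce
      qed
      moreover have "agrees cs (f (wd h))"
        unfolding agrees_def using f_wd g_const partition_onD1[OF pc] by (metis UnionI)
      ultimately show ?thesis by (simp add: M_iff)
    qed
    \<comment> \<open>The inverse of \<open>wd\<close>: an admissible word has a constant letter on
      each removed component, read here at an arbitrary vertex.\<close>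
    define bk where "bk xs = (\<lambda>C\<in>Rm. f xs (SOME v. v \<in> C))" for xs
    have some_C: "(SOME v. v \<in> C) \<in> C" "C \<subseteq> V" if "C \<in> cs" for C
      using that partition_onD3[OF pc] partition_onD1[OF pc] by (auto simp: some_in_eq)
    have bk_PiE: "bk xs \<in> Rm \<rightarrow>\<^sub>E {1..N}" if "xs \<in> M" for xs
    proof -
      have "f xs (SOME v. v \<in> C) \<in> {1..N}" if "C \<in> Rm" for C
      proof -
        have "(SOME v. v \<in> C) \<in> C" "C \<subseteq> V" "C \<subseteq> range Mid" using some_C that by (auto simp: Rm_def)
        then have "(SOME v. v \<in> C) \<in> V" "(SOME v. v \<in> C) \<in> range Mid" by blast+
        then obtain i where "(SOME v. v \<in> C) = Mid i" "i \<in> {1..strands k}"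
          by (auto simp: V_def stack_vertices_def)
        then show ?thesis using complete_word_range[of xs N k i] \<open>xs \<in> M\<close> N by (simp add: M_def top)
      qed
      then show ?thesis by (auto simp: bk_def)
    qed
    have "bij_betw wd (Rm \<rightarrow>\<^sub>E {1..N}) M"
    proof (rule bij_betw_byWitness[where f' = bk])
      show "\<forall>h\<in>Rm \<rightarrow>\<^sub>E {1..N}. bk (wd h) = h"
      proof
        fix h assume h: "h \<in> Rm \<rightarrow>\<^sub>E {1..N}"
        show "bk (wd h) = h"
        proof (rule PiE_ext[OF bk_PiE[OF wd_M[OF h]] h])
          fix C assume C: "C \<in> Rm"
          then have *: "(SOME v. v \<in> C) \<in> C" "C \<subseteq> V" "C \<in> cs" using some_C by (auto simp: Rm_def)
          then have "bk (wd h) C = g h (SOME v. v \<in> C)" using C f_wd by (auto simp: bk_def)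
          also have "\<dots> = h C" using * C cl[of C] by (simp add: g_def)
          finally show "bk (wd h) C = h C" .
        qed
      qed
      show "\<forall>xs\<in>M. wd (bk xs) = xs"
      proof
        fix xs assume xs: "xs \<in> M"
        then have ag: "agrees cs (f xs)" and len: "length xs = tensor_degree k"
          using M_iff by (auto simp: tuples_def)
        show "wd (bk xs) = xs"
        proof (rule nth_equalityI)
          show "length (wd (bk xs)) = length xs" by (simp add: wd_def len)
          fix i assume "i < length (wd (bk xs))"
          then have i: "i < tensor_degree k" by (simp add: wd_def)
          let ?v = "Mid (Suc i)"
          have vV: "?v \<in> V" using i by (cases k) (auto simp: V_def stack_vertices_def)
          have fx: "f xs ?v = xs ! i" using i len by (cases k) (auto simp: top nth_append)
          have "g (bk xs) ?v = f xs ?v"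
          proof (cases "cl ?v \<in> Rm")
            case True
            then have "g (bk xs) ?v = f xs (SOME v. v \<in> cl ?v)" by (simp add: g_def bk_def)
            also have "\<dots> = f xs ?v" using agreesD[OF ag] cl_in[OF vV] some_C(1) by blast
            finally show ?thesis .
          next
            case False
            then obtain u where u: "u \<in> cl ?v" "u \<notin> range Mid" using cl_in[OF vV] by (auto simp: Rm_def)
            then have "u \<in> V" using cl_in[OF vV] partition_onD1[OF pc] by auto
            have "g (bk xs) ?v = g (bk xs) u" using cl_in[OF vV] u by (intro g_const) auto
            also have "\<dots> = f xs u" using g_nonmid \<open>u \<in> V\<close> u by auto
            also have "\<dots> = f xs ?v" using agreesD[OF ag] cl_in[OF vV] u by blast
            finally show ?thesis .
          qed
          then show "wd (bk xs) ! i = xs ! i" using i fx by (simp add: wd_def)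
        qed
      qed
    qed (use wd_M bk_PiE in auto)
    then have "card M = card (Rm \<rightarrow>\<^sub>E {1..N})" by (simp add: bij_betw_same_card)
    also have "\<dots> = N ^ card Rm" using finRm by (simp add: card_PiE)
    finally show ?thesis using True by (simp add: M_def Rm_def cs_def removed_def)
  qed
qed

subsection \<open>Words whose labels separate the blocks of a diagram\<close>

text \<open>The natural number \<open>2 k\<close>. It bounds the number of blocks of a diagram,
  hence the number of letters needed to tell its blocks apart.\<close>

fun word_bound :: "half_integer \<Rightarrow> nat" where
  "word_bound (Whole m) = 2 * m"
| "word_bound (Half m) = 2 * m + 1"

lemma hval_word_bound: "of_nat N \<ge> 2 * hval k \<longleftrightarrow> N \<ge> word_bound k"
proof (cases k)
  case (Whole m)
  have "2 * of_nat m \<le> (of_nat N :: rat) \<longleftrightarrow> of_nat (2 * m) \<le> (of_nat N :: rat)" by simp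
  then show ?thesis unfolding Whole by (simp only: hval.simps word_bound.simps of_nat_le_iff)
next
  case (Half m)
  have "2 * (of_nat m + 1 / 2) \<le> (of_nat N :: rat) \<longleftrightarrow> of_nat (2 * m + 1) \<le> (of_nat N :: rat)"
    by (simp add: add.commute)
  then show ?thesis unfolding Half by (simp only: hval.simps word_bound.simps of_nat_le_iff)
qed

definition block_of :: "'a set set \<Rightarrow> 'a \<Rightarrow> 'a set" where
  "block_of d v = (THE B. B \<in> d \<and> v \<in> B)"

lemma block_of_eq:
  assumes "partition_on V d" "B \<in> d" "v \<in> B"
  shows "block_of d v = B"
  unfolding block_of_def
  using assms partition_onD2[OF assms(1)] by (intro the_equality) (auto simp: disjoint_def)

lemma block_of_in:
  assumes "partition_on V d" "v \<in> V"
  shows "block_of d v \<in> d" "v \<in> block_of d v"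
proof -
  obtain B where "B \<in> d" "v \<in> B" using assms partition_onD1 by blast
  then show "block_of d v \<in> d" "v \<in> block_of d v" using block_of_eq[OF assms(1)] by auto
qed

lemma card_diagram_le:
  assumes "d \<in> diagrams k"
  shows "card d \<le> word_bound k"
proof -
  have p: "partition_on (vertices (strands k)) d" by (rule diagrams_partition_on[OF assms])
  have onto: "d \<subseteq> block_of d ` vertices (strands k)"
  proof
    fix B assume B: "B \<in> d"
    then obtain v where "v \<in> B" using partition_onD3[OF p] by fastforce
    then have "v \<in> vertices (strands k)" "block_of d v = B"
      using B partition_onD1[OF p] block_of_eq[OF p] by auto
    then show "B \<in> block_of d ` vertices (strands k)" by blast
  qed
  have card_v: "card (vertices m) = 2 * m" for m
  proof -
    have "card (vertices m) = card (Unprimed ` {1..m}) + card (Primed ` {1..m})"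
      unfolding vertices_def by (intro card_Un_disjoint) auto
    then show ?thesis by (simp add: card_image inj_on_def)
  qed
  show ?thesis
  proof (cases k)
    case (Whole m)
    have "card d \<le> card (vertices (strands k))"
      using surj_card_le[OF _ onto] by simp
    then show ?thesis using Whole card_v by simp
  next
    case (Half m)
    obtain B where B: "B \<in> d" "Unprimed (m+1) \<in> B" "Primed (m+1) \<in> B" using assms Half by auto
    then have eq: "block_of d (Unprimed (m+1)) = block_of d (Primed (m+1))"
      using block_of_eq[OF p] by metis
    let ?V = "vertices (m+1) - {Primed (m+1)}"
    have "d \<subseteq> block_of d ` ?V"
    proof
      fix C assume "C \<in> d"
      then obtain v where v: "v \<in> vertices (m+1)" "C = block_of d v" using onto Half by auto
      then show "C \<in> block_of d ` ?V"
        using eq by (cases "v = Primed (m+1)") (auto intro: image_eqI[of _ _ "Unprimed (m+1)"])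
    qed
    then have "card d \<le> card ?V" using surj_card_le by (metis finite_Diff finite_vertices)
    also have "card ?V = 2 * m + 1" using card_v[of "m+1"] by simp
    finally show ?thesis using Half by simp
  qed
qed

lemma exact_words:
  assumes d: "d \<in> diagrams k" and N: "N \<ge> word_bound k"
  obtains ys xs where "ys \<in> words k N" "xs \<in> words k N"
    "\<And>a b. a \<in> vertices (strands k) \<Longrightarrow> b \<in> vertices (strands k) \<Longrightarrow>
       word_label k N ys xs a = word_label k N ys xs b \<longleftrightarrow> block_of d a = block_of d b"
proof -
  have p: "partition_on (vertices (strands k)) d" by (rule diagrams_partition_on[OF d])
  have fin: "finite d" using finite_elements[OF _ p] by simp
  have "card d \<le> card {1..N}" using card_diagram_le[OF d] N by simp
  then obtain b0 where b0: "b0 ` d \<subseteq> {1..N}" "inj_on b0 d"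
    using card_le_inj[OF fin] by blast
  obtain b where b: "inj_on b d" "b ` d \<subseteq> {1..N}"
    and last: "\<And>m. k = Half m \<Longrightarrow> b (block_of d (Unprimed (m+1))) = N"
  proof (cases k)
    case (Whole m)
    then show ?thesis using that[OF b0(2,1)] by simp
  next
    case (Half m)
    let ?B = "block_of d (Unprimed (m+1))"
    \<comment> \<open>Completed words carry \<open>N\<close> at position \<open>m + 1\<close>, so
      the letter chosen for that block is exchanged with \<open>N\<close>.\<close>
    let ?t = "Transposition.transpose (b0 ?B) N"
    have B: "?B \<in> d" using block_of_in(1)[OF p, of "Unprimed (m+1)"] Half by simp
    have "inj_on (?t \<circ> b0) d" using b0(2) by (intro comp_inj_on) auto
    moreover have "(?t \<circ> b0) ` d \<subseteq> {1..N}"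
    proof -
      have "b0 ?B \<in> {1..N}" using b0(1) B by blast
      moreover have "N \<ge> 1" using N Half by simp
      ultimately show ?thesis using b0(1) by (auto simp: Transposition.transpose_def)
    qed
    moreover have "(?t \<circ> b0) (block_of d (Unprimed (m'+1))) = N" if "k = Half m'" for m'
      using that Half by simp
    ultimately show ?thesis by (rule that)
  qed
  define ys where "ys = map (\<lambda>i. b (block_of d (Unprimed (Suc i)))) [0..<tensor_degree k]"
  define xs where "xs = map (\<lambda>i. b (block_of d (Primed (Suc i)))) [0..<tensor_degree k]"
  have le: "tensor_degree k \<le> strands k" by (cases k) auto
  have "b (block_of d v) \<in> {1..N}" if "v \<in> vertices (strands k)" for v
    using b(2) block_of_in(1)[OF p that] by auto
  then have t: "ys \<in> words k N" "xs \<in> words k N"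
    using le by (auto simp: tuples_def ys_def xs_def subset_iff)
  have lab: "word_label k N ys xs v = b (block_of d v)" if v: "v \<in> vertices (strands k)" for v
  proof (cases "v \<in> vertices (tensor_degree k)")
    case True
    then show ?thesis
      by (cases k; cases v) (auto simp: ys_def xs_def nth_append)
  next
    case False
    then obtain m where m: "k = Half m" "v = Unprimed (m+1) \<or> v = Primed (m+1)"
      using v by (cases k; cases v) (auto simp: le_Suc_eq)
    obtain B where B: "B \<in> d" "Unprimed (m+1) \<in> B" "Primed (m+1) \<in> B" using d m(1) by auto
    then have "block_of d v = block_of d (Unprimed (m+1))"
      using block_of_eq[OF p] m(2) by metis
    then have "b (block_of d v) = N" using last[OF m(1)] by simp
    then show ?thesis using m by (auto simp: ys_def xs_def nth_append)
  qed
  show ?thesis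
  proof (rule that[OF t])
    fix v w assume "v \<in> vertices (strands k)" "w \<in> vertices (strands k)"
    then show "word_label k N ys xs v = word_label k N ys xs w \<longleftrightarrow> block_of d v = block_of d w"
      using lab b(1) block_of_in(1)[OF p] by (auto dest: inj_onD)
  qed
qed

abbreviation finer :: "half_integer \<Rightarrow> diagram \<Rightarrow> diagram \<Rightarrow> bool" where
  "finer k \<equiv> refines (vertices (strands k))"

text \<open>Evaluated at separating words, the matrices of diagrams form the zeta matrix of the
  refinement order. Its triangularity later yields both the faithfulness of the action and the
  existence of an algebra element with a prescribed invariant matrix.\<close>

lemma labels_agree_exact_iff:
  assumes d: "d \<in> diagrams k" and d': "d' \<in> diagrams k"
    and ex: "\<And>a b. a \<in> vertices (strands k) \<Longrightarrow> b \<in> vertices (strands k) \<Longrightarrow>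
       word_label k N ys xs a = word_label k N ys xs b \<longleftrightarrow> block_of d a = block_of d b"
  shows "labels_agree k N d' ys xs \<longleftrightarrow> finer k d' d"
proof -
  let ?V = "vertices (strands k)"
  have p: "partition_on ?V d" "partition_on ?V d'" using d d' by (auto intro: diagrams_partition_on)
  have sub: "B \<subseteq> ?V" if "B \<in> d'" for B using that partition_onD1[OF p(2)] by blast
  have "labels_agree k N d' ys xs \<longleftrightarrow> (\<forall>B\<in>d'. \<forall>a\<in>B. \<forall>b\<in>B. block_of d a = block_of d b)"
    unfolding labels_agree_agrees agrees_def using ex sub by (intro ball_cong refl) blast
  also have "\<dots> \<longleftrightarrow> (\<forall>B\<in>d'. \<exists>C\<in>d. B \<subseteq> C)"
  proof (intro ball_cong refl iffI)
    fix B assume B: "B \<in> d'" and *: "\<forall>a\<in>B. \<forall>b\<in>B. block_of d a = block_of d b"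
    obtain a where a: "a \<in> B" using B partition_onD3[OF p(2)] by fastforce
    have "B \<subseteq> block_of d a"
    proof
      fix b assume b: "b \<in> B"
      then have "block_of d a = block_of d b" using * a by blast
      then show "b \<in> block_of d a" using block_of_in(2)[OF p(1)] b sub[OF B] by auto
    qed
    then show "\<exists>C\<in>d. B \<subseteq> C" using block_of_in(1)[OF p(1)] a sub[OF B] by blast
  next
    fix B assume B: "B \<in> d'" and "\<exists>C\<in>d. B \<subseteq> C"
    then obtain C where "C \<in> d" "B \<subseteq> C" by blast
    then have "block_of d a = C" if "a \<in> B" for a using that block_of_eq[OF p(1)] by blast
    then show "\<forall>a\<in>B. \<forall>b\<in>B. block_of d a = block_of d b" by simp
  qed
  finally show ?thesis using p by (simp add: refines_def)
qed

lemma labels_agree_detects: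
  assumes d: "d \<in> diagrams k" and d': "d' \<in> diagrams k" and N: "N \<ge> word_bound k"
    and eq: "\<And>ys xs. ys \<in> words k N \<Longrightarrow> xs \<in> words k N \<Longrightarrow>
       labels_agree k N d ys xs \<longleftrightarrow> labels_agree k N d' ys xs"
  shows "d = d'"
proof -
  have "finer k d' d" if d: "d \<in> diagrams k" and d': "d' \<in> diagrams k"
    and eq: "\<And>ys xs. ys \<in> words k N \<Longrightarrow> xs \<in> words k N \<Longrightarrow>
       labels_agree k N d ys xs \<longleftrightarrow> labels_agree k N d' ys xs" for d d'
  proof -
    obtain ys xs where t: "ys \<in> words k N" "xs \<in> words k N"
      and ex: "\<And>a b. a \<in> vertices (strands k) \<Longrightarrow> b \<in> vertices (strands k) \<Longrightarrow>
       word_label k N ys xs a = word_label k N ys xs b \<longleftrightarrow> block_of d a = block_of d b"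
      using exact_words[OF d N] by metis
    have "labels_agree k N d ys xs"
      using labels_agree_exact_iff[OF d d ex] refines_refl diagrams_partition_on[OF d] by blast
    then have "labels_agree k N d' ys xs" using eq t by blast
    then show ?thesis using labels_agree_exact_iff[OF d d' ex] by blast
  qed
  then show ?thesis using assms refines_asym by metis
qed

text \<open>With the letter \<open>N\<close> everywhere, even the completing letter of the
  half-integer case agrees. Since every diagram has entry 1 here, these entries serve to compare
  scalars.\<close>

lemma constant_word:
  assumes "d \<in> diagrams k" "N \<ge> 1"
  defines "w \<equiv> replicate (tensor_degree k) N"
  shows "w \<in> words k N" "labels_agree k N d w w"
proof -
  show "w \<in> words k N" using assms(2) by (auto simp: w_def tuples_def)
  have p: "partition_on (vertices (strands k)) d" by (rule diagrams_partition_on[OF assms(1)])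
  have "word_label k N w w v = N" if "v \<in> vertices (strands k)" for v
    using that by (cases k; cases v) (auto simp: w_def nth_append)
  then have "agrees d (word_label k N w w) \<longleftrightarrow> agrees d (\<lambda>_. N)"
    by (rule agrees_cong[OF p])
  then show "labels_agree k N d w w"
    unfolding labels_agree_agrees using agreesI[of d "\<lambda>_. N"] by blast
qed

text \<open>Stacks are computed by counting labellings: \<open>d1\<close> stacked on \<open>d2\<close> gives \<open>N ^ removed d1 d2\<close> times
  the matrix of \<open>compose d1 d2\<close>, and for large \<open>N\<close> this product determines both the composite and
  the number of removed components.\<close>

lemma power_labels_agree_cancel:
  assumes "d \<in> diagrams k" "d' \<in> diagrams k" and N: "N \<ge> word_bound k" "N \<ge> 2"
    and eq: "\<And>ys xs. ys \<in> words k N \<Longrightarrow> xs \<in> words k N \<Longrightarrow>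
       N ^ i * of_bool (labels_agree k N d ys xs) = N ^ j * of_bool (labels_agree k N d' ys xs)"
  shows "d = d'" "i = j"
proof -
  show "d = d'"
  proof (rule labels_agree_detects[OF assms(1-3)])
    fix ys xs assume "ys \<in> words k N" "xs \<in> words k N"
    from eq[OF this] show "labels_agree k N d ys xs \<longleftrightarrow> labels_agree k N d' ys xs"
      using N by (auto simp: of_bool_def split: if_splits)
  qed
  then have "N ^ i = N ^ j"
    using eq[OF constant_word(1)[OF assms(1)] constant_word(1)[OF assms(1)]] constant_word(2)[OF assms(1)] N
    by simp
  then show "i = j" using N by (simp add: power_inject_exp)
qed

lemma middle_label_sum:
  assumes "d1 \<in> diagrams k" "d2 \<in> diagrams k"
    and "ys \<in> words k N" "zs \<in> words k N" and "N \<ge> 1"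
  shows "(\<Sum>xs\<in>words k N.
      of_bool (labels_agree k N d1 ys xs) * of_bool (labels_agree k N d2 xs zs)) =
    (of_nat N ^ removed d1 d2 * of_bool (labels_agree k N (compose d1 d2) ys zs) :: 'c::comm_semiring_1)"
proof -
  have "(\<Sum>xs\<in>words k N.
      of_bool (labels_agree k N d1 ys xs) * of_bool (labels_agree k N d2 xs zs)) =
    (\<Sum>xs\<in>words k N. of_bool (labels_agree k N d1 ys xs \<and> labels_agree k N d2 xs zs) :: 'c)"
    by (intro sum.cong) (auto simp: of_bool_def)
  also have "\<dots> = of_nat (card {xs \<in> words k N.
      labels_agree k N d1 ys xs \<and> labels_agree k N d2 xs zs})"
    by (simp add: sum_of_bool_eq Int_def)
  finally show ?thesis by (simp add: middle_label_count[OF assms])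
qed

text \<open>If agreeing outer words admit exactly one middle word and all others none, the count of
  middle words is the matrix of \<open>D\<close> without any factor; so nothing is removed and the
  composite is \<open>D\<close>. Products with identity, permutation and padded diagrams are
  computed in this way, without inspecting components.\<close>

lemma compose_determined:
  assumes d: "d1 \<in> diagrams k" "d2 \<in> diagrams k" and D: "D \<in> diagrams k"
    and N: "N \<ge> word_bound k" "N \<ge> 2"
    and eq: "\<And>ys zs. ys \<in> words k N \<Longrightarrow> zs \<in> words k N \<Longrightarrow>
       \<exists>w\<in>words k N. \<forall>xs\<in>words k N.
         labels_agree k N d1 ys xs \<and> labels_agree k N d2 xs zs \<longleftrightarrow> xs = w \<and> labels_agree k N D ys zs"
  shows "compose d1 d2 = D" "removed d1 d2 = 0"
proof -
  have *: "N ^ removed d1 d2 * of_bool (labels_agree k N (compose d1 d2) ys zs) =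
      N ^ 0 * of_bool (labels_agree k N D ys zs)"
    if t: "ys \<in> words k N" "zs \<in> words k N" for ys zs
  proof -
    obtain w where w: "w \<in> words k N" "\<And>xs. xs \<in> words k N \<Longrightarrow>
         labels_agree k N d1 ys xs \<and> labels_agree k N d2 xs zs \<longleftrightarrow> xs = w \<and> labels_agree k N D ys zs"
      using eq[OF t] by blast
    have "{xs \<in> words k N. labels_agree k N d1 ys xs \<and> labels_agree k N d2 xs zs} =
        (if labels_agree k N D ys zs then {w} else {})"
      using w by auto
    then have "card {xs \<in> words k N. labels_agree k N d1 ys xs \<and> labels_agree k N d2 xs zs} =
        of_bool (labels_agree k N D ys zs)" by simp
    then have "(if labels_agree k N (compose d1 d2) ys zs then N ^ removed d1 d2 else 0) =
        of_bool (labels_agree k N D ys zs)"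
      using middle_label_count[OF d t] N by simp
    then show ?thesis by (cases "labels_agree k N (compose d1 d2) ys zs") simp_all
  qed
  show "compose d1 d2 = D" "removed d1 d2 = 0"
    using power_labels_agree_cancel[OF compose_closed[OF d] D N *] by auto
qed

text \<open>Both bracketings give the same entry of a triple matrix product. As \<open>N\<close> is
  at least 2 and at least \<open>2 k\<close>, the diagram and the exponent of \<open>N\<close> can
  be read off from such entries separately.\<close>

lemma compose_assoc:
  assumes d: "d1 \<in> diagrams k" "d2 \<in> diagrams k" "d3 \<in> diagrams k"
  shows "compose (compose d1 d2) d3 = compose d1 (compose d2 d3)"
    and "removed d1 d2 + removed (compose d1 d2) d3 = removed d2 d3 + removed d1 (compose d2 d3)"
proof -
  define N where "N = max 2 (word_bound k)"
  have N: "N \<ge> word_bound k" "N \<ge> 2" "N \<ge> 1" by (auto simp: N_def)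
  let ?T = "words k N"
  let ?m = "\<lambda>d ys xs. of_bool (labels_agree k N d ys xs) :: nat"
  have *: "N ^ (removed d1 d2 + removed (compose d1 d2) d3) * ?m (compose (compose d1 d2) d3) ys zs =
      N ^ (removed d2 d3 + removed d1 (compose d2 d3)) * ?m (compose d1 (compose d2 d3)) ys zs"
    if t: "ys \<in> ?T" "zs \<in> ?T" for ys zs
  proof -
    have "(\<Sum>ws\<in>?T. (\<Sum>xs\<in>?T. ?m d1 ys xs * ?m d2 xs ws) * ?m d3 ws zs) =
        (\<Sum>ws\<in>?T. N ^ removed d1 d2 * (?m (compose d1 d2) ys ws * ?m d3 ws zs))"
      using middle_label_sum[OF d(1,2) t(1) _ N(3), where 'c = nat] by (intro sum.cong) simp_all
    also have "\<dots> = N ^ removed d1 d2 * (N ^ removed (compose d1 d2) d3 * ?m (compose (compose d1 d2) d3) ys zs)"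
      using middle_label_sum[OF compose_closed[OF d(1,2)] d(3) t N(3), where 'c = nat]
      by (simp flip: sum_distrib_left)
    finally have 1: "(\<Sum>ws\<in>?T. (\<Sum>xs\<in>?T. ?m d1 ys xs * ?m d2 xs ws) * ?m d3 ws zs) = \<dots>" .
    have "(\<Sum>ws\<in>?T. (\<Sum>xs\<in>?T. ?m d1 ys xs * ?m d2 xs ws) * ?m d3 ws zs) =
        (\<Sum>xs\<in>?T. ?m d1 ys xs * (\<Sum>ws\<in>?T. ?m d2 xs ws * ?m d3 ws zs))"
      unfolding sum_distrib_left sum_distrib_right by (subst sum.swap) (simp add: mult.assoc)
    also have "\<dots> = (\<Sum>xs\<in>?T. N ^ removed d2 d3 * (?m d1 ys xs * ?m (compose d2 d3) xs zs))"
      using middle_label_sum[OF d(2,3) _ t(2) N(3), where 'c = nat] by (intro sum.cong) simp_all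
    also have "\<dots> = N ^ removed d2 d3 * (N ^ removed d1 (compose d2 d3) * ?m (compose d1 (compose d2 d3)) ys zs)"
      using middle_label_sum[OF d(1) compose_closed[OF d(2,3)] t N(3), where 'c = nat]
      by (simp flip: sum_distrib_left)
    finally show ?thesis using 1 by (simp add: power_add mult.assoc)
  qed
  show "compose (compose d1 d2) d3 = compose d1 (compose d2 d3)"
    "removed d1 d2 + removed (compose d1 d2) d3 = removed d2 d3 + removed d1 (compose d2 d3)"
    using power_labels_agree_cancel[OF _ _ N(1,2) *] d by (auto intro!: compose_closed)
qed

subsection \<open>The identity diagram\<close>

lemma id_diagram_closed: "id_diagram (strands k) \<in> diagrams k"
proof -
  have "partition_on (vertices m) (id_diagram m)" for m
    by (rule partition_onI) (auto simp: id_diagram_def vertices_def disjnt_def)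
  then show ?thesis by (cases k) (auto simp: id_diagram_def)
qed

lemma labels_agree_id:
  assumes "ys \<in> words k N" "xs \<in> words k N"
  shows "labels_agree k N (id_diagram (strands k)) ys xs \<longleftrightarrow> ys = xs"
proof -
  have len: "length ys = tensor_degree k" "length xs = tensor_degree k" using assms by (auto simp: tuples_def)
  have "labels_agree k N (id_diagram (strands k)) ys xs \<longleftrightarrow>
      (\<forall>i\<in>{1..strands k}. complete_word k N ys ! (i - 1) = complete_word k N xs ! (i - 1))"
    unfolding labels_agree_def id_diagram_def ball_simps
    by (intro ball_cong refl) auto
  also have "\<dots> \<longleftrightarrow> (\<forall>i<strands k. complete_word k N ys ! i = complete_word k N xs ! i)"
  proof (intro iffI allI impI ballI)
    fix i assume *: "\<forall>i\<in>{1..strands k}. complete_word k N ys ! (i - 1) = complete_word k N xs ! (i - 1)"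
      and "i < strands k"
    then show "complete_word k N ys ! i = complete_word k N xs ! i"
      using bspec[OF *, of "Suc i"] by simp
  next
    fix i assume *: "\<forall>i<strands k. complete_word k N ys ! i = complete_word k N xs ! i"
      and "i \<in> {1..strands k}"
    then have "i - 1 < strands k" by auto
    then show "complete_word k N ys ! (i - 1) = complete_word k N xs ! (i - 1)" using * by blast
  qed
  also have "\<dots> \<longleftrightarrow> complete_word k N ys = complete_word k N xs"
  proof -
    have "length (complete_word k N ys) = strands k" "length (complete_word k N xs) = strands k"
      using len by (cases k; simp)+
    then show ?thesis by (auto intro: nth_equalityI)
  qed
  also have "\<dots> \<longleftrightarrow> ys = xs" by (cases k) auto
  finally show ?thesis .
qed

lemma compose_id:
  assumes d: "d \<in> diagrams k"
  shows "compose (id_diagram (strands k)) d = d" "removed (id_diagram (strands k)) d = 0"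
    and "compose d (id_diagram (strands k)) = d" "removed d (id_diagram (strands k)) = 0"
proof -
  define N where "N = max 2 (word_bound k)"
  have N: "N \<ge> word_bound k" "N \<ge> 2" by (auto simp: N_def)
  have l: "\<exists>w\<in>words k N. \<forall>xs\<in>words k N.
      labels_agree k N (id_diagram (strands k)) ys xs \<and> labels_agree k N d xs zs \<longleftrightarrow>
      xs = w \<and> labels_agree k N d ys zs"
    if "ys \<in> words k N" for ys zs
    using labels_agree_id[OF that] by (intro bexI[OF _ that]) auto
  show "compose (id_diagram (strands k)) d = d" "removed (id_diagram (strands k)) d = 0"
    using compose_determined[OF id_diagram_closed d d N l] by auto
  have r: "\<exists>w\<in>words k N. \<forall>xs\<in>words k N.
      labels_agree k N d ys xs \<and> labels_agree k N (id_diagram (strands k)) xs zs \<longleftrightarrow>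
      xs = w \<and> labels_agree k N d ys zs"
    if "zs \<in> words k N" for ys zs
    using labels_agree_id[OF _ that] by (intro bexI[OF _ that]) auto
  show "compose d (id_diagram (strands k)) = d" "removed d (id_diagram (strands k)) = 0"
    using compose_determined[OF d id_diagram_closed d N r] by auto
qed

subsection \<open>Coefficients are determined by sums over refinements\<close>

text \<open>The number of connected pairs of vertices. It grows strictly when a partition is
  coarsened and so serves as a rank for inductions over the refinement order.\<close>

definition connection_size :: "diagram \<Rightarrow> nat" where
  "connection_size d = card (\<Union>B\<in>d. B \<times> B)"

lemma connection_size_less:
  assumes "finer k d' d" "d' \<noteq> d"
  shows "connection_size d' < connection_size d"
proof -
  let ?V = "vertices (strands k)"
  have p: "partition_on ?V d" "partition_on ?V d'" using assms(1) by (auto simp: refines_def)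
  have "(\<Union>B\<in>d. B \<times> B) \<subseteq> ?V \<times> ?V" using partition_onD1[OF p(1)] by blast
  then have fin: "finite (\<Union>B\<in>d. B \<times> B)" by (rule finite_subset) simp
  have "(\<Union>B\<in>d'. B \<times> B) \<subseteq> (\<Union>B\<in>d. B \<times> B)" using assms(1) unfolding refines_def by blast
  moreover have "(\<Union>B\<in>d'. B \<times> B) \<noteq> (\<Union>B\<in>d. B \<times> B)"
  proof
    assume eq: "(\<Union>B\<in>d'. B \<times> B) = (\<Union>B\<in>d. B \<times> B)"
    have "\<exists>B'\<in>d'. B \<subseteq> B'" if B: "B \<in> d" for B
    proof -
      obtain a where a: "a \<in> B" using B partition_onD3[OF p(1)] by fastforce
      have aV: "a \<in> ?V" using a B partition_onD1[OF p(1)] by blast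
      have "B \<subseteq> block_of d' a"
      proof
        fix b assume "b \<in> B"
        then have "(a, b) \<in> (\<Union>B\<in>d'. B \<times> B)" unfolding eq using a B by blast
        then obtain B' where "B' \<in> d'" "a \<in> B'" "b \<in> B'" by blast
        then show "b \<in> block_of d' a" using block_of_eq[OF p(2)] by blast
      qed
      then show ?thesis using block_of_in(1)[OF p(2) aV] by blast
    qed
    then have "finer k d d'" using p by (simp add: refines_def)
    then show False using refines_asym assms by blast
  qed
  ultimately show ?thesis unfolding connection_size_def using fin by (intro psubset_card_mono) auto
qed

lemma refinement_sums_injective:
  fixes c :: "diagram \<Rightarrow> 'c::comm_ring_1"
  assumes "\<And>d. d \<in> diagrams k \<Longrightarrow> (\<Sum>d'\<in>{d'\<in>diagrams k. finer k d' d}. c d') = 0" "d \<in> diagrams k"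
  shows "c d = 0"
  using assms(2)
proof (induction "connection_size d" arbitrary: d rule: less_induct)
  case less
  have "c d' = 0" if "d' \<in> diagrams k" "finer k d' d" "d' \<noteq> d" for d'
    using less.hyps connection_size_less[OF that(2,3)] that(1) by blast
  then have "(\<Sum>d'\<in>{d'\<in>diagrams k. finer k d' d}. c d') = (\<Sum>d'\<in>{d'\<in>diagrams k. finer k d' d}. if d' = d then c d else 0)"
    by (intro sum.cong) auto
  also have "\<dots> = c d"
    using less.prems refines_refl[OF diagrams_partition_on[OF less.prems]] by simp
  finally show ?case using assms(1)[OF less.prems] by simp
qed

lemma refinement_sums_surjective:
  fixes t :: "diagram \<Rightarrow> 'c::comm_ring_1"
  shows "\<exists>c. \<forall>d\<in>diagrams k. (\<Sum>d'\<in>{d'\<in>diagrams k. finer k d' d}. c d') = t d"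
proof -
  have "\<exists>c. \<forall>d\<in>diagrams k. connection_size d < n \<longrightarrow> (\<Sum>d'\<in>{d'\<in>diagrams k. finer k d' d}. c d') = t d" for n
  proof (induction n)
    case (Suc n)
    then obtain c where c: "\<And>d. d \<in> diagrams k \<Longrightarrow> connection_size d < n \<Longrightarrow>
        (\<Sum>d'\<in>{d'\<in>diagrams k. finer k d' d}. c d') = t d" by blast
    define s where "s d = (\<Sum>d'\<in>{d'\<in>diagrams k. finer k d' d}. c d')" for d
    \<comment> \<open>Coefficients are corrected at size exactly \<open>n\<close>. Proper
      refinements of a diagram of size at most \<open>n\<close> have size below \<open>n\<close>, so
      each sum up to that size changes only by the correction at the diagram itself.\<close>
    define c' where "c' d = (if connection_size d = n then c d + (t d - s d) else c d)" for d
    have "(\<Sum>d'\<in>{d'\<in>diagrams k. finer k d' d}. c' d') = t d"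
      if d: "d \<in> diagrams k" "connection_size d < Suc n" for d
    proof -
      have "(\<Sum>d'\<in>{d'\<in>diagrams k. finer k d' d}. c' d') =
          (\<Sum>d'\<in>{d'\<in>diagrams k. finer k d' d}. c d' + (if d' = d then (if connection_size d = n then t d - s d else 0) else 0))"
      proof (intro sum.cong refl)
        fix d' assume "d' \<in> {d'\<in>diagrams k. finer k d' d}"
        then show "c' d' = c d' + (if d' = d then (if connection_size d = n then t d - s d else 0) else 0)"
          using connection_size_less[of k d' d] d(2) by (cases "d' = d") (simp_all add: c'_def)
      qed
      also have "\<dots> = s d + (if connection_size d = n then t d - s d else 0)"
        using d refines_refl[OF diagrams_partition_on[OF d(1)]] by (simp add: sum.distrib s_def)
      also have "\<dots> = t d" using c[OF d(1)] d(2) by (auto simp: s_def)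
      finally show ?thesis .
    qed
    then show ?case by blast
  qed auto
  from this[of "Suc (Max (connection_size ` diagrams k))"] obtain c where
    c: "\<And>d. d \<in> diagrams k \<Longrightarrow> connection_size d < Suc (Max (connection_size ` diagrams k)) \<Longrightarrow>
       (\<Sum>d'\<in>{d'\<in>diagrams k. finer k d' d}. c d') = t d" by blast
  have "connection_size d < Suc (Max (connection_size ` diagrams k))" if "d \<in> diagrams k" for d
    using that by (simp add: less_Suc_eq_le)
  then show ?thesis using c by blast
qed

subsection \<open>Propagating numbers\<close>

abbreviation propagating :: "vertex set \<Rightarrow> bool" where
  "propagating B \<equiv> (\<exists>i. Unprimed i \<in> B) \<and> (\<exists>j. Primed j \<in> B)"

text \<open>If \<open>C\<close> contained no propagating block of \<open>d1\<close>, every block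
  meeting the top row of \<open>C\<close> would stay in the top row, and so would all of
  \<open>C\<close>, although it reaches the bottom row. The second part is the mirror image.\<close>

lemma component_meets_propagating_block:
  assumes C: "C \<in> components d1 d2" "Top i \<in> C" "Bot j \<in> C"
  shows "\<exists>B\<in>d1. propagating B \<and> upper ` B \<subseteq> C" "\<exists>B\<in>d2. propagating B \<and> lower ` B \<subseteq> C"
proof -
  let ?S = "stack d1 d2"
  have C': "C \<in> \<Union>?S // connection ?S" using C(1) by (simp add: components_alt)
  show "\<exists>B\<in>d1. propagating B \<and> upper ` B \<subseteq> C"
  proof (rule ccontr)
    assume none: "\<not> ?thesis"
    have "C \<subseteq> C \<inter> range Top"
    proof (rule component_subset_closed[OF C'])
      fix B assume B: "B \<in> ?S" "B \<inter> (C \<inter> range Top) \<noteq> {}"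
      then have BC: "B \<subseteq> C" using block_subset_component[OF C' B(1)] by blast
      obtain i where i: "Top i \<in> B" using B(2) by blast
      then obtain B1 where B1: "B1 \<in> d1" "B = upper ` B1"
        using B(1) by (auto simp: stack_def) (metis lower.cases lower.simps stack_vertex.distinct(1,3))
      have "Unprimed i \<in> B1"
      proof -
        obtain v where "v \<in> B1" "upper v = Top i" using i B1(2) by auto
        then show ?thesis by (cases v) auto
      qed
      then have "Primed j \<notin> B1" for j using none B1 BC by blast
      then have "upper v \<in> range Top" if "v \<in> B1" for v using that by (cases v) auto
      then show "B \<subseteq> C \<inter> range Top" using BC B1(2) by blast
    qed (use C in blast)
    then show False using C(3) by blast
  qed
  show "\<exists>B\<in>d2. propagating B \<and> lower ` B \<subseteq> C"
  proof (rule ccontr)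
    assume none: "\<not> ?thesis"
    have "C \<subseteq> C \<inter> range Bot"
    proof (rule component_subset_closed[OF C'])
      fix B assume B: "B \<in> ?S" "B \<inter> (C \<inter> range Bot) \<noteq> {}"
      then have BC: "B \<subseteq> C" using block_subset_component[OF C' B(1)] by blast
      obtain i where i: "Bot i \<in> B" using B(2) by blast
      then obtain B1 where B1: "B1 \<in> d2" "B = lower ` B1"
        using B(1) by (auto simp: stack_def) (metis upper.cases upper.simps stack_vertex.distinct(3,5))
      have "Primed i \<in> B1"
      proof -
        obtain v where "v \<in> B1" "lower v = Bot i" using i B1(2) by auto
        then show ?thesis by (cases v) auto
      qed
      then have "Unprimed j \<notin> B1" for j using none B1 BC by blast
      then have "lower v \<in> range Bot" if "v \<in> B1" for v using that by (cases v) auto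
      then show "B \<subseteq> C \<inter> range Bot" using BC B1(2) by blast
    qed (use C in blast)
    then show False using C(2) by blast
  qed
qed

text \<open>A propagating block of the composite comes from a component that meets both outer rows.
  Choosing inside it a propagating block of one factor is injective because components are
  disjoint.\<close>

lemma propagating_number_compose:
  assumes d: "d1 \<in> diagrams k" "d2 \<in> diagrams k"
  shows "propagating_number (compose d1 d2) \<le> propagating_number d1"
    and "propagating_number (compose d1 d2) \<le> propagating_number d2"
proof -
  let ?s = "strands k"
  have p: "partition_on (vertices ?s) d1" "partition_on (vertices ?s) d2"
    using d by (auto intro: diagrams_partition_on)
  have pc: "partition_on (stack_vertices ?s) (components d1 d2)"
    by (rule partition_on_components[OF p])
  have fin: "finite {B \<in> d. propagating B}" if "partition_on (vertices ?s) d" for d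
    using finite_elements[OF _ that] by simp
  define PC where "PC = {C \<in> components d1 d2. (\<exists>i. Top i \<in> C) \<and> (\<exists>j. Bot j \<in> C)}"
  have finPC: "finite PC"
    unfolding PC_def using finite_elements[OF _ pc] by (simp add: stack_vertices_def)
  have "{B \<in> compose d1 d2. propagating B} \<subseteq> (-`) outer ` PC"
  proof
    fix B assume B: "B \<in> {B \<in> compose d1 d2. propagating B}"
    then obtain C where C: "C \<in> components d1 d2" "B = outer -` C" by (auto simp: compose_alt)
    then have "C \<in> PC" using B by (simp add: PC_def)
    then show "B \<in> (-`) outer ` PC" using C(2) by blast
  qed
  then have le: "propagating_number (compose d1 d2) \<le> card PC"
    unfolding propagating_number_def using surj_card_le[OF finPC] by blast
  have disj: "C = C'" if "C \<in> PC" "C' \<in> PC" "f ` B \<subseteq> C" "f ` B \<subseteq> C'" "propagating B"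
    for C C' B and f :: "vertex \<Rightarrow> stack_vertex"
  proof -
    obtain v where "v \<in> B" using \<open>propagating B\<close> by blast
    then have "C \<inter> C' \<noteq> {}" using that(3,4) by blast
    then show ?thesis
      using disjointD[OF partition_onD2[OF pc], of C C'] that(1,2) by (auto simp: PC_def)
  qed
  have "\<forall>C\<in>PC. \<exists>B\<in>d1. propagating B \<and> upper ` B \<subseteq> C"
    using component_meets_propagating_block(1) by (auto simp: PC_def)
  then obtain h where h: "\<And>C. C \<in> PC \<Longrightarrow> h C \<in> d1 \<and> propagating (h C) \<and> upper ` h C \<subseteq> C" by metis
  have "inj_on h PC"
    using h by (intro inj_onI) (metis disj[of _ _ upper])
  then have "card PC \<le> propagating_number d1"
    unfolding propagating_number_def using h by (intro card_inj_on_le[of h] fin p) auto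
  then show "propagating_number (compose d1 d2) \<le> propagating_number d1" using le by simp
  have "\<forall>C\<in>PC. \<exists>B\<in>d2. propagating B \<and> lower ` B \<subseteq> C"
    using component_meets_propagating_block(2) by (auto simp: PC_def)
  then obtain h where h: "\<And>C. C \<in> PC \<Longrightarrow> h C \<in> d2 \<and> propagating (h C) \<and> lower ` h C \<subseteq> C" by metis
  have "inj_on h PC"
    using h by (intro inj_onI) (metis disj[of _ _ lower])
  then have "card PC \<le> propagating_number d2"
    unfolding propagating_number_def using h by (intro card_inj_on_le[of h] fin p) auto
  then show "propagating_number (compose d1 d2) \<le> propagating_number d2" using le by simp
qed

section \<open>The partition algebra is a ring\<close>

definition pmul :: "'c::comm_ring_1 \<Rightarrow> (diagram \<Rightarrow>\<^sub>0 'c) \<Rightarrow> (diagram \<Rightarrow>\<^sub>0 'c) \<Rightarrow> (diagram \<Rightarrow>\<^sub>0 'c)" where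
  "pmul q f g = lin_ext (\<lambda>d1. lin_ext (\<lambda>d2. single (compose d1 d2) (q ^ removed d1 d2)) g) f"

definition diagram_span :: "half_integer \<Rightarrow> (diagram \<Rightarrow>\<^sub>0 'c::comm_ring_1) set" where
  "diagram_span k = {f. keys f \<subseteq> diagrams k}"

lemma partition_algebra_simps [simp]:
  "carrier (partition_algebra q k) = diagram_span k"
  "mult (partition_algebra q k) = pmul q"
  "one (partition_algebra q k) = single (id_diagram (strands k)) 1"
  "ring.zero (partition_algebra q k) = 0"
  "ring.add (partition_algebra q k) = (+)"
  by (simp_all add: partition_algebra_def diagram_span_def pmul_def fun_eq_iff)

lemma diagram_span_closed [simp, intro]:
  "0 \<in> diagram_span k"
  "f \<in> diagram_span k \<Longrightarrow> g \<in> diagram_span k \<Longrightarrow> f + g \<in> diagram_span k"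
  "f \<in> diagram_span k \<Longrightarrow> - f \<in> diagram_span k"
  "f \<in> diagram_span k \<Longrightarrow> scale c f \<in> diagram_span k"
  "d \<in> diagrams k \<Longrightarrow> single d c \<in> diagram_span k"
  using keys_add[of f g] keys_scale_subset[of c f] by (auto simp: diagram_span_def)

lemma diagram_span_diff: "f \<in> diagram_span k \<Longrightarrow> g \<in> diagram_span k \<Longrightarrow> f - g \<in> diagram_span k"
  using diagram_span_closed(2)[of f k "- g"] diagram_span_closed(3)[of g k] by simp

lemma diagram_span_sum: "(\<And>i. i \<in> I \<Longrightarrow> f i \<in> diagram_span k) \<Longrightarrow> (\<Sum>i\<in>I. f i) \<in> diagram_span k"
  unfolding diagram_span_def using keys_sum_subset[of I f "diagrams k"] by blast

lemma linear_pmul_right: "linear_map (pmul q f)"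
  unfolding pmul_def by (rule linear_lin_ext_lin_ext)

lemma linear_pmul_left: "linear_map (\<lambda>f. pmul q f g)"
  unfolding pmul_def by (rule linear_lin_ext)

lemmas [linear_intros] = linear_map_comp[OF linear_pmul_left] linear_map_comp[OF linear_pmul_right]

lemma pmul_single:
  "pmul q (single d1 a) (single d2 b) = single (compose d1 d2) (a * b * q ^ removed d1 d2)"
  by (simp add: pmul_def mult.assoc)

lemma pmul_closed [simp, intro]:
  assumes "f \<in> diagram_span k" "g \<in> diagram_span k"
  shows "pmul q f g \<in> diagram_span k"
proof -
  have "keys (single (compose d1 d2) (q ^ removed d1 d2)) \<subseteq> diagrams k"
    if "d1 \<in> keys f" "d2 \<in> keys g" for d1 d2
    using compose_closed[of d1 k d2] that assms by (auto simp: diagram_span_def)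
  then show ?thesis
    unfolding diagram_span_def pmul_def mem_Collect_eq by (intro keys_lin_ext) blast
qed

lemma pmul_id_left:
  assumes "f \<in> diagram_span k"
  shows "pmul q (single (id_diagram (strands k)) c) f = scale c f"
proof (rule linear_map_eqI[OF linear_pmul_right linear_map_scaled[OF linear_map_id]])
  show "keys f \<subseteq> diagrams k" using assms by (simp add: diagram_span_def)
qed (simp add: pmul_single compose_id)

lemma pmul_id_right:
  assumes "f \<in> diagram_span k"
  shows "pmul q f (single (id_diagram (strands k)) c) = scale c f"
proof (rule linear_map_eqI[OF linear_pmul_left linear_map_scaled[OF linear_map_id]])
  show "keys f \<subseteq> diagrams k" using assms by (simp add: diagram_span_def)
qed (simp add: pmul_single compose_id)

lemma pmul_assoc:
  assumes "f \<in> diagram_span k" "g \<in> diagram_span k" "h \<in> diagram_span k"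
  shows "pmul q (pmul q f g) h = pmul q f (pmul q g h)"
proof (rule linear_map_eqI[where S = "\<lambda>f. pmul q (pmul q f g) h" and T = "\<lambda>f. pmul q f (pmul q g h)" and A = "diagrams k"])
  fix d1 assume d1: "d1 \<in> diagrams k"
  show "pmul q (pmul q (single d1 1) g) h = pmul q (single d1 1) (pmul q g h)"
  proof (rule linear_map_eqI2[where S = "\<lambda>g. pmul q (pmul q (single d1 1) g)"
        and T = "\<lambda>g h. pmul q (single d1 1) (pmul q g h)" and A = "diagrams k" and B = "diagrams k"])
    fix d2 d3 assume "d2 \<in> diagrams k" "d3 \<in> diagrams k"
    then show "pmul q (pmul q (single d1 1) (single d2 1)) (single d3 1) =
        pmul q (single d1 1) (pmul q (single d2 1) (single d3 1))"
      using compose_assoc[OF d1] by (simp add: pmul_single flip: power_add)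
  qed (use assms in \<open>auto simp: diagram_span_def intro!: linear_intros\<close>)
qed (use assms in \<open>auto simp: diagram_span_def intro!: linear_intros\<close>)

lemma abelian_group_additiveI:
  fixes M :: "('a::ab_group_add, 'x) ring_scheme"
  assumes "ring.add M = (+)" "ring.zero M = 0" "0 \<in> carrier M"
    and "\<And>x y. x \<in> carrier M \<Longrightarrow> y \<in> carrier M \<Longrightarrow> x + y \<in> carrier M"
    and "\<And>x. x \<in> carrier M \<Longrightarrow> - x \<in> carrier M"
  shows "abelian_group M"
  using assms by (intro abelian_groupI) (auto simp: algebra_simps intro!: bexI[of _ "- x" for x])

lemma ring_partition_algebra: "ring (partition_algebra q k)"
proof (rule ringI)
  show "abelian_group (partition_algebra q k)"
    by (rule abelian_group_additiveI) auto
  show "monoid (partition_algebra q k)"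
    by (rule monoidI) (auto simp: pmul_assoc id_diagram_closed pmul_id_left pmul_id_right)
qed (simp_all add: linear_map_add[OF linear_pmul_left] linear_map_add[OF linear_pmul_right])

section \<open>Transport of modules along isomorphisms\<close>

text \<open>Used to show that \<open>M\<close> is a module, of which nothing is known beforehand;
  preservation of zero is therefore part of the definition rather than a consequence.\<close>

definition module_iso :: "('a, 'x) ring_scheme \<Rightarrow> ('a, 'm) module \<Rightarrow> ('a, 'n) module \<Rightarrow> ('m \<Rightarrow> 'n) \<Rightarrow> bool" where
  "module_iso A X M f \<longleftrightarrow> bij_betw f (carrier X) (carrier M) \<and> f \<zero>\<^bsub>X\<^esub> = \<zero>\<^bsub>M\<^esub> \<and>
     (\<forall>x\<in>carrier X. \<forall>y\<in>carrier X. f (x \<oplus>\<^bsub>X\<^esub> y) = f x \<oplus>\<^bsub>M\<^esub> f y) \<and>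
     (\<forall>a\<in>carrier A. \<forall>x\<in>carrier X. f (a \<odot>\<^bsub>X\<^esub> x) = a \<odot>\<^bsub>M\<^esub> f x)"

lemma left_moduleD:
  assumes "left_module A M"
  shows "ring A" "abelian_group M"
    "\<And>a m. a \<in> carrier A \<Longrightarrow> m \<in> carrier M \<Longrightarrow> a \<odot>\<^bsub>M\<^esub> m \<in> carrier M"
  using assms by (auto simp: left_module_def)

lemma abelian_group_iso:
  assumes X: "abelian_group X"
    and surj: "f ` carrier X = carrier M" and zero: "f \<zero>\<^bsub>X\<^esub> = \<zero>\<^bsub>M\<^esub>"
    and add: "\<And>x y. x \<in> carrier X \<Longrightarrow> y \<in> carrier X \<Longrightarrow> f (x \<oplus>\<^bsub>X\<^esub> y) = f x \<oplus>\<^bsub>M\<^esub> f y"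
  shows "abelian_group M"
proof -
  interpret X: abelian_group X by (rule X)
  have ex: "\<exists>x\<in>carrier X. m = f x" if "m \<in> carrier M" for m using that surj by blast
  have fin: "f x \<in> carrier M" if "x \<in> carrier X" for x using that surj by blast
  show ?thesis
  proof (rule abelian_groupI)
    fix m n assume "m \<in> carrier M" "n \<in> carrier M"
    then obtain x y where x: "x \<in> carrier X" "m = f x" "y \<in> carrier X" "n = f y" using ex by metis
    show "m \<oplus>\<^bsub>M\<^esub> n \<in> carrier M" using x add fin by (metis X.a_closed)
    show "m \<oplus>\<^bsub>M\<^esub> n = n \<oplus>\<^bsub>M\<^esub> m" using x add by (metis X.a_comm)
    fix l assume "l \<in> carrier M"
    then obtain z where z: "z \<in> carrier X" "l = f z" using ex by blast
    show "m \<oplus>\<^bsub>M\<^esub> n \<oplus>\<^bsub>M\<^esub> l = m \<oplus>\<^bsub>M\<^esub> (n \<oplus>\<^bsub>M\<^esub> l)"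
      using x z by (simp add: X.a_assoc flip: add)
  next
    show "\<zero>\<^bsub>M\<^esub> \<in> carrier M" using zero fin by (metis X.zero_closed)
  next
    fix m assume "m \<in> carrier M"
    then obtain x where x: "x \<in> carrier X" "m = f x" using ex by metis
    show "\<zero>\<^bsub>M\<^esub> \<oplus>\<^bsub>M\<^esub> m = m" using x by (simp flip: zero add)
    show "\<exists>y\<in>carrier M. y \<oplus>\<^bsub>M\<^esub> m = \<zero>\<^bsub>M\<^esub>"
      using x fin by (intro bexI[of _ "f (\<ominus>\<^bsub>X\<^esub> x)"]) (simp_all add: X.l_neg flip: zero add)
  qed
qed

lemma left_module_iso:
  assumes X: "left_module A X" and iso: "module_iso A X M f"
  shows "left_module A M"
proof -
  interpret X: abelian_group X using X by (rule left_moduleD)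
  interpret A: ring A using X by (rule left_moduleD)
  note f = iso[unfolded module_iso_def]
  have surj: "f ` carrier X = carrier M" using f by (auto simp: bij_betw_def)
  have ex: "\<exists>x\<in>carrier X. m = f x" if "m \<in> carrier M" for m using that surj by blast
  have fin: "f x \<in> carrier M" if "x \<in> carrier X" for x using that surj by blast
  have add: "f x \<oplus>\<^bsub>M\<^esub> f y = f (x \<oplus>\<^bsub>X\<^esub> y)" if "x \<in> carrier X" "y \<in> carrier X" for x y using f that by simp
  have sm: "a \<odot>\<^bsub>M\<^esub> f x = f (a \<odot>\<^bsub>X\<^esub> x)" if "a \<in> carrier A" "x \<in> carrier X" for a x using f that by simp
  have ag: "abelian_group M"
    using f by (intro abelian_group_iso[OF X.abelian_group_axioms surj]) auto
  note XM = X[unfolded left_module_def]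
  have c: "a \<odot>\<^bsub>X\<^esub> x \<in> carrier X" if "a \<in> carrier A" "x \<in> carrier X" for a x
    using XM that by blast
  show ?thesis
    unfolding left_module_def
  proof (intro conjI ballI)
    show "ring A" by (rule A.ring_axioms)
    show "abelian_group M" by (rule ag)
  next
    fix a m assume a: "a \<in> carrier A" and "m \<in> carrier M"
    then obtain x where x: "x \<in> carrier X" "m = f x" using ex by blast
    show "a \<odot>\<^bsub>M\<^esub> m \<in> carrier M" using a x by (simp add: sm fin c)
  next
    fix a b m assume a: "a \<in> carrier A" "b \<in> carrier A" and "m \<in> carrier M"
    then obtain x where x: "x \<in> carrier X" "m = f x" using ex by blast
    have "(a \<oplus>\<^bsub>A\<^esub> b) \<odot>\<^bsub>X\<^esub> x = a \<odot>\<^bsub>X\<^esub> x \<oplus>\<^bsub>X\<^esub> b \<odot>\<^bsub>X\<^esub> x" using XM a x by blast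
    then show "(a \<oplus>\<^bsub>A\<^esub> b) \<odot>\<^bsub>M\<^esub> m = a \<odot>\<^bsub>M\<^esub> m \<oplus>\<^bsub>M\<^esub> b \<odot>\<^bsub>M\<^esub> m" using a x by (simp add: sm add c)
    have "(a \<otimes>\<^bsub>A\<^esub> b) \<odot>\<^bsub>X\<^esub> x = a \<odot>\<^bsub>X\<^esub> (b \<odot>\<^bsub>X\<^esub> x)" using XM a x by blast
    then show "(a \<otimes>\<^bsub>A\<^esub> b) \<odot>\<^bsub>M\<^esub> m = a \<odot>\<^bsub>M\<^esub> (b \<odot>\<^bsub>M\<^esub> m)" using a x by (simp add: sm c)
  next
    fix a m m' assume a: "a \<in> carrier A" and "m \<in> carrier M" "m' \<in> carrier M"
    then obtain x x' where x: "x \<in> carrier X" "m = f x" "x' \<in> carrier X" "m' = f x'" using ex by metis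
    have "a \<odot>\<^bsub>X\<^esub> (x \<oplus>\<^bsub>X\<^esub> x') = a \<odot>\<^bsub>X\<^esub> x \<oplus>\<^bsub>X\<^esub> a \<odot>\<^bsub>X\<^esub> x'" using XM a x by blast
    then show "a \<odot>\<^bsub>M\<^esub> (m \<oplus>\<^bsub>M\<^esub> m') = a \<odot>\<^bsub>M\<^esub> m \<oplus>\<^bsub>M\<^esub> a \<odot>\<^bsub>M\<^esub> m'" using a x by (simp add: sm add c)
  next
    fix m assume "m \<in> carrier M"
    then obtain x where x: "x \<in> carrier X" "m = f x" using ex by blast
    have "\<one>\<^bsub>A\<^esub> \<odot>\<^bsub>X\<^esub> x = x" using XM x by blast
    then show "\<one>\<^bsub>A\<^esub> \<odot>\<^bsub>M\<^esub> m = m" using x by (simp add: sm)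
  qed
qed

lemma irreducible_module_iso:
  assumes X: "irreducible_module A X" and iso: "module_iso A X M f"
  shows "irreducible_module A M"
proof -
  have lX: "left_module A X" using X by (simp add: irreducible_module_def)
  have lM: "left_module A M" by (rule left_module_iso[OF lX iso])
  interpret X: abelian_group X using lX by (rule left_moduleD)
  interpret M: abelian_group M using lM by (rule left_moduleD)
  note f = iso[unfolded module_iso_def]
  have bij: "bij_betw f (carrier X) (carrier M)" using f by blast
  have inj: "inj_on f (carrier X)" and surj: "f ` carrier X = carrier M" using bij by (auto simp: bij_betw_def)
  have zero: "f \<zero>\<^bsub>X\<^esub> = \<zero>\<^bsub>M\<^esub>" using f by blast
  have add: "f (x \<oplus>\<^bsub>X\<^esub> y) = f x \<oplus>\<^bsub>M\<^esub> f y" if "x \<in> carrier X" "y \<in> carrier X" for x y using f that by simp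
  have sm: "f (a \<odot>\<^bsub>X\<^esub> x) = a \<odot>\<^bsub>M\<^esub> f x" if "a \<in> carrier A" "x \<in> carrier X" for a x using f that by simp
  have neg: "f (\<ominus>\<^bsub>X\<^esub> x) = \<ominus>\<^bsub>M\<^esub> f x" if x: "x \<in> carrier X" for x
  proof -
    have "f (\<ominus>\<^bsub>X\<^esub> x) \<oplus>\<^bsub>M\<^esub> f x = \<zero>\<^bsub>M\<^esub>"
      using x by (simp add: X.l_neg flip: add zero)
    moreover have "f (\<ominus>\<^bsub>X\<^esub> x) \<in> carrier M" "f x \<in> carrier M" using x surj by auto
    ultimately show ?thesis using M.minus_equality by metis
  qed
  have "U = {\<zero>\<^bsub>M\<^esub>} \<or> U = carrier M" if U: "submodule U A M" for U
  proof -
    have sgU: "subgroup U (add_monoid M)" and smU: "\<And>a u. a \<in> carrier A \<Longrightarrow> u \<in> U \<Longrightarrow> a \<odot>\<^bsub>M\<^esub> u \<in> U"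
      using U by (auto simp: submodule_def submodule_axioms_def)
    have Usub: "U \<subseteq> carrier M" using subgroup.subset[OF sgU] by simp
    define W where "W = {x \<in> carrier X. f x \<in> U}"
    have "subgroup W (add_monoid X)"
    proof (rule group.subgroupI)
      show "group (add_monoid X)" by (rule X.a_group)
      show "W \<subseteq> carrier (add_monoid X)" by (auto simp: W_def)
      have "\<zero>\<^bsub>X\<^esub> \<in> W" using zero subgroup.one_closed[OF sgU] by (simp add: W_def)
      then show "W \<noteq> {}" by blast
      show "inv\<^bsub>add_monoid X\<^esub> a \<in> W" if "a \<in> W" for a
        using that neg subgroup.m_inv_closed[OF sgU] by (simp add: W_def a_inv_def[symmetric])
      show "a \<otimes>\<^bsub>add_monoid X\<^esub> b \<in> W" if "a \<in> W" "b \<in> W" for a b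
        using that add subgroup.m_closed[OF sgU] by (simp add: W_def)
    qed
    then have "submodule W A X"
      using smU sm left_moduleD(3)[OF lX] by (auto simp: submodule_def submodule_axioms_def W_def)
    then have "W = {\<zero>\<^bsub>X\<^esub>} \<or> W = carrier X" using X by (simp add: irreducible_module_def)
    moreover have "U = f ` W" using Usub surj by (auto simp: W_def)
    ultimately show ?thesis using zero surj by auto
  qed
  moreover have "carrier M \<noteq> {\<zero>\<^bsub>M\<^esub>}"
  proof
    assume "carrier M = {\<zero>\<^bsub>M\<^esub>}"
    then have "x = \<zero>\<^bsub>X\<^esub>" if "x \<in> carrier X" for x
      using that surj zero inj by (metis X.zero_closed imageI inj_onD singletonD)
    then have "carrier X = {\<zero>\<^bsub>X\<^esub>}" by auto
    then show False using X by (simp add: irreducible_module_def)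
  qed
  ultimately show ?thesis using lM by (simp add: irreducible_module_def)
qed

section \<open>Invariance of characters under isomorphism\<close>

lemma restrict_to_scalars_simps [simp]:
  "carrier (restrict_to_scalars k M) = carrier M"
  "ring.zero (restrict_to_scalars k M) = ring.zero M"
  "ring.add (restrict_to_scalars k M) = ring.add M"
  "smult (restrict_to_scalars k M) c m = single (id_diagram (strands k)) c \<odot>\<^bsub>M\<^esub> m"
  by (simp_all add: restrict_to_scalars_def)

lemma finsum_restrict_to_scalars [simp]: "finsum (restrict_to_scalars k M) = finsum M"
  by (simp add: finsum_def finprod_def fun_eq_iff)

lemma finsum_iso:
  assumes "abelian_group X" "abelian_group M"
    and f: "f ` carrier X \<subseteq> carrier M" "f \<zero>\<^bsub>X\<^esub> = \<zero>\<^bsub>M\<^esub>"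
    "\<And>x y. x \<in> carrier X \<Longrightarrow> y \<in> carrier X \<Longrightarrow> f (x \<oplus>\<^bsub>X\<^esub> y) = f x \<oplus>\<^bsub>M\<^esub> f y"
    and h: "h \<in> B \<rightarrow> carrier X" and "finite B"
  shows "f (finsum X h B) = finsum M (\<lambda>b. f (h b)) B"
proof -
  interpret X: abelian_group X by fact
  interpret M: abelian_group M by fact
  show ?thesis
    using \<open>finite B\<close> h
  proof (induction B rule: finite_induct)
    case (insert b B)
    then have h': "h \<in> B \<rightarrow> carrier X" "h b \<in> carrier X" by auto
    then have "(\<lambda>b. f (h b)) \<in> B \<rightarrow> carrier M" "f (h b) \<in> carrier M" using f(1) by auto
    then show ?case using insert h' f(3) by simp
  qed (use f in simp)
qed

lemma has_character_iso:
  fixes X :: "(diagram \<Rightarrow>\<^sub>0 complex, 'm) module" and M :: "(diagram \<Rightarrow>\<^sub>0 complex, 'n) module"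
  assumes X: "left_module (partition_algebra q k) X" and iso: "module_iso (partition_algebra q k) X M f"
    and d: "d \<in> diagrams k" and ch: "has_character k X d t"
  shows "has_character k M d t"
proof -
  let ?A = "partition_algebra q k" and ?s = "\<lambda>c. single (id_diagram (strands k)) (c::complex)"
  have lM: "left_module ?A M" by (rule left_module_iso[OF X iso])
  interpret X: abelian_group X using X by (rule left_moduleD)
  interpret M: abelian_group M using lM by (rule left_moduleD)
  note f = iso[unfolded module_iso_def]
  have inj: "inj_on f (carrier X)" and surj: "f ` carrier X = carrier M" using f by (auto simp: bij_betw_def)
  have sm: "f (a \<odot>\<^bsub>X\<^esub> x) = a \<odot>\<^bsub>M\<^esub> f x" if "a \<in> diagram_span k" "x \<in> carrier X" for a x using f that by simp
  have cl: "a \<odot>\<^bsub>X\<^esub> x \<in> carrier X" if "a \<in> diagram_span k" "x \<in> carrier X" for a x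
    using left_moduleD(3)[OF X] that by simp
  have sd: "?s c \<in> diagram_span k" for c using id_diagram_closed by blast
  obtain B c where B: "is_basis (restrict_to_scalars k X) B"
    and c: "\<And>b. b \<in> B \<Longrightarrow> single d 1 \<odot>\<^bsub>X\<^esub> b = (\<Oplus>\<^bsub>X\<^esub>b'\<in>B. ?s (c b' b) \<odot>\<^bsub>X\<^esub> b')"
    and t: "t = (\<Sum>b\<in>B. c b b)"
    using ch by (auto simp: has_character_def has_trace_def)
  have finB: "finite B" and Bsub: "B \<subseteq> carrier X"
    and Bex: "\<And>v. v \<in> carrier X \<Longrightarrow> \<exists>!c. c \<in> extensional B \<and> v = (\<Oplus>\<^bsub>X\<^esub>b\<in>B. ?s (c b) \<odot>\<^bsub>X\<^esub> b)"
    using B by (auto simp: is_basis_def)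
  have fB: "f b \<in> carrier M" if "b \<in> B" for b using that Bsub surj by blast
  have injB: "inj_on f B" using inj Bsub by (rule inj_on_subset)
  define g where "g = inv_into B f"
  have g: "g (f b) = b" if "b \<in> B" for b using that injB by (simp add: g_def)
  have tr: "f (\<Oplus>\<^bsub>X\<^esub>b\<in>B. ?s (c b) \<odot>\<^bsub>X\<^esub> b) = (\<Oplus>\<^bsub>M\<^esub>b'\<in>f ` B. ?s (c (g b')) \<odot>\<^bsub>M\<^esub> b')" for c
  proof -
    have "f (\<Oplus>\<^bsub>X\<^esub>b\<in>B. ?s (c b) \<odot>\<^bsub>X\<^esub> b) = (\<Oplus>\<^bsub>M\<^esub>b\<in>B. f (?s (c b) \<odot>\<^bsub>X\<^esub> b))"
      using f surj Bsub finB cl sd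
      by (intro finsum_iso[OF X.abelian_group_axioms M.abelian_group_axioms]) auto
    also have "\<dots> = (\<Oplus>\<^bsub>M\<^esub>b\<in>B. ?s (c (g (f b))) \<odot>\<^bsub>M\<^esub> f b)"
    proof (rule M.finsum_cong')
      show "(\<lambda>b. ?s (c (g (f b))) \<odot>\<^bsub>M\<^esub> f b) \<in> B \<rightarrow> carrier M"
        using left_moduleD(3)[OF lM] sd fB by auto
    qed (use sm sd Bsub g in auto)
    also have "\<dots> = (\<Oplus>\<^bsub>M\<^esub>b'\<in>f ` B. ?s (c (g b')) \<odot>\<^bsub>M\<^esub> b')"
    proof (rule M.finsum_reindex[symmetric, OF _ injB])
      show "(\<lambda>b'. ?s (c (g b')) \<odot>\<^bsub>M\<^esub> b') \<in> f ` B \<rightarrow> carrier M"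
        using left_moduleD(3)[OF lM] sd fB by auto
    qed
    finally show ?thesis .
  qed
  have fs: "(\<Oplus>\<^bsub>X\<^esub>b\<in>B. ?s (c b) \<odot>\<^bsub>X\<^esub> b) \<in> carrier X" for c
    using cl sd Bsub by (intro X.finsum_closed) auto
  have basis: "is_basis (restrict_to_scalars k M) (f ` B)"
    unfolding is_basis_def restrict_to_scalars_simps finsum_restrict_to_scalars
  proof (intro conjI ballI)
    show "finite (f ` B)" using finB by simp
    show "f ` B \<subseteq> carrier M" using Bsub surj by blast
    fix m assume "m \<in> carrier M"
    then obtain v where v: "v \<in> carrier X" "m = f v" using surj by blast
    obtain c where c: "c \<in> extensional B" "v = (\<Oplus>\<^bsub>X\<^esub>b\<in>B. ?s (c b) \<odot>\<^bsub>X\<^esub> b)"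
      and u: "\<And>c'. c' \<in> extensional B \<Longrightarrow> v = (\<Oplus>\<^bsub>X\<^esub>b\<in>B. ?s (c' b) \<odot>\<^bsub>X\<^esub> b) \<Longrightarrow> c' = c"
      using Bex[OF v(1)] by blast
    show "\<exists>!c. c \<in> extensional (f ` B) \<and> m = (\<Oplus>\<^bsub>M\<^esub>b\<in>f ` B. ?s (c b) \<odot>\<^bsub>M\<^esub> b)"
    proof (rule ex1I)
      have "m = (\<Oplus>\<^bsub>M\<^esub>b'\<in>f ` B. ?s (c (g b')) \<odot>\<^bsub>M\<^esub> b')" using tr[of c] v(2) c(2) by simp
      also have "\<dots> = (\<Oplus>\<^bsub>M\<^esub>b'\<in>f ` B. ?s ((\<lambda>b'\<in>f ` B. c (g b')) b') \<odot>\<^bsub>M\<^esub> b')"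
        using left_moduleD(3)[OF lM] sd fB by (intro M.finsum_cong') auto
      finally show "(\<lambda>b'\<in>f ` B. c (g b')) \<in> extensional (f ` B) \<and>
        m = (\<Oplus>\<^bsub>M\<^esub>b'\<in>f ` B. ?s ((\<lambda>b'\<in>f ` B. c (g b')) b') \<odot>\<^bsub>M\<^esub> b')" by simp
    next
      fix c' assume c': "c' \<in> extensional (f ` B) \<and> m = (\<Oplus>\<^bsub>M\<^esub>b\<in>f ` B. ?s (c' b) \<odot>\<^bsub>M\<^esub> b)"
      \<comment> \<open>A competing coordinate family for \<open>m\<close> is pulled back to one for
        \<open>v\<close>; restriction to \<open>B\<close> makes it extensional, so uniqueness in
        \<open>X\<close> applies.\<close>
      define c2 where "c2 = (\<lambda>b\<in>B. c' (f b))"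
      have "f (\<Oplus>\<^bsub>X\<^esub>b\<in>B. ?s (c2 b) \<odot>\<^bsub>X\<^esub> b) = (\<Oplus>\<^bsub>M\<^esub>b'\<in>f ` B. ?s (c2 (g b')) \<odot>\<^bsub>M\<^esub> b')" by (rule tr)
      also have "\<dots> = (\<Oplus>\<^bsub>M\<^esub>b'\<in>f ` B. ?s (c' b') \<odot>\<^bsub>M\<^esub> b')"
        using left_moduleD(3)[OF lM] sd fB g by (intro M.finsum_cong') (auto simp: c2_def)
      also have "\<dots> = f v" using c' v(2) by simp
      finally have "v = (\<Oplus>\<^bsub>X\<^esub>b\<in>B. ?s (c2 b) \<odot>\<^bsub>X\<^esub> b)" using inj fs v(1) by (auto dest: inj_onD)
      then have "c2 = c" using u by (simp add: c2_def)
      then show "c' = (\<lambda>b'\<in>f ` B. c (g b'))"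
        using c' g by (intro extensionalityI[of _ "f ` B"]) (auto simp: c2_def)
    qed
  qed
  have action: "single d 1 \<odot>\<^bsub>M\<^esub> b = (\<Oplus>\<^bsub>M\<^esub>b'\<in>f ` B. ?s (c (g b') (g b)) \<odot>\<^bsub>M\<^esub> b')" if b: "b \<in> f ` B" for b
  proof -
    obtain a where a: "a \<in> B" "b = f a" using b by blast
    have "single d 1 \<odot>\<^bsub>M\<^esub> b = f (single d 1 \<odot>\<^bsub>X\<^esub> a)" using a Bsub sm d by auto
    also have "\<dots> = (\<Oplus>\<^bsub>M\<^esub>b'\<in>f ` B. ?s (c (g b') a) \<odot>\<^bsub>M\<^esub> b')"
      unfolding c[OF a(1)] by (rule tr)
    finally show ?thesis using a g by simp
  qed
  have trace: "t = (\<Sum>b\<in>f ` B. c (g b) (g b))"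
    using t injB g by (simp add: sum.reindex)
  show ?thesis
    unfolding has_character_def has_trace_def restrict_to_scalars_simps finsum_restrict_to_scalars
    by (intro exI[of _ "f ` B"] exI[of _ "\<lambda>b' b. c (g b') (g b)"] conjI ballI basis action trace)
qed

section \<open>Modules generated by an element modulo diagrams of low propagating number\<close>

text \<open>The projection along the ideal of diagrams of low propagating number; elements of the
  quotient by this ideal are represented by their truncations.\<close>

definition trunc :: "half_integer \<Rightarrow> nat \<Rightarrow> (diagram \<Rightarrow>\<^sub>0 'c::comm_ring_1) \<Rightarrow> (diagram \<Rightarrow>\<^sub>0 'c)" where
  "trunc k r = lin_ext (\<lambda>d. if propagating_number d < propagating_bound k r then 0 else single d 1)"

lemma linear_trunc: "linear_map (trunc k r)"
  unfolding trunc_def by (rule linear_lin_ext)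

lemmas [linear_intros] = linear_map_comp[OF linear_trunc]

lemmas trunc_add = linear_map_add[OF linear_trunc]
lemmas trunc_scale = linear_map_scale[OF linear_trunc]
lemmas trunc_zero [simp] = linear_map_zero[OF linear_trunc]
lemmas trunc_sum = linear_map_sum[OF linear_trunc]
lemmas trunc_diff = linear_map_diff[OF linear_trunc]
lemmas trunc_minus = linear_map_minus[OF linear_trunc]

lemma trunc_single:
  "trunc k r (single d c) = (if propagating_number d < propagating_bound k r then 0 else single d c)"
  by (simp add: trunc_def)

lemma lookup_trunc:
  "lookup (trunc k r f) d = (if propagating_number d < propagating_bound k r then 0 else lookup f d)"
proof -
  have "lookup (trunc k r f) d = (\<Sum>a\<in>keys f. lookup f a *
      lookup (if propagating_number a < propagating_bound k r then 0 else single a 1) d)"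
    by (simp add: trunc_def lookup_lin_ext)
  also have "\<dots> = (\<Sum>a\<in>keys f. if d = a then
      (if propagating_number d < propagating_bound k r then 0 else lookup f d) else 0)"
    by (intro sum.cong) (auto simp: lookup_single)
  also have "\<dots> = (if propagating_number d < propagating_bound k r then 0 else lookup f d)"
    by (simp add: in_keys_iff)
  finally show ?thesis .
qed

lemma trunc_trunc [simp]: "trunc k r (trunc k r f) = trunc k r f"
  by (rule poly_mapping_eqI) (simp add: lookup_trunc)

lemma trunc_closed [simp, intro]: "f \<in> diagram_span k \<Longrightarrow> trunc k r f \<in> diagram_span k"
  by (auto simp: diagram_span_def in_keys_iff lookup_trunc split: if_splits)

text \<open>Composition does not raise the propagating number, so a term discarded from the right
  factor would be discarded from the product anyway. With the mirror image for the left factor,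
  truncation is compatible with products.\<close>

lemma trunc_pmul_right:
  assumes "f \<in> diagram_span k" "g \<in> diagram_span k"
  shows "trunc k r (pmul q f (trunc k r g)) = trunc k r (pmul q f g)"
proof (rule linear_map_eqI2[where S = "\<lambda>f g. trunc k r (pmul q f (trunc k r g))"
      and T = "\<lambda>f g. trunc k r (pmul q f g)" and A = "diagrams k" and B = "diagrams k"])
  fix d1 d2 assume "d1 \<in> diagrams k" "d2 \<in> diagrams k"
  then show "trunc k r (pmul q (single d1 1) (trunc k r (single d2 1))) = trunc k r (pmul q (single d1 1) (single d2 1))"
    using propagating_number_compose(2)[of d1 k d2]
    by (simp add: trunc_single pmul_single linear_map_zero[OF linear_pmul_right])
qed (use assms in \<open>auto simp: diagram_span_def intro!: linear_intros\<close>)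

lemma trunc_pmul_left:
  assumes "f \<in> diagram_span k" "g \<in> diagram_span k"
  shows "trunc k r (pmul q (trunc k r f) g) = trunc k r (pmul q f g)"
proof (rule linear_map_eqI2[where S = "\<lambda>f g. trunc k r (pmul q (trunc k r f) g)"
      and T = "\<lambda>f g. trunc k r (pmul q f g)" and A = "diagrams k" and B = "diagrams k"])
  fix d1 d2 assume "d1 \<in> diagrams k" "d2 \<in> diagrams k"
  then show "trunc k r (pmul q (trunc k r (single d1 1)) (single d2 1)) = trunc k r (pmul q (single d1 1) (single d2 1))"
    using propagating_number_compose(1)[of d1 k d2]
    by (simp add: trunc_single pmul_single linear_map_zero[OF linear_pmul_left])
qed (use assms in \<open>auto simp: diagram_span_def intro!: linear_intros\<close>)

text \<open>The image of the left ideal generated by \<open>e\<close> in the quotient by the low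
  diagrams, with truncations as normal forms of cosets. The coefficient ring is arbitrary, so the
  integral and the complex module are instances of one construction.\<close>

definition cell_module :: "'c::comm_ring_1 \<Rightarrow> half_integer \<Rightarrow> nat \<Rightarrow> (diagram \<Rightarrow>\<^sub>0 'c) \<Rightarrow>
    (diagram \<Rightarrow>\<^sub>0 'c, diagram \<Rightarrow>\<^sub>0 'c) module" where
  "cell_module q k r e = \<lparr>carrier = {trunc k r (pmul q a e) | a. a \<in> diagram_span k},
     mult = undefined, one = undefined, ring.zero = 0, ring.add = (+),
     smult = (\<lambda>a v. trunc k r (pmul q a v))\<rparr>"

lemma cell_module_simps [simp]:
  "ring.zero (cell_module q k r e) = 0" "ring.add (cell_module q k r e) = (+)"
  "smult (cell_module q k r e) a v = trunc k r (pmul q a v)"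
  by (simp_all add: cell_module_def)

lemma cell_module_carrierI:
  "a \<in> diagram_span k \<Longrightarrow> trunc k r (pmul q a e) \<in> carrier (cell_module q k r e)"
  by (auto simp: cell_module_def)

lemma cell_module_carrierE:
  assumes "v \<in> carrier (cell_module q k r e)"
  obtains a where "a \<in> diagram_span k" "v = trunc k r (pmul q a e)"
  using assms by (auto simp: cell_module_def)

lemma left_module_cell_module:
  assumes e: "e \<in> diagram_span k"
  shows "left_module (partition_algebra q k) (cell_module q k r e)"
proof -
  let ?X = "cell_module q k r e"
  have zero: "0 \<in> carrier ?X"
    using cell_module_carrierI[of 0 k r q e] by (simp add: linear_map_zero[OF linear_pmul_left])
  have add: "x + y \<in> carrier ?X" if xy: "x \<in> carrier ?X" "y \<in> carrier ?X" for x y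
  proof -
    obtain a b where "a \<in> diagram_span k" "x = trunc k r (pmul q a e)" "b \<in> diagram_span k" "y = trunc k r (pmul q b e)"
      using xy by (auto elim!: cell_module_carrierE)
    then show ?thesis using cell_module_carrierI[of "a + b" k r q e]
      by (simp add: linear_map_add[OF linear_pmul_left] trunc_add)
  qed
  have neg: "- x \<in> carrier ?X" if x: "x \<in> carrier ?X" for x
  proof -
    obtain a where "a \<in> diagram_span k" "x = trunc k r (pmul q a e)"
      using x by (auto elim!: cell_module_carrierE)
    then show ?thesis using cell_module_carrierI[of "- a" k r q e]
      by (simp add: linear_map_minus[OF linear_pmul_left] trunc_minus)
  qed
  have span: "x \<in> diagram_span k" "trunc k r x = x" if "x \<in> carrier ?X" for x
    using that e by (auto elim!: cell_module_carrierE)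
  have sm: "trunc k r (pmul q a x) \<in> carrier ?X" if a: "a \<in> diagram_span k" and x: "x \<in> carrier ?X" for a x
  proof -
    obtain b where b: "b \<in> diagram_span k" "x = trunc k r (pmul q b e)"
      using x by (auto elim!: cell_module_carrierE)
    have "trunc k r (pmul q a x) = trunc k r (pmul q (pmul q a b) e)"
      using a b e by (simp add: trunc_pmul_right pmul_assoc[OF a b(1) e])
    then show ?thesis using a b cell_module_carrierI by (metis pmul_closed)
  qed
  show ?thesis
    unfolding left_module_def
  proof (intro conjI ballI)
    show "ring (partition_algebra q k)" by (rule ring_partition_algebra)
    show "abelian_group ?X" using zero add neg by (intro abelian_group_additiveI) auto
  qed (use sm span in \<open>auto simp: linear_map_add[OF linear_pmul_left] linear_map_add[OF linear_pmul_right]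
        trunc_add trunc_pmul_right pmul_assoc pmul_id_left\<close>)
qed

text \<open>Let \<open>L\<close> be the preimage in the algebra of a submodule. By semisimplicity \<open>L\<close> is generated by an
  element \<open>l\<close> that is a right identity of \<open>L\<close>. Modulo the ideal, \<open>e l\<close> is a multiple of \<open>e\<close>: if
  the scalar is nonzero then \<open>L\<close> contains \<open>e\<close>, and otherwise \<open>l = l l\<close> lies in the ideal.\<close>

lemma irreducible_cell_module:
  fixes q :: complex
  assumes ss: "semisimple_ring (partition_algebra q k)"
    and e: "e \<in> diagram_span k" and ne: "trunc k r e \<noteq> 0"
    and rank1: "\<And>a. a \<in> diagram_span k \<Longrightarrow> \<exists>c. trunc k r (pmul q (pmul q e a) e) = scale c (trunc k r e)"
  shows "irreducible_module (partition_algebra q k) (cell_module q k r e)"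
proof -
  let ?A = "partition_algebra q k" and ?X = "cell_module q k r e" and ?R = "regular_module (partition_algebra q k)"
  let ?I = "single (id_diagram (strands k)) (1::complex)"
  have regular_simps [simp]: "carrier ?R = diagram_span k" "ring.add ?R = (+)" "ring.zero ?R = 0" "smult ?R = pmul q"
    by (simp_all add: regular_module_def)
  have lX: "left_module ?A ?X" by (rule left_module_cell_module[OF e])
  have I: "?I \<in> diagram_span k" using id_diagram_closed by blast
  have e_in: "trunc k r e \<in> carrier ?X"
    using cell_module_carrierI[OF I, of r q e] by (simp add: pmul_id_left[OF e])
  have span: "x \<in> diagram_span k" "trunc k r x = x" if "x \<in> carrier ?X" for x
    using that e by (auto elim!: cell_module_carrierE)
  have "U = {0} \<or> U = carrier ?X" if U: "submodule U ?A ?X" for U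
  proof -
    have sg: "subgroup U (add_monoid ?X)" and smU: "\<And>a u. a \<in> diagram_span k \<Longrightarrow> u \<in> U \<Longrightarrow> trunc k r (pmul q a u) \<in> U"
      using U by (auto simp: submodule_def submodule_axioms_def)
    have Usub: "U \<subseteq> carrier ?X" using subgroup.subset[OF sg] by simp
    have U0: "0 \<in> U" using subgroup.one_closed[OF sg] by simp
    have Uadd: "x + y \<in> U" if "x \<in> U" "y \<in> U" for x y using subgroup.m_closed[OF sg that] by simp
    have Uscale: "scale c x \<in> U" if "x \<in> U" for c x
      using smU[of "single (id_diagram (strands k)) c" x] that Usub span id_diagram_closed
      by (auto simp: pmul_id_left trunc_scale)
    define L where "L = {a \<in> diagram_span k. trunc k r a \<in> U}"
    have L0: "0 \<in> L" using U0 by (simp add: L_def)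
    have Ladd: "x + y \<in> L" if "x \<in> L" "y \<in> L" for x y using that Uadd by (auto simp: L_def trunc_add)
    have Lneg: "- x \<in> L" if "x \<in> L" for x
      using that Uscale[of "trunc k r x" "- 1"] by (auto simp: L_def trunc_minus scale_minus_one)
    have Lmul: "pmul q a x \<in> L" if "a \<in> diagram_span k" "x \<in> L" for a x
      using that smU[of a "trunc k r x"] by (auto simp: L_def trunc_pmul_right)
    have "abelian_group ?R" by (rule abelian_group_additiveI) auto
    then interpret R: abelian_group ?R .
    have "subgroup L (add_monoid ?R)"
    proof (rule group.subgroupI)
      show "group (add_monoid ?R)" by (rule R.a_group)
      show "L \<noteq> {}" using L0 by blast
      show "inv\<^bsub>add_monoid ?R\<^esub> a \<in> L" if a: "a \<in> L" for a
      proof -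
        have "\<ominus>\<^bsub>?R\<^esub> a = - a" using a Lneg[OF a] by (intro R.minus_equality) (auto simp: L_def)
        then show ?thesis using Lneg[OF a] by (simp add: a_inv_def)
      qed
    qed (use Ladd in \<open>auto simp: L_def\<close>)
    then have "submodule L ?A ?R" using Lmul by (auto simp: submodule_def submodule_axioms_def)
    then obtain W where W: "submodule W ?A ?R" "L \<inter> W = {0}" "L <+>\<^bsub>?R\<^esub> W = diagram_span k"
      using ss unfolding semisimple_ring_def semisimple_module_def by auto
    have Wsub: "W \<subseteq> diagram_span k" and Wmul: "\<And>a w. a \<in> diagram_span k \<Longrightarrow> w \<in> W \<Longrightarrow> pmul q a w \<in> W"
      using W(1) subgroup.subset[of W "add_monoid ?R"] by (auto simp: submodule_def submodule_axioms_def)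
    have "?I \<in> L <+>\<^bsub>?R\<^esub> W" using I W(3) by simp
    then obtain l w where lw: "l \<in> L" "w \<in> W" "?I = l + w" by (auto simp: set_add_def')
    have l: "l \<in> diagram_span k" "trunc k r l \<in> U" and w: "w \<in> diagram_span k" using lw Wsub by (auto simp: L_def)
    have right_id: "pmul q a l = a" if a: "a \<in> L" for a
    proof -
      have as: "a \<in> diagram_span k" using a by (simp add: L_def)
      have "a = pmul q a ?I" using pmul_id_right[OF as, of q 1] by simp
      also have "\<dots> = pmul q a l + pmul q a w" by (simp add: lw(3) linear_map_add[OF linear_pmul_right])
      finally have eq: "a = pmul q a l + pmul q a w" .
      then have "pmul q a w = a + - pmul q a l" by (simp add: algebra_simps)
      then have "pmul q a w \<in> L" using Ladd[OF a Lneg[OF Lmul[OF as lw(1)]]] by simp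
      then have "pmul q a w = 0" using Wmul[OF as lw(2)] W(2) by blast
      then show ?thesis using eq by simp
    qed
    obtain b where b: "b \<in> diagram_span k" "trunc k r l = trunc k r (pmul q b e)"
      using l(2) Usub by (auto elim!: cell_module_carrierE)
    obtain c where c: "trunc k r (pmul q (pmul q e b) e) = scale c (trunc k r e)" using rank1[OF b(1)] by blast
    have el: "trunc k r (pmul q e l) = scale c (trunc k r e)"
    proof -
      have "trunc k r (pmul q e l) = trunc k r (pmul q e (trunc k r l))" using e l by (simp add: trunc_pmul_right)
      also have "\<dots> = trunc k r (pmul q e (pmul q b e))" unfolding b(2) using e b(1) by (simp add: trunc_pmul_right)
      finally show ?thesis using c e b(1) by (simp add: pmul_assoc)
    qed
    show ?thesis
    proof (cases "c = 0")
      case False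
      have "trunc k r (pmul q e (trunc k r l)) \<in> U" using smU[OF e l(2)] .
      then have "scale c (trunc k r e) \<in> U" using el e l by (simp add: trunc_pmul_right)
      then have "scale (1 / c) (scale c (trunc k r e)) \<in> U" by (rule Uscale)
      then have eU: "trunc k r e \<in> U" using False by simp
      have "trunc k r (pmul q a e) \<in> U" if "a \<in> diagram_span k" for a
        using smU[OF that eU] that e by (simp add: trunc_pmul_right)
      then have "carrier ?X \<subseteq> U" by (auto elim!: cell_module_carrierE)
      then show ?thesis using Usub by blast
    next
      case True
      have "trunc k r l = trunc k r (pmul q (trunc k r l) l)" using right_id[OF lw(1)] l by (simp add: trunc_pmul_left)
      also have "\<dots> = trunc k r (pmul q (pmul q b e) l)" unfolding b(2) using b(1) e l by (simp add: trunc_pmul_left)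
      also have "\<dots> = trunc k r (pmul q b (trunc k r (pmul q e l)))"
        using b(1) e l by (simp add: trunc_pmul_right pmul_assoc)
      also have "\<dots> = 0" by (simp add: el True linear_map_zero[OF linear_pmul_right])
      finally have l0: "trunc k r l = 0" .
      have "u = 0" if u: "u \<in> U" for u
      proof -
        have uX: "u \<in> diagram_span k" "trunc k r u = u" using u Usub span by auto
        then have "u \<in> L" using u by (simp add: L_def)
        then have "u = trunc k r (pmul q u l)" using right_id uX by simp
        also have "\<dots> = trunc k r (pmul q u (trunc k r l))" using uX l by (simp add: trunc_pmul_right)
        also have "\<dots> = 0" by (simp add: l0 linear_map_zero[OF linear_pmul_right])
        finally show ?thesis .
      qed
      then show ?thesis using U0 by auto
    qed
  qed
  moreover have "carrier ?X \<noteq> {0}" using e_in ne by auto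
  ultimately show ?thesis using lX by (simp add: irreducible_module_def)
qed

section \<open>Characters computed from an independent spanning family\<close>

lemma finsum_additive:
  fixes M :: "('a::ab_group_add, 'x) ring_scheme"
  assumes "abelian_group M" "ring.add M = (+)" "ring.zero M = 0" "finite B" "h \<in> B \<rightarrow> carrier M"
  shows "finsum M h B = sum h B"
proof -
  interpret M: abelian_group M by fact
  show ?thesis using assms(4,5) by (induction B rule: finite_induct) (auto simp: assms(2,3))
qed

lemma has_character_additiveI:
  fixes X :: "(diagram \<Rightarrow>\<^sub>0 complex, 'b \<Rightarrow>\<^sub>0 complex) module"
  assumes X: "abelian_group X" "ring.add X = (+)" "ring.zero X = 0"
    and scalar: "\<And>c v. v \<in> carrier X \<Longrightarrow> single (id_diagram (strands k)) c \<odot>\<^bsub>X\<^esub> v = scale c v"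
    and scale_closed: "\<And>c v. v \<in> carrier X \<Longrightarrow> scale c v \<in> carrier X"
    and I: "finite I" and g: "\<And>i. i \<in> I \<Longrightarrow> g i \<in> carrier X"
    and spanning: "\<And>v. v \<in> carrier X \<Longrightarrow> \<exists>c. v = (\<Sum>i\<in>I. scale (c i) (g i))"
    and indep: "\<And>c i. (\<Sum>i\<in>I. scale (c i) (g i)) = 0 \<Longrightarrow> i \<in> I \<Longrightarrow> c i = 0"
    and action: "\<And>i. i \<in> I \<Longrightarrow> single d 1 \<odot>\<^bsub>X\<^esub> g i = (\<Sum>j\<in>I. scale (m j i) (g j))"
  shows "has_character k X d (\<Sum>i\<in>I. m i i)"
proof -
  have injg: "inj_on g I"
  proof (rule inj_onI)
    fix i j assume ij: "i \<in> I" "j \<in> I" "g i = g j"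
    show "i = j"
    proof (rule ccontr)
      assume "i \<noteq> j"
      \<comment> \<open>A vector occurring for two indices would give a nontrivial relation, with
        coefficients 1 at \<open>i\<close> and -1 at \<open>j\<close>.\<close>
      define c where "c l = (if l = i then 1 else 0) - (if l = j then 1 else (0::complex))" for l
      have "(\<Sum>l\<in>I. scale (c l) (g l)) = (\<Sum>l\<in>I. scale (if l = i then 1 else 0) (g l)) - (\<Sum>l\<in>I. scale (if l = j then 1 else 0) (g l))"
        unfolding sum_subtractf[symmetric] by (intro sum.cong refl poly_mapping_eqI) (simp add: c_def lookup_minus algebra_simps)
      also have "\<dots> = g i - g j"
        using ij I by (simp add: if_distrib[of "\<lambda>c. scale c _"] cong: if_cong)
      finally have "c i = 0" using ij indep[of c i] by simp
      then show False using \<open>i \<noteq> j\<close> by (simp add: c_def)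
    qed
  qed
  define gi where "gi = inv_into I g"
  have gi: "gi (g i) = i" if "i \<in> I" for i using that injg by (simp add: gi_def)
  have fs: "(\<Oplus>\<^bsub>X\<^esub>b\<in>g ` I. single (id_diagram (strands k)) (c b) \<odot>\<^bsub>X\<^esub> b) = (\<Sum>i\<in>I. scale (c (g i)) (g i))" for c
  proof -
    have "(\<Oplus>\<^bsub>X\<^esub>b\<in>g ` I. single (id_diagram (strands k)) (c b) \<odot>\<^bsub>X\<^esub> b) =
        (\<Sum>b\<in>g ` I. single (id_diagram (strands k)) (c b) \<odot>\<^bsub>X\<^esub> b)"
      using I g scalar scale_closed by (intro finsum_additive X) auto
    also have "\<dots> = (\<Sum>i\<in>I. scale (c (g i)) (g i))"
      using g scalar by (simp add: sum.reindex[OF injg])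
    finally show ?thesis .
  qed
  have "is_basis (restrict_to_scalars k X) (g ` I)"
    unfolding is_basis_def restrict_to_scalars_simps finsum_restrict_to_scalars fs
  proof (intro conjI ballI)
    show "finite (g ` I)" using I by simp
    show "g ` I \<subseteq> carrier X" using g by blast
    fix v assume "v \<in> carrier X"
    then obtain c where c: "v = (\<Sum>i\<in>I. scale (c i) (g i))" using spanning by blast
    show "\<exists>!c. c \<in> extensional (g ` I) \<and> v = (\<Sum>i\<in>I. scale (c (g i)) (g i))"
    proof (rule ex1I)
      show "(\<lambda>b\<in>g ` I. c (gi b)) \<in> extensional (g ` I) \<and> v = (\<Sum>i\<in>I. scale ((\<lambda>b\<in>g ` I. c (gi b)) (g i)) (g i))"
        unfolding c using gi by (auto intro!: sum.cong)
    next
      fix c' assume c': "c' \<in> extensional (g ` I) \<and> v = (\<Sum>i\<in>I. scale (c' (g i)) (g i))"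
      have "(\<Sum>i\<in>I. scale (c' (g i) - c i) (g i)) = (\<Sum>i\<in>I. scale (c' (g i)) (g i)) - (\<Sum>i\<in>I. scale (c i) (g i))"
        unfolding sum_subtractf[symmetric] by (intro sum.cong refl poly_mapping_eqI) (simp add: lookup_minus algebra_simps)
      also have "\<dots> = 0" using c c' by simp
      finally have "c' (g i) = c i" if "i \<in> I" for i using indep[of "\<lambda>i. c' (g i) - c i"] that by simp
      then show "c' = (\<lambda>b\<in>g ` I. c (gi b))"
        using c' gi by (intro extensionalityI[of _ "g ` I"]) auto
    qed
  qed
  moreover have "single d 1 \<odot>\<^bsub>X\<^esub> b = (\<Sum>i\<in>I. scale (m (gi (g i)) (gi b)) (g i))" if "b \<in> g ` I" for b
    using that action gi by (auto intro!: sum.cong)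
  then have "\<forall>b\<in>g ` I. single d 1 \<odot>\<^bsub>X\<^esub> b =
      (\<Oplus>\<^bsub>X\<^esub>b'\<in>g ` I. single (id_diagram (strands k)) (m (gi b') (gi b)) \<odot>\<^bsub>X\<^esub> b')"
    unfolding fs by blast
  moreover have "(\<Sum>i\<in>I. m i i) = (\<Sum>b\<in>g ` I. m (gi b) (gi b))"
    using gi by (simp add: sum.reindex[OF injg])
  ultimately show ?thesis
    unfolding has_character_def has_trace_def restrict_to_scalars_simps finsum_restrict_to_scalars
    by (intro exI[of _ "g ` I"] exI[of _ "\<lambda>b' b. m (gi b') (gi b)"] conjI) auto
qed

section \<open>Group algebras and Young symmetrizers\<close>

text \<open>HOL-Algebra occupies the notation \<open>inv\<close>.\<close>

abbreviation "pinv \<equiv> inv_into UNIV"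

subsection \<open>The group algebra\<close>

lemma linear_group_mult_right: "linear_map (group_mult f)"
  unfolding group_mult_def by (rule linear_lin_ext_lin_ext)

lemma linear_group_mult_left: "linear_map (\<lambda>f. group_mult f g)"
  unfolding group_mult_def by (rule linear_lin_ext)

lemmas [linear_intros] = linear_map_comp[OF linear_group_mult_left] linear_map_comp[OF linear_group_mult_right]

lemma group_mult_single: "group_mult (single u a) (single v b) = single (u \<circ> v) (a * b)"
  by (simp add: group_mult_def)

lemma group_mult_assoc: "group_mult (group_mult f g) h = group_mult f (group_mult g h)"
proof (rule linear_map_eqI[where S = "\<lambda>f. group_mult (group_mult f g) h" and T = "\<lambda>f. group_mult f (group_mult g h)" and A = UNIV])
  show "group_mult (group_mult (single u 1) g) h = group_mult (single u 1) (group_mult g h)" for u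
    by (rule linear_map_eqI2[where S = "\<lambda>g. group_mult (group_mult (single u 1) g)"
          and T = "\<lambda>g h. group_mult (single u 1) (group_mult g h)" and A = UNIV and B = UNIV])
      (auto simp: group_mult_single o_assoc intro!: linear_intros)
qed (auto intro!: linear_intros)

lemma group_mult_id_left: "group_mult (single id 1) f = f"
  by (rule linear_map_eqI[OF linear_group_mult_right linear_map_id subset_UNIV]) (simp add: group_mult_single)

lemma comp_cancel_left: "bij u \<Longrightarrow> u \<circ> (pinv u \<circ> v) = v" "bij u \<Longrightarrow> pinv u \<circ> (u \<circ> v) = v"
  and comp_cancel_right: "bij u \<Longrightarrow> (v \<circ> pinv u) \<circ> u = v" "bij u \<Longrightarrow> (v \<circ> u) \<circ> pinv u = v"
  for u v :: "nat \<Rightarrow> nat"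
  by (auto simp: fun_eq_iff bij_is_surj surj_f_inv_f inv_f_f bij_is_inj)

lemma lookup_group_mult_single_left:
  assumes "bij u"
  shows "lookup (group_mult (single u 1) f) w = lookup f (pinv u \<circ> w)"
proof -
  have eq: "u \<circ> v = w \<longleftrightarrow> v = pinv u \<circ> w" for v
    using comp_cancel_left[OF assms] by metis
  have "lookup (group_mult (single u 1) f) w = (\<Sum>v\<in>keys f. lookup f v * lookup (single (u \<circ> v) 1) w)"
    by (simp add: group_mult_def lookup_lin_ext)
  also have "\<dots> = (\<Sum>v\<in>keys f. if v = pinv u \<circ> w then lookup f v else 0)"
    by (intro sum.cong) (auto simp: lookup_single when_def eq)
  also have "\<dots> = lookup f (pinv u \<circ> w)" by (simp add: in_keys_iff)
  finally show ?thesis .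
qed

lemma lookup_group_mult_single_right:
  assumes "bij u"
  shows "lookup (group_mult f (single u 1)) w = lookup f (w \<circ> pinv u)"
proof -
  have eq: "v \<circ> u = w \<longleftrightarrow> v = w \<circ> pinv u" for v
    using assms by (metis bij_is_inj bij_is_surj comp_assoc comp_id inv_o_cancel surj_iff)
  have "lookup (group_mult f (single u 1)) w = (\<Sum>v\<in>keys f. lookup f v * lookup (single (v \<circ> u) 1) w)"
    by (simp add: group_mult_def lookup_lin_ext)
  also have "\<dots> = (\<Sum>v\<in>keys f. if v = w \<circ> pinv u then lookup f v else 0)"
    by (intro sum.cong) (auto simp: lookup_single when_def eq)
  also have "\<dots> = lookup f (w \<circ> pinv u)" by (simp add: in_keys_iff)
  finally show ?thesis .
qed

lemma group_mult_double_sum: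
  "group_mult (\<Sum>u\<in>U. single u (a u)) (\<Sum>v\<in>V. single v (b v)) = (\<Sum>u\<in>U. \<Sum>v\<in>V. single (u \<circ> v) (a u * b v))"
  by (simp only: linear_map_sum[OF linear_group_mult_left], simp only: linear_map_sum[OF linear_group_mult_right] group_mult_single)

definition perm_span :: "nat set \<Rightarrow> ((nat \<Rightarrow> nat) \<Rightarrow>\<^sub>0 complex) set" where
  "perm_span \<Omega> = {f. keys f \<subseteq> {w. w permutes \<Omega>}}"

lemma perm_span_single [simp]: "w permutes \<Omega> \<Longrightarrow> single w c \<in> perm_span \<Omega>"
  by (auto simp: perm_span_def)

lemma perm_span_sum: "(\<And>i. i \<in> I \<Longrightarrow> f i \<in> perm_span \<Omega>) \<Longrightarrow> (\<Sum>i\<in>I. f i) \<in> perm_span \<Omega>"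
  unfolding perm_span_def using keys_sum_subset[of I f] by blast

lemma perm_span_mult:
  assumes "f \<in> perm_span \<Omega>" "g \<in> perm_span \<Omega>"
  shows "group_mult f g \<in> perm_span \<Omega>"
proof -
  have "keys (single (u \<circ> v) (1::complex)) \<subseteq> {w. w permutes \<Omega>}" if "u \<in> keys f" "v \<in> keys g" for u v
    using assms that permutes_compose[of v \<Omega> u] by (auto simp: perm_span_def)
  then show ?thesis
    unfolding perm_span_def group_mult_def mem_Collect_eq by (intro keys_lin_ext) blast
qed

subsection \<open>Abstract tableaux\<close>

text \<open>Removing the maximum, which is at least \<open>card S - 1\<close>, reduces the size by
  one; equality of the totals forces equality at every stage.\<close>

lemma sum_nat_set_ge:
  fixes S :: "nat set"
  assumes "finite S"
  shows "\<Sum>{..<card S} \<le> \<Sum>S" "\<Sum>S = \<Sum>{..<card S} \<Longrightarrow> S = {..<card S}"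
proof -
  have "\<Sum>{..<card S} \<le> \<Sum>S \<and> (\<Sum>S = \<Sum>{..<card S} \<longrightarrow> S = {..<card S})"
    using assms
  proof (induction "card S" arbitrary: S)
    case (Suc n)
    define M where "M = Max S"
    have ne: "S \<noteq> {}" using Suc.hyps(2) by auto
    have M: "M \<in> S" unfolding M_def using Suc.prems ne by simp
    have c: "card (S - {M}) = n" using Suc.hyps(2) Suc.prems M by simp
    have "S \<subseteq> {..M}" using Suc.prems by (auto simp: M_def)
    then have "card S \<le> card {..M}" by (rule card_mono[rotated]) simp
    then have nM: "n \<le> M" using Suc.hyps(2) by simp
    have S: "\<Sum>S = M + \<Sum>(S - {M})" using Suc.prems M by (simp add: sum.remove)
    have IH: "\<Sum>{..<n} \<le> \<Sum>(S - {M})" "\<Sum>(S - {M}) = \<Sum>{..<n} \<longrightarrow> S - {M} = {..<n}"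
      using Suc.hyps(1)[of "S - {M}"] c Suc.prems by auto
    have N: "\<Sum>{..<card S} = n + \<Sum>{..<n}" using Suc.hyps(2)[symmetric] by (simp add: lessThan_Suc)
    show ?case
    proof (intro conjI impI)
      show "\<Sum>{..<card S} \<le> \<Sum>S" using S N IH nM by simp
      assume "\<Sum>S = \<Sum>{..<card S}"
      then have "M = n" "\<Sum>(S - {M}) = \<Sum>{..<n}" using S N IH nM by simp_all
      then have "S = insert n {..<n}" using IH(2) M by blast
      then show "S = {..<card S}" using Suc.hyps(2)[symmetric] by (simp add: lessThan_Suc)
    qed
  qed simp
  then show "\<Sum>{..<card S} \<le> \<Sum>S" "\<Sum>S = \<Sum>{..<card S} \<Longrightarrow> S = {..<card S}" by auto
qed

text \<open>Row and column indices of entries replace an explicit filling of a shape.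
  \<open>column_rows\<close> expresses that columns are top-justified; in this form the shape of a
  partition enters the theory of the Young symmetrizer.\<close>

locale tableau =
  fixes \<Omega> :: "nat set" and row col :: "nat \<Rightarrow> nat"
  assumes finite_entries: "finite \<Omega>"
    and position_inj: "a \<in> \<Omega> \<Longrightarrow> b \<in> \<Omega> \<Longrightarrow> row a = row b \<Longrightarrow> col a = col b \<Longrightarrow> a = b"
    and column_rows: "row ` {a \<in> \<Omega>. col a = j} = {..<card {a \<in> \<Omega>. col a = j}}"
begin

definition Rows :: "(nat \<Rightarrow> nat) set" where
  "Rows = {w. w permutes \<Omega> \<and> (\<forall>a\<in>\<Omega>. row (w a) = row a)}"

definition Cols :: "(nat \<Rightarrow> nat) set" where
  "Cols = {w. w permutes \<Omega> \<and> (\<forall>a\<in>\<Omega>. col (w a) = col a)}"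

lemma Rows_permutes: "w \<in> Rows \<Longrightarrow> w permutes \<Omega>" and Cols_permutes: "w \<in> Cols \<Longrightarrow> w permutes \<Omega>"
  by (auto simp: Rows_def Cols_def)

lemma finite_Rows: "finite Rows" and finite_Cols: "finite Cols"
  unfolding Rows_def Cols_def by (rule finite_subset[OF _ finite_permutations[OF finite_entries]], auto)+

lemma id_Rows: "id \<in> Rows" and id_Cols: "id \<in> Cols"
  by (auto simp: Rows_def Cols_def permutes_id)

lemma Rows_comp: "u \<in> Rows \<Longrightarrow> v \<in> Rows \<Longrightarrow> u \<circ> v \<in> Rows"
  and Cols_comp: "u \<in> Cols \<Longrightarrow> v \<in> Cols \<Longrightarrow> u \<circ> v \<in> Cols"
  by (auto simp: Rows_def Cols_def permutes_compose permutes_in_image)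

lemma Rows_inv: assumes "u \<in> Rows" shows "pinv u \<in> Rows"
proof -
  have u: "u permutes \<Omega>" and r: "\<And>a. a \<in> \<Omega> \<Longrightarrow> row (u a) = row a" using assms by (auto simp: Rows_def)
  have "row (pinv u a) = row a" if "a \<in> \<Omega>" for a
    using r[of "pinv u a"] that permutes_inv[OF u] u by (simp add: permutes_in_image permutes_inverses)
  then show ?thesis using permutes_inv[OF u] by (simp add: Rows_def)
qed

lemma Cols_inv: assumes "u \<in> Cols" shows "pinv u \<in> Cols"
proof -
  have u: "u permutes \<Omega>" and r: "\<And>a. a \<in> \<Omega> \<Longrightarrow> col (u a) = col a" using assms by (auto simp: Cols_def)
  have "col (pinv u a) = col a" if "a \<in> \<Omega>" for a
    using r[of "pinv u a"] that permutes_inv[OF u] u by (simp add: permutes_in_image permutes_inverses)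
  then show ?thesis using permutes_inv[OF u] by (simp add: Cols_def)
qed

lemma Rows_Cols_id: assumes "w \<in> Rows" "w \<in> Cols" shows "w = id"
proof
  fix a
  show "w a = id a"
  proof (cases "a \<in> \<Omega>")
    case True
    then have "w a \<in> \<Omega>" using assms by (simp add: Rows_def permutes_in_image)
    then show ?thesis using True assms position_inj[of "w a" a] by (simp add: Rows_def Cols_def)
  next
    case False
    then show ?thesis using permutes_not_in[OF Rows_permutes[OF assms(1)]] by simp
  qed
qed

text \<open>If no two entries of a row of the tableau lie in a common column of its translate by \<open>g\<close>, then
  the entries of every column of the translate can be sorted into their rows. The rows met by a column
  form an initial segment because the sum of all row indices is minimal.\<close>

lemma row_column_factorization:
  assumes g: "g permutes \<Omega>"
    and sep: "\<And>a b. a \<in> \<Omega> \<Longrightarrow> b \<in> \<Omega> \<Longrightarrow> a \<noteq> b \<Longrightarrow> row a = row b \<Longrightarrow> col (pinv g a) \<noteq> col (pinv g b)"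
  obtains u v where "u \<in> Rows" "v \<in> Cols" "g = u \<circ> v"
proof -
  define c where "c a = col (pinv g a)" for a
  define E where "E j = {a \<in> \<Omega>. c a = j}" for j
  have g': "pinv g permutes \<Omega>" by (rule permutes_inv[OF g])
  have gin: "g a \<in> \<Omega> \<longleftrightarrow> a \<in> \<Omega>" "pinv g a \<in> \<Omega> \<longleftrightarrow> a \<in> \<Omega>" for a
    using g g' by (simp_all add: permutes_in_image)
  have inv1: "pinv g (g a) = a" "g (pinv g a) = a" for a using g by (simp_all add: permutes_inverses)
  have E: "E j = g ` {a \<in> \<Omega>. col a = j}" for j
  proof (intro equalityI subsetI)
    fix a assume "a \<in> E j"
    then show "a \<in> g ` {a \<in> \<Omega>. col a = j}"
      by (intro image_eqI[of _ _ "pinv g a"]) (auto simp: E_def c_def gin inv1)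
  qed (auto simp: E_def c_def gin inv1)
  have cardE: "card (E j) = card {a \<in> \<Omega>. col a = j}" for j
    unfolding E using permutes_inj[OF g] by (intro card_image) (auto intro: inj_on_subset)
  have finE: "finite (E j)" for j using finite_entries by (simp add: E_def)
  have injE: "inj_on row (E j)" for j
  proof (rule inj_onI, rule ccontr)
    fix a b assume "a \<in> E j" "b \<in> E j" "row a = row b" "a \<noteq> b"
    then show False using sep[of a b] by (simp add: E_def c_def)
  qed
  have partE: "(\<Sum>a\<in>\<Omega>. f a) = (\<Sum>j\<in>col ` \<Omega>. \<Sum>a\<in>E j. f a)" for f :: "nat \<Rightarrow> nat"
  proof -
    have "(\<Sum>a\<in>\<Omega>. f a) = (\<Sum>j\<in>c ` \<Omega>. \<Sum>a\<in>E j. f a)"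
      unfolding E_def by (rule sum.image_gen[OF finite_entries])
    moreover have "c ` \<Omega> = col ` \<Omega>"
      using permutes_image[OF g'] by (auto simp: c_def image_iff) (metis gin(1) inv1(1))
    ultimately show ?thesis by simp
  qed
  \<comment> \<open>The sum of all row indices is counted twice, by the columns of the translate and
    by those of the tableau. The second count shows that it is the least possible for the given
    column lengths, so each column of the translate attains the minimum.\<close>
  have "(\<Sum>j\<in>col ` \<Omega>. \<Sum>(row ` E j)) = (\<Sum>a\<in>\<Omega>. row a)"
    unfolding partE[of row]
  proof (rule sum.cong[OF refl])
    fix j
    show "\<Sum>(row ` E j) = (\<Sum>a\<in>E j. row a)"
      using sum.reindex[OF injE, of "\<lambda>x. x"] by (simp add: o_def)
  qed
  also have "\<dots> = (\<Sum>j\<in>col ` \<Omega>. \<Sum>a\<in>{a \<in> \<Omega>. col a = j}. row a)"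
    by (rule sum.image_gen[OF finite_entries])
  also have "\<dots> = (\<Sum>j\<in>col ` \<Omega>. \<Sum>{..<card (E j)})"
  proof (rule sum.cong[OF refl])
    fix j
    have "inj_on row {a \<in> \<Omega>. col a = j}" using position_inj by (auto intro: inj_onI)
    then have "(\<Sum>a\<in>{a \<in> \<Omega>. col a = j}. row a) = \<Sum>(row ` {a \<in> \<Omega>. col a = j})" by (simp add: sum.reindex)
    then show "(\<Sum>a\<in>{a \<in> \<Omega>. col a = j}. row a) = \<Sum>{..<card (E j)}" by (simp only: column_rows cardE)
  qed
  finally have tot: "(\<Sum>j\<in>col ` \<Omega>. \<Sum>{..<card (E j)}) = (\<Sum>j\<in>col ` \<Omega>. \<Sum>(row ` E j))" by simp
  have rowE: "row ` E j = {..<card (E j)}" for j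
  proof (cases "j \<in> col ` \<Omega>")
    case True
    have ge: "\<Sum>{..<card (E j)} \<le> \<Sum>(row ` E j)" for j
      using sum_nat_set_ge(1)[of "row ` E j"] finE injE by (simp add: card_image)
    have "\<Sum>{..<card (E j)} = \<Sum>(row ` E j)"
      using sum_mono_inv[OF tot ge True] finite_entries by simp
    then show ?thesis using sum_nat_set_ge(2)[of "row ` E j"] finE injE by (simp add: card_image)
  next
    case False
    then have "{a \<in> \<Omega>. col a = j} = {}" by auto
    then show ?thesis unfolding E by (simp del: Collect_empty_eq)
  qed
  have "\<exists>x\<in>\<Omega>. row x = row a \<and> col x = c a" if a: "a \<in> \<Omega>" for a
  proof -
    have "row a \<in> row ` E (c a)" using a by (auto simp: E_def)
    then have "row a \<in> row ` {x \<in> \<Omega>. col x = c a}" using rowE column_rows cardE by metis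
    then obtain x where "x \<in> \<Omega>" "col x = c a" "row a = row x" by blast
    then show ?thesis by auto
  qed
  then obtain p0 where p0: "\<And>a. a \<in> \<Omega> \<Longrightarrow> p0 a \<in> \<Omega> \<and> row (p0 a) = row a \<and> col (p0 a) = c a" by metis
  \<comment> \<open>The entry in the row of \<open>a\<close> and in the column that \<open>a\<close>
    occupies in the translate: \<open>p\<close> moves entries within rows, and
    \<open>p \<circ> g\<close> moves them within columns.\<close>
  define p where "p a = (if a \<in> \<Omega> then p0 a else a)" for a
  have p: "p permutes \<Omega>"
  proof (rule bij_imp_permutes)
    have "inj_on p \<Omega>"
    proof (rule inj_onI)
      fix a b assume ab: "a \<in> \<Omega>" "b \<in> \<Omega>" "p a = p b"
      then have "row a = row b" "c a = c b" using p0[of a] p0[of b] by (auto simp: p_def)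
      then show "a = b" using sep ab by (auto simp: c_def)
    qed
    moreover have "p ` \<Omega> \<subseteq> \<Omega>" using p0 by (auto simp: p_def)
    ultimately show "bij_betw p \<Omega> \<Omega>"
      using finite_entries by (simp add: bij_betw_def endo_inj_surj)
  qed (simp add: p_def)
  have pR: "p \<in> Rows" using p p0 by (auto simp: Rows_def p_def)
  have "p \<circ> g \<in> Cols"
    using p g p0 by (auto simp: Cols_def permutes_compose p_def gin c_def inv1)
  moreover have "g = pinv p \<circ> (p \<circ> g)" using p by (simp add: fun_eq_iff permutes_inverses)
  ultimately show ?thesis using that[OF Rows_inv[OF pR]] by blast
qed

definition row_sum :: "(nat \<Rightarrow> nat) \<Rightarrow>\<^sub>0 complex" where
  "row_sum = (\<Sum>u\<in>Rows. single u 1)"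

definition col_sum :: "(nat \<Rightarrow> nat) \<Rightarrow>\<^sub>0 complex" where
  "col_sum = (\<Sum>v\<in>Cols. single v (of_int (sign v)))"

definition symmetrizer :: "(nat \<Rightarrow> nat) \<Rightarrow>\<^sub>0 complex" where
  "symmetrizer = group_mult row_sum col_sum"

lemma row_sum_span: "row_sum \<in> perm_span \<Omega>" and col_sum_span: "col_sum \<in> perm_span \<Omega>"
  unfolding row_sum_def col_sum_def using Rows_permutes Cols_permutes by (auto intro!: perm_span_sum)

lemma symmetrizer_span: "symmetrizer \<in> perm_span \<Omega>"
  unfolding symmetrizer_def by (intro perm_span_mult row_sum_span col_sum_span)

lemma sign_comp: "u permutes \<Omega> \<Longrightarrow> v permutes \<Omega> \<Longrightarrow> sign (u \<circ> v) = sign u * sign v"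
  using finite_entries by (intro sign_compose) (auto intro: permutation_permutes[THEN iffD2])

lemma bij_Rows: "u \<in> Rows \<Longrightarrow> bij u" and bij_Cols: "u \<in> Cols \<Longrightarrow> bij u"
  using Rows_permutes Cols_permutes permutes_bij by blast+

lemma row_sum_absorb:
  assumes u: "u \<in> Rows"
  shows "group_mult (single u 1) row_sum = row_sum" "group_mult row_sum (single u 1) = row_sum"
proof -
  have "bij_betw ((\<circ>) u) Rows Rows"
    using u bij_Rows[OF u] by (intro bij_betw_byWitness[where f' = "(\<circ>) (pinv u)"])
      (auto simp: Rows_comp Rows_inv comp_cancel_left simp del: o_apply)
  from sum.reindex_bij_betw[OF this, of "\<lambda>w. single w (1::complex)"]
  show "group_mult (single u 1) row_sum = row_sum"
    by (simp add: row_sum_def linear_map_sum[OF linear_group_mult_right] group_mult_single)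
  have "bij_betw (\<lambda>v. v \<circ> u) Rows Rows"
    using u bij_Rows[OF u] by (intro bij_betw_byWitness[where f' = "\<lambda>v. v \<circ> pinv u"])
      (auto simp: Rows_comp Rows_inv comp_cancel_right simp del: o_apply)
  from sum.reindex_bij_betw[OF this, of "\<lambda>w. single w (1::complex)"]
  show "group_mult row_sum (single u 1) = row_sum"
    by (simp add: row_sum_def linear_map_sum[OF linear_group_mult_left] group_mult_single)
qed

lemma col_sum_absorb:
  assumes u: "u \<in> Cols"
  shows "group_mult col_sum (single u 1) = scale (of_int (sign u)) col_sum"
proof -
  have b: "bij_betw (\<lambda>v. v \<circ> u) Cols Cols"
    using u bij_Cols[OF u] by (intro bij_betw_byWitness[where f' = "\<lambda>v. v \<circ> pinv u"])
      (auto simp: Cols_comp Cols_inv comp_cancel_right simp del: o_apply)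
  have "group_mult col_sum (single u 1) = (\<Sum>v\<in>Cols. single (v \<circ> u) (of_int (sign v)))"
    by (simp add: col_sum_def linear_map_sum[OF linear_group_mult_left] group_mult_single)
  also have "\<dots> = (\<Sum>v\<in>Cols. single (v \<circ> u) (of_int (sign u) * of_int (sign (v \<circ> u))))"
  proof (intro sum.cong refl)
    fix v assume v: "v \<in> Cols"
    have "sign u * sign (v \<circ> u) = sign v"
      using sign_comp[OF Cols_permutes[OF v] Cols_permutes[OF u]] by (simp add: mult.commute)
    then show "single (v \<circ> u) (of_int (sign v)) = single (v \<circ> u) (of_int (sign u) * of_int (sign (v \<circ> u)) :: complex)"
      by (simp flip: of_int_mult)
  qed
  also have "\<dots> = (\<Sum>v\<in>Cols. single v (of_int (sign u) * of_int (sign v)))"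
    by (rule sum.reindex_bij_betw[OF b, of "\<lambda>w. single w (of_int (sign u) * of_int (sign w) :: complex)"])
  also have "\<dots> = scale (of_int (sign u)) col_sum" by (simp add: col_sum_def scale_sum)
  finally show ?thesis .
qed

lemma symmetrizer_absorb_left: "u \<in> Rows \<Longrightarrow> group_mult (single u 1) symmetrizer = symmetrizer"
  by (simp add: symmetrizer_def row_sum_absorb flip: group_mult_assoc)

lemma symmetrizer_absorb_right:
  "v \<in> Cols \<Longrightarrow> group_mult symmetrizer (single v 1) = scale (of_int (sign v)) symmetrizer"
  by (simp add: symmetrizer_def col_sum_absorb group_mult_assoc linear_map_scale[OF linear_group_mult_right])

lemma lookup_symmetrizer_id: "lookup symmetrizer id = 1"
proof -
  have "lookup symmetrizer id = (\<Sum>u\<in>Rows. \<Sum>v\<in>Cols. lookup (single (u \<circ> v) (of_int (sign v))) id)"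
    by (simp add: symmetrizer_def row_sum_def col_sum_def group_mult_double_sum lookup_sum)
  also have "\<dots> = (\<Sum>u\<in>Rows. \<Sum>v\<in>Cols. if u = id then if v = id then 1 else 0 else 0)"
  proof (intro sum.cong refl)
    fix u v assume uv: "u \<in> Rows" "v \<in> Cols"
    show "lookup (single (u \<circ> v) (of_int (sign v))) id = (if u = id then if v = id then 1 else 0 else (0::complex))"
    proof (cases "u \<circ> v = id")
      case True
      have "u = (u \<circ> v) \<circ> pinv v" using comp_cancel_right(2)[OF bij_Cols[OF uv(2)]] by simp
      then have "u = pinv v" using True by simp
      then have "u = id" using Rows_Cols_id uv Cols_inv by blast
      moreover have "v = id" using True \<open>u = id\<close> by simp
      ultimately show ?thesis by simp
    next
      case False
      then show ?thesis by (auto simp: lookup_single_not_eq)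
    qed
  qed
  also have "\<dots> = (\<Sum>u\<in>Rows. if u = id then 1 else 0)"
    using finite_Cols id_Cols by (intro sum.cong refl) simp
  also have "\<dots> = 1" using finite_Rows id_Rows by simp
  finally show ?thesis .
qed

lemma lookup_row_col:
  assumes "\<And>u. u \<in> Rows \<Longrightarrow> group_mult (single u 1) f = f"
    and "\<And>v. v \<in> Cols \<Longrightarrow> group_mult f (single v 1) = scale (of_int (sign v)) f"
    and u: "u \<in> Rows" and v: "v \<in> Cols"
  shows "lookup f (u \<circ> v) = of_int (sign v) * lookup f id"
proof -
  have "lookup f (u \<circ> v) = lookup (group_mult (single u 1) f) (u \<circ> v)" using assms(1)[OF u] by simp
  also have "\<dots> = lookup f v" by (simp add: lookup_group_mult_single_left[OF bij_Rows[OF u]] comp_cancel_left[OF bij_Rows[OF u]])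
  finally have 1: "lookup f (u \<circ> v) = lookup f v" .
  have "of_int (sign v) * lookup f v = lookup (group_mult f (single v 1)) v" using assms(2)[OF v] by simp
  also have "\<dots> = lookup f id"
    using comp_cancel_right(2)[OF bij_Cols[OF v], of id] by (simp add: lookup_group_mult_single_right[OF bij_Cols[OF v]])
  finally have "of_int (sign v) * (of_int (sign v) * lookup f v) = of_int (sign v) * lookup f id" by simp
  moreover have "of_int (sign v) * (of_int (sign v) * lookup f v) = of_int (sign v * sign v) * lookup f v"
    by (simp only: of_int_mult mult.assoc)
  ultimately show ?thesis using 1 by (simp only: sign_idempotent of_int_1 mult_1_left)
qed

text \<open>By the factorization, two entries of one row share a column of the translate by
  \<open>g\<close>. Their transposition \<open>t\<close> satisfies \<open>t g = g t'\<close> with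
  \<open>t'\<close> a transposition in the column stabilizer, so the coefficient at \<open>g\<close>
  equals its own negative.\<close>

lemma lookup_not_row_col:
  assumes "\<And>u. u \<in> Rows \<Longrightarrow> group_mult (single u 1) f = f"
    and "\<And>v. v \<in> Cols \<Longrightarrow> group_mult f (single v 1) = scale (of_int (sign v)) f"
    and g: "g permutes \<Omega>" and no: "\<And>u v. u \<in> Rows \<Longrightarrow> v \<in> Cols \<Longrightarrow> g \<noteq> u \<circ> v"
  shows "lookup f g = 0"
proof -
  obtain a b where ab: "a \<in> \<Omega>" "b \<in> \<Omega>" "a \<noteq> b" "row a = row b" "col (pinv g a) = col (pinv g b)"
    using row_column_factorization[OF g] no by metis
  let ?u = "Transposition.transpose a b" and ?v = "Transposition.transpose (pinv g a) (pinv g b)"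
  have g': "pinv g permutes \<Omega>" by (rule permutes_inv[OF g])
  have u: "?u \<in> Rows"
    using ab permutes_swap_id[of a \<Omega> b] by (auto simp: Rows_def Transposition.transpose_def)
  have "pinv g a \<in> \<Omega>" "pinv g b \<in> \<Omega>" using ab g' by (simp_all add: permutes_in_image)
  then have v: "?v \<in> Cols"
    using ab permutes_swap_id[of "pinv g a" \<Omega> "pinv g b"] by (auto simp: Cols_def Transposition.transpose_def)
  have comm: "?u \<circ> g = g \<circ> ?v"
    using permutes_inverses[OF g] by (auto simp: fun_eq_iff Transposition.transpose_def)
  have "pinv g a \<noteq> pinv g b" using ab(3) permutes_inverses(1)[OF g] by metis
  then have sgn: "sign ?v = - 1" by (simp add: sign_swap_id)
  have "lookup f (?u \<circ> g) = lookup (group_mult (single ?u 1) f) (?u \<circ> g)" using assms(1)[OF u] by simp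
  also have "\<dots> = lookup f g"
    by (simp only: lookup_group_mult_single_left[OF bij_Rows[OF u]] comp_cancel_left[OF bij_Rows[OF u]])
  finally have 1: "lookup f (?u \<circ> g) = lookup f g" .
  have "- lookup f (g \<circ> ?v) = lookup (group_mult f (single ?v 1)) (g \<circ> ?v)" using assms(2)[OF v] sgn by simp
  also have "\<dots> = lookup f g"
    by (simp only: lookup_group_mult_single_right[OF bij_Cols[OF v]] comp_cancel_right[OF bij_Cols[OF v]])
  finally show ?thesis using 1 comm by simp
qed

text \<open>The two absorption rules fix the coefficient at \<open>u \<circ> v\<close> as
  \<open>sign v\<close> times the one at the identity and force 0 elsewhere. Their solutions form a
  line, on which the symmetrizer is the point with coefficient 1 at the identity.\<close>

lemma symmetrizer_unique:
  assumes f: "\<And>u. u \<in> Rows \<Longrightarrow> group_mult (single u 1) f = f"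
    "\<And>v. v \<in> Cols \<Longrightarrow> group_mult f (single v 1) = scale (of_int (sign v)) f"
    and "f \<in> perm_span \<Omega>"
  shows "f = scale (lookup f id) symmetrizer"
proof (rule poly_mapping_eqI)
  fix g
  consider (rc) u v where "u \<in> Rows" "v \<in> Cols" "g = u \<circ> v"
    | (perm) "g permutes \<Omega>" "\<And>u v. u \<in> Rows \<Longrightarrow> v \<in> Cols \<Longrightarrow> g \<noteq> u \<circ> v"
    | (out) "\<not> g permutes \<Omega>" by blast
  then show "lookup f g = lookup (scale (lookup f id) symmetrizer) g"
  proof cases
    case rc
    then show ?thesis
      using lookup_row_col[OF f] lookup_row_col[OF symmetrizer_absorb_left symmetrizer_absorb_right]
      by (simp add: lookup_symmetrizer_id)
  next
    case perm
    then show ?thesis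
      using lookup_not_row_col[OF f] lookup_not_row_col[OF symmetrizer_absorb_left symmetrizer_absorb_right]
      by simp
  next
    case out
    then have "g \<notin> keys f" "g \<notin> keys symmetrizer" using assms(3) symmetrizer_span by (auto simp: perm_span_def)
    then show ?thesis by (simp add: in_keys_iff)
  qed
qed

lemma symmetrizer_sandwich:
  assumes "f \<in> perm_span \<Omega>"
  shows "group_mult (group_mult symmetrizer f) symmetrizer =
    scale (lookup (group_mult (group_mult symmetrizer f) symmetrizer) id) symmetrizer"
proof (rule symmetrizer_unique)
  show "group_mult (single u 1) (group_mult (group_mult symmetrizer f) symmetrizer) =
      group_mult (group_mult symmetrizer f) symmetrizer" if "u \<in> Rows" for u
    using symmetrizer_absorb_left[OF that] by (simp flip: group_mult_assoc)
  show "group_mult (group_mult (group_mult symmetrizer f) symmetrizer) (single v 1) =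
      scale (of_int (sign v)) (group_mult (group_mult symmetrizer f) symmetrizer)" if "v \<in> Cols" for v
    using symmetrizer_absorb_right[OF that]
    by (simp add: group_mult_assoc linear_map_scale[OF linear_group_mult_right])
  show "group_mult (group_mult symmetrizer f) symmetrizer \<in> perm_span \<Omega>"
    by (intro perm_span_mult symmetrizer_span assms)
qed

text \<open>The linear antiautomorphism that inverts permutations. Even without complex conjugation
  it acts as the adjoint on the elements below, whose coefficients are real.\<close>

definition reversal :: "((nat \<Rightarrow> nat) \<Rightarrow>\<^sub>0 complex) \<Rightarrow> ((nat \<Rightarrow> nat) \<Rightarrow>\<^sub>0 complex)" where
  "reversal = lin_ext (\<lambda>w. single (pinv w) 1)"

lemma linear_reversal: "linear_map reversal"
  unfolding reversal_def by (rule linear_lin_ext)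

lemmas [linear_intros] = linear_map_comp[OF linear_reversal]

lemma reversal_group_mult:
  assumes "f \<in> perm_span \<Omega>" "g \<in> perm_span \<Omega>"
  shows "reversal (group_mult f g) = group_mult (reversal g) (reversal f)"
proof (rule linear_map_eqI2[where S = "\<lambda>f g. reversal (group_mult f g)" and T = "\<lambda>f g. group_mult (reversal g) (reversal f)"
      and A = "{w. w permutes \<Omega>}" and B = "{w. w permutes \<Omega>}"])
  fix u v assume uv: "u \<in> {w. w permutes \<Omega>}" "v \<in> {w. w permutes \<Omega>}"
  have "pinv (u \<circ> v) = pinv v \<circ> pinv u" using uv by (intro o_inv_distrib) (auto intro: permutes_bij)
  then show "reversal (group_mult (single u 1) (single v 1)) = group_mult (reversal (single v 1)) (reversal (single u 1))"
    by (simp add: reversal_def group_mult_single)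
qed (use assms in \<open>auto simp: perm_span_def intro!: linear_intros\<close>)

lemma lookup_reversal:
  assumes "f \<in> perm_span \<Omega>" "w permutes \<Omega>"
  shows "lookup (reversal f) w = lookup f (pinv w)"
proof -
  have "lookup (reversal f) w = (\<Sum>v\<in>keys f. lookup f v * lookup (single (pinv v) 1) w)"
    by (simp add: reversal_def lookup_lin_ext)
  also have "\<dots> = (\<Sum>v\<in>keys f. if v = pinv w then lookup f v else 0)"
  proof (intro sum.cong refl)
    fix v assume "v \<in> keys f"
    then have "v permutes \<Omega>" using assms by (auto simp: perm_span_def)
    then have "pinv v = w \<longleftrightarrow> v = pinv w" using assms(2) by (metis inv_inv_eq permutes_bij)
    then show "lookup f v * lookup (single (pinv v) 1) w = (if v = pinv w then lookup f v else 0)"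
      by (auto simp: lookup_single when_def)
  qed
  also have "\<dots> = lookup f (pinv w)" by (simp add: in_keys_iff)
  finally show ?thesis .
qed

lemma reversal_row_sum: "reversal row_sum = row_sum"
proof -
  have "bij_betw pinv Rows Rows"
    using Rows_inv bij_Rows by (intro bij_betw_byWitness[where f' = pinv]) (auto simp: inv_inv_eq)
  from sum.reindex_bij_betw[OF this, of "\<lambda>w. single w (1::complex)"]
  show ?thesis by (simp add: row_sum_def linear_map_sum[OF linear_reversal]) (simp add: reversal_def)
qed

lemma reversal_col_sum: "reversal col_sum = col_sum"
proof -
  have b: "bij_betw pinv Cols Cols"
    using Cols_inv bij_Cols by (intro bij_betw_byWitness[where f' = pinv]) (auto simp: inv_inv_eq)
  have "reversal col_sum = (\<Sum>v\<in>Cols. single (pinv v) (of_int (sign v)))"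
    by (simp add: col_sum_def linear_map_sum[OF linear_reversal]) (simp add: reversal_def)
  also have "\<dots> = (\<Sum>v\<in>Cols. single (pinv v) (of_int (sign (pinv v))))"
    using Cols_permutes finite_entries by (intro sum.cong refl) (metis sign_inverse permutation_permutes)
  also have "\<dots> = col_sum"
    unfolding col_sum_def by (rule sum.reindex_bij_betw[OF b])
  finally show ?thesis .
qed

text \<open>The element \<open>z\<close> = (row sum)(column sum)(row sum) is self-adjoint with real coefficients, so the
  coefficient of the identity in \<open>z z\<close> is a sum of squares; it would vanish if the symmetrizer squared to 0.\<close>

lemma symmetrizer_square:
  obtains c where "c \<noteq> 0" "group_mult symmetrizer symmetrizer = scale c symmetrizer"
proof -
  define c where "c = lookup (group_mult symmetrizer symmetrizer) id"
  have sq: "group_mult symmetrizer symmetrizer = scale c symmetrizer"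
    using symmetrizer_sandwich[of "single id 1"]
    by (simp add: c_def permutes_id group_mult_assoc group_mult_id_left)
  have "c \<noteq> 0"
  proof
    assume "c = 0"
    \<comment> \<open>Reversal exchanges the two factors of the symmetrizer; appending a further row
      sum makes the product palindromic.\<close>
    define z where "z = group_mult symmetrizer row_sum"
    have zs: "z \<in> perm_span \<Omega>" unfolding z_def by (intro perm_span_mult symmetrizer_span row_sum_span)
    have rr: "group_mult row_sum row_sum = scale (of_nat (card Rows)) row_sum"
    proof -
      have "group_mult row_sum row_sum = (\<Sum>u\<in>Rows. group_mult (single u 1) row_sum)"
        by (subst (1) row_sum_def) (simp add: linear_map_sum[OF linear_group_mult_left])
      also have "\<dots> = (\<Sum>u\<in>Rows. row_sum)" by (intro sum.cong refl) (rule row_sum_absorb(1))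
      also have "\<dots> = scale (\<Sum>u\<in>Rows. 1) row_sum" by (simp only: scale_sum_left scale_one)
      finally show ?thesis by simp
    qed
    have "group_mult z z = group_mult symmetrizer (group_mult (group_mult row_sum row_sum) (group_mult col_sum row_sum))"
      by (simp add: z_def symmetrizer_def group_mult_assoc)
    also have "\<dots> = scale (of_nat (card Rows)) (group_mult (group_mult symmetrizer symmetrizer) row_sum)"
      by (simp add: rr symmetrizer_def group_mult_assoc linear_map_scale[OF linear_group_mult_left]
          linear_map_scale[OF linear_group_mult_right])
    also have "\<dots> = 0" by (simp add: sq \<open>c = 0\<close> linear_map_zero[OF linear_group_mult_left])
    finally have zz: "group_mult z z = 0" .
    have "reversal z = z"
      unfolding z_def symmetrizer_def
      by (simp add: reversal_group_mult perm_span_mult row_sum_span col_sum_span reversal_row_sum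
          reversal_col_sum group_mult_assoc)
    then have sym: "lookup z (pinv w) = lookup z w" if "w permutes \<Omega>" for w
      using lookup_reversal[OF zs that] by simp
    have real_mult: "lookup (group_mult f g) w \<in> \<real>"
      if "\<And>w. lookup f w \<in> \<real>" "\<And>w. lookup g w \<in> \<real>" for f g :: "(nat \<Rightarrow> nat) \<Rightarrow>\<^sub>0 complex" and w
      unfolding group_mult_def lookup_lin_ext using that
      by (intro sum_in_Reals Reals_mult) (auto simp: lookup_single when_def)
    have "lookup row_sum w \<in> \<real>" "lookup col_sum w \<in> \<real>" for w
      by (auto simp: row_sum_def col_sum_def lookup_sum lookup_single when_def intro!: sum_in_Reals)
    then have zr: "lookup z w \<in> \<real>" for w
      unfolding z_def symmetrizer_def by (intro real_mult)
    have "lookup (group_mult z z) id = (\<Sum>u\<in>keys z. lookup z u * lookup z (pinv u))"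
    proof -
      have "group_mult z z = lin_ext (\<lambda>u. group_mult (single u 1) z) z"
        by (simp add: group_mult_def)
      then have "lookup (group_mult z z) id = (\<Sum>u\<in>keys z. lookup z u * lookup (group_mult (single u 1) z) id)"
        by (simp add: lookup_lin_ext)
      also have "\<dots> = (\<Sum>u\<in>keys z. lookup z u * lookup z (pinv u))"
      proof (intro sum.cong refl)
        fix u assume "u \<in> keys z"
        then have "bij u" using zs by (auto simp: perm_span_def permutes_bij)
        then show "lookup z u * lookup (group_mult (single u 1) z) id = lookup z u * lookup z (pinv u)"
          by (simp add: lookup_group_mult_single_left)
      qed
      finally show ?thesis .
    qed
    also have "\<dots> = (\<Sum>u\<in>keys z. of_real ((Re (lookup z u))\<^sup>2))"
    proof (intro sum.cong refl)
      fix u assume "u \<in> keys z"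
      then have "u permutes \<Omega>" using zs by (auto simp: perm_span_def)
      moreover have "lookup z u = of_real (Re (lookup z u))" using zr[of u] by (simp add: of_real_Re)
      ultimately show "lookup z u * lookup z (pinv u) = of_real ((Re (lookup z u))\<^sup>2)"
        using sym by (metis of_real_mult power2_eq_square)
    qed
    also have "\<dots> = of_real (\<Sum>u\<in>keys z. (Re (lookup z u))\<^sup>2)" by simp
    finally have "(\<Sum>u\<in>keys z. (Re (lookup z u))\<^sup>2) = 0" using zz by (metis lookup_zero of_real_eq_0_iff)
    then have "Re (lookup z u) = 0" if "u \<in> keys z" for u using that by (simp add: sum_nonneg_eq_0_iff)
    then have "lookup z u = 0" for u using zr[of u] by (cases "u \<in> keys z") (auto simp: in_keys_iff complex_is_Real_iff complex_eq_iff)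
    then have "lookup z id = 0" by simp
    \<comment> \<open>Each translate of the symmetrizer by a row permutation contributes the
      coefficient 1.\<close>
    moreover have "lookup z id = of_nat (card Rows)"
    proof -
      have "lookup z id = (\<Sum>u\<in>Rows. lookup (group_mult symmetrizer (single u 1)) id)"
        by (simp add: z_def row_sum_def linear_map_sum[OF linear_group_mult_right] lookup_sum)
      also have "\<dots> = (\<Sum>u\<in>Rows. 1)"
      proof (intro sum.cong refl)
        fix u assume u: "u \<in> Rows"
        have "lookup (group_mult symmetrizer (single u 1)) id = lookup symmetrizer (pinv u \<circ> id)"
          by (simp add: lookup_group_mult_single_right bij_Rows[OF u])
        also have "\<dots> = 1"
          using lookup_row_col[OF symmetrizer_absorb_left symmetrizer_absorb_right Rows_inv[OF u] id_Cols]
          by (simp add: lookup_symmetrizer_id)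
        finally show "lookup (group_mult symmetrizer (single u 1)) id = 1" .
      qed
      finally show ?thesis by simp
    qed
    ultimately show False using finite_Rows id_Rows by auto
  qed
  then show ?thesis using that sq by blast
qed

end

subsection \<open>Row reading tableaux\<close>

lemma row_reading_Cons:
  "row_reading (p # L) (0, j) = j + 1"
  "row_reading (p # L) (Suc i, j) = p + row_reading L (i, j)"
  by (simp_all add: row_reading_def)

lemma boxes_Cons: "boxes (p # L) = Pair 0 ` {..<p} \<union> (\<lambda>(i, j). (Suc i, j)) ` boxes L"
proof -
  have "(i, j) \<in> boxes (p # L) \<longleftrightarrow> (i, j) \<in> Pair 0 ` {..<p} \<union> (\<lambda>(i, j). (Suc i, j)) ` boxes L" for i j
    by (cases i) (auto simp: boxes_def)
  then show ?thesis by (auto simp del: Un_iff)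
qed

lemma bij_betw_row_reading: "bij_betw (row_reading L) (boxes L) {1..sum_list L}"
proof (induction L)
  case Nil
  then show ?case by (simp add: boxes_def bij_betw_def)
next
  case (Cons p L)
  have inj: "inj_on (row_reading L) (boxes L)" and im: "row_reading L ` boxes L = {1..sum_list L}"
    using Cons.IH by (auto simp: bij_betw_def)
  have 1: "bij_betw (row_reading (p # L)) (Pair 0 ` {..<p}) {1..p}"
    by (rule bij_betw_byWitness[where f' = "\<lambda>t. (0, t - 1)"]) (auto simp: row_reading_Cons)
  have 2: "bij_betw (row_reading (p # L)) ((\<lambda>(i, j). (Suc i, j)) ` boxes L) ((+) p ` {1..sum_list L})"
    unfolding bij_betw_def
  proof
    show "inj_on (row_reading (p # L)) ((\<lambda>(i, j). (Suc i, j)) ` boxes L)"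
    proof (rule inj_onI)
      fix x y assume "x \<in> (\<lambda>(i, j). (Suc i, j)) ` boxes L" "y \<in> (\<lambda>(i, j). (Suc i, j)) ` boxes L"
        and eq: "row_reading (p # L) x = row_reading (p # L) y"
      then obtain i j i' j' where ij: "x = (Suc i, j)" "y = (Suc i', j')" "(i, j) \<in> boxes L" "(i', j') \<in> boxes L"
        by auto
      then have "(i, j) = (i', j')" using eq by (intro inj_onD[OF inj]) (simp_all add: row_reading_Cons)
      then show "x = y" using ij by simp
    qed
    have "row_reading (p # L) ` (\<lambda>(i, j). (Suc i, j)) ` boxes L = (+) p ` row_reading L ` boxes L"
      unfolding image_image by (intro image_cong refl) (auto simp: row_reading_Cons)
    then show "row_reading (p # L) ` (\<lambda>(i, j). (Suc i, j)) ` boxes L = (+) p ` {1..sum_list L}"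
      by (simp only: im)
  qed
  have "{1..p} \<inter> (+) p ` {1..sum_list L} = {}" by auto
  from bij_betw_combine[OF 1 2 this]
  have "bij_betw (row_reading (p # L)) (boxes (p # L)) ({1..p} \<union> (+) p ` {1..sum_list L})"
    by (simp only: boxes_Cons)
  moreover have "{1..p} \<union> (+) p ` {1..sum_list L} = {1..sum_list (p # L)}"
    unfolding image_add_atLeastAtMost by auto
  ultimately show ?case by simp
qed

definition position :: "nat list \<Rightarrow> nat \<Rightarrow> nat \<times> nat" where
  "position L t = inv_into (boxes L) (row_reading L) t"

definition rowof :: "nat list \<Rightarrow> nat \<Rightarrow> nat" where "rowof L t = fst (position L t)"
definition colof :: "nat list \<Rightarrow> nat \<Rightarrow> nat" where "colof L t = snd (position L t)"

lemma position_row_reading: "(i, j) \<in> boxes L \<Longrightarrow> position L (row_reading L (i, j)) = (i, j)"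
  unfolding position_def using bij_betw_row_reading[of L] by (simp add: bij_betw_def)

lemma row_reading_position:
  assumes "t \<in> {1..sum_list L}"
  shows "row_reading L (position L t) = t" "position L t \<in> boxes L"
proof -
  have "t \<in> row_reading L ` boxes L" using assms bij_betw_row_reading[of L] by (simp add: bij_betw_def)
  then show "row_reading L (position L t) = t" "position L t \<in> boxes L"
    unfolding position_def by (auto intro: f_inv_into_f inv_into_into)
qed

lemma row_reading_in: "(i, j) \<in> boxes L \<Longrightarrow> row_reading L (i, j) \<in> {1..sum_list L}"
  using bij_betw_row_reading[of L] by (auto simp: bij_betw_def)

lemma rowof_row_reading: "(i, j) \<in> boxes L \<Longrightarrow> rowof L (row_reading L (i, j)) = i"
  and colof_row_reading: "(i, j) \<in> boxes L \<Longrightarrow> colof L (row_reading L (i, j)) = j"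
  by (simp_all add: rowof_def colof_def position_row_reading)

lemma row_col_box:
  "t \<in> {1..sum_list L} \<Longrightarrow> (rowof L t, colof L t) \<in> boxes L"
  "t \<in> {1..sum_list L} \<Longrightarrow> row_reading L (rowof L t, colof L t) = t"
  using row_reading_position[of t L] by (simp_all add: rowof_def colof_def)

lemma row_interval:
  assumes i: "i < length L"
  shows "{sum_list (take i L)<..sum_list (take (Suc i) L)} = {t \<in> {1..sum_list L}. rowof L t = i}"
proof (intro equalityI subsetI)
  fix t assume t: "t \<in> {sum_list (take i L)<..sum_list (take (Suc i) L)}"
  define j where "j = t - sum_list (take i L) - 1"
  have "sum_list (take (Suc i) L) = sum_list (take i L) + L ! i" using i by (simp add: take_Suc_conv_app_nth)
  then have "(i, j) \<in> boxes L" "t = row_reading L (i, j)"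
    using t i by (auto simp: j_def boxes_def row_reading_def)
  then show "t \<in> {t \<in> {1..sum_list L}. rowof L t = i}"
    using row_reading_in rowof_row_reading by auto
next
  fix t assume "t \<in> {t \<in> {1..sum_list L}. rowof L t = i}"
  then have "(i, colof L t) \<in> boxes L" "row_reading L (i, colof L t) = t"
    using row_col_box[of t L] by auto
  then show "t \<in> {sum_list (take i L)<..sum_list (take (Suc i) L)}"
    using i by (auto simp: boxes_def row_reading_def take_Suc_conv_app_nth)
qed

lemma young_subgroup_rows:
  "young_subgroup L = {w. w permutes {1..sum_list L} \<and> (\<forall>t\<in>{1..sum_list L}. rowof L (w t) = rowof L t)}"
proof (intro equalityI subsetI)
  fix w assume "w \<in> young_subgroup L"
  then have w: "w permutes {1..sum_list L}"
    and I: "\<And>i. i < length L \<Longrightarrow> w ` {t \<in> {1..sum_list L}. rowof L t = i} = {t \<in> {1..sum_list L}. rowof L t = i}"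
    by (auto simp: young_subgroup_def row_interval simp del: atLeastAtMost_iff)
  have "rowof L (w t) = rowof L t" if t: "t \<in> {1..sum_list L}" for t
  proof -
    have "rowof L t < length L" using row_col_box(1)[OF t] by (simp add: boxes_def)
    then show ?thesis using I[of "rowof L t"] t by blast
  qed
  then show "w \<in> {w. w permutes {1..sum_list L} \<and> (\<forall>t\<in>{1..sum_list L}. rowof L (w t) = rowof L t)}" using w by blast
next
  fix w assume "w \<in> {w. w permutes {1..sum_list L} \<and> (\<forall>t\<in>{1..sum_list L}. rowof L (w t) = rowof L t)}"
  then have w: "w permutes {1..sum_list L}" and r: "\<And>t. t \<in> {1..sum_list L} \<Longrightarrow> rowof L (w t) = rowof L t" by blast+
  have "w ` {t \<in> {1..sum_list L}. rowof L t = i} = {t \<in> {1..sum_list L}. rowof L t = i}" for i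
  proof (rule endo_inj_surj)
    show "w ` {t \<in> {1..sum_list L}. rowof L t = i} \<subseteq> {t \<in> {1..sum_list L}. rowof L t = i}"
      using r permutes_in_image[OF w] by auto
    show "inj_on w {t \<in> {1..sum_list L}. rowof L t = i}" using permutes_inj[OF w] by (rule inj_on_subset) simp
  qed simp
  then show "w \<in> young_subgroup L" using w by (simp add: young_subgroup_def row_interval)
qed

text \<open>In a weakly decreasing list the parts exceeding \<open>j\<close> form a prefix, so their
  number bounds their positions.\<close>

lemma less_length_filter_iff:
  fixes L :: "nat list"
  shows "sorted_wrt (\<ge>) L \<Longrightarrow> i < length (filter (\<lambda>p. j < p) L) \<longleftrightarrow> i < length L \<and> j < L ! i"
proof (induction L arbitrary: i)
  case (Cons p L)
  show ?case
  proof (cases "j < p")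
    case True
    then show ?thesis using Cons by (cases i) auto
  next
    case False
    have le: "\<forall>x\<in>set L. x \<le> p" using Cons.prems by simp
    have "\<not> j < x" if "x \<in> set L" for x using bspec[OF le that] False by linarith
    then have "filter (\<lambda>p. j < p) L = []" by (simp add: filter_empty_conv)
    moreover have "\<not> j < (p # L) ! i" if "i < length (p # L)"
    proof (cases i)
      case (Suc i')
      then have "L ! i' \<in> set L" using that by simp
      then show ?thesis using bspec[OF le, of "L ! i'"] False Suc by simp
    qed (use False in simp)
    ultimately show ?thesis using False by auto
  qed
qed simp

section \<open>Conjugate shapes and column stabilizers\<close>

lemma boxes_conjugate:
  assumes s: "sorted_wrt (\<ge>) L"
  shows "(j, i) \<in> boxes (conjugate L) \<longleftrightarrow> (i, j) \<in> boxes L"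
proof -
  have "(j, i) \<in> boxes (conjugate L) \<longleftrightarrow>
      j < (if L = [] then 0 else hd L) \<and> i < length (filter (\<lambda>p. j < p) L)"
    by (auto simp: boxes_def conjugate_def)
  also have "\<dots> \<longleftrightarrow> j < (if L = [] then 0 else hd L) \<and> i < length L \<and> j < L ! i"
    by (simp only: less_length_filter_iff[OF s])
  also have "\<dots> \<longleftrightarrow> i < length L \<and> j < L ! i"
  proof -
    have "L ! i \<le> hd L" if "i < length L"
      using s that by (cases L; cases i) (auto dest!: nth_mem)
    then show ?thesis by (cases "L = []") force+
  qed
  finally show ?thesis by (simp add: boxes_def)
qed

lemma sum_list_conjugate:
  assumes s: "sorted_wrt (\<ge>) L"
  shows "sum_list (conjugate L) = sum_list L"
proof -
  have c: "card (boxes L) = sum_list L" for L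
    using bij_betw_same_card[OF bij_betw_row_reading[of L]] by simp
  have "boxes (conjugate L) = prod.swap ` boxes L"
    using boxes_conjugate[OF s] by (auto simp: image_iff) (metis prod.swap_def swap_simp)
  then have "card (boxes (conjugate L)) = card (boxes L)" by (simp only: card_image[OF inj_swap])
  then show ?thesis by (simp only: c)
qed

lemma column_reading_conjugate: "column_reading L (i, j) = row_reading (conjugate L) (j, i)"
  by (simp add: column_reading_def row_reading_def)

lemma tableau_row_reading:
  assumes s: "sorted_wrt (\<ge>) L"
  shows "tableau {1..sum_list L} (rowof L) (colof L)"
proof
  show "a = b" if "a \<in> {1..sum_list L}" "b \<in> {1..sum_list L}" "rowof L a = rowof L b" "colof L a = colof L b" for a b
    using row_col_box(2)[OF that(1)] row_col_box(2)[OF that(2)] that(3,4) by metis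
  fix j
  let ?c = "{t \<in> {1..sum_list L}. colof L t = j}"
  have "rowof L ` ?c = {..<length (filter (\<lambda>p. j < p) L)}"
  proof (intro equalityI subsetI)
    fix i assume "i \<in> rowof L ` ?c"
    then have "(i, j) \<in> boxes L" using row_col_box(1) by auto
    then show "i \<in> {..<length (filter (\<lambda>p. j < p) L)}" using less_length_filter_iff[OF s] by (simp add: boxes_def)
  next
    fix i assume "i \<in> {..<length (filter (\<lambda>p. j < p) L)}"
    then have b: "(i, j) \<in> boxes L" using less_length_filter_iff[OF s] by (simp add: boxes_def)
    then show "i \<in> rowof L ` ?c"
      using row_reading_in[OF b] rowof_row_reading[OF b] colof_row_reading[OF b]
      by (intro image_eqI[of _ _ "row_reading L (i, j)"]) auto
  qed
  moreover have "inj_on (rowof L) ?c"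
    by (rule inj_onI) (metis (mono_tags, lifting) mem_Collect_eq row_col_box(2))
  then have "card (rowof L ` ?c) = card ?c" by (rule card_image)
  ultimately show "rowof L ` ?c = {..<card ?c}" by simp
qed simp

text \<open>Column reading is row reading of the conjugate shape at the transposed box. So
  \<open>reading_perm\<close> carries the entry of a box to the entry of the transposed box, and
  columns become rows of the conjugate shape.\<close>

lemma reading_perm_permutes:
  assumes s: "sorted_wrt (\<ge>) L"
  shows "reading_perm L permutes {1..sum_list L}"
    and "t \<in> {1..sum_list L} \<Longrightarrow> rowof (conjugate L) (reading_perm L t) = colof L t"
proof -
  have val: "reading_perm L t = row_reading (conjugate L) (colof L t, rowof L t)" if "t \<in> {1..sum_list L}" for t
    using that unfolding reading_perm_def position_def[symmetric]
    by (simp add: rowof_def colof_def flip: column_reading_conjugate)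
  have box: "(colof L t, rowof L t) \<in> boxes (conjugate L)" if "t \<in> {1..sum_list L}" for t
    using row_col_box(1)[OF that] boxes_conjugate[OF s] by simp
  show *: "rowof (conjugate L) (reading_perm L t) = colof L t" if "t \<in> {1..sum_list L}" for t
    using val[OF that] rowof_row_reading[OF box[OF that]] by simp
  have **: "colof (conjugate L) (reading_perm L t) = rowof L t" if "t \<in> {1..sum_list L}" for t
    using val[OF that] colof_row_reading[OF box[OF that]] by simp
  show "reading_perm L permutes {1..sum_list L}"
  proof (rule bij_imp_permutes)
    have "inj_on (reading_perm L) {1..sum_list L}"
      by (rule inj_onI) (metis * ** row_col_box(2))
    moreover have "reading_perm L ` {1..sum_list L} \<subseteq> {1..sum_list L}"
      using val row_reading_in[OF box] sum_list_conjugate[OF s] by auto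
    ultimately show "bij_betw (reading_perm L) {1..sum_list L} {1..sum_list L}"
      by (simp add: bij_betw_def endo_inj_surj)
  qed (simp only: reading_perm_def if_False)
qed

lemma young_subgroup_Rows:
  assumes s: "sorted_wrt (\<ge>) L"
  shows "young_subgroup L = tableau.Rows {1..sum_list L} (rowof L)"
  unfolding tableau.Rows_def[OF tableau_row_reading[OF s]] by (rule young_subgroup_rows)

text \<open>Since \<open>\<tau>\<close> carries columns to rows of the conjugate shape, conjugation
  by it identifies the Young subgroup of that shape with the column stabilizer. Signs are preserved,
  as the sign of \<open>\<tau>\<close> occurs squared.\<close>

lemma young_subgroup_Cols:
  assumes s: "sorted_wrt (\<ge>) L"
  defines "\<tau> \<equiv> reading_perm L"
  shows "bij_betw (\<lambda>v. pinv \<tau> \<circ> v \<circ> \<tau>) (young_subgroup (conjugate L)) (tableau.Cols {1..sum_list L} (colof L))"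
    and "v \<in> young_subgroup (conjugate L) \<Longrightarrow> sign (pinv \<tau> \<circ> v \<circ> \<tau>) = sign v"
proof -
  let ?O = "{1..sum_list L}"
  interpret tableau ?O "rowof L" "colof L" by (rule tableau_row_reading[OF s])
  have t: "\<tau> permutes ?O" unfolding \<tau>_def by (rule reading_perm_permutes[OF s])
  have t': "pinv \<tau> permutes ?O" by (rule permutes_inv[OF t])
  have YS: "young_subgroup (conjugate L) =
      {w. w permutes ?O \<and> (\<forall>t\<in>?O. rowof (conjugate L) (w t) = rowof (conjugate L) t)}"
    using young_subgroup_rows[of "conjugate L"] by (simp only: sum_list_conjugate[OF s])
  have ti: "\<tau> a \<in> ?O \<longleftrightarrow> a \<in> ?O" "pinv \<tau> a \<in> ?O \<longleftrightarrow> a \<in> ?O" for a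
    using permutes_in_image[OF t] permutes_in_image[OF t'] by simp_all
  have inv1: "pinv \<tau> (\<tau> a) = a" "\<tau> (pinv \<tau> a) = a" for a using permutes_inverses[OF t] by simp_all
  have row: "rowof (conjugate L) (\<tau> a) = colof L a" if "a \<in> ?O" for a
    unfolding \<tau>_def by (rule reading_perm_permutes(2)[OF s that])
  have col: "colof L (pinv \<tau> a) = rowof (conjugate L) a" if "a \<in> ?O" for a
    using row[of "pinv \<tau> a"] that ti inv1 by simp
  show "bij_betw (\<lambda>v. pinv \<tau> \<circ> v \<circ> \<tau>) (young_subgroup (conjugate L)) Cols"
  proof (rule bij_betw_byWitness[where f' = "\<lambda>w. \<tau> \<circ> w \<circ> pinv \<tau>"])
    show "(\<lambda>v. pinv \<tau> \<circ> v \<circ> \<tau>) ` young_subgroup (conjugate L) \<subseteq> Cols"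
    proof (rule image_subsetI)
      fix v assume v: "v \<in> young_subgroup (conjugate L)"
      then have vp: "v permutes ?O" and vr: "\<And>a. a \<in> ?O \<Longrightarrow> rowof (conjugate L) (v a) = rowof (conjugate L) a"
        by (auto simp: YS)
      have "colof L (pinv \<tau> (v (\<tau> a))) = colof L a" if "a \<in> ?O" for a
        using that ti vr[of "\<tau> a"] row col permutes_in_image[OF vp] by simp
      then show "pinv \<tau> \<circ> v \<circ> \<tau> \<in> Cols"
        unfolding Cols_def using t t' vp by (intro CollectI conjI ballI permutes_compose) simp_all
    qed
    show "(\<lambda>w. \<tau> \<circ> w \<circ> pinv \<tau>) ` Cols \<subseteq> young_subgroup (conjugate L)"
    proof (rule image_subsetI)
      fix w assume w: "w \<in> Cols"
      then have wp: "w permutes ?O" and wc: "\<And>a. a \<in> ?O \<Longrightarrow> colof L (w a) = colof L a"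
        unfolding Cols_def by blast+
      have "rowof (conjugate L) (\<tau> (w (pinv \<tau> a))) = rowof (conjugate L) a" if "a \<in> ?O" for a
        using that ti wc[of "pinv \<tau> a"] row col permutes_in_image[OF wp] by simp
      then show "\<tau> \<circ> w \<circ> pinv \<tau> \<in> young_subgroup (conjugate L)"
        unfolding YS using t t' wp by (intro CollectI conjI ballI permutes_compose) simp_all
    qed
  qed (auto simp: fun_eq_iff inv1)
  show "sign (pinv \<tau> \<circ> v \<circ> \<tau>) = sign v" if "v \<in> young_subgroup (conjugate L)"
  proof -
    have vp: "v permutes ?O" using that by (auto simp: YS)
    have "sign (pinv \<tau> \<circ> v \<circ> \<tau>) = sign (pinv \<tau>) * sign v * sign \<tau>"
      using t t' vp by (simp add: sign_comp permutes_compose)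
    also have "sign (pinv \<tau>) = sign \<tau>" using t by (metis finite_entries permutation_permutes sign_inverse)
    also have "sign \<tau> * sign v * sign \<tau> = sign v * (sign \<tau> * sign \<tau>)" by (simp only: ac_simps)
    finally show ?thesis by (simp only: sign_idempotent mult_1_right)
  qed
qed

lemma young_symmetrizer_tableau:
  assumes s: "sorted_wrt (\<ge>) L"
  shows "young_symmetrizer L = tableau.symmetrizer {1..sum_list L} (rowof L) (colof L)"
proof -
  interpret tableau "{1..sum_list L}" "rowof L" "colof L" by (rule tableau_row_reading[OF s])
  let ?\<tau> = "reading_perm L"
  have "(\<Sum>v\<in>young_subgroup (conjugate L). single (pinv ?\<tau> \<circ> v \<circ> ?\<tau>) (of_int (sign v) :: complex)) =
      (\<Sum>v\<in>young_subgroup (conjugate L). single (pinv ?\<tau> \<circ> v \<circ> ?\<tau>) (of_int (sign (pinv ?\<tau> \<circ> v \<circ> ?\<tau>))))"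
    by (intro sum.cong refl) (simp only: young_subgroup_Cols(2)[OF s])
  also have "\<dots> = col_sum"
    unfolding col_sum_def by (rule sum.reindex_bij_betw[OF young_subgroup_Cols(1)[OF s]])
  finally show ?thesis
    unfolding young_symmetrizer_def Let_def symmetrizer_def row_sum_def young_subgroup_Rows[OF s] by simp
qed

section \<open>Permutation diagrams and the generators of Specht modules\<close>

text \<open>The image of a permutation of the first \<open>r\<close> strands under the linear extension that defines
  \<open>e_elem\<close>.\<close>

definition padded :: "half_integer \<Rightarrow> nat \<Rightarrow> (nat \<Rightarrow> nat) \<Rightarrow> diagram" where
  "padded k r w = perm_diagram r w \<union> extra_blocks k r"

abbreviation "perm_diag k \<equiv> perm_diagram (strands k)"

lemma Union_perm_diagram: "w permutes {1..r} \<Longrightarrow> \<Union>(perm_diagram r w) = vertices r"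
  using permutes_image[of w "{1..r}"] by (auto simp: perm_diagram_def vertices_def)

lemma partition_on_perm_diagram:
  assumes w: "w permutes {1..r}"
  shows "partition_on (vertices r) (perm_diagram r w)"
proof (rule partition_onI)
  show "\<Union>(perm_diagram r w) = vertices r" by (rule Union_perm_diagram[OF w])
  show "disjnt B B'" if "B \<in> perm_diagram r w" "B' \<in> perm_diagram r w" "B \<noteq> B'" for B B'
    using that permutes_inj[OF w] by (auto simp: perm_diagram_def disjnt_def dest: injD)
qed (auto simp: perm_diagram_def)

lemma tensor_degree_le_strands: "tensor_degree k \<le> strands k"
  by (cases k) auto

lemma permutes_mono: "w permutes {1..r} \<Longrightarrow> r \<le> s \<Longrightarrow> w permutes {1..s::nat}"
  by (rule permutes_subset) auto

lemma perm_diag_closed: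
  assumes w: "w permutes {1..tensor_degree k}"
  shows "perm_diag k w \<in> diagrams k"
proof -
  have p: "partition_on (vertices (strands k)) (perm_diag k w)"
    by (rule partition_on_perm_diagram[OF permutes_mono[OF w tensor_degree_le_strands]])
  show ?thesis
  proof (cases k)
    case (Half m)
    then have "w (m + 1) = m + 1" using permutes_not_in[OF w] by simp
    then have "{Unprimed (m+1), Primed (m+1)} \<in> perm_diag k w"
      using Half by (auto simp: perm_diagram_def intro!: image_eqI[of _ _ "m + 1"])
    then show ?thesis using p Half by auto
  qed (use p in simp)
qed

lemma padded_closed:
  assumes w: "w permutes {1..r}" and r: "r \<le> tensor_degree k"
  shows "padded k r w \<in> diagrams k"
proof -
  have p: "partition_on (vertices r) (perm_diagram r w)" by (rule partition_on_perm_diagram[OF w])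
  have "v \<in> \<Union>(extra_blocks k r) \<longleftrightarrow> v \<in> vertices (strands k) - vertices r" for v
    using r by (cases k; cases v) (auto simp: image_iff)
  then have U: "\<Union>(extra_blocks k r) = vertices (strands k) - vertices r" by blast
  have V: "vertices r \<subseteq> vertices (strands k)"
    using r tensor_degree_le_strands[of k] by (auto simp: vertices_def)
  have q: "partition_on (vertices (strands k) - vertices r) (extra_blocks k r)"
  proof (rule partition_onI)
    show "\<Union>(extra_blocks k r) = vertices (strands k) - vertices r" by (rule U)
    show "disjnt B B'" if "B \<in> extra_blocks k r" "B' \<in> extra_blocks k r" "B \<noteq> B'" for B B'
      using that by (cases k) (auto simp: disjnt_def)
    show "{} \<notin> extra_blocks k r" using r by (cases k) auto
  qed
  have "partition_on (vertices r \<union> (vertices (strands k) - vertices r)) (padded k r w)"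
    unfolding padded_def
  proof (rule partition_onI)
    show "\<Union>(perm_diagram r w \<union> extra_blocks k r) = vertices r \<union> (vertices (strands k) - vertices r)"
      using partition_onD1[OF p] partition_onD1[OF q] by simp
    show "{} \<notin> perm_diagram r w \<union> extra_blocks k r"
      using partition_onD3[OF p] partition_onD3[OF q] by simp
    show "disjnt B B'" if "B \<in> perm_diagram r w \<union> extra_blocks k r" "B' \<in> perm_diagram r w \<union> extra_blocks k r" "B \<noteq> B'" for B B'
    proof -
      have 1: "disjnt B B'" if "B \<in> perm_diagram r w" "B' \<in> extra_blocks k r" for B B'
        using that partition_onD1[OF p] partition_onD1[OF q] by (auto simp: disjnt_def)
      show ?thesis
        using that 1[of B B'] 1[of B' B] disjointD[OF partition_onD2[OF p], of B B']
          disjointD[OF partition_onD2[OF q], of B B'] by (auto simp: disjnt_def)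
    qed
  qed
  then have pp: "partition_on (vertices (strands k)) (padded k r w)" using V by (simp add: Un_absorb1)
  show ?thesis
  proof (cases k)
    case (Half m)
    let ?X = "Unprimed ` {r<..m + 1} \<union> Primed ` {r<..m + 1}"
    have "?X \<in> padded k r w" using Half by (simp add: padded_def)
    \<comment> \<open>Here \<open>r \<le> tensor_degree k\<close> means \<open>r \<le> m\<close>
      rather than \<open>r \<le> m + 1\<close>: the vertices \<open>m + 1\<close> and
      \<open>(m + 1)'\<close> belong to the padding.\<close>
    moreover have "Unprimed (m+1) \<in> ?X" "Primed (m+1) \<in> ?X" using r Half by auto
    ultimately have "\<exists>B\<in>padded k r w. Unprimed (m+1) \<in> B \<and> Primed (m+1) \<in> B" by (intro bexI[of _ ?X] conjI)
    then show ?thesis using pp Half by simp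
  qed (use pp in simp)
qed

lemma complete_word_nth:
  assumes "xs \<in> words k N" "i \<in> {1..strands k}"
  shows "complete_word k N xs ! (i - 1) = (if i \<le> tensor_degree k then xs ! (i - 1) else N)"
  using assms by (cases k) (auto simp: tuples_def nth_append)

lemma labels_agree_perm_diagram:
  "agrees (perm_diagram r w) (label ys xs) \<longleftrightarrow> (\<forall>i\<in>{1..r}. ys ! (i - 1) = xs ! (w i - 1))"
proof -
  have "agrees (perm_diagram r w) (label ys xs) \<longleftrightarrow>
      (\<forall>i\<in>{1..r}. \<forall>a\<in>{Unprimed i, Primed (w i)}. \<forall>b\<in>{Unprimed i, Primed (w i)}. label ys xs a = label ys xs b)"
    unfolding perm_diagram_def agrees_def ball_simps by (rule refl)
  also have "\<dots> \<longleftrightarrow> (\<forall>i\<in>{1..r}. ys ! (i - 1) = xs ! (w i - 1))" by (intro ball_cong refl) auto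
  finally show ?thesis .
qed

lemma labels_agree_perm_diag:
  assumes w: "w permutes {1..tensor_degree k}"
    and t: "ys \<in> words k N" "xs \<in> words k N"
  shows "labels_agree k N (perm_diag k w) ys xs \<longleftrightarrow> (\<forall>i\<in>{1..tensor_degree k}. ys ! (i - 1) = xs ! (w i - 1))"
proof -
  have w': "w permutes {1..strands k}" by (rule permutes_mono[OF w tensor_degree_le_strands])
  have win: "w i \<in> {1..strands k} \<longleftrightarrow> i \<in> {1..strands k}" "w i \<in> {1..tensor_degree k} \<longleftrightarrow> i \<in> {1..tensor_degree k}" for i
    using permutes_in_image[OF w'] permutes_in_image[OF w] by blast+
  have eq: "complete_word k N ys ! (i - 1) = complete_word k N xs ! (w i - 1) \<longleftrightarrow>
      (i \<le> tensor_degree k \<longrightarrow> ys ! (i - 1) = xs ! (w i - 1))" if i: "i \<in> {1..strands k}" for i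
    using complete_word_nth[OF t(1) i] complete_word_nth[OF t(2), of "w i"] i win[of i] by auto
  have "labels_agree k N (perm_diag k w) ys xs \<longleftrightarrow>
      (\<forall>i\<in>{1..strands k}. i \<le> tensor_degree k \<longrightarrow> ys ! (i - 1) = xs ! (w i - 1))"
    unfolding labels_agree_agrees labels_agree_perm_diagram using eq by blast
  also have "\<dots> \<longleftrightarrow> (\<forall>i\<in>{1..tensor_degree k}. ys ! (i - 1) = xs ! (w i - 1))"
    using tensor_degree_le_strands[of k] by auto
  finally show ?thesis .
qed

text \<open>Padding with singletons imposes no condition; padding with the block of \<open>m + 1\<close> forces the
  remaining letters to be \<open>N\<close>.\<close>

definition forced :: "half_integer \<Rightarrow> nat \<Rightarrow> nat \<Rightarrow> nat list \<Rightarrow> bool" where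
  "forced k N r xs \<longleftrightarrow> (\<forall>m. k = Half m \<longrightarrow> (\<forall>i\<in>{r<..m}. xs ! (i - 1) = N))"

lemma labels_agree_padded:
  assumes w: "w permutes {1..r}" and r: "r \<le> tensor_degree k"
    and t: "ys \<in> words k N" "xs \<in> words k N"
  shows "labels_agree k N (padded k r w) ys xs \<longleftrightarrow>
    (\<forall>i\<in>{1..r}. ys ! (i - 1) = xs ! (w i - 1)) \<and> forced k N r ys \<and> forced k N r xs"
proof -
  have win: "w i \<in> {1..r} \<longleftrightarrow> i \<in> {1..r}" for i using permutes_in_image[OF w] by blast
  have sub: "{1..r} \<subseteq> {1..strands k}" using r tensor_degree_le_strands[of k] by auto
  have 1: "agrees (perm_diagram r w) (word_label k N ys xs) \<longleftrightarrow> (\<forall>i\<in>{1..r}. ys ! (i - 1) = xs ! (w i - 1))"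
    unfolding labels_agree_perm_diagram
  proof (intro ball_cong refl)
    fix i assume i: "i \<in> {1..r}"
    then have "i \<in> {1..strands k}" "w i \<in> {1..strands k}" "w i \<in> {1..r}" using sub win[of i] by blast+
    then show "complete_word k N ys ! (i - 1) = complete_word k N xs ! (w i - 1) \<longleftrightarrow> ys ! (i - 1) = xs ! (w i - 1)"
      using complete_word_nth[OF t(1), of i] complete_word_nth[OF t(2), of "w i"] r i by auto
  qed
  have 2: "agrees (extra_blocks k r) (word_label k N ys xs) \<longleftrightarrow> forced k N r ys \<and> forced k N r xs"
  proof (cases k)
    case (Whole m)
    then show ?thesis by (auto simp: forced_def intro!: agreesI)
  next
    case (Half m)
    let ?B = "Unprimed ` {r<..m + 1} \<union> Primed ` {r<..m + 1}"
    have last: "word_label k N ys xs (Unprimed (m+1)) = N" "word_label k N ys xs (Primed (m+1)) = N"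
      using t complete_word_nth[of ys N k "m+1"] complete_word_nth[of xs N k "m+1"] Half by simp_all
    have "agrees (extra_blocks k r) (word_label k N ys xs) \<longleftrightarrow> (\<forall>a\<in>?B. word_label k N ys xs a = N)"
    proof
      assume a: "agrees (extra_blocks k r) (word_label k N ys xs)"
      have "Unprimed (m+1) \<in> ?B" using r Half by simp
      then show "\<forall>a\<in>?B. word_label k N ys xs a = N"
        using agreesD[OF a, of ?B _ "Unprimed (m+1)"] last Half by simp
    next
      assume "\<forall>a\<in>?B. word_label k N ys xs a = N"
      then have "word_label k N ys xs a = word_label k N ys xs b" if "a \<in> ?B" "b \<in> ?B" for a b using that by metis
      then show "agrees (extra_blocks k r) (word_label k N ys xs)" unfolding Half extra_blocks.simps by (intro agreesI) blast
    qed
    also have "\<dots> \<longleftrightarrow> (\<forall>i\<in>{r<..m+1}. complete_word k N ys ! (i - 1) = N \<and> complete_word k N xs ! (i - 1) = N)"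
      by (auto simp: ball_Un)
    also have "\<dots> \<longleftrightarrow> (\<forall>i\<in>{r<..m}. ys ! (i - 1) = N \<and> xs ! (i - 1) = N)"
    proof -
      have *: "complete_word k N zs ! (i - 1) = (if i \<le> m then zs ! (i - 1) else N)"
        if "zs \<in> words k N" "i \<in> {r<..m+1}" for zs i
        using complete_word_nth[OF that(1), of i] that(2) Half by auto
      show ?thesis using *[OF t(1)] *[OF t(2)] by auto
    qed
    finally show ?thesis using Half by (auto simp: forced_def)
  qed
  have "labels_agree k N (padded k r w) ys xs \<longleftrightarrow>
      agrees (perm_diagram r w) (word_label k N ys xs) \<and> agrees (extra_blocks k r) (word_label k N ys xs)"
    unfolding labels_agree_agrees padded_def agrees_def by blast
  then show ?thesis using 1 2 by blast
qed

subsection \<open>Products with permutation diagrams\<close>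

text \<open>Permutes places, whereas \<open>map w\<close> permutes letters. Places are numbered from
  1 in diagrams and from 0 in lists, hence the shifts.\<close>

definition permute_word :: "(nat \<Rightarrow> nat) \<Rightarrow> nat list \<Rightarrow> nat list" where
  "permute_word w xs = map (\<lambda>i. xs ! (w (Suc i) - 1)) [0..<length xs]"

lemma permute_word_nth:
  "length xs = m \<Longrightarrow> i \<in> {1..m} \<Longrightarrow> permute_word w xs ! (i - 1) = xs ! (w i - 1)"
  by (auto simp: permute_word_def)

lemma permute_word_tuples:
  assumes w: "w permutes {1..m}" and xs: "xs \<in> tuples N m"
  shows "permute_word w xs \<in> tuples N m"
proof -
  have l: "length xs = m" and s: "set xs \<subseteq> {1..N}" using xs by (auto simp: tuples_def)
  have "xs ! (w (Suc i) - 1) \<in> {1..N}" if "i < m" for i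
  proof -
    have "w (Suc i) \<in> {1..m}" using that permutes_in_image[OF w, of "Suc i"] by simp
    then have "w (Suc i) - 1 < length xs" using l by auto
    then show ?thesis using s nth_mem by blast
  qed
  then show ?thesis using l by (auto simp: tuples_def permute_word_def)
qed

lemma words_eq_iff:
  assumes "xs \<in> tuples N m" "ys \<in> tuples N m"
  shows "xs = ys \<longleftrightarrow> (\<forall>i\<in>{1..m}. xs ! (i - 1) = ys ! (i - 1))"
proof
  assume *: "\<forall>i\<in>{1..m}. xs ! (i - 1) = ys ! (i - 1)"
  show "xs = ys"
  proof (rule nth_equalityI)
    show "length xs = length ys" using assms by (simp add: tuples_def)
    show "xs ! i = ys ! i" if "i < length xs" for i
      using bspec[OF *, of "Suc i"] that assms by (simp add: tuples_def)
  qed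
qed simp

text \<open>The matrix of a permutation diagram is a permutation matrix, so each word determines its
  partner. This supplies the unique middle word when composites with permutation diagrams are
  computed.\<close>

lemma labels_agree_perm_diag':
  assumes w: "w permutes {1..tensor_degree k}"
    and t: "ys \<in> words k N" "xs \<in> words k N"
  shows "labels_agree k N (perm_diag k w) ys xs \<longleftrightarrow> ys = permute_word w xs"
    and "labels_agree k N (perm_diag k w) ys xs \<longleftrightarrow> xs = permute_word (pinv w) ys"
proof -
  let ?m = "tensor_degree k"
  have l: "length ys = ?m" "length xs = ?m" using t by (auto simp: tuples_def)
  have w': "pinv w permutes {1..?m}" by (rule permutes_inv[OF w])
  show "labels_agree k N (perm_diag k w) ys xs \<longleftrightarrow> ys = permute_word w xs"
    unfolding labels_agree_perm_diag[OF w t] words_eq_iff[OF t(1) permute_word_tuples[OF w t(2)]]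
    by (intro ball_cong refl) (simp only: permute_word_nth[OF l(2)])
  have "(\<forall>i\<in>{1..?m}. ys ! (i - 1) = xs ! (w i - 1)) \<longleftrightarrow> (\<forall>i\<in>{1..?m}. xs ! (i - 1) = ys ! (pinv w i - 1))"
  proof (intro iffI ballI)
    fix i assume *: "\<forall>i\<in>{1..?m}. ys ! (i - 1) = xs ! (w i - 1)" and i: "i \<in> {1..?m}"
    then have "pinv w i \<in> {1..?m}" using permutes_in_image[OF w'] by blast
    then show "xs ! (i - 1) = ys ! (pinv w i - 1)" using bspec[OF *, of "pinv w i"] permutes_inverses(1)[OF w] by simp
  next
    fix i assume *: "\<forall>i\<in>{1..?m}. xs ! (i - 1) = ys ! (pinv w i - 1)" and i: "i \<in> {1..?m}"
    then have "w i \<in> {1..?m}" using permutes_in_image[OF w] by blast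
    then show "ys ! (i - 1) = xs ! (w i - 1)" using bspec[OF *, of "w i"] permutes_inverses(2)[OF w] by simp
  qed
  also have "\<dots> \<longleftrightarrow> (\<forall>i\<in>{1..?m}. xs ! (i - 1) = permute_word (pinv w) ys ! (i - 1))"
    by (intro ball_cong refl) (simp only: permute_word_nth[OF l(1)])
  finally show "labels_agree k N (perm_diag k w) ys xs \<longleftrightarrow> xs = permute_word (pinv w) ys"
    unfolding labels_agree_perm_diag[OF w t] words_eq_iff[OF t(2) permute_word_tuples[OF w' t(1)]] .
qed

lemma compose_perm_left:
  assumes w: "w permutes {1..tensor_degree k}" and d: "d \<in> diagrams k" "D \<in> diagrams k"
    and eq: "\<And>N ys zs. ys \<in> words k N \<Longrightarrow> zs \<in> words k N \<Longrightarrow>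
      labels_agree k N d (permute_word (pinv w) ys) zs \<longleftrightarrow> labels_agree k N D ys zs"
  shows "compose (perm_diag k w) d = D" "removed (perm_diag k w) d = 0"
proof -
  define N where "N = max 2 (word_bound k)"
  have N: "N \<ge> word_bound k" "N \<ge> 2" by (auto simp: N_def)
  have *: "\<exists>u\<in>words k N. \<forall>xs\<in>words k N.
      labels_agree k N (perm_diag k w) ys xs \<and> labels_agree k N d xs zs \<longleftrightarrow> xs = u \<and> labels_agree k N D ys zs"
    if t: "ys \<in> words k N" "zs \<in> words k N" for ys zs
    using labels_agree_perm_diag'(2)[OF w t(1)] eq[OF t]
    by (intro bexI[OF _ permute_word_tuples[OF permutes_inv[OF w] t(1)]]) auto
  show "compose (perm_diag k w) d = D" "removed (perm_diag k w) d = 0"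
    using compose_determined[OF perm_diag_closed[OF w] d N *] by auto
qed

lemma compose_perm_right:
  assumes w: "w permutes {1..tensor_degree k}" and d: "d \<in> diagrams k" "D \<in> diagrams k"
    and eq: "\<And>N ys zs. ys \<in> words k N \<Longrightarrow> zs \<in> words k N \<Longrightarrow>
      labels_agree k N d ys (permute_word w zs) \<longleftrightarrow> labels_agree k N D ys zs"
  shows "compose d (perm_diag k w) = D" "removed d (perm_diag k w) = 0"
proof -
  define N where "N = max 2 (word_bound k)"
  have N: "N \<ge> word_bound k" "N \<ge> 2" by (auto simp: N_def)
  have *: "\<exists>u\<in>words k N. \<forall>xs\<in>words k N.
      labels_agree k N d ys xs \<and> labels_agree k N (perm_diag k w) xs zs \<longleftrightarrow> xs = u \<and> labels_agree k N D ys zs"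
    if t: "ys \<in> words k N" "zs \<in> words k N" for ys zs
    using labels_agree_perm_diag'(1)[OF w _ t(2)] eq[OF t]
    by (intro bexI[OF _ permute_word_tuples[OF w t(2)]]) auto
  show "compose d (perm_diag k w) = D" "removed d (perm_diag k w) = 0"
    using compose_determined[OF d(1) perm_diag_closed[OF w] d(2) N *] by auto
qed

text \<open>A strand followed downwards meets the upper diagram first, hence the order
  \<open>v \<circ> u\<close>.\<close>

lemma compose_perm_perm:
  assumes u: "u permutes {1..tensor_degree k}" and v: "v permutes {1..tensor_degree k}"
  shows "compose (perm_diag k u) (perm_diag k v) = perm_diag k (v \<circ> u)"
    "removed (perm_diag k u) (perm_diag k v) = 0"
proof -
  let ?m = "tensor_degree k"
  have vu: "v \<circ> u permutes {1..?m}" by (rule permutes_compose[OF u v])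
  have *: "labels_agree k N (perm_diag k u) ys (permute_word v zs) \<longleftrightarrow> labels_agree k N (perm_diag k (v \<circ> u)) ys zs"
    if t: "ys \<in> tuples N ?m" "zs \<in> tuples N ?m" for N ys zs
  proof -
    have l: "length zs = ?m" using t by (simp add: tuples_def)
    have "permute_word v zs ! (u i - 1) = zs ! (v (u i) - 1)" if "i \<in> {1..?m}" for i
      using that permutes_in_image[OF u] by (intro permute_word_nth[OF l]) blast
    then show ?thesis
      using labels_agree_perm_diag[OF u t(1) permute_word_tuples[OF v t(2)]] labels_agree_perm_diag[OF vu t]
      by simp
  qed
  show "compose (perm_diag k u) (perm_diag k v) = perm_diag k (v \<circ> u)" "removed (perm_diag k u) (perm_diag k v) = 0"
    using compose_perm_right[OF v perm_diag_closed[OF u] perm_diag_closed[OF vu] *] by auto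
qed

lemma forced_permute_word:
  assumes w: "w permutes {1..r}" and xs: "length xs = tensor_degree k"
  shows "forced k N r (permute_word w xs) \<longleftrightarrow> forced k N r xs"
proof -
  have "permute_word w xs ! (i - 1) = xs ! (i - 1)" if "k = Half m" "i \<in> {r<..m}" for m i
  proof -
    have "w i = i" using permutes_not_in[OF w, of i] that by simp
    moreover have "i \<in> {1..tensor_degree k}" using that by auto
    ultimately show ?thesis using permute_word_nth[OF xs, of i w] by simp
  qed
  then show ?thesis by (auto simp: forced_def)
qed

lemma compose_perm_padded:
  assumes u: "u permutes {1..r}" and v: "v permutes {1..r}" and r: "r \<le> tensor_degree k"
  shows "compose (perm_diag k u) (padded k r v) = padded k r (v \<circ> u)"
    "removed (perm_diag k u) (padded k r v) = 0"
    "compose (padded k r u) (perm_diag k v) = padded k r (v \<circ> u)"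
    "removed (padded k r u) (perm_diag k v) = 0"
proof -
  let ?m = "tensor_degree k"
  have vu: "v \<circ> u permutes {1..r}" by (rule permutes_compose[OF u v])
  have u': "u permutes {1..?m}" and v': "v permutes {1..?m}" using permutes_mono[OF u r] permutes_mono[OF v r] by auto
  have rm: "i \<in> {1..?m}" if "i \<in> {1..r}" for i using that r by auto
  have *: "labels_agree k N (padded k r v) (permute_word (pinv u) ys) zs \<longleftrightarrow> labels_agree k N (padded k r (v \<circ> u)) ys zs"
    if t: "ys \<in> tuples N ?m" "zs \<in> tuples N ?m" for N ys zs
  proof -
    have l: "length ys = ?m" using t by (simp add: tuples_def)
    have "(\<forall>i\<in>{1..r}. permute_word (pinv u) ys ! (i - 1) = zs ! (v i - 1)) \<longleftrightarrow>
        (\<forall>i\<in>{1..r}. ys ! (i - 1) = zs ! (v (u i) - 1))"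
    proof (intro iffI ballI)
      fix i assume *: "\<forall>i\<in>{1..r}. permute_word (pinv u) ys ! (i - 1) = zs ! (v i - 1)" and i: "i \<in> {1..r}"
      then have ui: "u i \<in> {1..r}" using permutes_in_image[OF u] by blast
      have "permute_word (pinv u) ys ! (u i - 1) = ys ! (i - 1)"
        using permute_word_nth[OF l rm[OF ui], of "pinv u"] permutes_inverses(2)[OF u] by simp
      then show "ys ! (i - 1) = zs ! (v (u i) - 1)" using bspec[OF * ui] by simp
    next
      fix i assume *: "\<forall>i\<in>{1..r}. ys ! (i - 1) = zs ! (v (u i) - 1)" and i: "i \<in> {1..r}"
      then have ui: "pinv u i \<in> {1..r}" using permutes_in_image[OF permutes_inv[OF u]] by blast
      have "permute_word (pinv u) ys ! (i - 1) = ys ! (pinv u i - 1)" by (rule permute_word_nth[OF l rm[OF i]])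
      also have "\<dots> = zs ! (v i - 1)" using bspec[OF * ui] permutes_inverses(1)[OF u] by simp
      finally show "permute_word (pinv u) ys ! (i - 1) = zs ! (v i - 1)" .
    qed
    then show ?thesis
      using labels_agree_padded[OF v r permute_word_tuples[OF permutes_inv[OF u'] t(1)] t(2)]
        labels_agree_padded[OF vu r t] forced_permute_word[OF permutes_inv[OF u] l] by simp
  qed
  show "compose (perm_diag k u) (padded k r v) = padded k r (v \<circ> u)" "removed (perm_diag k u) (padded k r v) = 0"
    using compose_perm_left[OF u' padded_closed[OF v r] padded_closed[OF vu r] *] by auto
  have **: "labels_agree k N (padded k r u) ys (permute_word v zs) \<longleftrightarrow> labels_agree k N (padded k r (v \<circ> u)) ys zs"
    if t: "ys \<in> tuples N ?m" "zs \<in> tuples N ?m" for N ys zs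
  proof -
    have l: "length zs = ?m" using t by (simp add: tuples_def)
    have "permute_word v zs ! (u i - 1) = zs ! (v (u i) - 1)" if "i \<in> {1..r}" for i
      using that permutes_in_image[OF u] rm by (intro permute_word_nth[OF l]) blast
    then show ?thesis
      using labels_agree_padded[OF u r t(1) permute_word_tuples[OF v' t(2)]]
        labels_agree_padded[OF vu r t] forced_permute_word[OF v l] by simp
  qed
  show "compose (padded k r u) (perm_diag k v) = padded k r (v \<circ> u)" "removed (padded k r u) (perm_diag k v) = 0"
    using compose_perm_right[OF v' padded_closed[OF u r] padded_closed[OF vu r] **] by auto
qed

subsection \<open>Removed components\<close>

text \<open>Every vertex of the middle row lies in a block of \<open>d2\<close>, and such a block
  reaches the bottom row, so no component is confined to the middle row.\<close>

lemma removed_zero: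
  assumes d: "d1 \<in> diagrams k" "d2 \<in> diagrams k" and P: "\<And>B. B \<in> d2 \<Longrightarrow> \<exists>j. Primed j \<in> B"
  shows "removed d1 d2 = 0"
proof -
  have p: "partition_on (vertices (strands k)) d1" "partition_on (vertices (strands k)) d2"
    using d by (auto intro: diagrams_partition_on)
  have pc: "partition_on (stack_vertices (strands k)) (components d1 d2)" by (rule partition_on_components[OF p])
  have "\<not> C \<subseteq> range Mid" if C: "C \<in> components d1 d2" for C
  proof
    assume sub: "C \<subseteq> range Mid"
    obtain v where "v \<in> C" using C partition_onD3[OF pc] by fastforce
    then obtain i where i: "Mid i \<in> C" using sub by blast
    then have "Mid i \<in> stack_vertices (strands k)" using C partition_onD1[OF pc] by blast
    then have "Unprimed i \<in> vertices (strands k)" by (auto simp: stack_vertices_def)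
    then obtain B where B: "B \<in> d2" "Unprimed i \<in> B" using partition_onD1[OF p(2)] by blast
    then have "Mid i \<in> lower ` B" by force
    moreover have "lower ` B \<in> stack d1 d2" using B by (simp add: stack_def)
    ultimately have "lower ` B \<subseteq> C"
      using i C by (intro block_subset_component[of C "stack d1 d2"]) (auto simp: components_alt)
    moreover obtain j where "Primed j \<in> B" using P[OF B(1)] by blast
    then have "Bot j \<in> lower ` B" by force
    ultimately show False using sub by blast
  qed
  then have "{C \<in> components d1 d2. C \<subseteq> range Mid} = {}" by blast
  then show ?thesis by (simp only: removed_def card.empty)
qed

lemma partition_on_subset_eq:
  assumes P: "partition_on V P" and Q: "partition_on V Q" and sub: "P \<subseteq> Q"
  shows "P = Q"
proof
  show "Q \<subseteq> P"
  proof
    fix B assume B: "B \<in> Q"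
    obtain v where v: "v \<in> B" using B partition_onD3[OF Q] by fastforce
    then obtain C where C: "C \<in> P" "v \<in> C" using B partition_onD1[OF P] partition_onD1[OF Q] by blast
    then have "B = C" using disjointD[OF partition_onD2[OF Q] B, of C] sub v by blast
    then show "B \<in> P" using C by simp
  qed
qed (rule sub)

lemma compose_singleton_top:
  assumes d: "d1 \<in> diagrams k" "d2 \<in> diagrams k" and i: "{Unprimed i} \<in> d1"
  shows "{Unprimed i} \<in> compose d1 d2"
proof -
  have p: "partition_on (vertices (strands k)) d1" "partition_on (vertices (strands k)) d2"
    using d by (auto intro: diagrams_partition_on)
  have pc: "partition_on (stack_vertices (strands k)) (components d1 d2)" by (rule partition_on_components[OF p])
  have "Unprimed i \<in> vertices (strands k)" using i partition_onD1[OF p(1)] by blast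
  then have "Top i \<in> stack_vertices (strands k)" by (auto simp: stack_vertices_def)
  then obtain C where C: "C \<in> components d1 d2" "Top i \<in> C" using partition_onD1[OF pc] by blast
  have "C \<subseteq> {Top i}"
  proof (rule component_subset_closed[of C "stack d1 d2"])
    show "C \<in> \<Union>(stack d1 d2) // connection (stack d1 d2)" using C(1) by (simp add: components_alt)
    fix B assume B: "B \<in> stack d1 d2" "B \<inter> {Top i} \<noteq> {}"
    then have T: "Top i \<in> B" by simp
    have "B \<notin> (`) lower ` d2"
    proof
      assume "B \<in> (`) lower ` d2"
      then obtain v where "lower v = Top i" using T by auto
      then show False by (cases v) auto
    qed
    then obtain B1 where B1: "B1 \<in> d1" "B = upper ` B1" using B(1) by (auto simp: stack_def)
    then obtain v where v: "v \<in> B1" "upper v = Top i" using T by auto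
    then have "Unprimed i \<in> B1" by (cases v) auto
    then have "B1 = {Unprimed i}" using disjointD[OF partition_onD2[OF p(1)] B1(1) i] by blast
    then show "B \<subseteq> {Top i}" using B1 by simp
  qed (use C in blast)
  then have "C = {Top i}" using C by blast
  then have eq: "outer -` C = {Unprimed i}" and "\<not> C \<subseteq> range Mid" by (auto simp: outer_vimage)
  then have "outer -` C \<in> compose d1 d2"
    unfolding compose_alt using C(1) by (intro imageI) simp
  then show ?thesis using eq by simp
qed

lemma compose_singleton_bottom:
  assumes d: "d1 \<in> diagrams k" "d2 \<in> diagrams k" and i: "{Primed i} \<in> d2"
  shows "{Primed i} \<in> compose d1 d2"
proof -
  have p: "partition_on (vertices (strands k)) d1" "partition_on (vertices (strands k)) d2"
    using d by (auto intro: diagrams_partition_on)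
  have pc: "partition_on (stack_vertices (strands k)) (components d1 d2)" by (rule partition_on_components[OF p])
  have "Primed i \<in> vertices (strands k)" using i partition_onD1[OF p(2)] by blast
  then have "Bot i \<in> stack_vertices (strands k)" by (auto simp: stack_vertices_def)
  then obtain C where C: "C \<in> components d1 d2" "Bot i \<in> C" using partition_onD1[OF pc] by blast
  have "C \<subseteq> {Bot i}"
  proof (rule component_subset_closed[of C "stack d1 d2"])
    show "C \<in> \<Union>(stack d1 d2) // connection (stack d1 d2)" using C(1) by (simp add: components_alt)
    fix B assume B: "B \<in> stack d1 d2" "B \<inter> {Bot i} \<noteq> {}"
    then have T: "Bot i \<in> B" by simp
    have "B \<notin> (`) upper ` d1"
    proof
      assume "B \<in> (`) upper ` d1"
      then obtain v where "upper v = Bot i" using T by auto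
      then show False by (cases v) auto
    qed
    then obtain B1 where B1: "B1 \<in> d2" "B = lower ` B1" using B(1) by (auto simp: stack_def)
    then obtain v where v: "v \<in> B1" "lower v = Bot i" using T by auto
    then have "Primed i \<in> B1" by (cases v) auto
    then have "B1 = {Primed i}" using disjointD[OF partition_onD2[OF p(2)] B1(1) i] by blast
    then show "B \<subseteq> {Bot i}" using B1 by simp
  qed (use C in blast)
  then have "C = {Bot i}" using C by blast
  then have eq: "outer -` C = {Primed i}" and "\<not> C \<subseteq> range Mid" by (auto simp: outer_vimage)
  then have "outer -` C \<in> compose d1 d2"
    unfolding compose_alt using C(1) by (intro imageI) simp
  then show ?thesis using eq by simp
qed

subsection \<open>Diagrams sandwiched between padded identities\<close>

text \<open>At least \<open>r\<close> disjoint blocks each need an unprimed and a primed vertex, and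
  only \<open>r\<close> of either kind are available. So there are exactly \<open>r\<close> blocks,
  each with one vertex of either kind.\<close>

lemma matching_of_blocks:
  assumes p: "partition_on V D" and PB: "PB \<subseteq> D" "finite PB" "r \<le> card PB"
    and sub: "\<And>B. B \<in> PB \<Longrightarrow> B \<subseteq> vertices r" and props: "\<And>B. B \<in> PB \<Longrightarrow> propagating B"
  obtains \<sigma> where "\<sigma> permutes {1..r}" "PB = perm_diagram r \<sigma>"
proof -
  obtain a where a: "\<And>B. B \<in> PB \<Longrightarrow> Unprimed (a B) \<in> B" using props by metis
  obtain b where b: "\<And>B. B \<in> PB \<Longrightarrow> Primed (b B) \<in> B" using props by metis
  have same: "B = B'" if "B \<in> PB" "B' \<in> PB" "v \<in> B" "v \<in> B'" for B B' v
    using disjointD[OF partition_onD2[OF p], of B B'] that PB(1) by blast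
  have ar: "a B \<in> {1..r}" "b B \<in> {1..r}" if "B \<in> PB" for B
    using a[OF that] b[OF that] sub[OF that] by auto
  have inja: "inj_on a PB" using same a by (metis inj_onI)
  have injb: "inj_on b PB" using same b by (metis inj_onI)
  have "card PB \<le> card {1..r}" using inja ar by (intro card_inj_on_le[of a]) auto
  then have c: "card PB = r" using PB(3) by simp
  have ima: "a ` PB = {1..r}" using ar c card_image[OF inja] by (intro card_subset_eq) auto
  have imb: "b ` PB = {1..r}" using ar c card_image[OF injb] by (intro card_subset_eq) auto
  define \<sigma> where "\<sigma> i = (if i \<in> {1..r} then b (inv_into PB a i) else i)" for i
  have "bij_betw (inv_into PB a) {1..r} PB" using inja ima by (metis bij_betw_inv_into bij_betw_def)
  moreover have "bij_betw b PB {1..r}" using injb imb by (simp add: bij_betw_def)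
  ultimately have "bij_betw (b \<circ> inv_into PB a) {1..r} {1..r}" by (rule bij_betw_trans)
  then have "bij_betw \<sigma> {1..r} {1..r}" by (rule bij_betw_cong[THEN iffD1, rotated]) (simp add: \<sigma>_def)
  then have \<sigma>: "\<sigma> permutes {1..r}" by (rule bij_imp_permutes) (simp only: \<sigma>_def if_False)
  have B: "B = {Unprimed (a B), Primed (b B)}" if B: "B \<in> PB" for B
  proof
    show "B \<subseteq> {Unprimed (a B), Primed (b B)}"
    proof
      fix v assume v: "v \<in> B"
      show "v \<in> {Unprimed (a B), Primed (b B)}"
      proof (cases v)
        case (Unprimed i)
        then have "i \<in> a ` PB" using sub[OF B] v ima by auto
        then obtain B' where B': "B' \<in> PB" "i = a B'" by blast
        then have "B' = B" using same[OF B'(1) B, of v] a[OF B'(1)] v Unprimed by simp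
        then show ?thesis using B' Unprimed by simp
      next
        case (Primed i)
        then have "i \<in> b ` PB" using sub[OF B] v imb by auto
        then obtain B' where B': "B' \<in> PB" "i = b B'" by blast
        then have "B' = B" using same[OF B'(1) B, of v] b[OF B'(1)] v Primed by simp
        then show ?thesis using B' Primed by simp
      qed
    qed
  qed (use a[OF that] b[OF that] in simp)
  have "perm_diagram r \<sigma> = (\<lambda>i. {Unprimed i, Primed (\<sigma> i)}) ` a ` PB" by (simp only: perm_diagram_def ima)
  also have "\<dots> = (\<lambda>B. B) ` PB"
    unfolding image_image
  proof (rule image_cong[OF refl])
    fix B assume "B \<in> PB"
    then show "{Unprimed (a B), Primed (\<sigma> (a B))} = B"
      using B[of B] inv_into_f_f[OF inja, of B] ar(1)[of B] by (simp only: \<sigma>_def if_True)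
  qed
  finally show ?thesis using that[OF \<sigma>] by simp
qed

lemma compose_same_block_top:
  assumes d: "d1 \<in> diagrams k" "d2 \<in> diagrams k" and B: "B \<in> d1" "Unprimed i \<in> B" "Unprimed j \<in> B"
  shows "\<exists>C\<in>compose d1 d2. Unprimed i \<in> C \<and> Unprimed j \<in> C"
proof -
  have p: "partition_on (vertices (strands k)) d1" "partition_on (vertices (strands k)) d2"
    using d by (auto intro: diagrams_partition_on)
  have pc: "partition_on (stack_vertices (strands k)) (components d1 d2)" by (rule partition_on_components[OF p])
  have "Unprimed i \<in> vertices (strands k)" using B partition_onD1[OF p(1)] by blast
  then have "Top i \<in> stack_vertices (strands k)" by (auto simp: stack_vertices_def)
  then obtain C where C: "C \<in> components d1 d2" "Top i \<in> C" using partition_onD1[OF pc] by blast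
  have "Top i \<in> upper ` B" "Top j \<in> upper ` B" using B by force+
  moreover have "upper ` B \<in> stack d1 d2" using B(1) by (simp add: stack_def)
  ultimately have "upper ` B \<subseteq> C"
    using C by (intro block_subset_component[of C "stack d1 d2"]) (auto simp: components_alt)
  then have "Top j \<in> C" using \<open>Top j \<in> upper ` B\<close> by blast
  moreover have "\<not> C \<subseteq> range Mid" using C by blast
  then have "outer -` C \<in> compose d1 d2" unfolding compose_alt using C(1) by (intro imageI) simp
  ultimately show ?thesis using C(2) by (intro bexI[of _ "outer -` C"]) simp_all
qed

lemma compose_same_block_bottom:
  assumes d: "d1 \<in> diagrams k" "d2 \<in> diagrams k" and B: "B \<in> d2" "Primed i \<in> B" "Primed j \<in> B"
  shows "\<exists>C\<in>compose d1 d2. Primed i \<in> C \<and> Primed j \<in> C"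
proof -
  have p: "partition_on (vertices (strands k)) d1" "partition_on (vertices (strands k)) d2"
    using d by (auto intro: diagrams_partition_on)
  have pc: "partition_on (stack_vertices (strands k)) (components d1 d2)" by (rule partition_on_components[OF p])
  have "Primed i \<in> vertices (strands k)" using B partition_onD1[OF p(2)] by blast
  then have "Bot i \<in> stack_vertices (strands k)" by (auto simp: stack_vertices_def)
  then obtain C where C: "C \<in> components d1 d2" "Bot i \<in> C" using partition_onD1[OF pc] by blast
  have "Bot i \<in> lower ` B" "Bot j \<in> lower ` B" using B by force+
  moreover have "lower ` B \<in> stack d1 d2" using B(1) by (simp add: stack_def)
  ultimately have "lower ` B \<subseteq> C"
    using C by (intro block_subset_component[of C "stack d1 d2"]) (auto simp: components_alt)
  then have "Bot j \<in> C" using \<open>Bot j \<in> lower ` B\<close> by blast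
  moreover have "\<not> C \<subseteq> range Mid" using C by blast
  then have "outer -` C \<in> compose d1 d2" unfolding compose_alt using C(1) by (intro imageI) simp
  ultimately show ?thesis using C(2) by (intro bexI[of _ "outer -` C"]) simp_all
qed

text \<open>The padding on both sides isolates all outer vertices beyond \<open>r\<close>, or joins
  them to the block of \<open>m + 1\<close> in the half-integer case. The remaining propagating
  blocks live on the first \<open>r\<close> strands; if there are enough of them, they form a
  permutation and exhaust these strands.\<close>

lemma sandwich_padded:
  assumes r: "r \<le> tensor_degree k" and d: "d \<in> diagrams k"
  defines "D \<equiv> compose (compose (padded k r id) d) (padded k r id)"
  assumes props: "propagating_bound k r \<le> propagating_number D"
  obtains \<sigma> where "\<sigma> permutes {1..r}" "D = padded k r \<sigma>"
proof -
  let ?E = "padded k r id"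
  have E: "?E \<in> diagrams k" by (rule padded_closed[OF permutes_id r])
  have Ed: "compose ?E d \<in> diagrams k" by (rule compose_closed[OF E d])
  have D: "D \<in> diagrams k" unfolding D_def by (rule compose_closed[OF Ed E])
  have p: "partition_on (vertices (strands k)) D" by (rule diagrams_partition_on[OF D])
  have fin: "finite D" using finite_elements[OF _ p] by simp
  have same: "B = B'" if "B \<in> D" "B' \<in> D" "v \<in> B" "v \<in> B'" for B B' v
    using disjointD[OF partition_onD2[OF p], of B B'] that by blast
  show ?thesis
  proof (cases k)
    case (Whole m)
    have top: "{Unprimed i} \<in> D" if "i \<in> {r<..m}" for i
      unfolding D_def using that Whole
      by (intro compose_singleton_top[OF Ed E] compose_singleton_top[OF E d]) (auto simp: padded_def)
    have bot: "{Primed i} \<in> D" if "i \<in> {r<..m}" for i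
      unfolding D_def using that Whole
      by (intro compose_singleton_bottom[OF Ed E]) (auto simp: padded_def)
    let ?PB = "{B \<in> D. propagating B}"
    have sub: "B \<subseteq> vertices r" if B: "B \<in> ?PB" for B
    proof
      fix v assume v: "v \<in> B"
      have vV: "v \<in> vertices m" using v B partition_onD1[OF p] Whole by auto
      show "v \<in> vertices r"
      proof (cases v)
        case (Unprimed i)
        have "i \<le> r"
        proof (rule ccontr)
          assume "\<not> i \<le> r"
          then have "B = {Unprimed i}" using same[of B "{Unprimed i}" v] top[of i] v vV B Unprimed by auto
          then show False using B by auto
        qed
        then show ?thesis using vV Unprimed by simp
      next
        case (Primed i)
        have "i \<le> r"
        proof (rule ccontr)
          assume "\<not> i \<le> r"
          then have "B = {Primed i}" using same[of B "{Primed i}" v] bot[of i] v vV B Primed by auto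
          then show False using B by auto
        qed
        then show ?thesis using vV Primed by simp
      qed
    qed
    have c: "r \<le> card ?PB" using props Whole by (simp add: propagating_number_def)
    have PB: "?PB \<subseteq> D" "finite ?PB" using fin by auto
    have pr: "propagating B" if "B \<in> ?PB" for B using that by blast
    obtain \<sigma> where s: "\<sigma> permutes {1..r}" "?PB = perm_diagram r \<sigma>"
      by (rule matching_of_blocks[OF p PB c sub pr])
    have "padded k r \<sigma> \<subseteq> D"
      unfolding padded_def s(2)[symmetric] using top bot Whole by auto
    then have "padded k r \<sigma> = D"
      using partition_on_subset_eq[OF diagrams_partition_on[OF padded_closed[OF s(1) r]] p] by blast
    then show ?thesis using that[OF s(1)] by simp
  next
    case (Half m)
    let ?X = "Unprimed ` {r<..m + 1} \<union> Primed ` {r<..m + 1}"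
    have XE: "?X \<in> ?E" using Half by (simp add: padded_def)
    have rm: "r \<le> m" using r Half by simp
    obtain B0 where B0: "B0 \<in> D" "Unprimed (m+1) \<in> B0" "Primed (m+1) \<in> B0" using D Half by force
    have X: "?X \<subseteq> B0"
    proof
      fix v assume v: "v \<in> ?X"
      show "v \<in> B0"
      proof (cases v)
        case (Unprimed i)
        then have "\<exists>C\<in>compose ?E d. Unprimed i \<in> C \<and> Unprimed (m+1) \<in> C"
          using v rm by (intro compose_same_block_top[OF E d XE]) auto
        then have "\<exists>C\<in>D. Unprimed i \<in> C \<and> Unprimed (m+1) \<in> C"
          unfolding D_def using compose_same_block_top[OF Ed E] by blast
        then show ?thesis using same B0 Unprimed by blast
      next
        case (Primed i)
        then have "\<exists>C\<in>D. Primed i \<in> C \<and> Primed (m+1) \<in> C"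
          unfolding D_def using v rm by (intro compose_same_block_bottom[OF Ed E XE]) auto
        then show ?thesis using same B0 Primed by blast
      qed
    qed
    let ?PB = "{B \<in> D. propagating B} - {B0}"
    have sub: "B \<subseteq> vertices r" if B: "B \<in> ?PB" for B
    proof
      fix v assume v: "v \<in> B"
      then have "v \<notin> ?X" using X same[of B B0 v] B B0 by blast
      moreover have "v \<in> vertices (m + 1)" using v B partition_onD1[OF p] Half by auto
      ultimately show "v \<in> vertices r" by (cases v) auto
    qed
    have "B0 \<in> {B \<in> D. propagating B}" using B0 by blast
    \<comment> \<open>The block of \<open>m + 1\<close> propagates as well; the bound
      \<open>r + 1\<close> of the half-integer case leaves \<open>r\<close> for the others.\<close>
    then have "card ?PB = card {B \<in> D. propagating B} - 1" by (rule card_Diff_singleton)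
    then have c: "r \<le> card ?PB" using props Half by (simp add: propagating_number_def)
    have PB: "?PB \<subseteq> D" "finite ?PB" using fin by auto
    have pr: "propagating B" if "B \<in> ?PB" for B using that by blast
    obtain \<sigma> where s: "\<sigma> permutes {1..r}" "?PB = perm_diagram r \<sigma>"
      by (rule matching_of_blocks[OF p PB c sub pr])
    have "B0 \<subseteq> ?X"
    proof
      fix v assume v: "v \<in> B0"
      have "v \<notin> vertices r"
      proof
        assume "v \<in> vertices r"
        then obtain B where "B \<in> ?PB" "v \<in> B" using Union_perm_diagram[OF s(1)] s(2) by blast
        then show False using same[of B B0 v] v B0 by blast
      qed
      moreover have "v \<in> vertices (m + 1)" using v B0 partition_onD1[OF p] Half by auto
      ultimately show "v \<in> ?X" by (cases v) (auto simp: image_iff)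
    qed
    then have "B0 = ?X" using X by blast
    then have "padded k r \<sigma> \<subseteq> D"
      unfolding padded_def s(2)[symmetric] using B0 Half by auto
    then have "padded k r \<sigma> = D"
      using partition_on_subset_eq[OF diagrams_partition_on[OF padded_closed[OF s(1) r]] p] by blast
    then show ?thesis using that[OF s(1)] by simp
  qed
qed

text \<open>Stacking \<open>d\<close> on \<open>E = padded k r id\<close> may remove components, which contributes a power of \<open>x\<close>. To avoid it, the
  singletons in the bottom row of \<open>d E\<close> are attached to the block of the first vertex of the top row.\<close>

lemma good_representative:
  assumes r: "r \<le> tensor_degree k" and d: "d \<in> diagrams k"
  shows "\<exists>d'\<in>diagrams k. compose d' (padded k r id) = compose d (padded k r id) \<and> removed d' (padded k r id) = 0"
proof -
  let ?E = "padded k r id"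
  have E: "?E \<in> diagrams k" by (rule padded_closed[OF permutes_id r])
  show ?thesis
  proof (cases "\<forall>B\<in>?E. \<exists>j. Primed j \<in> B")
    case True
    then show ?thesis using d removed_zero[OF d E] by (intro bexI[of _ d]) auto
  next
    case False
    then obtain B where B: "B \<in> extra_blocks k r" "\<not> (\<exists>j. Primed j \<in> B)" by (auto simp: padded_def perm_diagram_def)
    \<comment> \<open>The padding block of the half-integer case contains \<open>(m + 1)'\<close>,
      so only the singletons of the integer case can be without a primed vertex.\<close>
    obtain m where m: "k = Whole m"
    proof (cases k)
      case (Half m)
      then have "Primed (m + 1) \<in> B" using B(1) r by simp
      then show ?thesis using B(2) by blast
    qed
    then have m1: "m \<ge> 1" using B(1) by (cases "m = 0") auto
    define D where "D = compose d ?E"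
    have D: "D \<in> diagrams k" unfolding D_def by (rule compose_closed[OF d E])
    have p: "partition_on (vertices m) D" using diagrams_partition_on[OF D] m by simp
    have same: "B = B'" if "B \<in> D" "B' \<in> D" "v \<in> B" "v \<in> B'" for B B' v
      using disjointD[OF partition_onD2[OF p], of B B'] that by blast
    have single: "{Primed i} \<in> D" if "i \<in> {r<..m}" for i
      unfolding D_def using that m by (intro compose_singleton_bottom[OF d E]) (auto simp: padded_def)
    have "Unprimed 1 \<in> vertices m" using m1 by simp
    then obtain B0 where B0: "B0 \<in> D" "Unprimed 1 \<in> B0" using partition_onD1[OF p] by blast
    let ?S = "Primed ` {r<..m}" and ?F = "(\<lambda>i. {Primed i}) ` {r<..m}"
    define d' where "d' = insert (B0 \<union> ?S) (D - {B0} - ?F)"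
    have "partition_on (vertices m) d'"
    proof (rule partition_onI)
      have "?S \<subseteq> vertices m" using r m by auto
      moreover have "\<Union>?F = ?S" by blast
      ultimately show "\<Union>d' = vertices m" unfolding d'_def partition_onD1[OF p] using B0(1) by auto
      show "{} \<notin> d'" using partition_onD3[OF p] B0 by (auto simp: d'_def)
      have *: "disjnt (B0 \<union> ?S) B" if "B \<in> D - {B0} - ?F" for B
      proof -
        have "v \<notin> B" if vS: "v \<in> B0 \<union> ?S" for v
        proof
          assume v: "v \<in> B"
          show False
          proof (cases "v \<in> B0")
            case True
            then show False using same[of B B0 v] v B0 \<open>B \<in> D - {B0} - ?F\<close> by blast
          next
            case False
            then obtain i where "v = Primed i" "i \<in> {r<..m}" using vS by blast
            then show False using same[of B "{Primed i}" v] single[of i] v \<open>B \<in> D - {B0} - ?F\<close> by blast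
          qed
        qed
        then show ?thesis by (auto simp: disjnt_def)
      qed
      show "disjnt B B'" if "B \<in> d'" "B' \<in> d'" "B \<noteq> B'" for B B'
      proof -
        have cases: "B = B0 \<union> ?S \<or> B \<in> D - {B0} - ?F" "B' = B0 \<union> ?S \<or> B' \<in> D - {B0} - ?F"
          using that(1,2) unfolding d'_def insert_iff .
        show ?thesis
        proof (cases "B = B0 \<union> ?S")
          case True
          then have "B' \<in> D - {B0} - ?F" using cases(2) \<open>B \<noteq> B'\<close> by argo
          then show ?thesis unfolding True by (rule *)
        next
          case False
          then have R: "B \<in> D - {B0} - ?F" using cases(1) by argo
          show ?thesis
          proof (cases "B' = B0 \<union> ?S")
            case True
            show ?thesis unfolding True by (rule disjnt_sym[OF *[OF R]])
          next
            case False
            then have "B' \<in> D" using cases(2) by simp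
            then show ?thesis
              using disjointD[OF partition_onD2[OF p], of B B'] R \<open>B \<noteq> B'\<close> by (simp add: disjnt_def)
          qed
        qed
      qed
    qed
    then have d': "d' \<in> diagrams k" using m by simp
    \<comment> \<open>In terms of words, the modification only adds the demand that the bottom
      letters beyond \<open>r\<close> equal the first top letter.\<close>
    have agree': "labels_agree k N d' ys xs \<longleftrightarrow> labels_agree k N D ys xs \<and> (\<forall>i\<in>{r<..m}. xs ! (i - 1) = ys ! 0)" for N ys xs
    proof
      assume a: "labels_agree k N d' ys xs"
      then have ag: "agrees d' (label ys xs)" using m by (simp add: labels_agree_agrees)
      have "agrees D (label ys xs)"
      proof (rule agreesI)
        fix B v w assume B: "B \<in> D" "v \<in> B" "w \<in> B"
        consider "B = B0" | "B \<in> ?F" | "B \<in> d'" using B(1) by (auto simp: d'_def)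
        then show "label ys xs v = label ys xs w"
        proof cases
          case 1
          then show ?thesis using B by (intro agreesD[OF ag, of "B0 \<union> ?S"]) (auto simp: d'_def)
        next
          case 2
          then show ?thesis using B by auto
        next
          case 3
          then show ?thesis using B by (intro agreesD[OF ag])
        qed
      qed
      moreover have "xs ! (i - 1) = ys ! 0" if "i \<in> {r<..m}" for i
        using agreesD[OF ag, of "B0 \<union> ?S" "Primed i" "Unprimed 1"] that B0 by (simp add: d'_def)
      ultimately show "labels_agree k N D ys xs \<and> (\<forall>i\<in>{r<..m}. xs ! (i - 1) = ys ! 0)"
        using m by (simp add: labels_agree_agrees)
    next
      assume a: "labels_agree k N D ys xs \<and> (\<forall>i\<in>{r<..m}. xs ! (i - 1) = ys ! 0)"
      then have ag: "agrees D (label ys xs)" using m by (simp add: labels_agree_agrees)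
      have B0S: "label ys xs v = ys ! 0" if "v \<in> B0 \<union> ?S" for v
      proof (cases "v \<in> B0")
        case True
        then show ?thesis using agreesD[OF ag B0(1) True B0(2)] by simp
      next
        case False
        then show ?thesis using that a by auto
      qed
      have "agrees d' (label ys xs)"
      proof (rule agreesI)
        fix B v w assume B: "B \<in> d'" "v \<in> B" "w \<in> B"
        show "label ys xs v = label ys xs w"
        proof (cases "B = B0 \<union> ?S")
          case True
          then show ?thesis using B B0S by metis
        next
          case False
          then show ?thesis using B by (intro agreesD[OF ag, of B]) (auto simp: d'_def)
        qed
      qed
      then show "labels_agree k N d' ys xs" using m by (simp add: labels_agree_agrees)
    qed
    \<comment> \<open>In \<open>D\<close> the bottom vertices beyond \<open>r\<close> are
      singletons, so the corresponding letters can be changed freely.\<close>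
    have indep: "labels_agree k N D ys xs \<longleftrightarrow> labels_agree k N D ys zs"
      if "\<And>i. i \<in> {1..r} \<Longrightarrow> xs ! (i - 1) = zs ! (i - 1)" for N ys xs zs
    proof -
      have *: "agrees D (label ys zs)" if ag: "agrees D (label ys xs)" and eq: "\<And>i. i \<in> {1..r} \<Longrightarrow> xs ! (i - 1) = zs ! (i - 1)" for xs zs
      proof (rule agreesI)
        fix B v w assume B: "B \<in> D" "v \<in> B" "w \<in> B"
        show "label ys zs v = label ys zs w"
        proof (cases "B \<in> ?F")
          case True
          then show ?thesis using B by auto
        next
          case False
          have "label ys xs u = label ys zs u" if u: "u \<in> B" for u
          proof (cases u)
            case (Primed i)
            have "u \<in> vertices m" using u B(1) partition_onD1[OF p] by blast
            then have "i \<in> {1..m}" using Primed by simp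
            moreover have "i \<notin> {r<..m}" using False same[of B "{Primed i}" u] single[of i] B(1) u Primed by auto
            ultimately show ?thesis using eq[of i] Primed by simp
          qed simp
          then show ?thesis using agreesD[OF ag B] B by metis
        qed
      qed
      show ?thesis using *[of xs zs] *[of zs xs] that m by (simp add: labels_agree_agrees) metis
    qed
    define N where "N = max 2 (word_bound k)"
    have N: "N \<ge> word_bound k" "N \<ge> 2" by (auto simp: N_def)
    have det: "\<exists>w\<in>words k N. \<forall>xs\<in>words k N.
        labels_agree k N d' ys xs \<and> labels_agree k N ?E xs zs \<longleftrightarrow> xs = w \<and> labels_agree k N D ys zs"
      if t: "ys \<in> words k N" "zs \<in> words k N" for ys zs
    proof -
      \<comment> \<open>The only possible middle word: beyond place \<open>r\<close>, where
        \<open>zs\<close> imposes nothing, \<open>d'\<close> dictates the first letter of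
        \<open>ys\<close>.\<close>
      define w where "w = map (\<lambda>i. if Suc i \<le> r then zs ! i else ys ! 0) [0..<m]"
      have w_nth: "w ! (i - 1) = (if i \<le> r then zs ! (i - 1) else ys ! 0)" if "i \<in> {1..m}" for i
        using that by (auto simp: w_def)
      have len: "length ys = m" "length zs = m" "set ys \<subseteq> {1..N}" "set zs \<subseteq> {1..N}"
        using t m by (auto simp: tuples_def)
      have "zs ! i \<in> {1..N}" if "i < m" for i
        using subsetD[OF len(4) nth_mem[of i zs]] that len(2) by simp
      moreover have "ys ! 0 \<in> {1..N}"
        using subsetD[OF len(3) nth_mem[of 0 ys]] len(1) m1 by simp
      ultimately have w: "w \<in> words k N" using m by (auto simp: w_def tuples_def)
      have "labels_agree k N d' ys xs \<and> labels_agree k N ?E xs zs \<longleftrightarrow> xs = w \<and> labels_agree k N D ys zs"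
        if xs: "xs \<in> words k N" for xs
      proof -
        have Exz: "labels_agree k N ?E xs zs \<longleftrightarrow> (\<forall>i\<in>{1..r}. xs ! (i - 1) = zs ! (i - 1))"
          unfolding labels_agree_padded[OF permutes_id r xs t(2)] using m by (simp add: forced_def)
        have xw: "xs = w \<longleftrightarrow> (\<forall>i\<in>{1..m}. xs ! (i - 1) = w ! (i - 1))"
          using words_eq_iff[of xs N m w] xs w m by simp
        have "xs = w \<longleftrightarrow> (\<forall>i\<in>{r<..m}. xs ! (i - 1) = ys ! 0) \<and> (\<forall>i\<in>{1..r}. xs ! (i - 1) = zs ! (i - 1))"
        proof -
          have "{1..m} = {r<..m} \<union> {1..r}" using r m by auto
          moreover have "(\<forall>i\<in>{r<..m}. xs ! (i - 1) = w ! (i - 1)) \<longleftrightarrow> (\<forall>i\<in>{r<..m}. xs ! (i - 1) = ys ! 0)"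
            by (intro ball_cong refl) (subst w_nth, auto)
          moreover have "(\<forall>i\<in>{1..r}. xs ! (i - 1) = w ! (i - 1)) \<longleftrightarrow> (\<forall>i\<in>{1..r}. xs ! (i - 1) = zs ! (i - 1))"
            using r m by (intro ball_cong refl) (subst w_nth, auto)
          ultimately show ?thesis unfolding xw by (simp only: ball_Un)
        qed
        then show ?thesis using agree'[of N ys xs] Exz indep[of xs zs N ys] by blast
      qed
      then show ?thesis using w by blast
    qed
    show ?thesis
      using compose_determined[OF d' E D N det] d' by (intro bexI[of _ d']) (simp_all add: D_def)
  qed
qed

subsection \<open>The generator of a Specht module\<close>

text \<open>Products of diagrams compose permutations in the opposite order, hence the inverses.\<close>

definition perm_elem :: "half_integer \<Rightarrow> ((nat \<Rightarrow> nat) \<Rightarrow>\<^sub>0 complex) \<Rightarrow> (diagram \<Rightarrow>\<^sub>0 complex)" where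
  "perm_elem k = lin_ext (\<lambda>w. single (perm_diag k (pinv w)) 1)"

definition padded_elem :: "half_integer \<Rightarrow> nat \<Rightarrow> ((nat \<Rightarrow> nat) \<Rightarrow>\<^sub>0 complex) \<Rightarrow> (diagram \<Rightarrow>\<^sub>0 complex)" where
  "padded_elem k r = lin_ext (\<lambda>w. single (padded k r (pinv w)) 1)"

lemma linear_perm_elem: "linear_map (perm_elem k)" and linear_padded_elem: "linear_map (padded_elem k r)"
  unfolding perm_elem_def padded_elem_def by (rule linear_lin_ext)+

lemmas [linear_intros] = linear_map_comp[OF linear_perm_elem]

lemma perm_elem_single: "perm_elem k (single w c) = single (perm_diag k (pinv w)) c"
  and padded_elem_single: "padded_elem k r (single w c) = single (padded k r (pinv w)) c"
  by (simp_all add: perm_elem_def padded_elem_def)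

lemma perm_elem_closed:
  assumes "f \<in> perm_span {1..r}" "r \<le> tensor_degree k"
  shows "perm_elem k f \<in> diagram_span k"
proof -
  have "keys (single (perm_diag k (pinv w)) (1::complex)) \<subseteq> diagrams k" if "w \<in> keys f" for w
  proof -
    have "w permutes {1..r}" using that assms(1) by (auto simp: perm_span_def)
    then have "perm_diag k (pinv w) \<in> diagrams k"
      by (intro perm_diag_closed permutes_mono[OF permutes_inv assms(2)])
    then show ?thesis by simp
  qed
  then show ?thesis unfolding diagram_span_def perm_elem_def mem_Collect_eq by (intro keys_lin_ext)
qed

lemma padded_elem_closed:
  assumes "f \<in> perm_span {1..r}" "r \<le> tensor_degree k"
  shows "padded_elem k r f \<in> diagram_span k"
proof -
  have "keys (single (padded k r (pinv w)) (1::complex)) \<subseteq> diagrams k" if "w \<in> keys f" for w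
  proof -
    have "w permutes {1..r}" using that assms(1) by (auto simp: perm_span_def)
    then have "padded k r (pinv w) \<in> diagrams k" by (intro padded_closed permutes_inv assms(2))
    then show ?thesis by simp
  qed
  then show ?thesis unfolding diagram_span_def padded_elem_def mem_Collect_eq by (intro keys_lin_ext)
qed

lemma pmul_perm_elem:
  assumes f: "f \<in> perm_span {1..r}" and g: "g \<in> perm_span {1..r}" and r: "r \<le> tensor_degree k"
  shows "pmul q (perm_elem k f) (perm_elem k g) = perm_elem k (group_mult f g)"
proof (rule linear_map_eqI2[where S = "\<lambda>f g. pmul q (perm_elem k f) (perm_elem k g)"
      and T = "\<lambda>f g. perm_elem k (group_mult f g)" and A = "{w. w permutes {1..r}}" and B = "{w. w permutes {1..r}}"])
  fix u v assume u: "u \<in> {w. w permutes {1..r}}" and v: "v \<in> {w. w permutes {1..r}}"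
  have uv: "pinv u permutes {1..tensor_degree k}" "pinv v permutes {1..tensor_degree k}"
    using permutes_mono[OF permutes_inv r] u v by blast+
  have "pinv (u \<circ> v) = pinv v \<circ> pinv u" using u v by (intro o_inv_distrib) (auto intro: permutes_bij)
  then show "pmul q (perm_elem k (single u 1)) (perm_elem k (single v 1)) =
      perm_elem k (group_mult (single u 1) (single v 1))"
    by (simp add: perm_elem_single pmul_single group_mult_single compose_perm_perm[OF uv])
qed (use f g in \<open>simp_all add: perm_span_def\<close>, (intro linear_intros)+)

text \<open>The padded identity absorbs permutations of the first \<open>r\<close> strands alike
  from both sides, so the generator can be written with the symmetrizer on either side of
  it.\<close>

lemma pmul_perm_elem_padded:
  assumes f: "f \<in> perm_span {1..r}" and r: "r \<le> tensor_degree k"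
  shows "pmul q (perm_elem k f) (single (padded k r id) 1) = padded_elem k r f"
    and "pmul q (single (padded k r id) 1) (perm_elem k f) = padded_elem k r f"
proof -
  have k: "keys f \<subseteq> {w. w permutes {1..r}}" using f by (simp add: perm_span_def)
  show "pmul q (perm_elem k f) (single (padded k r id) 1) = padded_elem k r f"
  proof (rule linear_map_eqI[OF linear_map_comp[OF linear_pmul_left linear_perm_elem] linear_padded_elem k])
    fix w assume "w \<in> {w. w permutes {1..r}}"
    then have w: "pinv w permutes {1..r}" by (simp add: permutes_inv)
    show "pmul q (perm_elem k (single w 1)) (single (padded k r id) 1) = padded_elem k r (single w 1)"
      using compose_perm_padded(1,2)[OF w permutes_id r] by (simp add: perm_elem_single padded_elem_single pmul_single)
  qed
  show "pmul q (single (padded k r id) 1) (perm_elem k f) = padded_elem k r f"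
  proof (rule linear_map_eqI[OF linear_map_comp[OF linear_pmul_right linear_perm_elem] linear_padded_elem k])
    fix w assume "w \<in> {w. w permutes {1..r}}"
    then have w: "pinv w permutes {1..r}" by (simp add: permutes_inv)
    show "pmul q (single (padded k r id) 1) (perm_elem k (single w 1)) = padded_elem k r (single w 1)"
      using compose_perm_padded(3,4)[OF permutes_id w r] by (simp add: perm_elem_single padded_elem_single pmul_single)
  qed
qed

text \<open>Write \<open>e = y E = E y\<close> with \<open>E\<close> the padded identity. Then
  \<open>e d e = y (E d E) y\<close>, and \<open>E d E\<close> is a scalar times one diagram: either
  of low propagating number, so that truncation kills the product, or a padded permutation, to which
  the hypothesis \<open>yy\<close> applies.\<close>

lemma padded_elem_sandwich:
  fixes q :: complex
  assumes y: "y \<in> perm_span {1..r}" and r: "r \<le> tensor_degree k"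
    and yy: "\<And>f. f \<in> perm_span {1..r} \<Longrightarrow> \<exists>c. group_mult (group_mult y f) y = scale c y"
    and a: "a \<in> diagram_span k"
  shows "\<exists>c. trunc k r (pmul q (pmul q (padded_elem k r y) a) (padded_elem k r y)) = scale c (trunc k r (padded_elem k r y))"
proof -
  let ?e = "padded_elem k r y" and ?J = "perm_elem k" and ?E = "single (padded k r id) (1::complex)"
  have E: "padded k r id \<in> diagrams k" by (rule padded_closed[OF permutes_id r])
  have Es: "?E \<in> diagram_span k" using E by simp
  have Jy: "?J y \<in> diagram_span k" by (rule perm_elem_closed[OF y r])
  have e: "?e = pmul q (?J y) ?E" "?e = pmul q ?E (?J y)" using pmul_perm_elem_padded[OF y r] by simp_all
  have "\<exists>c. trunc k r (pmul q (pmul q ?e (single d 1)) ?e) = scale c (trunc k r ?e)" if d: "d \<in> diagrams k" for d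
  proof -
    define D where "D = compose (compose (padded k r id) d) (padded k r id)"
    obtain l where l: "pmul q (pmul q ?E (single d 1)) ?E = scale l (single D 1)"
      by (simp add: pmul_single D_def)
    have D: "D \<in> diagrams k" unfolding D_def by (intro compose_closed E d)
    have ds: "single d (1::complex) \<in> diagram_span k" and Ds: "single D (1::complex) \<in> diagram_span k" using d D by simp_all
    have Ed: "pmul q ?E (single d 1) \<in> diagram_span k" using Es ds by (rule pmul_closed)
    have "pmul q (pmul q ?e (single d 1)) ?e = pmul q (pmul q (pmul q (?J y) ?E) (single d 1)) (pmul q ?E (?J y))"
      using e by simp
    also have "\<dots> = pmul q (pmul q (?J y) (pmul q ?E (single d 1))) (pmul q ?E (?J y))"
      by (simp only: pmul_assoc[OF Jy Es ds])
    also have "\<dots> = pmul q (?J y) (pmul q (pmul q ?E (single d 1)) (pmul q ?E (?J y)))"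
      by (rule pmul_assoc[OF Jy Ed pmul_closed[OF Es Jy]])
    also have "\<dots> = pmul q (?J y) (pmul q (pmul q (pmul q ?E (single d 1)) ?E) (?J y))"
      by (simp only: pmul_assoc[OF Ed Es Jy])
    also have "\<dots> = scale l (pmul q (?J y) (pmul q (single D 1) (?J y)))"
      by (simp only: l linear_map_scale[OF linear_pmul_left] linear_map_scale[OF linear_pmul_right])
    finally have eq: "pmul q (pmul q ?e (single d 1)) ?e = scale l (pmul q (?J y) (pmul q (single D 1) (?J y)))" .
    show ?thesis
    proof (cases "propagating_number D < propagating_bound k r")
      case True
      have "trunc k r (pmul q (?J y) (pmul q (single D 1) (?J y))) =
          trunc k r (pmul q (?J y) (trunc k r (pmul q (single D 1) (?J y))))"
        by (rule trunc_pmul_right[OF Jy pmul_closed[OF Ds Jy], symmetric])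
      also have "trunc k r (pmul q (single D 1) (?J y)) = trunc k r (pmul q (trunc k r (single D 1)) (?J y))"
        by (rule trunc_pmul_left[OF Ds Jy, symmetric])
      also have "\<dots> = 0" using True by (simp add: trunc_single linear_map_zero[OF linear_pmul_left])
      finally have "trunc k r (pmul q (?J y) (pmul q (single D 1) (?J y))) = 0"
        by (simp add: linear_map_zero[OF linear_pmul_right])
      then show ?thesis unfolding eq by (intro exI[of _ 0]) (simp add: trunc_scale)
    next
      case False
      then obtain \<sigma> where s: "\<sigma> permutes {1..r}" "D = padded k r \<sigma>"
        using sandwich_padded[OF r d] unfolding D_def by (metis not_less)
      let ?s = "single (pinv \<sigma>) (1::complex)"
      have sp: "?s \<in> perm_span {1..r}" using permutes_inv[OF s(1)] by simp
      have Js: "?J ?s \<in> diagram_span k" by (rule perm_elem_closed[OF sp r])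
      have "single D 1 = padded_elem k r ?s"
        using s by (simp add: padded_elem_single inv_inv_eq permutes_bij)
      then have D1: "single D 1 = pmul q (?J ?s) ?E" using pmul_perm_elem_padded(1)[OF sp r, of q] by simp
      obtain c where c: "group_mult (group_mult y ?s) y = scale c y" using yy[OF sp] by blast
      have "pmul q (?J y) (pmul q (single D 1) (?J y)) = pmul q (?J y) (pmul q (?J ?s) (pmul q ?E (?J y)))"
        by (simp only: D1 pmul_assoc[OF Js Es Jy])
      also have "\<dots> = pmul q (pmul q (?J y) (?J ?s)) (pmul q ?E (?J y))"
        by (rule pmul_assoc[OF Jy Js pmul_closed[OF Es Jy], symmetric])
      also have "\<dots> = pmul q (?J (group_mult y ?s)) (pmul q (?J y) ?E)"
        by (simp only: pmul_perm_elem[OF y sp r] pmul_perm_elem_padded[OF y r])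
      also have "\<dots> = pmul q (pmul q (?J (group_mult y ?s)) (?J y)) ?E"
        by (rule pmul_assoc[OF perm_elem_closed[OF perm_span_mult[OF y sp] r] Jy Es, symmetric])
      also have "\<dots> = pmul q (?J (group_mult (group_mult y ?s) y)) ?E"
        by (simp only: pmul_perm_elem[OF perm_span_mult[OF y sp] y r])
      also have "\<dots> = scale c ?e"
        by (simp only: c linear_map_scale[OF linear_perm_elem] linear_map_scale[OF linear_pmul_left]
            pmul_perm_elem_padded(1)[OF y r])
      finally show ?thesis unfolding eq by (intro exI[of _ "l * c"]) (simp add: trunc_scale)
    qed
  qed
  then obtain c where c: "\<And>d. d \<in> diagrams k \<Longrightarrow> trunc k r (pmul q (pmul q ?e (single d 1)) ?e) = scale (c d) (trunc k r ?e)"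
    by metis
  have lin: "linear_map (\<lambda>a. trunc k r (pmul q (pmul q ?e a) ?e))"
    by (rule linear_map_comp[OF linear_trunc linear_map_comp[OF linear_pmul_left linear_pmul_right]])
  have "trunc k r (pmul q (pmul q ?e a) ?e) = (\<Sum>d\<in>keys a. scale (lookup a d) (trunc k r (pmul q (pmul q ?e (single d 1)) ?e)))"
    by (rule linear_map_expansion[OF lin])
  also have "\<dots> = (\<Sum>d\<in>keys a. scale (lookup a d * c d) (trunc k r ?e))"
    using a by (intro sum.cong refl) (auto simp: c diagram_span_def)
  also have "\<dots> = scale (\<Sum>d\<in>keys a. lookup a d * c d) (trunc k r ?e)" by (simp add: scale_sum_left)
  finally show ?thesis by blast
qed

subsection \<open>Specialization of the parameter\<close>

lemma eval_at_pCons: "eval_at n (pCons a p) = of_int a + n * eval_at n p"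
  by (simp add: eval_at_def map_poly_pCons)

lemma eval_at_0 [simp]: "eval_at n 0 = 0"
  by (simp add: eval_at_def)

lemma eval_at_add: "eval_at n (p + p') = eval_at n p + eval_at n p'"
  by (induction p p' rule: poly_induct2) (auto simp: eval_at_pCons algebra_simps)

lemma eval_at_smult: "eval_at n (Polynomial.smult a p) = of_int a * eval_at n p"
  by (induction p) (auto simp: eval_at_pCons algebra_simps)

lemma eval_at_mult: "eval_at n (p * p') = eval_at n p * eval_at n p'"
  by (induction p) (auto simp: eval_at_pCons eval_at_add eval_at_smult algebra_simps)

lemma eval_at_1 [simp]: "eval_at n 1 = 1"
  using eval_at_pCons[of n 1 0] by (simp add: one_pCons)

lemma eval_at_of_int [simp]: "eval_at n (of_int z) = of_int z"
  using eval_at_pCons[of n z 0] by (simp add: of_int_poly)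

lemma eval_at_power: "eval_at n (p ^ i) = eval_at n p ^ i"
  by (induction i) (auto simp: eval_at_mult)

lemma eval_at_X [simp]: "eval_at n [:0, 1:] = n"
  by (simp add: eval_at_pCons)

definition eval_coeffs :: "complex \<Rightarrow> ('a \<Rightarrow>\<^sub>0 int poly) \<Rightarrow> ('a \<Rightarrow>\<^sub>0 complex)" where
  "eval_coeffs n f = (\<Sum>d\<in>keys f. single d (eval_at n (lookup f d)))"

lemma lookup_eval_coeffs [simp]: "lookup (eval_coeffs n f) d = eval_at n (lookup f d)"
proof -
  have "lookup (eval_coeffs n f) d = (\<Sum>a\<in>keys f. if d = a then eval_at n (lookup f d) else 0)"
    unfolding eval_coeffs_def lookup_sum by (intro sum.cong) (auto simp: lookup_single)
  also have "\<dots> = eval_at n (lookup f d)" by (simp add: in_keys_iff)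
  finally show ?thesis .
qed

lemma keys_eval_coeffs: "keys (eval_coeffs n f) \<subseteq> keys f"
  by (auto simp: in_keys_iff)

lemma eval_coeffs_closed: "f \<in> diagram_span k \<Longrightarrow> eval_coeffs n f \<in> diagram_span k"
  using keys_eval_coeffs[of n f] by (auto simp: diagram_span_def)

lemma eval_coeffs_add: "eval_coeffs n (f + g) = eval_coeffs n f + eval_coeffs n g"
  by (rule poly_mapping_eqI) (simp add: lookup_add eval_at_add)

lemma eval_coeffs_scale: "eval_coeffs n (scale c f) = scale (eval_at n c) (eval_coeffs n f)"
  by (rule poly_mapping_eqI) (simp add: eval_at_mult)

lemma eval_coeffs_0 [simp]: "eval_coeffs n 0 = 0"
  by (rule poly_mapping_eqI) simp

lemma eval_coeffs_sum: "eval_coeffs n (\<Sum>i\<in>I. f i) = (\<Sum>i\<in>I. eval_coeffs n (f i))"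
  by (induction I rule: infinite_finite_induct) (auto simp: eval_coeffs_add)

lemma eval_coeffs_single: "eval_coeffs n (single d c) = single d (eval_at n c)"
  by (rule poly_mapping_eqI) (simp add: lookup_single when_def)

lemma eval_coeffs_lin_ext: "eval_coeffs n (lin_ext F f) = lin_ext (\<lambda>a. eval_coeffs n (F a)) (eval_coeffs n f)"
  unfolding lin_ext_superset[OF finite_keys keys_eval_coeffs, of _ n f]
  by (simp add: lin_ext_def eval_coeffs_sum eval_coeffs_scale)

lemma eval_coeffs_pmul: "eval_coeffs n (pmul [:0, 1:] f g) = pmul n (eval_coeffs n f) (eval_coeffs n g)"
  by (simp add: pmul_def eval_coeffs_lin_ext eval_coeffs_single eval_at_power)

lemma eval_coeffs_trunc: "eval_coeffs n (trunc k r f) = trunc k r (eval_coeffs n f)"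
  by (rule poly_mapping_eqI) (simp add: lookup_trunc)

text \<open>The factors \<open>\<tau>\<close> and \<open>pinv \<tau>\<close> conjugate the Young
  subgroup of the conjugate shape into the column stabilizer. As diagrams compose in the opposite
  order, the row permutation ends up innermost in \<open>v \<circ> u\<close>.\<close>

lemma p_diagram_expansion:
  assumes s: "sorted_wrt (\<ge>) lam"
  defines "r \<equiv> sum_list lam"
  shows "p_diagram lam = (\<Sum>u\<in>tableau.Rows {1..r} (rowof lam). \<Sum>v\<in>tableau.Cols {1..r} (colof lam).
    single (perm_diagram r (v \<circ> u)) (of_int (sign v)))"
proof -
  let ?\<tau> = "reading_perm lam" and ?x = "[:0, 1:] :: int poly" and ?k = "Whole r"
  let ?P = "\<lambda>w. single (perm_diagram r w) :: int poly \<Rightarrow> diagram \<Rightarrow>\<^sub>0 int poly"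
  interpret tableau "{1..r}" "rowof lam" "colof lam" unfolding r_def by (rule tableau_row_reading[OF s])
  have t: "?\<tau> permutes {1..r}" unfolding r_def by (rule reading_perm_permutes[OF s])
  have mult: "pmul ?x (?P u a) (?P v b) = ?P (v \<circ> u) (a * b)" if "u permutes {1..r}" "v permutes {1..r}" for u v a b
    using compose_perm_perm[of u ?k v] that by (simp add: pmul_single)
  let ?V = "young_subgroup (conjugate lam)"
  have V: "v permutes {1..r}" if "v \<in> ?V" for v
    using that young_subgroup_rows[of "conjugate lam"] sum_list_conjugate[OF s] by (simp add: r_def)
  have "p_diagram lam = pmul ?x (pmul ?x (pmul ?x (\<Sum>u\<in>Rows. ?P u 1) (?P ?\<tau> 1)) (\<Sum>v\<in>?V. ?P v (of_int (sign v)))) (?P (pinv ?\<tau>) 1)"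
    unfolding p_diagram_def Let_def r_def young_subgroup_Rows[OF s] by simp
  also have "pmul ?x (\<Sum>u\<in>Rows. ?P u 1) (?P ?\<tau> 1) = (\<Sum>u\<in>Rows. ?P (?\<tau> \<circ> u) 1)"
    using Rows_permutes t by (simp add: linear_map_sum[OF linear_pmul_left] mult)
  also have "pmul ?x (\<Sum>u\<in>Rows. ?P (?\<tau> \<circ> u) 1) (\<Sum>v\<in>?V. ?P v (of_int (sign v))) =
      (\<Sum>u\<in>Rows. \<Sum>v\<in>?V. ?P (v \<circ> (?\<tau> \<circ> u)) (of_int (sign v)))"
    unfolding linear_map_sum[OF linear_pmul_left]
    using Rows_permutes t V by (intro sum.cong refl) (simp add: linear_map_sum[OF linear_pmul_right] mult permutes_compose)
  also have "pmul ?x \<dots> (?P (pinv ?\<tau>) 1) = (\<Sum>u\<in>Rows. \<Sum>v\<in>?V. ?P (pinv ?\<tau> \<circ> (v \<circ> (?\<tau> \<circ> u))) (of_int (sign v)))"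
    using Rows_permutes t V permutes_inv[OF t]
    by (simp add: linear_map_sum[OF linear_pmul_left] mult permutes_compose)
  also have "\<dots> = (\<Sum>u\<in>Rows. \<Sum>v\<in>Cols. ?P (v \<circ> u) (of_int (sign v)))"
  proof (rule sum.cong[OF refl])
    fix u
    have "(\<Sum>v\<in>?V. ?P (pinv ?\<tau> \<circ> (v \<circ> (?\<tau> \<circ> u))) (of_int (sign v))) =
        (\<Sum>v\<in>?V. ?P ((pinv ?\<tau> \<circ> v \<circ> ?\<tau>) \<circ> u) (of_int (sign (pinv ?\<tau> \<circ> v \<circ> ?\<tau>))))"
      by (intro sum.cong refl) (simp only: young_subgroup_Cols(2)[OF s] o_assoc)
    also have "\<dots> = (\<Sum>v\<in>Cols. ?P (v \<circ> u) (of_int (sign v)))"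
      using sum.reindex_bij_betw[OF young_subgroup_Cols(1)[OF s], of "\<lambda>v. ?P (v \<circ> u) (of_int (sign v))"]
      by (simp add: r_def)
    finally show "(\<Sum>v\<in>?V. ?P (pinv ?\<tau> \<circ> (v \<circ> (?\<tau> \<circ> u))) (of_int (sign v))) = (\<Sum>v\<in>Cols. ?P (v \<circ> u) (of_int (sign v)))" .
  qed
  finally show ?thesis .
qed

lemma e_elem_expansion:
  assumes s: "sorted_wrt (\<ge>) lam"
  defines "r \<equiv> sum_list lam"
  shows "e_elem k lam = (\<Sum>u\<in>tableau.Rows {1..r} (rowof lam). \<Sum>v\<in>tableau.Cols {1..r} (colof lam).
    single (padded k r (v \<circ> u)) (of_int (sign v)))"
  unfolding e_elem_def p_diagram_expansion[OF s] lin_ext_sum r_def by (simp add: padded_def)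

text \<open>The symmetrizer multiplies permutations as functions, the integral generator multiplies
  them as diagrams. The inversion built into \<open>padded_elem\<close> reverses the order; it maps
  both stabilizers to themselves and preserves signs, so the expansions match after
  reindexing.\<close>

lemma eval_coeffs_e_elem:
  assumes s: "sorted_wrt (\<ge>) lam"
  defines "r \<equiv> sum_list lam"
  shows "eval_coeffs n (e_elem k lam) = padded_elem k r (young_symmetrizer lam)"
proof -
  interpret tableau "{1..r}" "rowof lam" "colof lam" unfolding r_def by (rule tableau_row_reading[OF s])
  let ?P = "\<lambda>w. single (padded k r w) :: complex \<Rightarrow> diagram \<Rightarrow>\<^sub>0 complex"
  have bR: "bij_betw pinv Rows Rows"
    using Rows_inv bij_Rows by (intro bij_betw_byWitness[where f' = pinv]) (auto simp: inv_inv_eq)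
  have bC: "bij_betw pinv Cols Cols"
    using Cols_inv bij_Cols by (intro bij_betw_byWitness[where f' = pinv]) (auto simp: inv_inv_eq)
  have "padded_elem k r (young_symmetrizer lam) =
      (\<Sum>u\<in>Rows. \<Sum>v\<in>Cols. ?P (pinv (u \<circ> v)) (of_int (sign v)))"
    unfolding young_symmetrizer_tableau[OF s] r_def[symmetric] symmetrizer_def row_sum_def col_sum_def group_mult_double_sum
    by (simp add: linear_map_sum[OF linear_padded_elem] padded_elem_single)
  also have "\<dots> = (\<Sum>u\<in>Rows. \<Sum>v\<in>Cols. ?P (pinv v \<circ> pinv u) (of_int (sign (pinv v))))"
  proof (intro sum.cong refl)
    fix u v assume uv: "u \<in> Rows" "v \<in> Cols"
    have "sign (pinv v) = sign v" using Cols_permutes[OF uv(2)] finite_entries by (metis permutation_permutes sign_inverse)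
    moreover have "pinv (u \<circ> v) = pinv v \<circ> pinv u" using bij_Rows bij_Cols uv by (intro o_inv_distrib) auto
    ultimately show "?P (pinv (u \<circ> v)) (of_int (sign v)) = ?P (pinv v \<circ> pinv u) (of_int (sign (pinv v)))" by simp
  qed
  also have "\<dots> = (\<Sum>u\<in>Rows. \<Sum>v\<in>Cols. ?P (v \<circ> pinv u) (of_int (sign v)))"
    by (rule sum.cong[OF refl]) (rule sum.reindex_bij_betw[OF bC])
  also have "\<dots> = (\<Sum>u\<in>Rows. \<Sum>v\<in>Cols. ?P (v \<circ> u) (of_int (sign v)))"
    by (rule sum.reindex_bij_betw[OF bR, of "\<lambda>u. \<Sum>v\<in>Cols. ?P (v \<circ> u) (of_int (sign v))"])
  finally show ?thesis
    unfolding e_elem_expansion[OF s] r_def[symmetric] by (simp add: eval_coeffs_sum eval_coeffs_single)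
qed

section \<open>Tensor space\<close>

lemma mem_tensor_space: "v \<in> tensor_space N m \<longleftrightarrow> keys v \<subseteq> tuples N m"
  by (simp add: tensor_space_def)

lemma tensor_space_closed [simp, intro]:
  "0 \<in> tensor_space N m"
  "v \<in> tensor_space N m \<Longrightarrow> w \<in> tensor_space N m \<Longrightarrow> v + w \<in> tensor_space N m"
  "v \<in> tensor_space N m \<Longrightarrow> - v \<in> tensor_space N m"
  "v \<in> tensor_space N m \<Longrightarrow> scale c v \<in> tensor_space N m"
  "xs \<in> tuples N m \<Longrightarrow> single xs c \<in> tensor_space N m"
  using keys_add[of v w] keys_scale_subset[of c v] by (auto simp: mem_tensor_space)

subsection \<open>The action of diagrams\<close>

lemma linear_diagram_action_left: "linear_map (\<lambda>a. diagram_action k N a v)"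
  unfolding diagram_action_def by (rule linear_lin_ext)

lemma linear_diagram_action_right: "linear_map (diagram_action k N a)"
  unfolding diagram_action_def by (rule linear_lin_ext_lin_ext)

lemmas [linear_intros] = linear_map_comp[OF linear_diagram_action_left] linear_map_comp[OF linear_diagram_action_right]

lemma diagram_action_single:
  "diagram_action k N (single d 1) (single xs 1) = (\<Sum>ys\<in>{ys \<in> words k N. labels_agree k N d ys xs}. single ys 1)"
  by (simp add: diagram_action_def)

lemma lookup_sum_single:
  "finite A \<Longrightarrow> lookup (\<Sum>x\<in>A. single x (c x)) y = (if y \<in> A then c y else 0)"
  by (simp add: lookup_sum lookup_single when_def)

lemma lookup_diagram_action_single:
  "lookup (diagram_action k N (single d 1) (single xs 1)) ys = of_bool (ys \<in> words k N \<and> labels_agree k N d ys xs)"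
  by (simp add: diagram_action_single lookup_sum_single)

lemma diagram_action_closed [simp, intro]: "diagram_action k N a v \<in> tensor_space N (tensor_degree k)"
  unfolding mem_tensor_space diagram_action_def by (intro keys_lin_ext keys_sum_subset) auto

lemma lookup_diagram_action_basis:
  "lookup (diagram_action k N a (single xs 1)) ys = of_bool (ys \<in> words k N) * (\<Sum>d\<in>keys a. lookup a d * of_bool (labels_agree k N d ys xs))"
proof -
  have "diagram_action k N a (single xs 1) = (\<Sum>d\<in>keys a. scale (lookup a d) (diagram_action k N (single d 1) (single xs 1)))"
    by (rule linear_map_expansion[OF linear_diagram_action_left])
  then have "lookup (diagram_action k N a (single xs 1)) ys =
      (\<Sum>d\<in>keys a. lookup a d * of_bool (ys \<in> words k N \<and> labels_agree k N d ys xs))"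
    by (simp add: lookup_sum lookup_diagram_action_single)
  also have "\<dots> = of_bool (ys \<in> words k N) * (\<Sum>d\<in>keys a. lookup a d * of_bool (labels_agree k N d ys xs))"
    by (simp add: sum_distrib_left of_bool_conj mult_ac)
  finally show ?thesis .
qed

lemma lookup_diagram_action:
  assumes "v \<in> tensor_space N (tensor_degree k)"
  shows "lookup (diagram_action k N a v) ys = (\<Sum>xs\<in>words k N. lookup v xs * lookup (diagram_action k N a (single xs 1)) ys)"
proof -
  have "diagram_action k N a v = (\<Sum>xs\<in>keys v. scale (lookup v xs) (diagram_action k N a (single xs 1)))"
    by (rule linear_map_expansion[OF linear_diagram_action_right])
  then have "lookup (diagram_action k N a v) ys = (\<Sum>xs\<in>keys v. lookup v xs * lookup (diagram_action k N a (single xs 1)) ys)"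
    by (simp add: lookup_sum)
  also have "\<dots> = (\<Sum>xs\<in>words k N. lookup v xs * lookup (diagram_action k N a (single xs 1)) ys)"
    using assms by (intro sum.mono_neutral_left) (auto simp: mem_tensor_space in_keys_iff)
  finally show ?thesis .
qed

text \<open>Matrix form of the count of middle words. The parameter is \<open>N\<close> because each
  removed component leaves one letter free.\<close>

lemma diagram_action_pmul:
  assumes a: "a \<in> diagram_span k" and b: "b \<in> diagram_span k"
    and v: "v \<in> tensor_space N (tensor_degree k)" and N: "N \<ge> 1"
  shows "diagram_action k N (pmul (of_nat N) a b) v = diagram_action k N a (diagram_action k N b v)"
proof (rule linear_map_eqI2[where S = "\<lambda>a b. diagram_action k N (pmul (of_nat N) a b) v"
      and T = "\<lambda>a b. diagram_action k N a (diagram_action k N b v)" and A = "diagrams k" and B = "diagrams k"])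
  fix d1 d2 assume d: "d1 \<in> diagrams k" "d2 \<in> diagrams k"
  let ?l = "\<lambda>v. diagram_action k N (pmul (of_nat N) (single d1 1) (single d2 1)) v"
    and ?r = "\<lambda>v. diagram_action k N (single d1 1) (diagram_action k N (single d2 1) v)"
  show "?l v = ?r v"
  proof (rule linear_map_eqI[where S = ?l and T = ?r and A = "words k N"])
    fix zs assume zs: "zs \<in> words k N"
    show "?l (single zs 1) = ?r (single zs 1)"
    proof (rule poly_mapping_eqI)
      fix ys
      have "pmul (of_nat N) (single d1 1) (single d2 1) = scale (of_nat N ^ removed d1 d2) (single (compose d1 d2) (1::complex))"
        by (simp add: pmul_single)
      then have L: "lookup (?l (single zs 1)) ys =
          of_nat N ^ removed d1 d2 * of_bool (ys \<in> words k N \<and> labels_agree k N (compose d1 d2) ys zs)"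
        by (simp only: linear_map_scale[OF linear_diagram_action_left] lookup_scale lookup_diagram_action_single)
      have R: "lookup (?r (single zs 1)) ys =
          (\<Sum>xs\<in>words k N. of_bool (labels_agree k N d2 xs zs) * of_bool (ys \<in> words k N \<and> labels_agree k N d1 ys xs))"
        unfolding lookup_diagram_action[OF diagram_action_closed] lookup_diagram_action_single
        by (intro sum.cong) auto
      show "lookup (?l (single zs 1)) ys = lookup (?r (single zs 1)) ys"
      proof (cases "ys \<in> words k N")
        case True
        then show ?thesis
          unfolding L R using middle_label_sum[OF d True zs N, where 'c = complex] by (simp add: mult.commute)
      qed (simp add: L R)
    qed
  qed (use v in \<open>auto simp: mem_tensor_space intro!: linear_intros\<close>)
qed (use a b in \<open>auto simp: diagram_span_def intro!: linear_intros\<close>)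

lemma diagram_action_id:
  assumes v: "v \<in> tensor_space N (tensor_degree k)"
  shows "diagram_action k N (single (id_diagram (strands k)) c) v = scale c v"
proof (rule linear_map_eqI[OF linear_diagram_action_right linear_map_scaled[OF linear_map_id]])
  show "keys v \<subseteq> words k N" using v by (simp add: mem_tensor_space)
  fix xs assume xs: "xs \<in> words k N"
  have "{ys \<in> words k N. labels_agree k N (id_diagram (strands k)) ys xs} = {xs}"
    using labels_agree_id[OF _ xs] xs by auto
  then have 1: "diagram_action k N (single (id_diagram (strands k)) 1) (single xs 1) = single xs 1"
    by (simp add: diagram_action_single)
  have "single (id_diagram (strands k)) c = scale c (single (id_diagram (strands k)) 1)" by simp
  then show "diagram_action k N (single (id_diagram (strands k)) c) (single xs 1) = scale c (single xs 1)"
    by (metis 1 linear_map_scale[OF linear_diagram_action_left])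
qed

subsection \<open>The action of permutations\<close>

lemma linear_perm_action: "linear_map (perm_action w)"
  unfolding perm_action_def by (rule linear_lin_ext)

lemmas [linear_intros] = linear_map_comp[OF linear_perm_action]

lemma perm_action_single [simp]: "perm_action w (single xs c) = single (map w xs) c"
  by (simp add: perm_action_def)

lemma lookup_perm_action:
  assumes "bij w"
  shows "lookup (perm_action w v) ys = lookup v (map (pinv w) ys)"
proof -
  have eq: "map w xs = ys \<longleftrightarrow> xs = map (pinv w) ys" for xs ys
    using assms by (auto simp: map_idI bij_is_surj surj_f_inv_f inv_f_f bij_is_inj)
  have "lookup (perm_action w v) ys = (\<Sum>xs\<in>keys v. lookup v xs * lookup (single (map w xs) 1) ys)"
    by (simp add: perm_action_def lookup_lin_ext)
  also have "\<dots> = (\<Sum>xs\<in>keys v. if xs = map (pinv w) ys then lookup v xs else 0)"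
    by (intro sum.cong refl) (auto simp: lookup_single when_def eq)
  also have "\<dots> = lookup v (map (pinv w) ys)" by (simp add: in_keys_iff)
  finally show ?thesis .
qed

lemma group_degree_le: "group_degree k N \<le> N"
  by (cases k) auto

lemma group_permutes: "w permutes {1..group_degree k N} \<Longrightarrow> w permutes {1..N}"
  by (rule permutes_mono[OF _ group_degree_le])

lemma map_tuples:
  assumes "w permutes {1..N}" "xs \<in> tuples N m"
  shows "map w xs \<in> tuples N m"
  using assms permutes_image[OF assms(1)] by (auto simp: tuples_def permutes_in_image subset_iff simp del: atLeastAtMost_iff)

lemma perm_action_closed:
  assumes "w permutes {1..N}" "v \<in> tensor_space N m"
  shows "perm_action w v \<in> tensor_space N m"
  unfolding mem_tensor_space perm_action_def
  using assms map_tuples[OF assms(1)] by (intro keys_lin_ext) (auto simp: mem_tensor_space)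

text \<open>In the half-integer case the group is the stabilizer of \<open>N\<close>, so the
  completing letter does not move. This is what makes the two actions commute there.\<close>

lemma complete_word_map:
  assumes w: "w permutes {1..group_degree k N}" and N: "N \<ge> 1"
  shows "complete_word k N (map w xs) = map w (complete_word k N xs)"
proof (cases k)
  case (Half m)
  then have "w N = N" using N by (intro permutes_not_in[OF w]) auto
  then show ?thesis using Half by simp
qed simp

lemma labels_agree_map:
  assumes w: "w permutes {1..group_degree k N}" and N: "N \<ge> 1" and d: "d \<in> diagrams k"
    and t: "ys \<in> words k N" "xs \<in> words k N"
  shows "labels_agree k N d (map w ys) (map w xs) \<longleftrightarrow> labels_agree k N d ys xs"
proof -
  have len: "length (complete_word k N ys) = strands k" "length (complete_word k N xs) = strands k"
    using t by (cases k; simp add: tuples_def)+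
  have "word_label k N (map w ys) (map w xs) v = w (word_label k N ys xs v)" if "v \<in> vertices (strands k)" for v
  proof (cases v)
    case (Unprimed i)
    then have "i - 1 < strands k" using that by auto
    then show ?thesis using Unprimed by (simp add: complete_word_map[OF w N] len)
  next
    case (Primed i)
    then have "i - 1 < strands k" using that by auto
    then show ?thesis using Primed by (simp add: complete_word_map[OF w N] len)
  qed
  then have "labels_agree k N d (map w ys) (map w xs) \<longleftrightarrow> agrees d (\<lambda>v. w (word_label k N ys xs v))"
    unfolding labels_agree_agrees by (rule agrees_cong[OF diagrams_partition_on[OF d]])
  also have "\<dots> \<longleftrightarrow> agrees d (word_label k N ys xs)"
    unfolding agrees_def inj_eq[OF permutes_inj[OF w]] by (rule refl)
  finally show ?thesis by (simp only: labels_agree_agrees)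
qed

lemma diagram_action_perm_action:
  assumes w: "w permutes {1..group_degree k N}" and N: "N \<ge> 1"
    and a: "a \<in> diagram_span k" and v: "v \<in> tensor_space N (tensor_degree k)"
  shows "diagram_action k N a (perm_action w v) = perm_action w (diagram_action k N a v)"
proof (rule linear_map_eqI2[where S = "\<lambda>a v. diagram_action k N a (perm_action w v)"
      and T = "\<lambda>a v. perm_action w (diagram_action k N a v)" and A = "diagrams k" and B = "words k N"])
  fix d xs assume d: "d \<in> diagrams k" and xs: "xs \<in> words k N"
  have w': "w permutes {1..N}" by (rule group_permutes[OF w])
  have wi: "pinv w permutes {1..N}" by (rule permutes_inv[OF w'])
  have inv1: "map (pinv w) (map w zs) = zs" "map w (map (pinv w) zs) = zs" for zs
    using permutes_inverses[OF w] by (simp_all add: map_idI)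
  have "bij_betw (map w) {ys \<in> words k N. labels_agree k N d ys xs} {ys \<in> words k N. labels_agree k N d ys (map w xs)}"
  proof (rule bij_betw_byWitness[where f' = "map (pinv w)"])
    show "map w ` {ys \<in> words k N. labels_agree k N d ys xs} \<subseteq> {ys \<in> words k N. labels_agree k N d ys (map w xs)}"
      using map_tuples[OF w'] labels_agree_map[OF w N d _ xs] by auto
    show "map (pinv w) ` {ys \<in> words k N. labels_agree k N d ys (map w xs)} \<subseteq> {ys \<in> words k N. labels_agree k N d ys xs}"
    proof (rule image_subsetI)
      fix ys assume ys: "ys \<in> {ys \<in> words k N. labels_agree k N d ys (map w xs)}"
      then have "map (pinv w) ys \<in> words k N" using map_tuples[OF wi] by blast
      moreover from labels_agree_map[OF w N d this xs] have "labels_agree k N d (map (pinv w) ys) xs"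
        using ys inv1(2) by simp
      ultimately show "map (pinv w) ys \<in> {ys \<in> words k N. labels_agree k N d ys xs}" by blast
    qed
  qed (use inv1 in blast)+
  from sum.reindex_bij_betw[OF this, of "\<lambda>ys. single ys (1::complex)"]
  show "diagram_action k N (single d 1) (perm_action w (single xs 1)) = perm_action w (diagram_action k N (single d 1) (single xs 1))"
    by (simp add: diagram_action_single linear_map_sum[OF linear_perm_action])
qed (use a v in \<open>auto simp: diagram_span_def mem_tensor_space intro!: linear_intros\<close>)

section \<open>The group algebra acting on tensor space\<close>

definition group_action :: "((nat \<Rightarrow> nat) \<Rightarrow>\<^sub>0 complex) \<Rightarrow> (nat list \<Rightarrow>\<^sub>0 complex) \<Rightarrow> (nat list \<Rightarrow>\<^sub>0 complex)" where
  "group_action f v = lin_ext (\<lambda>w. perm_action w v) f"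

lemma linear_group_action_left: "linear_map (\<lambda>f. group_action f v)"
  unfolding group_action_def by (rule linear_lin_ext)

lemma linear_group_action_right: "linear_map (group_action f)"
  unfolding group_action_def by (rule lin_ext_linear_fun) (rule linear_perm_action)

lemmas [linear_intros] = linear_map_comp[OF linear_group_action_left] linear_map_comp[OF linear_group_action_right]

lemma group_action_single: "group_action (single w c) v = scale c (perm_action w v)"
  by (simp add: group_action_def)

lemma perm_action_comp: "perm_action (u \<circ> v) x = perm_action u (perm_action v x)"
  by (rule linear_map_eqI[OF linear_perm_action linear_map_comp[OF linear_perm_action linear_perm_action] subset_UNIV]) simp

lemma group_action_mult: "group_action (group_mult f g) v = group_action f (group_action g v)"
  by (rule linear_map_eqI2[where S = "\<lambda>f g. group_action (group_mult f g) v"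
        and T = "\<lambda>f g. group_action f (group_action g v)" and A = UNIV and B = UNIV])
    (auto simp: group_mult_single group_action_single perm_action_comp intro!: linear_intros)

lemma group_action_closed:
  assumes f: "f \<in> perm_span {1..group_degree k N}" and v: "v \<in> tensor_space N m"
  shows "group_action f v \<in> tensor_space N m"
proof -
  have "keys (perm_action w v) \<subseteq> tuples N m" if "w \<in> keys f" for w
    using perm_action_closed[OF group_permutes v, of w k] f that by (auto simp: perm_span_def mem_tensor_space)
  then show ?thesis unfolding mem_tensor_space group_action_def by (intro keys_lin_ext)
qed

lemma diagram_action_group_action:
  assumes f: "f \<in> perm_span {1..group_degree k N}" and N: "N \<ge> 1"
    and a: "a \<in> diagram_span k" and v: "v \<in> tensor_space N (tensor_degree k)"
  shows "diagram_action k N a (group_action f v) = group_action f (diagram_action k N a v)"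
proof (rule linear_map_eqI[where S = "\<lambda>f. diagram_action k N a (group_action f v)"
      and T = "\<lambda>f. group_action f (diagram_action k N a v)" and A = "{w. w permutes {1..group_degree k N}}"])
  fix w assume "w \<in> {w. w permutes {1..group_degree k N}}"
  then show "diagram_action k N a (group_action (single w 1) v) = group_action (single w 1) (diagram_action k N a v)"
    using diagram_action_perm_action[OF _ N a v] by (simp add: group_action_single)
qed (use f in \<open>auto simp: perm_span_def intro!: linear_intros\<close>)

subsection \<open>Faithfulness\<close>

text \<open>The entry at a pair of words separating the blocks of \<open>d\<close> is the sum of the
  coefficients over all refinements of \<open>d\<close>, and these sums determine the
  coefficients.\<close>

lemma diagram_action_faithful:
  assumes a: "a \<in> diagram_span k" and N: "N \<ge> word_bound k"
    and zero: "\<And>xs ys. xs \<in> words k N \<Longrightarrow> ys \<in> words k N \<Longrightarrow> lookup (diagram_action k N a (single xs 1)) ys = 0"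
  shows "a = 0"
proof (rule poly_mapping_eqI)
  fix d
  have sums: "(\<Sum>d'\<in>{d'\<in>diagrams k. finer k d' d}. lookup a d') = 0" if d: "d \<in> diagrams k" for d
  proof -
    obtain ys xs where t: "ys \<in> words k N" "xs \<in> words k N"
      and ex: "\<And>a b. a \<in> vertices (strands k) \<Longrightarrow> b \<in> vertices (strands k) \<Longrightarrow>
       word_label k N ys xs a = word_label k N ys xs b \<longleftrightarrow> block_of d a = block_of d b"
      using exact_words[OF d N] by metis
    have sub: "keys a \<subseteq> diagrams k" using a by (simp add: diagram_span_def)
    have "0 = (\<Sum>d'\<in>keys a. lookup a d' * of_bool (labels_agree k N d' ys xs))"
      using zero[OF t(2,1)] t(1) by (simp add: lookup_diagram_action_basis)
    also have "\<dots> = (\<Sum>d'\<in>diagrams k. lookup a d' * of_bool (labels_agree k N d' ys xs))"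
      using sub by (intro sum.mono_neutral_left) (auto simp: in_keys_iff)
    also have "\<dots> = (\<Sum>d'\<in>diagrams k. if finer k d' d then lookup a d' else 0)"
    proof (intro sum.cong refl)
      fix d' assume "d' \<in> diagrams k"
      from labels_agree_exact_iff[OF d this ex]
      show "lookup a d' * of_bool (labels_agree k N d' ys xs) = (if finer k d' d then lookup a d' else 0)" by simp
    qed
    also have "\<dots> = (\<Sum>d'\<in>{d'\<in>diagrams k. finer k d' d}. lookup a d')" by (simp add: sum.inter_filter)
    finally show ?thesis by simp
  qed
  show "lookup a d = lookup 0 d"
  proof (cases "d \<in> diagrams k")
    case True
    then show ?thesis using refinement_sums_injective[OF sums True] by simp
  next
    case False
    then show ?thesis using a by (auto simp: diagram_span_def in_keys_iff)
  qed
qed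

subsection \<open>Density\<close>

text \<open>The level sets of a labelling. For the labelling by a pair of words, this diagram
  indexes the orbit of the pair under the group.\<close>

definition kernel_diagram :: "half_integer \<Rightarrow> (vertex \<Rightarrow> nat) \<Rightarrow> diagram" where
  "kernel_diagram k f = (\<lambda>u. {v \<in> vertices (strands k). f v = f u}) ` vertices (strands k)"

lemma kernel_diagram_partition: "partition_on (vertices (strands k)) (kernel_diagram k f)"
  by (rule partition_onI) (auto simp: kernel_diagram_def disjnt_def)

lemma block_of_kernel_diagram:
  assumes "u \<in> vertices (strands k)" "v \<in> vertices (strands k)"
  shows "f u = f v \<longleftrightarrow> block_of (kernel_diagram k f) u = block_of (kernel_diagram k f) v"
proof -
  have "block_of (kernel_diagram k f) w = {v \<in> vertices (strands k). f v = f w}" if "w \<in> vertices (strands k)" for w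
    using that by (intro block_of_eq[OF kernel_diagram_partition]) (auto simp: kernel_diagram_def)
  then show ?thesis using assms by auto
qed

lemma kernel_diagram_closed:
  assumes "ys \<in> words k N" "xs \<in> words k N"
  shows "kernel_diagram k (word_label k N ys xs) \<in> diagrams k"
proof -
  let ?f = "word_label k N ys xs"
  have p: "partition_on (vertices (strands k)) (kernel_diagram k ?f)" by (rule kernel_diagram_partition)
  show ?thesis
  proof (cases k)
    case (Half m)
    have l: "?f (Unprimed (m+1)) = N" "?f (Primed (m+1)) = N"
      using assms Half complete_word_nth[of ys N k "m+1"] complete_word_nth[of xs N k "m+1"] by simp_all
    let ?B = "{v \<in> vertices (strands k). ?f v = ?f (Unprimed (m+1))}"
    have "?B \<in> kernel_diagram k ?f" unfolding kernel_diagram_def using Half by (intro imageI) simp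
    moreover have "Unprimed (m+1) \<in> ?B" "Primed (m+1) \<in> ?B" using Half l by simp_all
    ultimately have "\<exists>B\<in>kernel_diagram k ?f. Unprimed (m+1) \<in> B \<and> Primed (m+1) \<in> B" by (intro bexI[of _ ?B] conjI)
    then show ?thesis using p Half by simp
  qed (use p in simp)
qed

lemma permutation_extension:
  assumes S: "finite S" and f: "inj_on f Q" "Q \<subseteq> S" "f ` Q \<subseteq> (S :: 'a set)"
  obtains w where "w permutes S" "\<And>q. q \<in> Q \<Longrightarrow> w q = f q"
proof -
  have finQ: "finite Q" using S f(2) by (rule rev_finite_subset)
  have "card (S - Q) = card (S - f ` Q)"
    using S f finQ by (simp add: card_Diff_subset card_image)
  then obtain h where h: "bij_betw h (S - Q) (S - f ` Q)"
    using finite_same_card_bij[of "S - Q" "S - f ` Q"] S by auto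
  define w where "w x = (if x \<in> Q then f x else if x \<in> S then h x else x)" for x
  have "bij_betw w Q (f ` Q)" using f(1) by (auto simp: bij_betw_def w_def inj_on_def)
  moreover have "bij_betw w (S - Q) (S - f ` Q)"
    using h by (rule bij_betw_cong[THEN iffD1, rotated]) (simp add: w_def)
  ultimately have "bij_betw w (Q \<union> (S - Q)) (f ` Q \<union> (S - f ` Q))" by (rule bij_betw_combine) blast
  moreover have "Q \<union> (S - Q) = S" "f ` Q \<union> (S - f ` Q) = S" using f by blast+
  ultimately have "bij_betw w S S" by simp
  moreover have "w x = x" if "x \<notin> S" for x using that f(2) by (auto simp: w_def)
  ultimately have "w permutes S" by (rule bij_imp_permutes)
  then show ?thesis using that[of w] by (simp add: w_def)
qed

text \<open>Equal patterns of coincidences give a bijection between the letters used, which extends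
  to a permutation. In the half-integer case the vertex \<open>m + 1\<close> is labelled
  \<open>N\<close> in both pairs, so the permutation fixes \<open>N\<close>.\<close>

lemma same_kernel_orbit:
  assumes t: "ys \<in> words k N" "xs \<in> words k N" "ys' \<in> words k N" "xs' \<in> words k N" and N: "N \<ge> 1"
    and eq: "\<And>a b. a \<in> vertices (strands k) \<Longrightarrow> b \<in> vertices (strands k) \<Longrightarrow>
      word_label k N ys xs a = word_label k N ys xs b \<longleftrightarrow> word_label k N ys' xs' a = word_label k N ys' xs' b"
  obtains w where "w permutes {1..group_degree k N}" "ys' = map w ys" "xs' = map w xs"
proof -
  let ?V = "vertices (strands k)" and ?f = "word_label k N ys xs" and ?g = "word_label k N ys' xs'"
  define Q where "Q = ?f ` ?V"
  define h where "h q = ?g (SOME v. v \<in> ?V \<and> ?f v = q)" for q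
  have h: "h (?f v) = ?g v" if "v \<in> ?V" for v
  proof -
    have "(SOME u. u \<in> ?V \<and> ?f u = ?f v) \<in> ?V \<and> ?f (SOME u. u \<in> ?V \<and> ?f u = ?f v) = ?f v"
      using that by (intro someI[of "\<lambda>u. u \<in> ?V \<and> ?f u = ?f v" v]) simp
    then show ?thesis unfolding h_def using eq[of "SOME u. u \<in> ?V \<and> ?f u = ?f v" v] that by blast
  qed
  have range: "word_label k N ys xs v \<in> {1..N}" if "v \<in> ?V" "ys \<in> words k N" "xs \<in> words k N" for v ys xs
    using that complete_word_range[OF _ N] by (cases v) auto
  have inj: "inj_on h Q"
    unfolding Q_def using h eq by (intro inj_onI) auto
  have Qs: "Q \<subseteq> {1..N}" "h ` Q \<subseteq> {1..N}"
    unfolding Q_def using range t h by (auto simp del: atLeastAtMost_iff)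
  obtain w where w: "w permutes {1..N}" "\<And>q. q \<in> Q \<Longrightarrow> w q = h q"
    using permutation_extension[OF _ inj Qs] by blast
  have wf: "w (?f v) = ?g v" if "v \<in> ?V" for v using w(2)[of "?f v"] h that by (simp add: Q_def)
  have wg: "w permutes {1..group_degree k N}"
  proof (cases k)
    case (Half m)
    have v: "Unprimed (m+1) \<in> ?V" using Half by simp
    have "?f (Unprimed (m+1)) = N" "?g (Unprimed (m+1)) = N"
      using t Half complete_word_nth[of ys N k "m+1"] complete_word_nth[of ys' N k "m+1"] by simp_all
    then have "w N = N" using wf[OF v] by simp
    show ?thesis
    proof (rule permutes_superset[OF w(1)])
      fix x assume "x \<in> {1..N} - {1..group_degree k N}"
      then have "x = N" using Half by auto
      then show "w x = x" using \<open>w N = N\<close> by simp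
    qed
  qed (use w in simp)
  have "ys' = map w ys"
  proof (rule nth_equalityI)
    show "length ys' = length (map w ys)" using t by (simp add: tuples_def)
    fix i assume "i < length ys'"
    then have i: "i < tensor_degree k" using t by (simp add: tuples_def)
    then have "Unprimed (Suc i) \<in> ?V" "Suc i \<in> {1..strands k}" using tensor_degree_le_strands[of k] by auto
    then show "ys' ! i = map w ys ! i"
      using wf[of "Unprimed (Suc i)"] complete_word_nth[of ys N k "Suc i"] complete_word_nth[of ys' N k "Suc i"] t i
      by (simp add: tuples_def)
  qed
  moreover have "xs' = map w xs"
  proof (rule nth_equalityI)
    show "length xs' = length (map w xs)" using t by (simp add: tuples_def)
    fix i assume "i < length xs'"
    then have i: "i < tensor_degree k" using t by (simp add: tuples_def)
    then have "Primed (Suc i) \<in> ?V" "Suc i \<in> {1..strands k}" using tensor_degree_le_strands[of k] by auto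
    then show "xs' ! i = map w xs ! i"
      using wf[of "Primed (Suc i)"] complete_word_nth[of xs N k "Suc i"] complete_word_nth[of xs' N k "Suc i"] t i
      by (simp add: tuples_def)
  qed
  ultimately show ?thesis using that[OF wg] by blast
qed

text \<open>One half of Schur-Weyl duality. An invariant matrix depends only on the orbit of a pair
  of words, and orbits correspond to diagrams through their coincidences; the coefficients solve a
  triangular system over the refinement order.\<close>

lemma invariant_matrix_is_action:
  assumes N: "N \<ge> word_bound k" "N \<ge> 1"
    and inv: "\<And>w ys xs. w permutes {1..group_degree k N} \<Longrightarrow> ys \<in> words k N \<Longrightarrow> xs \<in> words k N \<Longrightarrow>
      M (map w ys) (map w xs) = M ys xs"
  obtains a where "a \<in> diagram_span k"
    "\<And>ys xs. ys \<in> words k N \<Longrightarrow> xs \<in> words k N \<Longrightarrow> lookup (diagram_action k N a (single xs 1)) ys = M ys xs"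
proof -
  have "\<exists>p. fst p \<in> words k N \<and> snd p \<in> words k N \<and> (\<forall>a\<in>vertices (strands k). \<forall>b\<in>vertices (strands k).
       word_label k N (fst p) (snd p) a = word_label k N (fst p) (snd p) b \<longleftrightarrow> block_of d a = block_of d b)"
    if d: "d \<in> diagrams k" for d
  proof -
    obtain ys xs where "ys \<in> words k N" "xs \<in> words k N"
      "\<And>a b. a \<in> vertices (strands k) \<Longrightarrow> b \<in> vertices (strands k) \<Longrightarrow>
       word_label k N ys xs a = word_label k N ys xs b \<longleftrightarrow> block_of d a = block_of d b"
      using exact_words[OF d N(1)] by metis
    then show ?thesis by (intro exI[of _ "(ys, xs)"]) simp
  qed
  then obtain p where p: "\<And>d. d \<in> diagrams k \<Longrightarrow> fst (p d) \<in> words k N \<and> snd (p d) \<in> words k N \<and>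
      (\<forall>a\<in>vertices (strands k). \<forall>b\<in>vertices (strands k).
       word_label k N (fst (p d)) (snd (p d)) a = word_label k N (fst (p d)) (snd (p d)) b \<longleftrightarrow> block_of d a = block_of d b)"
    by metis
  define t where "t d = M (fst (p d)) (snd (p d))" for d
  obtain c where c: "\<And>d. d \<in> diagrams k \<Longrightarrow> (\<Sum>d'\<in>{d'\<in>diagrams k. finer k d' d}. c d') = t d"
    using refinement_sums_surjective[of k t] by blast
  define a where "a = (\<Sum>d\<in>diagrams k. single d (c d))"
  have la: "lookup a d = (if d \<in> diagrams k then c d else 0)" for d
    unfolding a_def by (rule lookup_sum_single) simp
  have "lookup (diagram_action k N a (single xs 1)) ys = M ys xs" if w: "ys \<in> words k N" "xs \<in> words k N" for ys xs
  proof -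
    define d where "d = kernel_diagram k (word_label k N ys xs)"
    have d: "d \<in> diagrams k" unfolding d_def by (rule kernel_diagram_closed[OF w])
    have ex: "word_label k N ys xs a = word_label k N ys xs b \<longleftrightarrow> block_of d a = block_of d b"
      if "a \<in> vertices (strands k)" "b \<in> vertices (strands k)" for a b
      unfolding d_def by (rule block_of_kernel_diagram[OF that])
    have "(\<Sum>d'\<in>keys a. lookup a d' * of_bool (labels_agree k N d' ys xs)) =
        (\<Sum>d'\<in>diagrams k. lookup a d' * of_bool (labels_agree k N d' ys xs))"
      by (intro sum.mono_neutral_left) (auto simp: in_keys_iff la split: if_splits)
    also have "\<dots> = (\<Sum>d'\<in>diagrams k. if finer k d' d then c d' else 0)"
    proof (intro sum.cong refl)
      fix d' assume d': "d' \<in> diagrams k"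
      from labels_agree_exact_iff[OF d d' ex]
      show "lookup a d' * of_bool (labels_agree k N d' ys xs) = (if finer k d' d then c d' else 0)" using d' by (simp add: la)
    qed
    also have "\<dots> = t d" using c[OF d] by (simp add: sum.inter_filter)
    finally have 1: "lookup (diagram_action k N a (single xs 1)) ys = t d"
      using w by (simp add: lookup_diagram_action_basis)
    have pd: "fst (p d) \<in> words k N" "snd (p d) \<in> words k N" using p[OF d] by blast+
    have same: "word_label k N ys xs a = word_label k N ys xs b \<longleftrightarrow>
        word_label k N (fst (p d)) (snd (p d)) a = word_label k N (fst (p d)) (snd (p d)) b"
      if "a \<in> vertices (strands k)" "b \<in> vertices (strands k)" for a b
      using ex[OF that] p[OF d] that by blast
    obtain g where g: "g permutes {1..group_degree k N}" "fst (p d) = map g ys" "snd (p d) = map g xs"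
      by (rule same_kernel_orbit[OF w pd N(2) same])
    show ?thesis unfolding 1 t_def g(2,3) by (rule inv[OF g(1) w])
  qed
  moreover have "a \<in> diagram_span k" unfolding a_def by (rule diagram_span_sum) simp
  ultimately show ?thesis using that by blast
qed

subsection \<open>Semisimplicity for large integer parameters\<close>

text \<open>The form \<open>(a, b) = trace (a b*)\<close> on operators on tensor space restricts to a positive definite form
  on the partition algebra, and the orthogonal complement of a left ideal is a left ideal.\<close>

fun flip :: "vertex \<Rightarrow> vertex" where
  "flip (Unprimed i) = Primed i"
| "flip (Primed i) = Unprimed i"

definition flip_diagram :: "diagram \<Rightarrow> diagram" where
  "flip_diagram d = (`) flip ` d"

lemma flip_flip [simp]: "flip (flip v) = v"
  by (cases v) auto

lemma flip_vertices: "flip ` vertices s = vertices s"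
  by (auto simp: vertices_def image_Un image_image)

lemma flip_diagram_closed:
  assumes d: "d \<in> diagrams k"
  shows "flip_diagram d \<in> diagrams k"
proof -
  have p: "partition_on (vertices (strands k)) d" by (rule diagrams_partition_on[OF d])
  have "inj_on flip (vertices (strands k))" by (metis flip_flip inj_onI)
  from partition_on_inj_image[OF p this]
  have "partition_on (vertices (strands k)) ((`) flip ` d - {{}})" by (simp only: flip_vertices)
  moreover have "(`) flip ` d - {{}} = flip_diagram d"
    using partition_onD3[OF p] by (auto simp: flip_diagram_def)
  ultimately have q: "partition_on (vertices (strands k)) (flip_diagram d)" by simp
  show ?thesis
  proof (cases k)
    case (Half m)
    then obtain B where B: "B \<in> d" "Unprimed (m+1) \<in> B" "Primed (m+1) \<in> B" using d by auto
    then have "flip ` B \<in> flip_diagram d" "Unprimed (m+1) \<in> flip ` B" "Primed (m+1) \<in> flip ` B"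
      by (auto simp: flip_diagram_def image_iff) (metis flip.simps)+
    then have "\<exists>B\<in>flip_diagram d. Unprimed (m+1) \<in> B \<and> Primed (m+1) \<in> B" by (intro bexI[of _ "flip ` B"] conjI)
    then show ?thesis using q Half by simp
  qed (use q in simp)
qed

lemma labels_agree_flip: "labels_agree k N (flip_diagram d) ys xs \<longleftrightarrow> labels_agree k N d xs ys"
proof -
  have "label zs ws (flip v) = label ws zs v" for zs ws v by (cases v) auto
  then show ?thesis
    unfolding labels_agree_agrees agrees_def flip_diagram_def ball_simps by simp
qed

text \<open>Flipping a diagram transposes its matrix, so this is the conjugate transpose; the
  algebra of operators is closed under adjoints.\<close>

definition adjoint :: "(diagram \<Rightarrow>\<^sub>0 complex) \<Rightarrow> (diagram \<Rightarrow>\<^sub>0 complex)" where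
  "adjoint a = (\<Sum>d\<in>keys a. single (flip_diagram d) (cnj (lookup a d)))"

lemma adjoint_closed: "a \<in> diagram_span k \<Longrightarrow> adjoint a \<in> diagram_span k"
  unfolding adjoint_def
  by (intro diagram_span_sum diagram_span_closed(5) flip_diagram_closed) (auto simp: diagram_span_def)

abbreviation entry :: "half_integer \<Rightarrow> nat \<Rightarrow> (diagram \<Rightarrow>\<^sub>0 complex) \<Rightarrow> nat list \<Rightarrow> nat list \<Rightarrow> complex" where
  "entry k N a ys xs \<equiv> lookup (diagram_action k N a (single xs 1)) ys"

lemma entry_adjoint:
  assumes "ys \<in> words k N" "xs \<in> words k N"
  shows "entry k N (adjoint a) ys xs = cnj (entry k N a xs ys)"
proof -
  have "diagram_action k N (single (flip_diagram d) (cnj c)) v = scale (cnj c) (diagram_action k N (single (flip_diagram d) 1) v)" for d c v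
    using linear_map_scale[OF linear_diagram_action_left, of k N "cnj c" "single (flip_diagram d) 1" v] by simp
  then have "entry k N (adjoint a) ys xs = (\<Sum>d\<in>keys a. cnj (lookup a d) * entry k N (single (flip_diagram d) 1) ys xs)"
    by (simp add: adjoint_def linear_map_sum[OF linear_diagram_action_left] lookup_sum)
  also have "\<dots> = (\<Sum>d\<in>keys a. cnj (lookup a d * of_bool (labels_agree k N d xs ys)))"
    using assms by (intro sum.cong refl) (simp add: lookup_diagram_action_single labels_agree_flip)
  also have "\<dots> = cnj (entry k N a xs ys)"
    by (simp only: lookup_diagram_action_basis assms of_bool_eq simp_thms mult_1_left cnj_sum)
  finally show ?thesis .
qed

lemma entry_pmul:
  assumes "a \<in> diagram_span k" "b \<in> diagram_span k" "N \<ge> 1" "xs \<in> words k N"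
  shows "entry k N (pmul (of_nat N) a b) ys xs = (\<Sum>zs\<in>words k N. entry k N b zs xs * entry k N a ys zs)"
  using assms by (simp add: diagram_action_pmul lookup_diagram_action[OF diagram_action_closed])

definition trace_form :: "half_integer \<Rightarrow> nat \<Rightarrow> (diagram \<Rightarrow>\<^sub>0 complex) \<Rightarrow> (diagram \<Rightarrow>\<^sub>0 complex) \<Rightarrow> complex" where
  "trace_form k N a b = (\<Sum>ys\<in>words k N. \<Sum>xs\<in>words k N. entry k N a ys xs * cnj (entry k N b ys xs))"

lemma trace_form_linear:
  "trace_form k N (a + a') b = trace_form k N a b + trace_form k N a' b"
  "trace_form k N (scale c a) b = c * trace_form k N a b"
  "trace_form k N a (b - b') = trace_form k N a b - trace_form k N a b'"
  "trace_form k N a (scale c b) = cnj c * trace_form k N a b"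
  "trace_form k N 0 b = 0" "trace_form k N a 0 = 0"
  by (simp_all add: trace_form_def linear_map_add[OF linear_diagram_action_left]
      linear_map_scale[OF linear_diagram_action_left] linear_map_diff[OF linear_diagram_action_left]
      linear_map_zero[OF linear_diagram_action_left] lookup_add lookup_minus sum.distrib sum_subtractf
      sum_distrib_left algebra_simps)

text \<open>A sum of squared moduli of all entries vanishes only for the zero operator, and the
  action is faithful.\<close>

lemma trace_form_definite:
  assumes a: "a \<in> diagram_span k" and N: "N \<ge> word_bound k" and zero: "trace_form k N a a = 0"
  shows "a = 0"
proof (rule diagram_action_faithful[OF a N])
  fix xs ys assume xs: "xs \<in> words k N" and ys: "ys \<in> words k N"
  have "trace_form k N a a = of_real (\<Sum>ys\<in>words k N. \<Sum>xs\<in>words k N. (cmod (entry k N a ys xs))\<^sup>2)"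
    by (simp add: trace_form_def complex_norm_square[symmetric])
  then have "(\<Sum>ys\<in>words k N. \<Sum>xs\<in>words k N. (cmod (entry k N a ys xs))\<^sup>2) = 0"
    using zero by (metis of_real_eq_0_iff)
  then have "\<forall>ys\<in>words k N. (\<Sum>xs\<in>words k N. (cmod (entry k N a ys xs))\<^sup>2) = 0"
    by (subst (asm) sum_nonneg_eq_0_iff) (auto intro: sum_nonneg)
  then have "(\<Sum>xs\<in>words k N. (cmod (entry k N a ys xs))\<^sup>2) = 0" using ys by blast
  then have "\<forall>xs\<in>words k N. (cmod (entry k N a ys xs))\<^sup>2 = 0"
    by (subst (asm) sum_nonneg_eq_0_iff) auto
  then show "entry k N a ys xs = 0" using xs by simp
qed

lemma trace_form_adjoint:
  assumes a: "a \<in> diagram_span k" and b: "b \<in> diagram_span k" and l: "l \<in> diagram_span k" and N: "N \<ge> 1"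
  shows "trace_form k N l (pmul (of_nat N) a b) = trace_form k N (pmul (of_nat N) (adjoint a) l) b"
proof -
  let ?T = "words k N"
  have "trace_form k N l (pmul (of_nat N) a b) =
      (\<Sum>ys\<in>?T. \<Sum>xs\<in>?T. \<Sum>zs\<in>?T. entry k N l ys xs * cnj (entry k N b zs xs) * cnj (entry k N a ys zs))"
    unfolding trace_form_def using entry_pmul[OF a b N]
    by (intro sum.cong refl) (simp add: sum_distrib_left mult_ac)
  also have "\<dots> = (\<Sum>ys\<in>?T. \<Sum>zs\<in>?T. \<Sum>xs\<in>?T. entry k N l ys xs * cnj (entry k N b zs xs) * cnj (entry k N a ys zs))"
    by (rule sum.cong[OF refl]) (rule sum.swap)
  also have "\<dots> = (\<Sum>zs\<in>?T. \<Sum>ys\<in>?T. \<Sum>xs\<in>?T. entry k N l ys xs * cnj (entry k N b zs xs) * cnj (entry k N a ys zs))"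
    by (rule sum.swap)
  also have "\<dots> = (\<Sum>zs\<in>?T. \<Sum>xs\<in>?T. \<Sum>ys\<in>?T. entry k N l ys xs * cnj (entry k N b zs xs) * cnj (entry k N a ys zs))"
    by (rule sum.cong[OF refl]) (rule sum.swap)
  also have "\<dots> = trace_form k N (pmul (of_nat N) (adjoint a) l) b"
    unfolding trace_form_def using entry_pmul[OF adjoint_closed[OF a] l N]
    by (intro sum.cong refl) (simp add: sum_distrib_left sum_distrib_right entry_adjoint mult_ac)
  finally show ?thesis .
qed

section \<open>Orthogonal complements of left ideals\<close>

interpretation diagram_space: vector_space "scale :: complex \<Rightarrow> (diagram \<Rightarrow>\<^sub>0 complex) \<Rightarrow> (diagram \<Rightarrow>\<^sub>0 complex)"
  by (rule vector_space_scale)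

lemma diagram_span_subspace: "diagram_space.subspace (diagram_span k)"
  by (simp add: diagram_space.subspace_def)

lemma trace_form_span_zero:
  assumes "\<And>b. b \<in> B \<Longrightarrow> trace_form k N b x = 0" "b \<in> diagram_space.span B"
  shows "trace_form k N b x = 0"
  using assms(2)
proof (rule diagram_space.span_induct)
  show "diagram_space.subspace {b. trace_form k N b x = 0}"
    by (simp add: diagram_space.subspace_def trace_form_linear)
  show "trace_form k N b x = 0" if "b \<in> B" for b by (rule assms(1)[OF that])
qed

lemma orthogonal_projection:
  assumes "finite B" "B \<subseteq> diagram_span k" and N: "N \<ge> word_bound k"
  shows "\<exists>l\<in>diagram_space.span B. \<forall>b\<in>B. trace_form k N b (a - l) = 0"
  using assms(1,2)
proof (induction B arbitrary: a rule: finite_induct)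
  case empty
  then show ?case using diagram_space.span_zero by blast
next
  case (insert b B)
  have sub: "diagram_space.span B \<subseteq> diagram_space.span (insert b B)"
    by (rule diagram_space.span_mono) blast
  have Bs: "diagram_space.span B \<subseteq> diagram_span k"
    using insert.prems diagram_span_subspace by (intro diagram_space.span_minimal) auto
  obtain lb where lb: "lb \<in> diagram_space.span B" "\<And>x. x \<in> B \<Longrightarrow> trace_form k N x (b - lb) = 0"
    using insert.IH[of b] insert.prems by auto
  obtain la where la: "la \<in> diagram_space.span B" "\<And>x. x \<in> B \<Longrightarrow> trace_form k N x (a - la) = 0"
    using insert.IH[of a] insert.prems by auto
  define b' where "b' = b - lb"
  have b': "b' \<in> diagram_span k" unfolding b'_def using insert.prems lb(1) Bs by (intro diagram_span_diff) auto
  have b: "b = b' + lb" by (simp add: b'_def)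
  show ?case
  proof (cases "trace_form k N b' b' = 0")
    case True
    then have "b' = 0" by (rule trace_form_definite[OF b' N])
    then have bs: "b \<in> diagram_space.span B" using lb(1) b by simp
    have "trace_form k N b (a - la) = 0" by (rule trace_form_span_zero[OF la(2) bs])
    then show ?thesis using la sub by blast
  next
    case False
    \<comment> \<open>Gram-Schmidt step: \<open>b'\<close> is the part of \<open>b\<close>
      orthogonal to \<open>B\<close>. The form is conjugate-linear in its second argument, hence the
      \<open>cnj\<close>.\<close>
    define c where "c = cnj (trace_form k N b' (a - la) / trace_form k N b' b')"
    define l where "l = la + scale c b'"
    have al: "a - l = (a - la) - scale c b'" by (simp add: l_def)
    have "b' \<in> diagram_space.span (insert b B)"
      unfolding b'_def
      by (rule diagram_space.span_diff[OF diagram_space.span_base[OF insertI1] subsetD[OF sub lb(1)]])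
    then have l: "l \<in> diagram_space.span (insert b B)"
      unfolding l_def using la(1) sub by (intro diagram_space.span_add diagram_space.span_scale) auto
    have split: "trace_form k N x (a - l) = trace_form k N x (a - la) - cnj c * trace_form k N x b'" for x
      by (simp only: al trace_form_linear(3,4))
    have B0: "trace_form k N x (a - l) = 0" if "x \<in> B" for x
      using la(2)[OF that] lb(2)[OF that] by (simp add: split b'_def)
    have "trace_form k N b' (a - l) = 0"
      unfolding split using False by (simp add: c_def)
    moreover have "trace_form k N lb (a - l) = 0" by (rule trace_form_span_zero[OF B0 lb(1)])
    ultimately have "trace_form k N b (a - l) = 0" by (simp add: b trace_form_linear)
    then show ?thesis using l B0 by blast
  qed
qed

lemma additive_subgroupI:
  fixes M :: "('a::ab_group_add, 'x) ring_scheme"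
  assumes M: "abelian_group M" "ring.add M = (+)" "ring.zero M = 0"
    and H: "H \<subseteq> carrier M" "0 \<in> H" "\<And>x y. x \<in> H \<Longrightarrow> y \<in> H \<Longrightarrow> x + y \<in> H" "\<And>x. x \<in> H \<Longrightarrow> - x \<in> H"
  shows "subgroup H (add_monoid M)"
proof -
  interpret M: abelian_group M by fact
  show ?thesis
  proof (rule group.subgroupI)
    show "group (add_monoid M)" by (rule M.a_group)
    show "inv\<^bsub>add_monoid M\<^esub> a \<in> H" if a: "a \<in> H" for a
    proof -
      have "\<ominus>\<^bsub>M\<^esub> a = - a" using a H(1) H(4)[OF a] by (intro M.minus_equality) (auto simp: M)
      then show ?thesis using H(4)[OF a] by (simp add: a_inv_def)
    qed
  qed (use H M in auto)
qed

lemma regular_module_simps: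
  "carrier (regular_module (partition_algebra q k)) = diagram_span k"
  "ring.add (regular_module (partition_algebra q k)) = (+)"
  "ring.zero (regular_module (partition_algebra q k)) = 0"
  "smult (regular_module (partition_algebra q k)) = pmul q"
  by (simp_all add: regular_module_def)

lemma abelian_group_regular_module: "abelian_group (regular_module (partition_algebra q k))"
  by (rule abelian_group_additiveI) (auto simp: regular_module_simps)

lemma semisimple_partition_algebra:
  assumes N: "N \<ge> word_bound k" "N \<ge> 1"
  shows "semisimple_ring (partition_algebra (of_nat N :: complex) k)"
proof -
  let ?q = "of_nat N :: complex"
  let ?A = "partition_algebra ?q k" and ?R = "regular_module (partition_algebra ?q k)"
  note ag = abelian_group_regular_module[of ?q k]
  note rm = regular_module_simps[of ?q k]
  have "left_module ?A ?R"
    unfolding left_module_def rm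
    using ring_partition_algebra[of ?q k] ag
    by (auto simp: linear_map_add[OF linear_pmul_left] linear_map_add[OF linear_pmul_right] pmul_assoc pmul_id_left)
  moreover have "\<exists>W. submodule W ?A ?R \<and> L \<inter> W = {\<zero>\<^bsub>?R\<^esub>} \<and> L <+>\<^bsub>?R\<^esub> W = carrier ?R" if L: "submodule L ?A ?R" for L
  proof -
    have sg: "subgroup L (add_monoid ?R)" and Lmul: "\<And>a x. a \<in> diagram_span k \<Longrightarrow> x \<in> L \<Longrightarrow> pmul ?q a x \<in> L"
      using L by (auto simp: submodule_def submodule_axioms_def rm)
    have Lsub: "L \<subseteq> diagram_span k" using subgroup.subset[OF sg] by (simp add: rm)
    have L0: "0 \<in> L" using subgroup.one_closed[OF sg] by (simp add: rm)
    have Ladd: "x + y \<in> L" if "x \<in> L" "y \<in> L" for x y using subgroup.m_closed[OF sg that] by (simp add: rm)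
    have Lscale: "scale c x \<in> L" if "x \<in> L" for c x
      using Lmul[of "single (id_diagram (strands k)) c" x] that Lsub id_diagram_closed by (auto simp: pmul_id_left)
    have Lspace: "diagram_space.subspace L" using L0 Ladd Lscale by (simp add: diagram_space.subspace_def)
    obtain B where B: "B \<subseteq> L" "diagram_space.independent B" "L \<subseteq> diagram_space.span B"
      using diagram_space.maximal_independent_subset[of L] by blast
    \<comment> \<open>The finitely many diagrams span, so the independent set \<open>B\<close> is
      finite and projections onto \<open>L\<close> exist.\<close>
    have "diagram_span k \<subseteq> diagram_space.span ((\<lambda>d. single d 1) ` diagrams k)"
    proof
      fix a :: "diagram \<Rightarrow>\<^sub>0 complex" assume "a \<in> diagram_span k"
      then have "(\<Sum>d\<in>keys a. scale (lookup a d) (single d 1)) \<in> diagram_space.span ((\<lambda>d. single d 1) ` diagrams k)"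
        by (intro diagram_space.span_sum diagram_space.span_scale diagram_space.span_base) (auto simp: diagram_span_def)
      then show "a \<in> diagram_space.span ((\<lambda>d. single d 1) ` diagrams k)"
        using poly_mapping_expansion[of a] by simp
    qed
    then have "finite B"
      using B(1) Lsub diagram_space.independent_span_bound[OF _ B(2), of "(\<lambda>d. single d 1) ` diagrams k"] by auto
    define W where "W = {b \<in> diagram_span k. \<forall>l\<in>L. trace_form k N l b = 0}"
    have "subgroup W (add_monoid ?R)"
    proof (rule additive_subgroupI[OF ag])
      show "x + y \<in> W" if "x \<in> W" "y \<in> W" for x y
      proof -
        have "x + y = x - scale (- 1) y" by (simp add: scale_minus_one)
        then have "trace_form k N l (x + y) = trace_form k N l x - cnj (- 1) * trace_form k N l y" for l
          by (simp only: trace_form_linear)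
        then show ?thesis using that by (simp add: W_def)
      qed
      show "- x \<in> W" if "x \<in> W" for x
        using that trace_form_linear(4)[of k N _ "- 1" x] by (simp add: W_def scale_minus_one)
    qed (auto simp: rm W_def trace_form_linear)
    moreover have "pmul ?q a b \<in> W" if "a \<in> diagram_span k" "b \<in> W" for a b
    proof -
      have b: "b \<in> diagram_span k" using that by (simp add: W_def)
      have "trace_form k N l (pmul ?q a b) = 0" if l: "l \<in> L" for l
      proof -
        have "pmul ?q (adjoint a) l \<in> L" using Lmul adjoint_closed \<open>a \<in> diagram_span k\<close> l by blast
        then show ?thesis
          using trace_form_adjoint[OF \<open>a \<in> diagram_span k\<close> b _ N(2), of l] l Lsub \<open>b \<in> W\<close> by (auto simp: W_def)
      qed
      then show ?thesis using that b by (simp add: W_def)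
    qed
    ultimately have "submodule W ?A ?R" by (auto simp: submodule_def submodule_axioms_def rm)
    moreover have "L \<inter> W = {\<zero>\<^bsub>?R\<^esub>}"
    proof -
      have "x = 0" if "x \<in> L" "x \<in> W" for x
        using that trace_form_definite[of x k N] N(1) by (auto simp: W_def)
      then show ?thesis using L0 by (auto simp: rm W_def trace_form_linear)
    qed
    moreover have "L <+>\<^bsub>?R\<^esub> W = carrier ?R"
    proof -
      have "\<exists>l\<in>L. \<exists>w\<in>W. a = l + w" if a: "a \<in> diagram_span k" for a
      proof -
        obtain l where l: "l \<in> diagram_space.span B" "\<forall>b\<in>B. trace_form k N b (a - l) = 0"
          using orthogonal_projection[OF \<open>finite B\<close> _ N(1), of a] B(1) Lsub by blast
        have lL: "l \<in> L" using l(1) diagram_space.span_minimal[OF B(1) Lspace] by blast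
        have "trace_form k N x (a - l) = 0" if "x \<in> L" for x
          by (rule trace_form_span_zero[OF l(2)[rule_format] subsetD[OF B(3) that]])
        then have "a - l \<in> W" using a lL Lsub by (auto simp: W_def intro: diagram_span_diff)
        then show ?thesis using lL by (intro bexI[of _ l] bexI[of _ "a - l"]) simp_all
      qed
      then show ?thesis using Lsub by (auto simp: set_add_def' rm W_def)
    qed
    ultimately show ?thesis by blast
  qed
  ultimately show ?thesis by (simp add: semisimple_ring_def semisimple_module_def)
qed

section \<open>The multiplicity space as a module generated by a Young symmetrizer\<close>

locale multiplicity =
  fixes k :: half_integer and lam :: "nat list" and N :: nat
  assumes lam: "is_partition lam" and boxes_le: "sum_list lam \<le> tensor_degree k"
    and N_ge: "N \<ge> word_bound k" and N_pos: "N \<ge> 1"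
begin

abbreviation "r \<equiv> sum_list lam"
abbreviation "g \<equiv> group_degree k N"
abbreviation "nu \<equiv> (g - r) # lam"
abbreviation "A \<equiv> partition_algebra (of_nat N :: complex) k"
abbreviation "W \<equiv> tensor_space N (tensor_degree k)"
abbreviation "act \<equiv> diagram_action k N"

lemma sorted_lam: "sorted_wrt (\<ge>) lam"
  using lam by (simp add: is_partition_def)

text \<open>The bound \<open>N \<ge> 2 k\<close> enters here: \<open>g\<close> is \<open>N\<close>
  or \<open>N - 1\<close>, in either case at least twice the tensor degree. It makes the first row
  \<open>g - r\<close> of \<open>nu\<close> at least as long as any part of \<open>lam\<close>, so
  \<open>nu\<close> is weakly decreasing.\<close>

lemma two_r_le: "2 * r \<le> g"
  using N_ge boxes_le by (cases k) auto

lemma g_le: "g \<le> N"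
  by (rule group_degree_le)

lemma part_le: "p \<in> set lam \<Longrightarrow> p \<le> g - r"
  using member_le_sum_list[of p lam] two_r_le by simp

lemma sorted_nu: "sorted_wrt (\<ge>) nu"
  using sorted_lam part_le by simp

lemma sum_list_nu: "sum_list nu = g"
  using two_r_le by simp

sublocale T: tableau "{1..g}" "rowof nu" "colof nu"
  using tableau_row_reading[OF sorted_nu] by (simp only: sum_list_nu)

sublocale S: tableau "{1..r}" "rowof lam" "colof lam"
  by (rule tableau_row_reading[OF sorted_lam])

definition y :: "(nat \<Rightarrow> nat) \<Rightarrow>\<^sub>0 complex" where "y = T.symmetrizer"

lemma young_symmetrizer_nu: "young_symmetrizer nu = y"
  using young_symmetrizer_tableau[OF sorted_nu] by (simp only: sum_list_nu y_def)

lemma y_span: "y \<in> perm_span {1..g}"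
  unfolding y_def by (rule T.symmetrizer_span)

lemma y_absorb_right: "v \<in> T.Cols \<Longrightarrow> group_mult y (single v 1) = scale (of_int (sign v)) y"
  unfolding y_def by (rule T.symmetrizer_absorb_right)

lemma y_sandwich:
  "f \<in> perm_span {1..g} \<Longrightarrow> group_mult (group_mult y f) y = scale (lookup (group_mult (group_mult y f) y) id) y"
  unfolding y_def by (rule T.symmetrizer_sandwich)

lemma y_square: obtains c where "c \<noteq> 0" "group_mult y y = scale c y"
  unfolding y_def by (rule T.symmetrizer_square)

lemma colof_nu_less: "t \<in> {1..g} \<Longrightarrow> colof nu t < g - r"
proof -
  assume "t \<in> {1..g}"
  then have b: "(rowof nu t, colof nu t) \<in> boxes nu" using row_col_box(1)[of t nu] by (simp only: sum_list_nu)
  have "nu ! i \<le> g - r" if "i < length nu" for i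
    using that part_le by (cases i) auto
  then show "colof nu t < g - r" using b by (fastforce simp: boxes_def)
qed

text \<open>The shape \<open>nu\<close> is \<open>lam\<close> with a row of length
  \<open>g - r\<close> put on top, so row reading gives the box of \<open>i\<close> the entry
  \<open>g - r + i\<close>, one row further down.\<close>

lemma nu_low:
  assumes i: "i \<in> {1..r}"
  shows "rowof nu (g - r + i) = Suc (rowof lam i)" "colof nu (g - r + i) = colof lam i"
proof -
  have b: "(rowof lam i, colof lam i) \<in> boxes lam" "row_reading lam (rowof lam i, colof lam i) = i"
    by (rule row_col_box[OF i])+
  have box: "(Suc (rowof lam i), colof lam i) \<in> boxes nu" using b(1) by (auto simp: boxes_Cons)
  have eq: "row_reading nu (Suc (rowof lam i), colof lam i) = g - r + i" by (simp only: row_reading_Cons b(2))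
  show "rowof nu (g - r + i) = Suc (rowof lam i)" using rowof_row_reading[OF box] by (simp only: eq)
  show "colof nu (g - r + i) = colof lam i" using colof_row_reading[OF box] by (simp only: eq)
qed

lemma nu_top:
  assumes t: "t \<in> {1..g - r}"
  shows "rowof nu t = 0"
proof -
  have box: "(0, t - 1) \<in> boxes nu" using t by (auto simp: boxes_def)
  have eq: "row_reading nu (0, t - 1) = t" using t by (simp add: row_reading_Cons)
  show ?thesis using rowof_row_reading[OF box] by (simp only: eq)
qed

text \<open>A model for the space of equivariant maps out of the left ideal generated by
  \<open>y\<close>: a map corresponds to its value at \<open>y\<close>, up to a nonzero
  scalar.\<close>

definition Y :: "(diagram \<Rightarrow>\<^sub>0 complex, nat list \<Rightarrow>\<^sub>0 complex) module" where
  "Y = \<lparr>carrier = {group_action y v | v. v \<in> W}, mult = undefined, one = undefined,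
     ring.zero = 0, ring.add = (+), smult = act\<rparr>"

lemma Y_simps [simp]: "ring.zero Y = 0" "ring.add Y = (+)" "smult Y = act"
  by (simp_all add: Y_def)

lemma Y_carrierI: "v \<in> W \<Longrightarrow> group_action y v \<in> carrier Y"
  by (auto simp: Y_def)

lemma Y_carrierE:
  assumes "u \<in> carrier Y"
  obtains v where "v \<in> W" "u = group_action y v"
  using assms by (auto simp: Y_def)

lemma Y_subset: "u \<in> carrier Y \<Longrightarrow> u \<in> W"
  using group_action_closed[OF y_span] by (auto elim!: Y_carrierE)

lemma Y_closed:
  "0 \<in> carrier Y"
  "u \<in> carrier Y \<Longrightarrow> u' \<in> carrier Y \<Longrightarrow> u + u' \<in> carrier Y"
  "u \<in> carrier Y \<Longrightarrow> - u \<in> carrier Y"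
  "u \<in> carrier Y \<Longrightarrow> scale c u \<in> carrier Y"
proof -
  show "0 \<in> carrier Y" using Y_carrierI[of 0] by (simp add: linear_map_zero[OF linear_group_action_right])
  show "u + u' \<in> carrier Y" if u: "u \<in> carrier Y" "u' \<in> carrier Y"
  proof -
    obtain v v' where "v \<in> W" "u = group_action y v" "v' \<in> W" "u' = group_action y v'" using u by (auto elim!: Y_carrierE)
    then show ?thesis using Y_carrierI[of "v + v'"] by (simp add: linear_map_add[OF linear_group_action_right])
  qed
  show "- u \<in> carrier Y" if u: "u \<in> carrier Y"
  proof -
    obtain v where "v \<in> W" "u = group_action y v" using u by (auto elim!: Y_carrierE)
    then show ?thesis using Y_carrierI[of "- v"] by (simp add: linear_map_minus[OF linear_group_action_right])
  qed
  show "scale c u \<in> carrier Y" if u: "u \<in> carrier Y"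
  proof -
    obtain v where "v \<in> W" "u = group_action y v" using u by (auto elim!: Y_carrierE)
    then show ?thesis using Y_carrierI[of "scale c v"] by (simp add: linear_map_scale[OF linear_group_action_right])
  qed
qed

lemma act_group_action:
  "f \<in> perm_span {1..g} \<Longrightarrow> a \<in> diagram_span k \<Longrightarrow> v \<in> W \<Longrightarrow> act a (group_action f v) = group_action f (act a v)"
  by (rule diagram_action_group_action[OF _ N_pos])

lemma act_closed_Y:
  assumes a: "a \<in> diagram_span k" and u: "u \<in> carrier Y"
  shows "act a u \<in> carrier Y"
proof -
  obtain v where v: "v \<in> W" "u = group_action y v" using u by (auto elim!: Y_carrierE)
  show ?thesis unfolding v(2) act_group_action[OF y_span a v(1)] by (rule Y_carrierI[OF diagram_action_closed])
qed

lemma left_module_Y: "left_module A Y"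
  unfolding left_module_def
proof (intro conjI ballI)
  show "ring A" by (rule ring_partition_algebra)
  show "abelian_group Y" using Y_closed by (intro abelian_group_additiveI) auto
qed (simp_all add: act_closed_Y linear_map_add[OF linear_diagram_action_left]
      linear_map_add[OF linear_diagram_action_right] diagram_action_pmul[OF _ _ Y_subset N_pos]
      diagram_action_id[OF Y_subset])

subsection \<open>The symmetrizer kills diagrams of low propagating number\<close>

text \<open>Some column of the tableau of shape \<open>nu\<close> has two entries that do not occur as labels of propagating
  blocks; their transposition fixes \<open>d v\<close> and is a sign on the symmetrizer.\<close>

lemma low_diagram_kills_word:
  assumes d: "d \<in> diagrams k" and low: "propagating_number d < propagating_bound k r" and xs: "xs \<in> words k N"
  shows "group_action y (act (single d 1) (single xs 1)) = 0"
proof -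
  let ?V = "vertices (strands k)"
  define X where "X = {ys \<in> words k N. labels_agree k N d ys xs}"
  have actX: "act (single d 1) (single xs 1) = (\<Sum>ys\<in>X. single ys 1)" by (simp add: diagram_action_single X_def)
  have p: "partition_on ?V d" by (rule diagrams_partition_on[OF d])
  have find: "finite d" using finite_elements[OF _ p] by simp
  show ?thesis
  proof (cases "X = {}")
    case True
    then show ?thesis by (simp add: actX linear_map_zero[OF linear_group_action_right])
  next
    case False
    then obtain ys0 where ys0: "ys0 \<in> X" by blast
    define f where "f = word_label k N ys0 xs"
    have agf: "agrees d f" using ys0 by (simp add: X_def labels_agree_agrees f_def)
    define PB where "PB = {B \<in> d. propagating B}"
    have cPB: "card PB < propagating_bound k r" using low by (simp add: PB_def propagating_number_def)
    have finPB: "finite PB" using find by (simp add: PB_def)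
    \<comment> \<open>The letters on propagating blocks. They are dictated by the bottom word
      \<open>xs\<close>, hence common to all words in \<open>X\<close>.\<close>
    define Q where "Q = (\<lambda>B. f (SOME v. v \<in> B)) ` PB"
    have Q: "f (Primed j) \<in> Q" if "B \<in> PB" "Primed j \<in> B" for B j
    proof -
      have "(SOME v. v \<in> B) \<in> B" using that(2) by (rule someI)
      then have "f (Primed j) = f (SOME v. v \<in> B)" using that by (intro agreesD[OF agf, of B]) (auto simp: PB_def)
      then show ?thesis using that(1) by (simp add: Q_def)
    qed
    have finQ: "finite Q" and cQ: "card Q \<le> card PB" using finPB by (auto simp: Q_def card_image_le)
    \<comment> \<open>In the half-integer case one propagating block carries \<open>N\<close>, which
      lies outside \<open>{1..g}\<close>; this offsets the larger bound
      \<open>r + 1\<close>.\<close>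
    have small: "card (Q \<inter> {1..g}) < r"
    proof (cases k)
      case (Whole m)
      have "card (Q \<inter> {1..g}) \<le> card Q" using finQ by (intro card_mono) auto
      then show ?thesis using cQ cPB Whole by simp
    next
      case (Half m)
      obtain B where B: "B \<in> d" "Unprimed (m+1) \<in> B" "Primed (m+1) \<in> B" using d Half by force
      have "f (Primed (m+1)) = N"
        using xs Half complete_word_nth[of xs N k "m+1"] by (simp add: f_def)
      then have NQ: "N \<in> Q" using Q[of B "m+1"] B by (auto simp: PB_def)
      have "Q \<inter> {1..g} \<subseteq> Q - {N}" using Half N_pos by auto
      then have "card (Q \<inter> {1..g}) \<le> card (Q - {N})" using finQ by (intro card_mono) auto
      also have "\<dots> = card Q - 1" using NQ by (rule card_Diff_singleton)
      also have "\<dots> < r"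
      proof -
        have "card Q > 0" using NQ finQ by (auto simp: card_gt_0_iff)
        then show ?thesis using cQ cPB Half by simp
      qed
      finally show ?thesis .
    qed
    define F where "F = {1..g} - Q"
    have "card F = g - card (Q \<inter> {1..g})"
    proof -
      have "F = {1..g} - (Q \<inter> {1..g})" by (auto simp: F_def)
      then show ?thesis using finQ by (simp only: card_Diff_subset[OF finite_Int[OF disjI1[OF finQ]] Int_lower2] card_atLeastAtMost)
    qed
    \<comment> \<open>More than \<open>g - r\<close> letters are left over, while columns are
      numbered below \<open>g - r\<close>; so two of these letters share a column.\<close>
    then have cF: "g - r < card F" using small two_r_le by simp
    have "colof nu ` F \<subseteq> {..<g - r}" using colof_nu_less by (auto simp: F_def)
    then have "card (colof nu ` F) \<le> g - r" using card_mono[of "{..<g - r}"] by simp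
    then have "card (colof nu ` F) < card F" using cF by simp
    then have "\<not> inj_on (colof nu) F" by (rule pigeonhole)
    then obtain a b where ab: "a \<in> F" "b \<in> F" "a \<noteq> b" "colof nu a = colof nu b" by (auto simp: inj_on_def)
    define t where "t = Transposition.transpose a b"
    have t: "t permutes {1..g}" unfolding t_def using ab by (intro permutes_swap_id) (auto simp: F_def)
    have tC: "t \<in> T.Cols" unfolding T.Cols_def using t ab by (auto simp: t_def Transposition.transpose_def)
    have tt: "t (t c) = c" for c by (simp add: t_def)
    have tQ: "t q = q" if "q \<in> Q" for q
      using that ab by (auto simp: t_def F_def Transposition.transpose_def)
    \<comment> \<open>A block with only top vertices has its letters moved alike, a propagating
      block carries a letter that \<open>t\<close> fixes, and bottom vertices are labelled by
      \<open>xs\<close>, which is left alone.\<close>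
    have tX: "map t ys \<in> X" if ys: "ys \<in> X" for ys
    proof -
      have ysw: "ys \<in> words k N" and ag: "agrees d (word_label k N ys xs)"
        using ys by (auto simp: X_def labels_agree_agrees)
      let ?f = "word_label k N ys xs" and ?f' = "word_label k N (map t ys) xs"
      have len: "length (complete_word k N ys) = strands k" using ysw by (cases k) (auto simp: tuples_def)
      have un: "?f' (Unprimed i) = t (?f (Unprimed i))" if "Unprimed i \<in> ?V" for i
      proof -
        have "i - 1 < strands k" using that by auto
        then show ?thesis by (simp add: complete_word_map[OF t N_pos] len)
      qed
      have "agrees d ?f'"
      proof (rule agreesI)
        fix B v w assume B: "B \<in> d" "v \<in> B" "w \<in> B"
        have BV: "B \<subseteq> ?V" using B(1) partition_onD1[OF p] by blast
        show "?f' v = ?f' w"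
        proof (cases "\<exists>j. Primed j \<in> B")
          case False
          then obtain i j where ij: "v = Unprimed i" "w = Unprimed j" using B by (metis vertex.exhaust)
          have "?f v = ?f w" by (rule agreesD[OF ag B])
          moreover have "Unprimed i \<in> ?V" "Unprimed j \<in> ?V" using ij B BV by blast+
          ultimately show ?thesis using un ij by metis
        next
          case True
          then obtain j0 where j0: "Primed j0 \<in> B" by blast
          have "?f' u = ?f (Primed j0)" if u: "u \<in> B" for u
          proof (cases u)
            case (Unprimed i)
            then have "B \<in> PB" using B(1) j0 u by (auto simp: PB_def)
            then have "f (Primed j0) \<in> Q" using Q j0 by blast
            then have q: "t (?f (Primed j0)) = ?f (Primed j0)" using tQ by (simp add: f_def)
            have "?f' u = t (?f u)" using un[of i] u BV Unprimed by auto
            also have "?f u = ?f (Primed j0)" by (rule agreesD[OF ag B(1) u j0])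
            finally show ?thesis using q by simp
          next
            case (Primed i)
            then have "?f' u = ?f u" by simp
            also have "\<dots> = ?f (Primed j0)" by (rule agreesD[OF ag B(1) u j0])
            finally show ?thesis .
          qed
          then show ?thesis using B by metis
        qed
      qed
      then show ?thesis using map_tuples[OF group_permutes[OF t] ysw] by (simp add: X_def labels_agree_agrees)
    qed
    have inv: "map t (map t ys) = ys" for ys by (simp add: map_idI tt)
    have "bij_betw (map t) X X"
      by (rule bij_betw_byWitness[where f' = "map t"]) (use tX inv in auto)
    from sum.reindex_bij_betw[OF this, of "\<lambda>ys. single ys (1::complex)"]
    have fixed: "perm_action t (act (single d 1) (single xs 1)) = act (single d 1) (single xs 1)"
      by (simp add: actX linear_map_sum[OF linear_perm_action])
    let ?x = "group_action y (act (single d 1) (single xs 1))"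
    have "?x = group_action y (group_action (single t 1) (act (single d 1) (single xs 1)))"
      by (simp add: group_action_single fixed)
    also have "\<dots> = group_action (group_mult y (single t 1)) (act (single d 1) (single xs 1))"
      by (rule group_action_mult[symmetric])
    also have "\<dots> = scale (of_int (sign t)) ?x"
      by (simp only: y_absorb_right[OF tC] linear_map_scale[OF linear_group_action_left])
    also have "sign t = - 1" unfolding t_def using ab(3) by (simp add: sign_swap_id)
    finally have neg: "?x = - ?x" by (simp add: scale_minus_one)
    show ?thesis
    proof (rule poly_mapping_eqI)
      fix z
      have "lookup ?x z = - lookup ?x z" using arg_cong[OF neg, of "\<lambda>f. lookup f z"] by simp
      then show "lookup ?x z = lookup 0 z" by simp
    qed
  qed
qed

lemma low_diagram_kills:
  assumes d: "d \<in> diagrams k" and low: "propagating_number d < propagating_bound k r" and u: "u \<in> carrier Y"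
  shows "act (single d 1) u = 0"
proof -
  obtain v where v: "v \<in> W" "u = group_action y v" using u by (auto elim!: Y_carrierE)
  have "group_action y (act (single d 1) v) = 0"
  proof (rule linear_map_eqI[where S = "\<lambda>v. group_action y (act (single d 1) v)" and T = "\<lambda>_. 0"])
    show "linear_map (\<lambda>v. group_action y (act (single d 1) v))"
      by (rule linear_map_comp[OF linear_group_action_right linear_diagram_action_right])
    show "linear_map (\<lambda>_. 0)" by (simp add: linear_map_def)
    show "keys v \<subseteq> words k N" using v by (simp add: mem_tensor_space)
    show "group_action y (act (single d 1) (single xs 1)) = 0" if "xs \<in> words k N" for xs
      by (rule low_diagram_kills_word[OF d low that])
  qed
  then show ?thesis using act_group_action[OF y_span _ v(1), of "single d 1"] d v(2) by simp
qed

lemma act_trunc: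
  assumes a: "a \<in> diagram_span k" and u: "u \<in> carrier Y"
  shows "act (trunc k r a) u = act a u"
proof (rule linear_map_eqI[where S = "\<lambda>a. act (trunc k r a) u" and T = "\<lambda>a. act a u"])
  show "linear_map (\<lambda>a. act (trunc k r a) u)" by (rule linear_map_comp[OF linear_diagram_action_left linear_trunc])
  show "linear_map (\<lambda>a. act a u)" by (rule linear_diagram_action_left)
  show "keys a \<subseteq> diagrams k" using a by (simp add: diagram_span_def)
  show "act (trunc k r (single d 1)) u = act (single d 1) u" if "d \<in> diagrams k" for d
    using low_diagram_kills[OF that _ u] by (simp add: trunc_single linear_map_zero[OF linear_diagram_action_left])
qed

subsection \<open>Transitivity\<close>

text \<open>The operator \<open>sum over w of w (u' z*) w^-1\<close> commutes with the group and maps \<open>u\<close> to a multiple of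
  \<open>u'\<close>, because \<open>y b y\<close> is a multiple of \<open>y\<close> for every \<open>b\<close> in the group algebra.\<close>

lemma Y_transitive:
  assumes u: "u \<in> carrier Y" "u \<noteq> 0" and u': "u' \<in> carrier Y"
  shows "\<exists>a\<in>diagram_span k. act a u = u'"
proof -
  let ?G = "{w. w permutes {1..g}}"
  have finG: "finite ?G" by (simp add: finite_permutations)
  obtain z where z: "lookup u z \<noteq> 0" using u(2) by (metis lookup_zero poly_mapping_eqI)
  have uW: "u \<in> W" "u' \<in> W" using u u' Y_subset by auto
  have zw: "z \<in> words k N" using z uW(1) by (auto simp: mem_tensor_space in_keys_iff)
  define M where "M ys xs = (\<Sum>w\<in>?G. lookup u' (map (pinv w) ys) * of_bool (map (pinv w) xs = z))" for ys xs
  have inv: "M (map h ys) (map h xs) = M ys xs" if h: "h permutes {1..g}" for h ys xs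
  proof -
    have hb: "bij h" by (rule permutes_bij[OF h])
    have b: "bij_betw ((\<circ>) h) ?G ?G"
      using permutes_compose[OF _ h] permutes_compose[OF _ permutes_inv[OF h]] comp_cancel_left[OF hb]
      by (intro bij_betw_byWitness[where f' = "(\<circ>) (pinv h)"]) auto
    have m: "map (pinv (h \<circ> w)) (map h zs) = map (pinv w) zs" if "w permutes {1..g}" for w zs
      using permutes_bij[OF that] hb by (simp add: o_inv_distrib inv_f_f bij_is_inj)
    have "M (map h ys) (map h xs) = (\<Sum>w\<in>?G. lookup u' (map (pinv (h \<circ> w)) (map h ys)) * of_bool (map (pinv (h \<circ> w)) (map h xs) = z))"
      unfolding M_def by (rule sum.reindex_bij_betw[OF b, symmetric])
    also have "\<dots> = M ys xs" unfolding M_def by (intro sum.cong refl) (simp only: m mem_Collect_eq)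
    finally show ?thesis .
  qed
  obtain a where a: "a \<in> diagram_span k"
    "\<And>ys xs. ys \<in> words k N \<Longrightarrow> xs \<in> words k N \<Longrightarrow> lookup (act a (single xs 1)) ys = M ys xs"
    using invariant_matrix_is_action[OF N_ge N_pos, of M] inv by blast
  \<comment> \<open>Applying the operator to \<open>u\<close> collects the coefficients of
    \<open>u\<close> along the orbit of \<open>z\<close> into an element of the group algebra, which
    then acts on \<open>u'\<close>.\<close>
  define b where "b = (\<Sum>w\<in>?G. single w (lookup u (map w z)))"
  have act_u: "act a u = group_action b u'"
  proof (rule poly_mapping_eqI)
    fix ys
    have R: "lookup (group_action b u') ys = (\<Sum>w\<in>?G. lookup u (map w z) * lookup u' (map (pinv w) ys))"
      unfolding b_def linear_map_sum[OF linear_group_action_left] lookup_sum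
    proof (intro sum.cong refl)
      fix w assume "w \<in> ?G"
      then have "bij w" using permutes_bij by blast
      then show "lookup (group_action (single w (lookup u (map w z))) u') ys = lookup u (map w z) * lookup u' (map (pinv w) ys)"
        by (simp add: group_action_single lookup_perm_action)
    qed
    show "lookup (act a u) ys = lookup (group_action b u') ys"
    proof (cases "ys \<in> words k N")
      case True
      have "lookup (act a u) ys = (\<Sum>xs\<in>words k N. lookup u xs * M ys xs)"
        unfolding lookup_diagram_action[OF uW(1)] using a(2)[OF True] by (intro sum.cong refl) simp
      also have "\<dots> = (\<Sum>xs\<in>words k N. \<Sum>w\<in>?G. lookup u xs * (lookup u' (map (pinv w) ys) * of_bool (map (pinv w) xs = z)))"
        by (simp only: M_def sum_distrib_left)
      also have "\<dots> = (\<Sum>w\<in>?G. \<Sum>xs\<in>words k N. lookup u xs * (lookup u' (map (pinv w) ys) * of_bool (map (pinv w) xs = z)))"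
        by (rule sum.swap)
      also have "\<dots> = (\<Sum>w\<in>?G. lookup u (map w z) * lookup u' (map (pinv w) ys))"
      proof (rule sum.cong[OF refl])
        fix w assume "w \<in> ?G"
        then have w: "w permutes {1..g}" by simp
        have eq: "map (pinv w) xs = z \<longleftrightarrow> xs = map w z" for xs
          using permutes_inverses[OF w] by (auto simp: map_idI)
        have wz: "map w z \<in> words k N" by (rule map_tuples[OF group_permutes[OF w] zw])
        have "(\<Sum>xs\<in>words k N. lookup u xs * (lookup u' (map (pinv w) ys) * of_bool (map (pinv w) xs = z))) =
            (\<Sum>xs\<in>words k N. if xs = map w z then lookup u xs * lookup u' (map (pinv w) ys) else 0)"
          by (intro sum.cong refl) (simp add: eq)
        then show "(\<Sum>xs\<in>words k N. lookup u xs * (lookup u' (map (pinv w) ys) * of_bool (map (pinv w) xs = z))) =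
            lookup u (map w z) * lookup u' (map (pinv w) ys)"
          using wz by simp
      qed
      finally show ?thesis by (simp only: R)
    next
      case False
      have "b \<in> perm_span {1..g}" unfolding b_def by (rule perm_span_sum) simp
      then have "group_action b u' \<in> W" using uW(2) by (rule group_action_closed)
      moreover have "act a u \<in> W" by (rule diagram_action_closed)
      ultimately have "ys \<notin> keys (act a u)" "ys \<notin> keys (group_action b u')" using False by (auto simp: mem_tensor_space)
      then show ?thesis by (simp add: in_keys_iff)
    qed
  qed
  obtain u0 where u0: "u0 \<in> W" "u = group_action y u0" using u(1) by (auto elim!: Y_carrierE)
  obtain u0' where u0': "u0' \<in> W" "u' = group_action y u0'" using u' by (auto elim!: Y_carrierE)
  define b0 where "b0 = (\<Sum>w\<in>?G. single w (lookup u0 (map w z)))"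
  have lb: "lookup b w = lookup u (map w z)" "lookup b0 w = lookup u0 (map w z)" if "w permutes {1..g}" for w
    unfolding b_def b0_def using that finG by (simp_all add: lookup_sum_single)
  have b0s: "b0 \<in> perm_span {1..g}" and bs: "b \<in> perm_span {1..g}"
    unfolding b0_def b_def by (rule perm_span_sum, simp)+
  \<comment> \<open>Writing \<open>u = y u0\<close> turns these coefficients into those of
    \<open>y b0\<close>; with \<open>u' = y u0'\<close> the product \<open>y b0 y\<close>
    appears.\<close>
  have b_y: "b = group_mult y b0"
  proof (rule poly_mapping_eqI)
    fix w
    show "lookup b w = lookup (group_mult y b0) w"
    proof (cases "w permutes {1..g}")
      case True
      have hp: "h permutes {1..g}" if "h \<in> keys y" for h using y_span that by (auto simp: perm_span_def)
      have "lookup b w = (\<Sum>h\<in>keys y. lookup y h * lookup (perm_action h u0) (map w z))"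
        using True by (simp add: lb u0(2) group_action_def lookup_lin_ext)
      also have "\<dots> = (\<Sum>h\<in>keys y. lookup y h * lookup (group_mult (single h 1) b0) w)"
      proof (intro sum.cong refl)
        fix h assume "h \<in> keys y"
        then have h: "h permutes {1..g}" "bij h" using hp permutes_bij by blast+
        have "pinv h \<circ> w permutes {1..g}" by (rule permutes_compose[OF True permutes_inv[OF h(1)]])
        then show "lookup y h * lookup (perm_action h u0) (map w z) = lookup y h * lookup (group_mult (single h 1) b0) w"
          by (simp add: lookup_perm_action[OF h(2)] lookup_group_mult_single_left[OF h(2)] lb)
      qed
      also have "\<dots> = lookup (group_mult y b0) w"
      proof -
        have "group_mult y b0 = (\<Sum>h\<in>keys y. scale (lookup y h) (group_mult (single h 1) b0))"
          by (rule linear_map_expansion[OF linear_group_mult_left])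
        then show ?thesis by (simp add: lookup_sum)
      qed
      finally show ?thesis .
    next
      case False
      then have "w \<notin> keys b" "w \<notin> keys (group_mult y b0)" using bs perm_span_mult[OF y_span b0s] by (auto simp: perm_span_def)
      then show ?thesis by (simp add: in_keys_iff)
    qed
  qed
  define c where "c = lookup (group_mult (group_mult y b0) y) id"
  have "act a u = group_action (group_mult (group_mult y b0) y) u0'"
    unfolding act_u b_y u0'(2) by (simp only: group_action_mult)
  also have "group_mult (group_mult y b0) y = scale c y"
    unfolding c_def by (rule y_sandwich[OF b0s])
  finally have cu: "act a u = scale c u'"
    by (simp only: linear_map_scale[OF linear_group_action_left] u0'(2))
  \<comment> \<open>As a coefficient, \<open>c\<close> is the value at \<open>z\<close> of
    \<open>y u\<close>, and \<open>y u = c' u\<close> because \<open>u\<close> is of the form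
    \<open>y u0\<close>; the word \<open>z\<close> was chosen in the support of
    \<open>u\<close>.\<close>
  have "c \<noteq> 0"
  proof -
    obtain c' where c': "c' \<noteq> 0" "group_mult y y = scale c' y" by (rule y_square)
    have "c = (\<Sum>w\<in>?G. lookup u (map w z) * lookup y (pinv w))"
    proof -
      have "group_mult b y = (\<Sum>w\<in>?G. scale (lookup u (map w z)) (group_mult (single w 1) y))"
        unfolding b_def linear_map_sum[OF linear_group_mult_left]
        using linear_map_scale[OF linear_group_mult_left, of _ "single _ 1" y] by (intro sum.cong refl) (metis mult.right_neutral scale_single)
      then have "c = (\<Sum>w\<in>?G. lookup u (map w z) * lookup (group_mult (single w 1) y) id)"
        by (simp add: c_def lookup_sum flip: b_y)
      also have "\<dots> = (\<Sum>w\<in>?G. lookup u (map w z) * lookup y (pinv w))"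
      proof (intro sum.cong refl)
        fix w assume "w \<in> ?G"
        then have "bij w" using permutes_bij by blast
        then show "lookup u (map w z) * lookup (group_mult (single w 1) y) id = lookup u (map w z) * lookup y (pinv w)"
          by (simp add: lookup_group_mult_single_left)
      qed
      finally show ?thesis .
    qed
    also have "\<dots> = (\<Sum>w\<in>?G. lookup u (map (pinv w) z) * lookup y w)"
    proof -
      have "bij_betw pinv ?G ?G"
        by (rule bij_betw_byWitness[where f' = pinv]) (auto simp: permutes_inv permutes_inv_inv)
      from sum.reindex_bij_betw[OF this, of "\<lambda>w. lookup u (map (pinv w) z) * lookup y w"]
      have "(\<Sum>w\<in>?G. lookup u (map (pinv (pinv w)) z) * lookup y (pinv w)) = (\<Sum>w\<in>?G. lookup u (map (pinv w) z) * lookup y w)" .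
      moreover have "(\<Sum>w\<in>?G. lookup u (map (pinv (pinv w)) z) * lookup y (pinv w)) = (\<Sum>w\<in>?G. lookup u (map w z) * lookup y (pinv w))"
        by (intro sum.cong refl) (simp add: permutes_inv_inv)
      ultimately show ?thesis by simp
    qed
    also have "\<dots> = (\<Sum>w\<in>keys y. lookup y w * lookup (perm_action w u) z)"
    proof -
      have "(\<Sum>w\<in>?G. lookup u (map (pinv w) z) * lookup y w) = (\<Sum>w\<in>keys y. lookup u (map (pinv w) z) * lookup y w)"
        using y_span finG by (intro sum.mono_neutral_right) (auto simp: perm_span_def in_keys_iff)
      also have "\<dots> = (\<Sum>w\<in>keys y. lookup y w * lookup (perm_action w u) z)"
      proof (intro sum.cong refl)
        fix w assume "w \<in> keys y"
        then have "bij w" using y_span permutes_bij unfolding perm_span_def by blast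
        then show "lookup u (map (pinv w) z) * lookup y w = lookup y w * lookup (perm_action w u) z"
          by (simp add: lookup_perm_action)
      qed
      finally show ?thesis .
    qed
    also have "\<dots> = lookup (group_action y u) z" by (simp add: group_action_def lookup_lin_ext)
    also have "group_action y u = scale c' u"
      unfolding u0(2) group_action_mult[symmetric] c'(2) by (rule linear_map_scale[OF linear_group_action_left])
    finally have "c = c' * lookup u z" by simp
    then show ?thesis using c'(1) z by simp
  qed
  then have "act (scale (1 / c) a) u = u'"
    by (simp add: linear_map_scale[OF linear_diagram_action_left] cu)
  then show ?thesis using a(1) by (intro bexI[of _ "scale (1 / c) a"]) auto
qed

end

context multiplicity
begin

subsection \<open>The generator acts nontrivially\<close>

definition generator :: "diagram \<Rightarrow>\<^sub>0 complex" where
  "generator = padded_elem k r (young_symmetrizer lam)"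

lemma generator_closed: "generator \<in> diagram_span k"
  unfolding generator_def young_symmetrizer_tableau[OF sorted_lam]
  by (rule padded_elem_closed[OF S.symmetrizer_span boxes_le])

lemma generator_expansion:
  "generator = (\<Sum>u\<in>S.Rows. \<Sum>v\<in>S.Cols. single (padded k r (v \<circ> u)) (of_int (sign v)))"
  unfolding generator_def eval_coeffs_e_elem[OF sorted_lam, of 0, symmetric] e_elem_expansion[OF sorted_lam]
  by (simp add: eval_coeffs_sum eval_coeffs_single)

text \<open>Moves the numbers up to \<open>r\<close> onto the entries of the rows below the first
  and the remaining letters to the front. Conjugation by it lets permutations of
  \<open>{1..r}\<close> act on the lower rows of \<open>nu\<close> as on \<open>lam\<close>.\<close>

definition shift :: "nat \<Rightarrow> nat" where
  "shift i = (if i \<in> {1..r} then g - r + i else if i \<in> {r<..g} then i - r else i)"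

lemma shift_permutes: "shift permutes {1..g}"
proof (rule bij_imp_permutes)
  show "bij_betw shift {1..g} {1..g}"
    using two_r_le
    by (intro bij_betw_byWitness[where f' = "\<lambda>t. if t \<in> {g - r<..g} then t - (g - r) else t + r"])
      (auto simp: shift_def)
  show "shift x = x" if "x \<notin> {1..g}" for x using that two_r_le by (auto simp: shift_def)
qed

definition shifted :: "(nat \<Rightarrow> nat) \<Rightarrow> nat \<Rightarrow> nat" where
  "shifted w = shift \<circ> w \<circ> pinv shift"

lemma shifted_permutes: "w permutes {1..r} \<Longrightarrow> shifted w permutes {1..g}"
proof -
  assume "w permutes {1..r}"
  then have "w permutes {1..g}" using two_r_le by (intro permutes_mono[of w r g]) auto
  then show ?thesis unfolding shifted_def
    by (intro permutes_compose permutes_inv[OF shift_permutes] shift_permutes)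
qed

lemma shifted_low:
  assumes "i \<in> {1..r}" "w permutes {1..r}"
  shows "shifted w (g - r + i) = g - r + w i"
proof -
  have wi: "w i \<in> {1..r}" using assms permutes_in_image[OF assms(2)] by blast
  have "shift i = g - r + i" "shift (w i) = g - r + w i" using assms(1) wi by (simp_all only: shift_def if_True)
  then have "pinv shift (g - r + i) = i" using permutes_inverses(2)[OF shift_permutes, of i] by simp
  then show ?thesis using \<open>shift (w i) = g - r + w i\<close> by (simp add: shifted_def)
qed

lemma shifted_top:
  assumes t: "t \<in> {1..g - r}" and w: "w permutes {1..r}"
  shows "shifted w t = t"
proof -
  have "shift (t + r) = t" using t two_r_le by (auto simp: shift_def)
  moreover have "w (t + r) = t + r" using t by (intro permutes_not_in[OF w]) auto
  moreover have "pinv shift t = t + r" using \<open>shift (t + r) = t\<close> permutes_inverses(2)[OF shift_permutes, of "t + r"] by simp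
  ultimately show ?thesis by (simp add: shifted_def)
qed

lemma group_cases: "t \<in> {1..g} \<Longrightarrow> t \<in> {1..g - r} \<or> (\<exists>i\<in>{1..r}. t = g - r + i)"
  using two_r_le by (cases "t \<le> g - r") (auto intro!: bexI[of _ "t - (g - r)"])

lemma shifted_Rows: "u \<in> S.Rows \<Longrightarrow> shifted u \<in> T.Rows"
proof -
  assume u: "u \<in> S.Rows"
  then have up: "u permutes {1..r}" and ur: "\<And>i. i \<in> {1..r} \<Longrightarrow> rowof lam (u i) = rowof lam i"
    unfolding S.Rows_def by blast+
  have "rowof nu (shifted u t) = rowof nu t" if t: "t \<in> {1..g}" for t
    using group_cases[OF t]
  proof
    assume "\<exists>i\<in>{1..r}. t = g - r + i"
    then obtain i where i: "i \<in> {1..r}" "t = g - r + i" by blast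
    then have "u i \<in> {1..r}" using permutes_in_image[OF up] by blast
    then show ?thesis unfolding i(2) shifted_low[OF i(1) up] using nu_low(1) ur[OF i(1)] i(1) by simp
  qed (simp only: shifted_top[OF _ up])
  then show "shifted u \<in> T.Rows" unfolding T.Rows_def using shifted_permutes[OF up] by blast
qed

lemma shifted_Cols: "v \<in> S.Cols \<Longrightarrow> shifted v \<in> T.Cols"
proof -
  assume v: "v \<in> S.Cols"
  then have vp: "v permutes {1..r}" and vr: "\<And>i. i \<in> {1..r} \<Longrightarrow> colof lam (v i) = colof lam i"
    unfolding S.Cols_def by blast+
  have "colof nu (shifted v t) = colof nu t" if t: "t \<in> {1..g}" for t
    using group_cases[OF t]
  proof
    assume "\<exists>i\<in>{1..r}. t = g - r + i"
    then obtain i where i: "i \<in> {1..r}" "t = g - r + i" by blast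
    then have "v i \<in> {1..r}" using permutes_in_image[OF vp] by blast
    then show ?thesis unfolding i(2) shifted_low[OF i(1) vp] using nu_low(2) vr[OF i(1)] i(1) by simp
  qed (simp only: shifted_top[OF _ vp])
  then show "shifted v \<in> T.Cols" unfolding T.Cols_def using shifted_permutes[OF vp] by blast
qed

lemma sign_shifted: "v permutes {1..r} \<Longrightarrow> sign (shifted v) = sign v"
proof -
  assume "v permutes {1..r}"
  then have v: "v permutes {1..g}" using two_r_le by (intro permutes_mono[of v r g]) auto
  note s = shift_permutes and s' = permutes_inv[OF shift_permutes]
  have "sign (shifted v) = sign shift * sign v * sign (pinv shift)"
    unfolding shifted_def using T.sign_comp[OF permutes_compose[OF s' v] s] T.sign_comp[OF v s] T.sign_comp[OF s' permutes_compose[OF v s]]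
    by (metis T.sign_comp permutes_compose s s' v)
  also have "sign (pinv shift) = sign shift" using s by (metis T.finite_entries permutation_permutes sign_inverse)
  also have "sign shift * sign v * sign shift = sign v * (sign shift * sign shift)" by (simp only: ac_simps)
  finally show ?thesis by (simp only: sign_idempotent mult_1_right)
qed

text \<open>The first \<open>r\<close> places carry the entries of the lower rows of
  \<open>nu\<close>, all distinct. The filler \<open>N\<close> is what the padding block demands in
  the half-integer case.\<close>

definition test_word :: "nat list" where
  "test_word = map (\<lambda>i. if i < r then g - r + Suc i else N) [0..<tensor_degree k]"

lemma test_word_tuples: "test_word \<in> words k N"
  using two_r_le g_le N_pos by (auto simp: test_word_def tuples_def)

lemma test_word_nth:
  assumes "i \<in> {1..r}"
  shows "test_word ! (i - 1) = g - r + i"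
proof -
  have i: "i - 1 < tensor_degree k" "i - 1 < r" "Suc (i - 1) = i" using assms boxes_le by auto
  have "test_word ! (i - 1) = (if i - 1 < r then g - r + Suc (i - 1) else N)" using i(1) by (simp add: test_word_def)
  then show ?thesis using i by simp
qed

text \<open>Agreement means that \<open>\<pi>\<close> fixes every entry below the first row; it only
  permutes the first row and so lies in the row stabilizer. Then
  \<open>\<gamma> \<circ> shifted v\<close> lies in both stabilizers, hence is the identity, and the
  signs cancel.\<close>

lemma agreement_sign:
  assumes ru: "\<rho> \<in> T.Rows" "\<gamma> \<in> T.Cols" "u \<in> S.Rows" "v \<in> S.Cols"
    and ag: "labels_agree k N (padded k r (v \<circ> u)) (map (pinv (\<rho> \<circ> \<gamma>)) test_word) test_word"
  shows "sign \<gamma> * sign v = 1"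
proof -
  have perm: "\<rho> permutes {1..g}" "\<gamma> permutes {1..g}" "u permutes {1..r}" "v permutes {1..r}"
    using ru T.Rows_permutes T.Cols_permutes S.Rows_permutes S.Cols_permutes by blast+
  have h: "\<rho> \<circ> \<gamma> permutes {1..g}" by (rule permutes_compose[OF perm(2,1)])
  have vu: "v \<circ> u permutes {1..r}" by (rule permutes_compose[OF perm(3,4)])
  have mw: "map (pinv (\<rho> \<circ> \<gamma>)) test_word \<in> words k N"
    by (rule map_tuples[OF group_permutes[OF permutes_inv[OF h]] test_word_tuples])
  have len: "length test_word = tensor_degree k" by (simp add: test_word_def)
  define \<pi> where "\<pi> = (\<rho> \<circ> \<gamma>) \<circ> (shifted v \<circ> shifted u)"
  have \<pi>: "\<pi> permutes {1..g}"
    unfolding \<pi>_def by (intro permutes_compose h shifted_permutes perm)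
  have fixed: "\<pi> (g - r + i) = g - r + i" if i: "i \<in> {1..r}" for i
  proof -
    have ui: "u i \<in> {1..r}" "v (u i) \<in> {1..r}" using i permutes_in_image[OF perm(3)] permutes_in_image[OF perm(4)] by blast+
    have "map (pinv (\<rho> \<circ> \<gamma>)) test_word ! (i - 1) = test_word ! ((v \<circ> u) i - 1)"
      using ag i unfolding labels_agree_padded[OF vu boxes_le mw test_word_tuples] by blast
    moreover have "i - 1 < length test_word" using i boxes_le len by auto
    ultimately have "pinv (\<rho> \<circ> \<gamma>) (g - r + i) = g - r + v (u i)"
      using test_word_nth[OF i] test_word_nth[OF ui(2)] by simp
    then have "(\<rho> \<circ> \<gamma>) (g - r + v (u i)) = g - r + i"
      using permutes_inverses(1)[OF h, of "g - r + i"] by simp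
    then show ?thesis using shifted_low[OF i perm(3)] shifted_low[OF ui(1) perm(4)] by (simp add: \<pi>_def)
  qed
  have "rowof nu (\<pi> t) = rowof nu t" if t: "t \<in> {1..g}" for t
    using group_cases[OF t]
  proof
    assume top: "t \<in> {1..g - r}"
    have "\<pi> t \<in> {1..g}" using t permutes_in_image[OF \<pi>] by blast
    moreover have "\<pi> t \<noteq> g - r + i" if i: "i \<in> {1..r}" for i
    proof
      assume "\<pi> t = g - r + i"
      then have "\<pi> t = \<pi> (g - r + i)" using fixed[OF i] by simp
      then have "t = g - r + i" using permutes_inj[OF \<pi>] by (simp add: inj_eq)
      then show False using top i by auto
    qed
    ultimately have "\<pi> t \<in> {1..g - r}" using group_cases by blast
    then show ?thesis using nu_top top by simp
  qed (use fixed in auto)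
  then have \<pi>R: "\<pi> \<in> T.Rows" unfolding T.Rows_def using \<pi> by blast
  have uR: "shifted u \<in> T.Rows" by (rule shifted_Rows[OF ru(3)])
  have "\<gamma> \<circ> shifted v = pinv \<rho> \<circ> \<pi> \<circ> pinv (shifted u)"
    using permutes_inverses[OF perm(1)] permutes_inverses[OF shifted_permutes[OF perm(3)]]
    by (simp add: fun_eq_iff \<pi>_def)
  then have "\<gamma> \<circ> shifted v \<in> T.Rows" using T.Rows_comp T.Rows_inv ru(1) \<pi>R uR by simp
  moreover have "\<gamma> \<circ> shifted v \<in> T.Cols" using T.Cols_comp ru(2) shifted_Cols[OF ru(4)] by blast
  ultimately have "\<gamma> \<circ> shifted v = id" by (rule T.Rows_Cols_id)
  moreover have "sign (\<gamma> \<circ> shifted v) = sign \<gamma> * sign v"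
    using T.sign_comp[OF perm(2) shifted_permutes[OF perm(4)]] sign_shifted[OF perm(4)] by simp
  ultimately show ?thesis by simp
qed

text \<open>The coefficient of the test word in \<open>y e\<close> applied to the test word expands
  into terms \<open>sign \<gamma> * sign v\<close>, one for each agreement. All of them are 1 by
  \<open>agreement_sign\<close>, so nothing cancels, and the identity permutations contribute
  one.\<close>

lemma generator_acts_nontrivially:
  obtains u where "u \<in> carrier Y" "act generator u \<noteq> 0"
proof -
  define P where "P \<rho> \<gamma> u v \<longleftrightarrow> labels_agree k N (padded k r (v \<circ> u)) (map (pinv (\<rho> \<circ> \<gamma>)) test_word) test_word"
    for \<rho> \<gamma> u v :: "nat \<Rightarrow> nat"
  let ?x = "single test_word (1::complex)"
  have lookup_e: "lookup (act generator ?x) z = (\<Sum>u\<in>S.Rows. \<Sum>v\<in>S.Cols. of_int (sign v) *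
      of_bool (z \<in> words k N \<and> labels_agree k N (padded k r (v \<circ> u)) z test_word))" for z
  proof -
    have s: "act (single d (of_int j)) ?x = scale (of_int j) (act (single d 1) ?x)" for d j
      using linear_map_scale[OF linear_diagram_action_left, of k N "of_int j" "single d 1" ?x] by simp
    show ?thesis
      unfolding generator_expansion linear_map_sum[OF linear_diagram_action_left] lookup_sum s lookup_scale
        lookup_diagram_action_single by (rule refl)
  qed
  have y_sum: "y = (\<Sum>\<rho>\<in>T.Rows. \<Sum>\<gamma>\<in>T.Cols. single (\<rho> \<circ> \<gamma>) (of_int (sign \<gamma>)))"
    unfolding y_def T.symmetrizer_def T.row_sum_def T.col_sum_def group_mult_double_sum by simp
  have "lookup (group_action y (act generator ?x)) test_word =
      (\<Sum>\<rho>\<in>T.Rows. \<Sum>\<gamma>\<in>T.Cols. of_int (sign \<gamma>) * lookup (act generator ?x) (map (pinv (\<rho> \<circ> \<gamma>)) test_word))"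
    unfolding y_sum linear_map_sum[OF linear_group_action_left] lookup_sum group_action_single lookup_scale
  proof (intro sum.cong refl)
    fix \<rho> \<gamma> assume "\<rho> \<in> T.Rows" "\<gamma> \<in> T.Cols"
    then have "bij (\<rho> \<circ> \<gamma>)" by (intro bij_comp T.bij_Rows T.bij_Cols)
    then show "of_int (sign \<gamma>) * lookup (perm_action (\<rho> \<circ> \<gamma>) (act generator ?x)) test_word =
        of_int (sign \<gamma>) * lookup (act generator ?x) (map (pinv (\<rho> \<circ> \<gamma>)) test_word)"
      by (simp only: lookup_perm_action)
  qed
  also have "\<dots> = (\<Sum>\<rho>\<in>T.Rows. \<Sum>\<gamma>\<in>T.Cols. \<Sum>u\<in>S.Rows. \<Sum>v\<in>S.Cols. of_bool (P \<rho> \<gamma> u v))"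
    unfolding lookup_e sum_distrib_left
  proof (intro sum.cong refl)
    fix \<rho> \<gamma> u v assume ru: "\<rho> \<in> T.Rows" "\<gamma> \<in> T.Cols" "u \<in> S.Rows" "v \<in> S.Cols"
    have "\<rho> \<circ> \<gamma> permutes {1..g}" using ru T.Rows_permutes T.Cols_permutes permutes_compose by blast
    then have mw: "map (pinv (\<rho> \<circ> \<gamma>)) test_word \<in> words k N"
      by (intro map_tuples[OF group_permutes[OF permutes_inv] test_word_tuples])
    show "of_int (sign \<gamma>) * (of_int (sign v) * of_bool (map (pinv (\<rho> \<circ> \<gamma>)) test_word \<in> words k N \<and>
        labels_agree k N (padded k r (v \<circ> u)) (map (pinv (\<rho> \<circ> \<gamma>)) test_word) test_word)) = (of_bool (P \<rho> \<gamma> u v) :: complex)"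
    proof (cases "P \<rho> \<gamma> u v")
      case True
      have "sign \<gamma> * sign v = 1" using agreement_sign[OF ru] True by (simp add: P_def)
      then have "of_int (sign \<gamma>) * of_int (sign v) = (1::complex)" by (metis of_int_1 of_int_mult)
      then show ?thesis using True mw by (simp add: P_def)
    next
      case False
      then show ?thesis by (simp add: P_def)
    qed
  qed
  also have "\<dots> = of_nat (\<Sum>\<rho>\<in>T.Rows. \<Sum>\<gamma>\<in>T.Cols. \<Sum>u\<in>S.Rows. \<Sum>v\<in>S.Cols. of_bool (P \<rho> \<gamma> u v))"
    by (simp only: of_nat_sum of_nat_of_bool)
  finally have eq: "lookup (group_action y (act generator ?x)) test_word =
      of_nat (\<Sum>\<rho>\<in>T.Rows. \<Sum>\<gamma>\<in>T.Cols. \<Sum>u\<in>S.Rows. \<Sum>v\<in>S.Cols. of_bool (P \<rho> \<gamma> u v))" .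
  have "P id id id id"
  proof -
    have "pinv (id \<circ> id) = (id :: nat \<Rightarrow> nat)" by (simp add: inv_id)
    moreover have "forced k N r test_word"
    proof (cases k)
      case (Half m)
      have "test_word ! (i - 1) = N" if "i \<in> {r<..m}" for i
      proof -
        have "i - 1 < tensor_degree k" "\<not> i - 1 < r" using that Half by auto
        then show ?thesis by (simp add: test_word_def)
      qed
      then show ?thesis using Half by (simp add: forced_def)
    qed (simp add: forced_def)
    ultimately show ?thesis
      unfolding P_def using labels_agree_padded[OF permutes_id boxes_le test_word_tuples test_word_tuples]
      by simp
  qed
  then have "(1::nat) \<le> (\<Sum>v\<in>S.Cols. of_bool (P id id id v))"
    using member_le_sum[of id S.Cols "\<lambda>v. of_bool (P id id id v) :: nat"] S.id_Cols S.finite_Cols by simp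
  also have "\<dots> \<le> (\<Sum>u\<in>S.Rows. \<Sum>v\<in>S.Cols. of_bool (P id id u v))"
    using member_le_sum[of id S.Rows "\<lambda>u. \<Sum>v\<in>S.Cols. of_bool (P id id u v) :: nat"] S.id_Rows S.finite_Rows by simp
  also have "\<dots> \<le> (\<Sum>\<gamma>\<in>T.Cols. \<Sum>u\<in>S.Rows. \<Sum>v\<in>S.Cols. of_bool (P id \<gamma> u v))"
    using member_le_sum[of id T.Cols "\<lambda>\<gamma>. \<Sum>u\<in>S.Rows. \<Sum>v\<in>S.Cols. of_bool (P id \<gamma> u v) :: nat"] T.id_Cols T.finite_Cols by simp
  also have "\<dots> \<le> (\<Sum>\<rho>\<in>T.Rows. \<Sum>\<gamma>\<in>T.Cols. \<Sum>u\<in>S.Rows. \<Sum>v\<in>S.Cols. of_bool (P \<rho> \<gamma> u v))"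
    using member_le_sum[of id T.Rows "\<lambda>\<rho>. \<Sum>\<gamma>\<in>T.Cols. \<Sum>u\<in>S.Rows. \<Sum>v\<in>S.Cols. of_bool (P \<rho> \<gamma> u v) :: nat"] T.id_Rows T.finite_Rows by simp
  finally have "lookup (group_action y (act generator ?x)) test_word \<noteq> 0"
    unfolding eq by (simp only: of_nat_eq_0_iff)
  then have "group_action y (act generator ?x) \<noteq> 0" by auto
  moreover have xW: "?x \<in> W" using test_word_tuples by blast
  ultimately have "act generator (group_action y ?x) \<noteq> 0"
    using act_group_action[OF y_span generator_closed xW] by simp
  then show ?thesis using that[OF Y_carrierI[OF xW]] by blast
qed

text \<open>\<open>Y\<close> sees only the truncation, and the generator acts nontrivially on it.
  Neither the generator nor the truncation depends on \<open>N\<close>, so a single admissible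
  \<open>N\<close> settles this for every parameter.\<close>

lemma trunc_generator_nonzero: "trunc k r generator \<noteq> 0"
proof
  assume zero: "trunc k r generator = 0"
  obtain u where "u \<in> carrier Y" "act generator u \<noteq> 0" by (rule generator_acts_nontrivially)
  then show False
    using act_trunc[OF generator_closed, of u] zero by (simp add: linear_map_zero[OF linear_diagram_action_left])
qed

lemma generator_rank_one:
  fixes q :: complex
  assumes "a \<in> diagram_span k"
  shows "\<exists>c. trunc k r (pmul q (pmul q generator a) generator) = scale c (trunc k r generator)"
  unfolding generator_def young_symmetrizer_tableau[OF sorted_lam]
proof (rule padded_elem_sandwich[OF S.symmetrizer_span boxes_le _ assms])
  show "\<exists>c. group_mult (group_mult S.symmetrizer f) S.symmetrizer = scale c S.symmetrizer" if "f \<in> perm_span {1..r}" for f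
    using S.symmetrizer_sandwich[OF that] by blast
qed

abbreviation "X \<equiv> cell_module (of_nat N :: complex) k r generator"

text \<open>Evaluation at a vector \<open>v\<close> not killed by the generator \<open>e\<close>
  sends \<open>a e\<close> to \<open>a (e v)\<close>. It is compatible with truncation since low
  diagrams kill \<open>Y\<close>, surjective by transitivity and injective by irreducibility of
  \<open>X\<close>.\<close>

lemma X_iso_Y: "\<exists>f. module_iso A X Y f"
proof -
  obtain v where v: "v \<in> carrier Y" "act generator v \<noteq> 0" by (rule generator_acts_nontrivially)
  have irr: "irreducible_module A X"
    by (rule irreducible_cell_module[OF semisimple_partition_algebra[OF N_ge N_pos] generator_closed
          trunc_generator_nonzero generator_rank_one])
  have lX: "left_module A X" by (rule left_module_cell_module[OF generator_closed])
  interpret X: abelian_group X using lX by (rule left_moduleD)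
  have vW: "v \<in> W" by (rule Y_subset[OF v(1)])
  define f where "f x = act x v" for x
  have gv: "act generator v \<in> carrier Y" by (rule act_closed_Y[OF generator_closed v(1)])
  have f_gen: "f (trunc k r (pmul (of_nat N) a generator)) = act a (act generator v)" if a: "a \<in> diagram_span k" for a
    using act_trunc[OF pmul_closed[OF a generator_closed] v(1)]
      diagram_action_pmul[OF a generator_closed vW N_pos] by (simp add: f_def)
  have span: "x \<in> diagram_span k" if "x \<in> carrier X" for x
    using that generator_closed by (auto elim!: cell_module_carrierE)
  have add: "f (x + x') = f x + f x'" for x x' by (simp add: f_def linear_map_add[OF linear_diagram_action_left])
  have sm: "f (trunc k r (pmul (of_nat N) a x)) = act a (f x)" if "a \<in> diagram_span k" "x \<in> carrier X" for a x
    using act_trunc[OF pmul_closed[OF that(1) span[OF that(2)]] v(1)]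
      diagram_action_pmul[OF that(1) span[OF that(2)] vW N_pos] by (simp add: f_def)
  have f0: "f 0 = 0" by (simp add: f_def linear_map_zero[OF linear_diagram_action_left])
  have neg: "- x \<in> carrier X" if x: "x \<in> carrier X" for x
  proof -
    have "\<ominus>\<^bsub>X\<^esub> x + x = 0" using X.l_neg[OF x] by simp
    then have "\<ominus>\<^bsub>X\<^esub> x = - x" by (simp add: eq_neg_iff_add_eq_0)
    then show ?thesis using X.a_inv_closed[OF x] by simp
  qed
  have im: "f ` carrier X = carrier Y"
  proof
    show "f ` carrier X \<subseteq> carrier Y"
      using span act_closed_Y v(1) by (auto simp: f_def)
    show "carrier Y \<subseteq> f ` carrier X"
    proof
      fix u assume "u \<in> carrier Y"
      then obtain a where a: "a \<in> diagram_span k" "act a (act generator v) = u"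
        using Y_transitive[OF gv v(2)] by blast
      then show "u \<in> f ` carrier X" using f_gen[OF a(1)] cell_module_carrierI[OF a(1)] by (metis imageI)
    qed
  qed
  define K where "K = {x \<in> carrier X. f x = 0}"
  have "subgroup K (add_monoid X)"
  proof (rule additive_subgroupI[OF X.abelian_group_axioms])
    show "- x \<in> K" if "x \<in> K" for x
      using that neg add[of x "- x"] f0 by (auto simp: K_def)
    show "0 \<in> K" using X.zero_closed f0 by (simp add: K_def)
    show "x + y \<in> K" if "x \<in> K" "y \<in> K" for x y
      using that X.a_closed[of x y] add by (simp add: K_def)
  qed (auto simp: K_def)
  moreover have "trunc k r (pmul (of_nat N) a x) \<in> K" if "a \<in> diagram_span k" "x \<in> K" for a x
    using that sm[of a x] left_moduleD(3)[OF lX, of a x] by (simp add: K_def linear_map_zero[OF linear_diagram_action_right])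
  ultimately have "submodule K A X" by (auto simp: submodule_def submodule_axioms_def)
  then have "K = {0} \<or> K = carrier X" using irr by (auto simp: irreducible_module_def)
  moreover have "K \<noteq> carrier X"
  proof
    assume K: "K = carrier X"
    have "f ` carrier X = {0}" using K X.zero_closed f0 by (auto simp: K_def)
    then show False using im gv v(2) by auto
  qed
  ultimately have K0: "K = {0}" by blast
  have inj: "inj_on f (carrier X)"
  proof (rule inj_onI)
    fix x x' assume x: "x \<in> carrier X" "x' \<in> carrier X" "f x = f x'"
    have "x + - x' \<in> carrier X" using X.a_closed[OF x(1) neg[OF x(2)]] by simp
    moreover have "f (x + - x') = 0"
      using x(3) by (simp add: f_def linear_map_diff[OF linear_diagram_action_left])
    ultimately have "x + - x' \<in> K" by (simp add: K_def)
    then show "x = x'" using K0 by simp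
  qed
  have "module_iso A X Y f"
    unfolding module_iso_def using inj im f0 add sm by (auto simp: bij_betw_def)
  then show ?thesis by blast
qed

subsection \<open>Equivariant maps\<close>

lemma sym_irreducible_nu: "s \<in> sym_irreducible nu \<longleftrightarrow> (\<exists>a\<in>perm_span {1..g}. s = group_mult a y)"
  unfolding sym_irreducible_def young_symmetrizer_nu sum_list_nu perm_span_def by blast

text \<open>An equivariant map is determined by its value \<open>w0\<close> at \<open>y\<close>.
  Because \<open>y y = c y\<close>, equivariance gives \<open>y w0 = c w0\<close>, so
  \<open>w0\<close> lies in the image of \<open>y\<close> and the map is
  \<open>s \<mapsto> s u\<close> with \<open>u = w0 / c\<close>.\<close>

lemma Y_iso_multiplicity_space:
  "module_iso A Y (multiplicity_space k N lam) (\<lambda>u. \<lambda>s\<in>sym_irreducible nu. group_action s u)"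
proof -
  let ?S = "sym_irreducible nu" and ?M = "multiplicity_space k N lam"
  have carr: "carrier ?M = {\<phi> \<in> ?S \<rightarrow>\<^sub>E W.
      (\<forall>s\<in>?S. \<forall>t\<in>?S. \<phi> (s + t) = \<phi> s + \<phi> t) \<and> (\<forall>c. \<forall>s\<in>?S. \<phi> (scale c s) = scale c (\<phi> s)) \<and>
      (\<forall>w. w permutes {1..g} \<longrightarrow> (\<forall>s\<in>?S. \<phi> (group_mult (single w 1) s) = perm_action w (\<phi> s)))}"
    and ops: "ring.zero ?M = (\<lambda>s\<in>?S. 0)" "ring.add ?M = (\<lambda>\<phi> \<psi>. \<lambda>s\<in>?S. \<phi> s + \<psi> s)"
      "smult ?M = (\<lambda>a \<phi>. \<lambda>s\<in>?S. act a (\<phi> s))"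
    by (simp_all only: multiplicity_space_def Let_def partial_object.simps ring.simps module.simps)
  have Sspan: "s \<in> perm_span {1..g}" if "s \<in> ?S" for s
    using that perm_span_mult[OF _ y_span] unfolding sym_irreducible_nu by blast
  have id_span: "single id 1 \<in> perm_span {1..g}" using permutes_id by simp
  have yS: "y \<in> ?S" unfolding sym_irreducible_nu using id_span group_mult_id_left[of y] by metis
  have S_add: "s + t \<in> ?S" if st: "s \<in> ?S" "t \<in> ?S" for s t
  proof -
    obtain a b where a: "a \<in> perm_span {1..g}" "s = group_mult a y" "b \<in> perm_span {1..g}" "t = group_mult b y"
      using st unfolding sym_irreducible_nu by blast
    have "a + b \<in> perm_span {1..g}" using a keys_add_subset[of a _ b] by (simp add: perm_span_def)
    moreover have "s + t = group_mult (a + b) y" using a by (simp add: linear_map_add[OF linear_group_mult_left])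
    ultimately show ?thesis unfolding sym_irreducible_nu by blast
  qed
  have S_scale: "scale c s \<in> ?S" if s: "s \<in> ?S" for c s
  proof -
    obtain a where a: "a \<in> perm_span {1..g}" "s = group_mult a y" using s unfolding sym_irreducible_nu by blast
    have "scale c a \<in> perm_span {1..g}" using a keys_scale_subset[of c a] by (auto simp: perm_span_def)
    moreover have "scale c s = group_mult (scale c a) y" using a by (simp add: linear_map_scale[OF linear_group_mult_left])
    ultimately show ?thesis unfolding sym_irreducible_nu by blast
  qed
  have S_mult: "group_mult (single w 1) s \<in> ?S" if w: "w permutes {1..g}" and s: "s \<in> ?S" for w s
  proof -
    obtain a where a: "a \<in> perm_span {1..g}" "s = group_mult a y" using s unfolding sym_irreducible_nu by blast
    have "group_mult (single w 1) a \<in> perm_span {1..g}" by (rule perm_span_mult[OF perm_span_single[OF w] a(1)])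
    moreover have "group_mult (single w 1) s = group_mult (group_mult (single w 1) a) y" using a by (simp add: group_mult_assoc)
    ultimately show ?thesis unfolding sym_irreducible_nu by blast
  qed
  obtain c where c: "c \<noteq> 0" "group_mult y y = scale c y" by (rule y_square)
  have yu: "group_action y u = scale c u" if u: "u \<in> carrier Y" for u
  proof -
    obtain v where v: "v \<in> W" "u = group_action y v" using u by (auto elim!: Y_carrierE)
    show ?thesis unfolding v(2) group_action_mult[symmetric] c(2) by (rule linear_map_scale[OF linear_group_action_left])
  qed
  define F where "F u = (\<lambda>s\<in>?S. group_action s u)" for u
  have F_app: "F u s = group_action s u" if "s \<in> ?S" for u s using that by (simp add: F_def)
  have F_carrier: "F u \<in> carrier ?M" if u: "u \<in> carrier Y" for u
    unfolding carr
  proof (intro CollectI conjI ballI allI impI)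
    show "F u \<in> ?S \<rightarrow>\<^sub>E W"
      unfolding F_def using group_action_closed[OF Sspan Y_subset[OF u]] by auto
    show "F u (s + t) = F u s + F u t" if "s \<in> ?S" "t \<in> ?S" for s t
      using that by (simp add: F_app S_add linear_map_add[OF linear_group_action_left])
    show "F u (scale b s) = scale b (F u s)" if "s \<in> ?S" for b s
      using that by (simp add: F_app S_scale linear_map_scale[OF linear_group_action_left])
    show "F u (group_mult (single w 1) s) = perm_action w (F u s)" if "w permutes {1..g}" "s \<in> ?S" for w s
      by (simp add: F_app[OF that(2)] F_app[OF S_mult[OF that]] group_action_mult group_action_single)
  qed
  have inj: "inj_on F (carrier Y)"
  proof (rule inj_onI)
    fix u u' assume u: "u \<in> carrier Y" "u' \<in> carrier Y" "F u = F u'"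
    have "scale c u = scale c u'" using F_app[OF yS] u yu by metis
    then have "scale (1 / c) (scale c u) = scale (1 / c) (scale c u')" by simp
    then show "u = u'" using c(1) by simp
  qed
  have surj: "carrier ?M \<subseteq> F ` carrier Y"
  proof
    fix \<phi> assume p: "\<phi> \<in> carrier ?M"
    then have ext: "\<phi> \<in> ?S \<rightarrow>\<^sub>E W"
      and padd: "\<And>s t. s \<in> ?S \<Longrightarrow> t \<in> ?S \<Longrightarrow> \<phi> (s + t) = \<phi> s + \<phi> t"
      and pscale: "\<And>b s. s \<in> ?S \<Longrightarrow> \<phi> (scale b s) = scale b (\<phi> s)"
      and pw: "\<And>w s. w permutes {1..g} \<Longrightarrow> s \<in> ?S \<Longrightarrow> \<phi> (group_mult (single w 1) s) = perm_action w (\<phi> s)"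
      unfolding carr by blast+
    define w0 where "w0 = \<phi> y"
    have w0W: "w0 \<in> W" using ext yS unfolding w0_def by blast
    have zeroS: "0 \<in> ?S" using S_scale[OF yS, of 0] by simp
    have psum: "\<phi> (\<Sum>i\<in>I. h i) = (\<Sum>i\<in>I. \<phi> (h i)) \<and> (\<Sum>i\<in>I. h i) \<in> ?S"
      if "finite I" "\<And>i. i \<in> I \<Longrightarrow> h i \<in> ?S" for I and h :: "(nat \<Rightarrow> nat) \<Rightarrow> _"
      using that
    proof (induction I rule: finite_induct)
      case empty
      then show ?case using pscale[OF zeroS, of 0] zeroS by simp
    next
      case (insert i I)
      then show ?case using padd S_add by simp
    qed
    have key: "\<phi> (group_mult a y) = group_action a w0" if a: "a \<in> perm_span {1..g}" for a
    proof -
      have wp: "w permutes {1..g}" if "w \<in> keys a" for w using a that unfolding perm_span_def by blast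
      have "group_mult a y = (\<Sum>w\<in>keys a. scale (lookup a w) (group_mult (single w 1) y))"
        by (rule linear_map_expansion[OF linear_group_mult_left])
      then have "\<phi> (group_mult a y) = (\<Sum>w\<in>keys a. \<phi> (scale (lookup a w) (group_mult (single w 1) y)))"
        using psum[of "keys a" "\<lambda>w. scale (lookup a w) (group_mult (single w 1) y)"] S_scale S_mult[OF wp yS] by simp
      also have "\<dots> = (\<Sum>w\<in>keys a. scale (lookup a w) (perm_action w w0))"
        using wp pw[OF _ yS] pscale[OF S_mult[OF _ yS]] by (intro sum.cong refl) (simp add: w0_def)
      also have "\<dots> = group_action a w0" by (simp add: group_action_def lin_ext_def)
      finally show ?thesis .
    qed
    have yw0: "group_action y w0 = scale c w0"
      using key[OF y_span] c(2) pscale[OF yS, of c] by (simp add: w0_def)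
    \<comment> \<open>One factor \<open>1 / c\<close> compensates for \<open>y w0 = c w0\<close>,
      the other for the value \<open>y u = c u\<close> of the resulting map at
      \<open>y\<close>.\<close>
    define u where "u = group_action y (scale (1 / (c * c)) w0)"
    have u: "u \<in> carrier Y" unfolding u_def using w0W by (intro Y_carrierI) blast
    have uw0: "u = scale (1 / c) w0"
      unfolding u_def linear_map_scale[OF linear_group_action_right] yw0 using c(1) by simp
    have "F u = \<phi>"
    proof (rule PiE_ext[of _ ?S "\<lambda>_. W"])
      show "F u \<in> ?S \<rightarrow>\<^sub>E W" using F_carrier[OF u] unfolding carr by blast
      show "\<phi> \<in> ?S \<rightarrow>\<^sub>E W" by (rule ext)
      fix s assume s: "s \<in> ?S"
      then obtain a where a: "a \<in> perm_span {1..g}" "s = group_mult a y" unfolding sym_irreducible_nu by blast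
      have "F u s = group_action a (group_action y u)" using F_app[OF s] by (simp add: a(2) group_action_mult)
      also have "\<dots> = group_action a w0" using yu[OF u] uw0 c(1) by simp
      also have "\<dots> = \<phi> s" using key[OF a(1)] a(2) by simp
      finally show "F u s = \<phi> s" .
    qed
    then show "\<phi> \<in> F ` carrier Y" using u by blast
  qed
  have "module_iso A Y ?M F"
    unfolding module_iso_def ops
  proof (intro conjI ballI)
    show "bij_betw F (carrier Y) (carrier ?M)" using inj surj F_carrier by (auto simp: bij_betw_def)
    show "F \<zero>\<^bsub>Y\<^esub> = (\<lambda>s\<in>?S. 0)" by (simp add: F_def linear_map_zero[OF linear_group_action_right] cong: restrict_cong)
    show "F (u \<oplus>\<^bsub>Y\<^esub> u') = (\<lambda>s\<in>?S. F u s + F u' s)" for u u'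
      by (simp add: F_def linear_map_add[OF linear_group_action_right] cong: restrict_cong)
    show "F (a \<odot>\<^bsub>Y\<^esub> u) = (\<lambda>s\<in>?S. act a (F u s))" if "a \<in> carrier A" "u \<in> carrier Y" for a u
    proof
      fix s
      show "F (a \<odot>\<^bsub>Y\<^esub> u) s = (\<lambda>s\<in>?S. act a (F u s)) s"
        using act_group_action[OF Sspan _ Y_subset[OF that(2)], of s a] that(1) by (simp add: F_def)
    qed
  qed
  then show ?thesis unfolding F_def .
qed

lemma has_character_multiplicity_space:
  assumes d: "d \<in> diagrams k" and "has_character k X d t"
  shows "has_character k (multiplicity_space k N lam) d t"
proof -
  obtain f where "module_iso A X Y f" using X_iso_Y by blast
  then have "has_character k Y d t"
    using has_character_iso[OF left_module_cell_module[OF generator_closed] _ d assms(2)] by blast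
  then show ?thesis by (rule has_character_iso[OF left_module_Y Y_iso_multiplicity_space d])
qed

end

section \<open>An integral basis of the Specht module\<close>

definition pairing :: "'a set \<Rightarrow> ('d \<Rightarrow> 'a \<Rightarrow> 'f::field) \<Rightarrow> ('a \<Rightarrow> 'f) \<Rightarrow> 'd \<Rightarrow> 'f" where
  "pairing A z f d = (\<Sum>a\<in>A. f a * z d a)"

text \<open>A basis of the span of the vectors \<open>z d\<close>, chosen among them, together with
  dual functionals given by coefficient vectors. Explicit functionals carry the independence of the
  basis over to a larger field.\<close>

lemma dual_family:
  fixes z :: "'d \<Rightarrow> 'a \<Rightarrow> 'f::field"
  assumes "finite D" "finite A"
  shows "\<exists>B\<subseteq>D. \<exists>\<phi>. (\<forall>b\<in>B. \<forall>b'\<in>B. pairing A z (\<phi> b) b' = of_bool (b = b')) \<and>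
    (\<forall>d\<in>D. \<forall>a\<in>A. (\<Sum>b\<in>B. pairing A z (\<phi> b) d * z b a) = z d a)"
  using assms(1)
proof (induction D rule: finite_induct)
  case empty
  then show ?case by auto
next
  case (insert d D)
  let ?p = "pairing A z"
  obtain B \<phi> where B: "B \<subseteq> D" and dual0: "\<forall>b\<in>B. \<forall>b'\<in>B. ?p (\<phi> b) b' = of_bool (b = b')"
    and expand0: "\<forall>x\<in>D. \<forall>a\<in>A. (\<Sum>b\<in>B. ?p (\<phi> b) x * z b a) = z x a"
    using insert.IH by (elim exE conjE)
  note dual = dual0[rule_format] and expand = expand0[rule_format]
  have fin: "finite B" using B insert.hyps(1) by (rule finite_subset)
  show ?case
  proof (cases "\<forall>a\<in>A. (\<Sum>b\<in>B. ?p (\<phi> b) d * z b a) = z d a")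
    case True
    then have "\<forall>x\<in>insert d D. \<forall>a\<in>A. (\<Sum>b\<in>B. ?p (\<phi> b) x * z b a) = z x a" using expand0 by simp
    then show ?thesis using B dual0 by (intro exI[of _ B] conjI exI[of _ \<phi>]) auto
  next
    case False
    then obtain a0 where a0: "a0 \<in> A" "(\<Sum>b\<in>B. ?p (\<phi> b) d * z b a0) \<noteq> z d a0" by auto
    define v where "v = z d a0 - (\<Sum>b\<in>B. ?p (\<phi> b) d * z b a0)"
    have v: "v \<noteq> 0" using a0 by (simp add: v_def)
    \<comment> \<open>The coordinate at \<open>a0\<close> of the remainder after expansion in
      \<open>B\<close>, normalized to take the value 1 at \<open>d\<close>; it vanishes on
      everything already spanned.\<close>
    define \<psi> where "\<psi> a = (of_bool (a = a0) - (\<Sum>b\<in>B. z b a0 * \<phi> b a)) / v" for a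
    have pr_\<psi>: "?p \<psi> x = (z x a0 - (\<Sum>b\<in>B. ?p (\<phi> b) x * z b a0)) / v" for x
    proof -
      have "(\<Sum>a\<in>A. of_bool (a = a0) * z x a) = z x a0"
        using assms(2) a0(1) by (simp add: of_bool_def if_distrib[of "\<lambda>t. t * _"] cong: if_cong)
      moreover have "(\<Sum>a\<in>A. (\<Sum>b\<in>B. z b a0 * \<phi> b a) * z x a) = (\<Sum>b\<in>B. ?p (\<phi> b) x * z b a0)"
        unfolding pairing_def sum_distrib_right by (subst sum.swap) (simp add: ac_simps)
      ultimately show ?thesis
        unfolding pairing_def[of _ _ \<psi>] \<psi>_def by (simp add: sum_divide_distrib[symmetric] left_diff_distrib sum_subtractf)
    qed
    \<comment> \<open>The old functionals are corrected by multiples of \<open>\<psi>\<close> so as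
      to vanish at \<open>d\<close>; on the span of \<open>B\<close> this changes nothing.\<close>
    define \<phi>' where "\<phi>' b = (if b = d then \<psi> else (\<lambda>a. \<phi> b a - ?p (\<phi> b) d * \<psi> a))" for b
    have dB: "d \<notin> B" using B insert.hyps(2) by blast
    have pr_\<phi>': "?p (\<phi>' b) x = ?p (\<phi> b) x - ?p (\<phi> b) d * ?p \<psi> x" if "b \<in> B" for b x
    proof -
      have "b \<noteq> d" using that dB by blast
      then have "\<phi>' b = (\<lambda>a. \<phi> b a - ?p (\<phi> b) d * \<psi> a)" by (simp add: \<phi>'_def)
      then show ?thesis
        unfolding pairing_def[of _ _ "\<phi>' b"] pairing_def[of _ _ \<psi>] pairing_def[of _ _ _ x]
        by (simp add: left_diff_distrib sum_subtractf sum_distrib_left mult.assoc)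
    qed
    have \<psi>d: "?p \<psi> d = 1" unfolding pr_\<psi> using v by (simp add: v_def)
    have \<psi>D: "?p \<psi> x = 0" if "x \<in> D" for x unfolding pr_\<psi> using expand[OF that a0(1)] by simp
    have \<phi>'d: "\<phi>' d = \<psi>" by (simp add: \<phi>'_def)
    have "?p (\<phi>' b) b' = of_bool (b = b')" if bb: "b \<in> insert d B" "b' \<in> insert d B" for b b'
    proof -
      consider "b = d" "b' = d" | "b = d" "b' \<in> B" | "b \<in> B" "b' = d" | "b \<in> B" "b' \<in> B" using bb by blast
      then show ?thesis
      proof cases
        case 2
        then have "b' \<in> D" "b \<noteq> b'" using B dB by auto
        then show ?thesis using 2 \<psi>D by (simp add: \<phi>'d)
      next
        case 3
        then have "b \<noteq> d" using dB by auto
        then show ?thesis using 3 by (simp add: pr_\<phi>' \<psi>d)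
      next
        case 4
        then have "b' \<in> D" using B by auto
        then show ?thesis using \<psi>D[of b'] 4 dual by (simp add: pr_\<phi>')
      qed (simp add: \<phi>'d \<psi>d)
    qed
    moreover have "(\<Sum>b\<in>insert d B. ?p (\<phi>' b) x * z b a) = z x a" if xa: "x \<in> insert d D" "a \<in> A" for x a
    proof -
      have s: "(\<Sum>b\<in>insert d B. ?p (\<phi>' b) x * z b a) = ?p \<psi> x * z d a + (\<Sum>b\<in>B. (?p (\<phi> b) x - ?p (\<phi> b) d * ?p \<psi> x) * z b a)"
        using fin dB by (simp add: \<phi>'d pr_\<phi>')
      show ?thesis
      proof (cases "x = d")
        case True
        then show ?thesis unfolding s by (simp add: \<psi>d)
      next
        case False
        then have "x \<in> D" using xa by auto
        then show ?thesis unfolding s using expand[of x a] xa(2) by (simp add: \<psi>D)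
      qed
    qed
    moreover have "insert d B \<subseteq> insert d D" using B by (rule insert_mono)
    ultimately show ?thesis by (intro exI[of _ "insert d B"] conjI exI[of _ \<phi>'] ballI)
  qed
qed

lemma common_denominator:
  fixes m :: "'a \<Rightarrow> rat"
  assumes "finite B"
  shows "\<exists>q c. q \<noteq> (0::int) \<and> (\<forall>b\<in>B. of_int q * m b = of_int (c b))"
  using assms
proof (induction B rule: finite_induct)
  case empty
  show ?case by (intro exI[of _ 1]) auto
next
  case (insert b B)
  obtain q c where q: "q \<noteq> 0" "\<forall>b\<in>B. of_int q * m b = of_int (c b)" using insert.IH by blast
  obtain s t where st: "m b = of_int s / of_int t" "t \<noteq> 0" by (metis Fract_of_int_quotient Rat_cases less_irrefl)
  have "\<forall>b'\<in>insert b B. of_int (q * t) * m b' = of_int ((if b' = b then q * s else t * c b'))"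
  proof
    fix b' assume b': "b' \<in> insert b B"
    show "of_int (q * t) * m b' = of_int ((if b' = b then q * s else t * c b'))"
    proof (cases "b' = b")
      case False
      then have "of_int q * m b' = of_int (c b')" using b' q by blast
      then show ?thesis using False by (simp add: mult.assoc mult.left_commute[of "of_int q"])
    qed (use st in simp)
  qed
  then show ?case using q(1) st(2)
    by (intro exI[of _ "q * t"] exI[of _ "\<lambda>b'. if b' = b then q * s else t * c b'"]) simp
qed

locale specht =
  fixes k :: half_integer and lam :: "nat list"
  assumes lam: "is_partition lam" and boxes_le: "sum_list lam \<le> tensor_degree k"
begin

abbreviation "r \<equiv> sum_list lam"

lemma sorted_lam: "sorted_wrt (\<ge>) lam"
  using lam by (simp add: is_partition_def)

sublocale tableau "{1..r}" "rowof lam" "colof lam"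
  by (rule tableau_row_reading[OF sorted_lam])

text \<open>Polymorphic in the coefficients, so that the integral and the complex generator are
  instances of one term.\<close>

definition cell_elem :: "diagram \<Rightarrow>\<^sub>0 'c::comm_ring_1" where
  "cell_elem = (\<Sum>u\<in>Rows. \<Sum>v\<in>Cols. single (padded k r (v \<circ> u)) (of_int (sign v)))"

text \<open>The truncated product of \<open>d\<close> with the generator, stripped of its power of
  the parameter.\<close>

definition cell_gen :: "diagram \<Rightarrow> (diagram \<Rightarrow>\<^sub>0 'c::comm_ring_1)" where
  "cell_gen d = (\<Sum>u\<in>Rows. \<Sum>v\<in>Cols. trunc k r (single (compose d (padded k r (v \<circ> u))) (of_int (sign v))))"

lemma cell_elem_int: "cell_elem = e_elem k lam"
  unfolding cell_elem_def e_elem_expansion[OF sorted_lam] ..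

lemma eval_coeffs_cell_elem: "eval_coeffs n cell_elem = cell_elem"
  by (simp add: cell_elem_def eval_coeffs_sum eval_coeffs_single)

lemma cell_elem_complex: "cell_elem = padded_elem k r (young_symmetrizer lam)"
  using eval_coeffs_cell_elem[of 0] eval_coeffs_e_elem[OF sorted_lam, of 0 k] by (simp add: cell_elem_int)

lemma Rows_Cols_permutes: "u \<in> Rows \<Longrightarrow> v \<in> Cols \<Longrightarrow> v \<circ> u permutes {1..r}"
  using permutes_compose Rows_permutes Cols_permutes by blast

lemma cell_elem_closed: "cell_elem \<in> diagram_span k"
  unfolding cell_elem_def using Rows_Cols_permutes
  by (intro diagram_span_sum diagram_span_closed(5) padded_closed[OF _ boxes_le]) blast

lemma eval_coeffs_cell_gen: "eval_coeffs n (cell_gen d) = cell_gen d"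
  by (simp add: cell_gen_def eval_coeffs_sum eval_coeffs_trunc eval_coeffs_single)

lemma lookup_cell_gen: "lookup (cell_gen d :: diagram \<Rightarrow>\<^sub>0 'c::comm_ring_1) a = of_int (lookup (cell_gen d) a)"
  unfolding cell_gen_def lookup_sum of_int_sum
  by (intro sum.cong refl) (simp add: lookup_trunc lookup_single when_def)

text \<open>A padded permutation is the padded identity followed by a permutation diagram, and the
  latter never causes a removal. So the exponent of the parameter in \<open>d e\<close> is common to
  all terms of \<open>e\<close>.\<close>

lemma compose_padded:
  assumes d: "d \<in> diagrams k" and w: "w permutes {1..r}"
  shows "compose d (padded k r w) = compose (compose d (padded k r id)) (perm_diag k w)"
    and "removed d (padded k r w) = removed d (padded k r id)"
proof -
  have E: "padded k r id \<in> diagrams k" by (rule padded_closed[OF permutes_id boxes_le])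
  have "w permutes {1..tensor_degree k}" by (rule permutes_mono[OF w boxes_le])
  then have P: "perm_diag k w \<in> diagrams k" by (rule perm_diag_closed)
  have EP: "compose (padded k r id) (perm_diag k w) = padded k r w" "removed (padded k r id) (perm_diag k w) = 0"
    using compose_perm_padded(3,4)[OF permutes_id w boxes_le] by simp_all
  have "removed (compose d (padded k r id)) (perm_diag k w) = 0"
    by (rule removed_zero[OF compose_closed[OF d E] P]) (auto simp: perm_diagram_def)
  then show "removed d (padded k r w) = removed d (padded k r id)"
    using compose_assoc(2)[OF d E P] EP by simp
  show "compose d (padded k r w) = compose (compose d (padded k r id)) (perm_diag k w)"
    using compose_assoc(1)[OF d E P] EP by simp
qed

lemma trunc_pmul_cell_elem:
  assumes d: "d \<in> diagrams k"
  shows "trunc k r (pmul q (single d 1) cell_elem) = scale (q ^ removed d (padded k r id)) (cell_gen d)"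
  unfolding cell_elem_def cell_gen_def linear_map_sum[OF linear_pmul_right] pmul_single trunc_sum scale_sum
  using compose_padded(2)[OF d Rows_Cols_permutes]
  by (intro sum.cong refl) (simp add: trunc_single mult.commute)

lemma cell_gen_cong:
  assumes "d \<in> diagrams k" "d' \<in> diagrams k" "compose d (padded k r id) = compose d' (padded k r id)"
  shows "cell_gen d = cell_gen d'"
  unfolding cell_gen_def using assms compose_padded(1)[OF _ Rows_Cols_permutes] by (intro sum.cong refl) simp

text \<open>For parameter 0 a product with a removed component vanishes. A representative without
  removed components shows that the stripped product still lies in the module, for every parameter
  at once.\<close>

lemma cell_gen_good:
  assumes "d \<in> diagrams k"
  obtains d' where "d' \<in> diagrams k" "removed d' (padded k r id) = 0" "\<And>q. cell_gen d = trunc k r (pmul q (single d' 1) cell_elem)"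
    "cell_gen d = (cell_gen d' :: diagram \<Rightarrow>\<^sub>0 rat)"
proof -
  obtain d' where d': "d' \<in> diagrams k" "compose d' (padded k r id) = compose d (padded k r id)" "removed d' (padded k r id) = 0"
    using good_representative[OF boxes_le assms] by blast
  show thesis
  proof (rule that[OF d'(1,3)])
    show "cell_gen d = trunc k r (pmul q (single d' 1) cell_elem)" for q
      using trunc_pmul_cell_elem[OF d'(1), of q] d'(3) cell_gen_cong[OF assms d'(1) d'(2)[symmetric]] by simp
    show "cell_gen d = cell_gen d'" by (rule cell_gen_cong[OF assms d'(1) d'(2)[symmetric]])
  qed
qed

lemma cell_gen_carrier:
  assumes "d \<in> diagrams k"
  shows "cell_gen d \<in> carrier (cell_module q k r cell_elem)"
proof -
  obtain d' where "d' \<in> diagrams k" "cell_gen d = trunc k r (pmul q (single d' 1) cell_elem)"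
    using cell_gen_good[OF assms] by metis
  then show ?thesis by (simp add: cell_module_carrierI)
qed

lemma cell_module_expansion:
  assumes "v \<in> carrier (cell_module q k r cell_elem)"
  obtains c where "v = (\<Sum>d\<in>diagrams k. scale (c d) (cell_gen d))"
proof -
  obtain a where a: "a \<in> diagram_span k" "v = trunc k r (pmul q a cell_elem)"
    using assms by (rule cell_module_carrierE)
  have "linear_map (\<lambda>a. trunc k r (pmul q a cell_elem))"
    by (rule linear_map_comp[OF linear_trunc linear_pmul_left])
  then have "v = (\<Sum>d\<in>keys a. scale (lookup a d) (trunc k r (pmul q (single d 1) cell_elem)))"
    unfolding a(2) by (rule linear_map_expansion)
  also have "\<dots> = (\<Sum>d\<in>diagrams k. scale (lookup a d) (trunc k r (pmul q (single d 1) cell_elem)))"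
    using a(1) by (intro sum.mono_neutral_left) (auto simp: diagram_span_def in_keys_iff)
  also have "\<dots> = (\<Sum>d\<in>diagrams k. scale (lookup a d * q ^ removed d (padded k r id)) (cell_gen d))"
    by (rule sum.cong[OF refl]) (simp add: trunc_pmul_cell_elem)
  finally show thesis by (rule that)
qed

text \<open>As \<open>b\<close> causes no removal, \<open>cell_gen b\<close> is the product
  \<open>b e\<close> itself up to truncation, and the action of \<open>d\<close> is computed from
  \<open>(d b) e\<close>. The parameter enters only through the exponent.\<close>

lemma act_cell_gen:
  assumes "d \<in> diagrams k" "b \<in> diagrams k" "removed b (padded k r id) = 0"
  shows "trunc k r (pmul q (single d 1) (cell_gen b)) =
    scale (q ^ (removed d b + removed (compose d b) (padded k r id))) (cell_gen (compose d b))"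
proof -
  have s: "single b 1 \<in> diagram_span k" "single d 1 \<in> diagram_span k" using assms by simp_all
  have "cell_gen b = trunc k r (pmul q (single b 1) cell_elem)" using trunc_pmul_cell_elem[OF assms(2), of q] assms(3) by simp
  then have "trunc k r (pmul q (single d 1) (cell_gen b)) = trunc k r (pmul q (single d 1) (pmul q (single b 1) cell_elem))"
    using trunc_pmul_right[OF s(2) pmul_closed[OF s(1) cell_elem_closed]] by simp
  also have "\<dots> = trunc k r (pmul q (scale (q ^ removed d b) (single (compose d b) 1)) cell_elem)"
    by (simp add: pmul_assoc[OF s(2,1) cell_elem_closed, symmetric] pmul_single)
  also have "\<dots> = scale (q ^ removed d b) (scale (q ^ removed (compose d b) (padded k r id)) (cell_gen (compose d b)))"
    by (simp only: linear_map_scale[OF linear_pmul_left] trunc_scale trunc_pmul_cell_elem[OF compose_closed[OF assms(1,2)]])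
  finally show ?thesis by (simp add: power_add)
qed

text \<open>The vectors \<open>cell_gen b\<close> have integer coordinates, the same over every
  ring. Duality over the rationals selects a basis; clearing denominators gives integral relations
  up to a factor \<open>q\<close>, and the rational dual functionals, read in \<complex>, prove
  independence there.\<close>

lemma integral_basis:
  obtains B and m :: "diagram \<Rightarrow> diagram \<Rightarrow> rat" where
    "B \<subseteq> diagrams k" "\<And>b. b \<in> B \<Longrightarrow> removed b (padded k r id) = 0"
    "\<And>d. d \<in> diagrams k \<Longrightarrow> (cell_gen d :: diagram \<Rightarrow>\<^sub>0 complex) = (\<Sum>b\<in>B. scale (of_rat (m b d)) (cell_gen b))"
    "\<And>d. d \<in> diagrams k \<Longrightarrow> \<exists>q c. q \<noteq> 0 \<and>
       scale (of_int q) (cell_gen d :: diagram \<Rightarrow>\<^sub>0 int poly) = (\<Sum>b\<in>B. scale (of_int (c b)) (cell_gen b))"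
    "\<And>c b. (\<Sum>b\<in>B. scale (c b) (cell_gen b :: diagram \<Rightarrow>\<^sub>0 complex)) = 0 \<Longrightarrow> b \<in> B \<Longrightarrow> c b = 0"
proof -
  define D where "D = {d \<in> diagrams k. removed d (padded k r id) = 0}"
  define z :: "diagram \<Rightarrow> diagram \<Rightarrow> int" where "z d a = lookup (cell_gen d) a" for d a
  have zc: "lookup (cell_gen d) a = of_int (z d a)" for d a unfolding z_def by (rule lookup_cell_gen)
  have out: "z d a = 0" if d: "d \<in> diagrams k" and a: "a \<notin> diagrams k" for d a
  proof -
    have "(cell_gen d :: diagram \<Rightarrow>\<^sub>0 int) \<in> diagram_span k"
      unfolding cell_gen_def using compose_closed[OF d padded_closed[OF Rows_Cols_permutes boxes_le]]
      by (intro diagram_span_sum trunc_closed) auto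
    then show ?thesis using a unfolding z_def diagram_span_def by (auto simp: in_keys_iff)
  qed
  have "finite D" unfolding D_def by simp
  from dual_family[OF this finite_diagrams[of k], where z = "\<lambda>d a. of_int (z d a) :: rat"]
  obtain B \<phi> where B: "B \<subseteq> D"
    and dual: "\<And>b b'. b \<in> B \<Longrightarrow> b' \<in> B \<Longrightarrow> pairing (diagrams k) (\<lambda>d a. of_int (z d a)) (\<phi> b) b' = (of_bool (b = b') :: rat)"
    and exp0: "\<And>d a. d \<in> D \<Longrightarrow> a \<in> diagrams k \<Longrightarrow>
      (\<Sum>b\<in>B. pairing (diagrams k) (\<lambda>d a. of_int (z d a)) (\<phi> b) d * of_int (z b a)) = (of_int (z d a) :: rat)"
    by blast
  have fin: "finite B" using B \<open>finite D\<close> by (rule finite_subset)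
  have BD: "b \<in> diagrams k" "removed b (padded k r id) = 0" if "b \<in> B" for b using B that unfolding D_def by blast+
  define m where "m b d = pairing (diagrams k) (\<lambda>d a. of_int (z d a)) (\<phi> b) d" for b d
  have expand: "(of_int (z d a) :: rat) = (\<Sum>b\<in>B. m b d * of_int (z b a))" if d: "d \<in> diagrams k" for d a
  proof (cases "a \<in> diagrams k")
    case True
    obtain d' where d': "d' \<in> diagrams k" "removed d' (padded k r id) = 0" "cell_gen d = (cell_gen d' :: diagram \<Rightarrow>\<^sub>0 rat)"
      using cell_gen_good[OF d] by metis
    have "(of_int (z d a) :: rat) = of_int (z d' a)" for a unfolding zc[symmetric] d'(3) ..
    then have "z d = z d'" by (simp add: fun_eq_iff)
    then have "m b d = m b d'" for b by (simp add: m_def pairing_def)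
    then show ?thesis using exp0[of d' a] True d' \<open>z d = z d'\<close> unfolding m_def[symmetric] D_def by simp
  next
    case False
    then show ?thesis using out[OF d] out[OF BD(1)] by simp
  qed
  show thesis
  proof (rule that[of B m])
    show "B \<subseteq> diagrams k" using BD by blast
    show "removed b (padded k r id) = 0" if "b \<in> B" for b by (rule BD(2)[OF that])
    show "(cell_gen d :: diagram \<Rightarrow>\<^sub>0 complex) = (\<Sum>b\<in>B. scale (of_rat (m b d)) (cell_gen b))" if d: "d \<in> diagrams k" for d
    proof (rule poly_mapping_eqI)
      fix a
      have "(of_int (z d a) :: complex) = of_rat (of_int (z d a))" by simp
      also have "\<dots> = (\<Sum>b\<in>B. of_rat (m b d) * of_int (z b a))"
        unfolding expand[OF d] by (simp add: of_rat_sum of_rat_mult)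
      finally show "lookup (cell_gen d :: diagram \<Rightarrow>\<^sub>0 complex) a = lookup (\<Sum>b\<in>B. scale (of_rat (m b d)) (cell_gen b)) a"
        by (simp add: zc lookup_sum)
    qed
    show "\<exists>q c. q \<noteq> 0 \<and> scale (of_int q) (cell_gen d :: diagram \<Rightarrow>\<^sub>0 int poly) = (\<Sum>b\<in>B. scale (of_int (c b)) (cell_gen b))"
      if d: "d \<in> diagrams k" for d
    proof -
      obtain q c where q: "q \<noteq> 0" "\<And>b. b \<in> B \<Longrightarrow> of_int q * m b d = of_int (c b)"
        using common_denominator[OF fin, of "\<lambda>b. m b d"] by blast
      have "q * z d a = (\<Sum>b\<in>B. c b * z b a)" for a
      proof -
        have "(of_int (q * z d a) :: rat) = (\<Sum>b\<in>B. (of_int q * m b d) * of_int (z b a))"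
          by (simp add: expand[OF d] sum_distrib_left mult.assoc)
        also have "\<dots> = of_int (\<Sum>b\<in>B. c b * z b a)" using q(2) by simp
        finally show ?thesis by (simp only: of_int_eq_iff)
      qed
      then have "of_int q * of_int (z d a) = (\<Sum>b\<in>B. of_int (c b) * (of_int (z b a) :: int poly))" for a
        by (simp only: of_int_mult[symmetric] of_int_sum[symmetric])
      then have "scale (of_int q) (cell_gen d :: diagram \<Rightarrow>\<^sub>0 int poly) = (\<Sum>b\<in>B. scale (of_int (c b)) (cell_gen b))"
        by (intro poly_mapping_eqI) (simp only: zc lookup_sum lookup_scale)
      then show ?thesis using q(1) by blast
    qed
    show "c b = 0" if zero: "(\<Sum>b\<in>B. scale (c b) (cell_gen b :: diagram \<Rightarrow>\<^sub>0 complex)) = 0" and b: "b \<in> B" for c b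
    proof -
      have coord: "(\<Sum>b'\<in>B. c b' * of_int (z b' a)) = 0" for a
        using arg_cong[OF zero, of "\<lambda>f. lookup f a"] by (simp add: lookup_sum zc)
      have "c b = (\<Sum>b'\<in>B. c b' * of_bool (b = b'))" using fin b by (simp add: of_bool_def if_distrib cong: if_cong)
      also have "\<dots> = (\<Sum>b'\<in>B. c b' * of_rat (\<Sum>a\<in>diagrams k. \<phi> b a * of_int (z b' a)))"
        using dual[OF b] unfolding pairing_def by (intro sum.cong refl) simp
      also have "\<dots> = (\<Sum>a\<in>diagrams k. of_rat (\<phi> b a) * (\<Sum>b'\<in>B. c b' * of_int (z b' a)))"
        unfolding of_rat_sum of_rat_mult of_rat_of_int_eq sum_distrib_left by (subst sum.swap) (simp add: ac_simps)
      finally show ?thesis by (simp add: coord)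
    qed
  qed
qed

end

subsection \<open>Cosets of the ideal\<close>

context specht
begin

abbreviation "X \<equiv> [:0, 1:] :: int poly"
abbreviation "S \<equiv> specht_module k lam"

text \<open>The coset of \<open>v\<close> modulo the ideal, as a fibre of truncation; the operations
  on cosets then reduce to the compatibility of truncation with sums and products.\<close>

definition fib :: "(diagram \<Rightarrow>\<^sub>0 int poly) \<Rightarrow> (diagram \<Rightarrow>\<^sub>0 int poly) set" where
  "fib v = {w \<in> diagram_span k. trunc k r w = trunc k r v}"

lemma fib_trunc [simp]: "fib (trunc k r v) = fib v"
  by (simp add: fib_def)

lemma mem_fib: "v \<in> diagram_span k \<Longrightarrow> v \<in> fib v"
  by (simp add: fib_def)

lemma propagating_ideal_trunc: "propagating_ideal k r = {h \<in> diagram_span k. trunc k r h = 0}"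
proof -
  have "trunc k r h = 0 \<longleftrightarrow> (\<forall>d\<in>keys h. propagating_number d < propagating_bound k r)" for h :: "diagram \<Rightarrow>\<^sub>0 int poly"
    by (auto simp: poly_mapping_eq_iff fun_eq_iff lookup_trunc in_keys_iff)
  then show ?thesis by (auto simp: propagating_ideal_def diagram_span_def)
qed

lemma ideal_coset:
  assumes "v \<in> diagram_span k" and "ring.add M = (+)"
  shows "propagating_ideal k r +>\<^bsub>M\<^esub> v = fib v"
proof -
  have "w \<in> (\<Union>h\<in>propagating_ideal k r. {h + v}) \<longleftrightarrow> w \<in> fib v" for w
  proof
    assume "w \<in> fib v"
    then have "w - v \<in> propagating_ideal k r"
      using assms(1) by (simp add: propagating_ideal_trunc fib_def diagram_span_diff trunc_diff)
    then show "w \<in> (\<Union>h\<in>propagating_ideal k r. {h + v})" by (intro UN_I[of "w - v"]) simp_all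
  qed (use assms(1) in \<open>auto simp: propagating_ideal_trunc fib_def trunc_add\<close>)
  then show ?thesis unfolding a_r_coset_def' assms(2) by blast
qed

lemma specht_carrier: "carrier S = fib ` carrier (cell_module X k r cell_elem)"
proof -
  have "carrier S = (\<lambda>b. propagating_ideal k r +>\<^bsub>integral_partition_algebra k\<^esub> b) ` {pmul X a (e_elem k lam) | a. a \<in> diagram_span k}"
    by (simp add: specht_module_def Let_def)
  also have "\<dots> = fib ` {pmul X a cell_elem | a. a \<in> diagram_span k}"
    unfolding cell_elem_int[symmetric] using cell_elem_closed
    by (intro image_cong refl ideal_coset) auto
  also have "\<dots> = fib ` carrier (cell_module X k r cell_elem)"
    by (auto simp: cell_module_def image_iff) (metis fib_trunc)+
  finally show ?thesis .
qed

lemma specht_add: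
  assumes "v \<in> diagram_span k" "w \<in> diagram_span k"
  shows "fib v \<oplus>\<^bsub>S\<^esub> fib w = fib (v + w)"
proof -
  have "fib v \<oplus>\<^bsub>S\<^esub> fib w = (\<Union>x\<in>fib v. \<Union>y\<in>fib w. {x + y})"
    by (simp add: specht_module_def Let_def quotient_module_def set_add_def' regular_module_def)
  also have "\<dots> = fib (v + w)"
  proof (intro equalityI subsetI)
    fix x assume x: "x \<in> fib (v + w)"
    then have "x - w \<in> fib v" using assms by (simp add: fib_def diagram_span_diff trunc_diff trunc_add)
    then show "x \<in> (\<Union>x\<in>fib v. \<Union>y\<in>fib w. {x + y})"
      using mem_fib[OF assms(2)] by (intro UN_I[of "x - w"] UN_I[of w]) simp_all
  qed (auto simp: fib_def trunc_add)
  finally show ?thesis .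
qed

lemma specht_smult:
  assumes "a \<in> diagram_span k" "v \<in> diagram_span k"
  shows "a \<odot>\<^bsub>S\<^esub> fib v = fib (pmul X a v)"
proof -
  have "a \<odot>\<^bsub>S\<^esub> fib v = (\<Union>x\<in>fib v. propagating_ideal k r +>\<^bsub>regular_module (integral_partition_algebra k)\<^esub> (pmul X a x))"
    by (simp add: specht_module_def Let_def quotient_module_def) (simp add: regular_module_def)
  also have "\<dots> = (\<Union>x\<in>fib v. fib (pmul X a v))"
  proof (intro SUP_cong refl)
    fix x assume x: "x \<in> fib v"
    then have "x \<in> diagram_span k" "trunc k r x = trunc k r v" by (auto simp: fib_def)
    then have "trunc k r (pmul X a x) = trunc k r (pmul X a v)"
      using trunc_pmul_right[OF assms(1)] assms(2) by metis
    then show "propagating_ideal k r +>\<^bsub>regular_module (integral_partition_algebra k)\<^esub> (pmul X a x) = fib (pmul X a v)"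
      using ideal_coset[of "pmul X a x" "regular_module (integral_partition_algebra k)"] assms(1) \<open>x \<in> diagram_span k\<close>
      by (simp add: regular_module_def fib_def)
  qed
  also have "\<dots> = fib (pmul X a v)" using mem_fib[OF assms(2)] by auto
  finally show ?thesis .
qed

lemma cell_module_closed:
  fixes q :: "'c::comm_ring_1"
  defines "M \<equiv> cell_module q k r cell_elem"
  shows "0 \<in> carrier M"
    and "x \<in> carrier M \<Longrightarrow> y \<in> carrier M \<Longrightarrow> x + y \<in> carrier M"
    and "x \<in> carrier M \<Longrightarrow> scale c x \<in> carrier M"
    and "x \<in> carrier M \<Longrightarrow> x \<in> diagram_span k"
    and "x \<in> carrier M \<Longrightarrow> trunc k r x = x"
    and "a \<in> diagram_span k \<Longrightarrow> x \<in> carrier M \<Longrightarrow> trunc k r (pmul q a x) \<in> carrier M"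
proof -
  have l: "left_module (partition_algebra q k) M" unfolding M_def by (rule left_module_cell_module[OF cell_elem_closed])
  interpret M: abelian_group M using l by (rule left_moduleD)
  show "0 \<in> carrier M" using M.zero_closed by (simp add: M_def)
  show "x \<in> carrier M \<Longrightarrow> y \<in> carrier M \<Longrightarrow> x + y \<in> carrier M" using M.a_closed by (simp add: M_def)
  show "trunc k r (pmul q a x) \<in> carrier M" if "a \<in> diagram_span k" "x \<in> carrier M" for a x
    using left_moduleD(3)[OF l, of a x] that by (simp add: M_def)
  show "x \<in> diagram_span k" "trunc k r x = x" if "x \<in> carrier M" for x
    using that cell_elem_closed unfolding M_def by (auto elim!: cell_module_carrierE)
  show "scale c x \<in> carrier M" if x: "x \<in> carrier M"
  proof -
    obtain a where a: "a \<in> diagram_span k" "x = trunc k r (pmul q a cell_elem)"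
      using x unfolding M_def by (rule cell_module_carrierE)
    then have "scale c x = trunc k r (pmul q (scale c a) cell_elem)"
      by (simp add: linear_map_scale[OF linear_pmul_left] trunc_scale)
    then show ?thesis unfolding M_def using a(1) by (simp add: cell_module_carrierI)
  qed
qed

lemma cell_module_sum_closed:
  assumes "\<And>i. i \<in> I \<Longrightarrow> f i \<in> carrier (cell_module q k r cell_elem)"
  shows "(\<Sum>i\<in>I. f i) \<in> carrier (cell_module q k r cell_elem)"
  using assms by (induction I rule: infinite_finite_induct) (simp_all add: cell_module_closed)

lemma cell_gen_comb_closed:
  assumes "I \<subseteq> diagrams k"
  shows "(\<Sum>d\<in>I. scale (c d) (cell_gen d)) \<in> carrier (cell_module q k r cell_elem)"
  using assms by (intro cell_module_sum_closed cell_module_closed(3) cell_gen_carrier) blast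

lemma eval_coeffs_cell_module:
  assumes "v \<in> carrier (cell_module X k r cell_elem)"
  shows "eval_coeffs n v \<in> carrier (cell_module n k r cell_elem)"
proof -
  obtain a where a: "a \<in> diagram_span k" "v = trunc k r (pmul X a cell_elem)"
    using assms by (rule cell_module_carrierE)
  then show ?thesis
    by (simp add: eval_coeffs_trunc eval_coeffs_pmul eval_coeffs_cell_elem cell_module_carrierI eval_coeffs_closed)
qed

text \<open>In the basis \<open>B\<close> the entries of the matrix of \<open>d\<close> are powers
  of \<open>n\<close> times rational numbers, and neither \<open>B\<close> nor these numbers nor the
  exponents depend on \<open>n\<close>. The diagonal sums to one polynomial for all
  parameters.\<close>

lemma character_polynomial:
  assumes d: "d \<in> diagrams k"
  shows "\<exists>p. \<forall>n. has_character k (cell_module n k r cell_elem) d (poly p n)"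
proof -
  obtain B m where B: "B \<subseteq> diagrams k" "\<And>b. b \<in> B \<Longrightarrow> removed b (padded k r id) = 0"
    and ex: "\<And>d. d \<in> diagrams k \<Longrightarrow> (cell_gen d :: diagram \<Rightarrow>\<^sub>0 complex) = (\<Sum>b\<in>B. scale (of_rat (m b d)) (cell_gen b))"
    and "\<And>d. d \<in> diagrams k \<Longrightarrow> \<exists>q c. q \<noteq> 0 \<and>
       scale (of_int q) (cell_gen d :: diagram \<Rightarrow>\<^sub>0 int poly) = (\<Sum>b\<in>B. scale (of_int (c b)) (cell_gen b))"
    and ind: "\<And>c b. (\<Sum>b\<in>B. scale (c b) (cell_gen b :: diagram \<Rightarrow>\<^sub>0 complex)) = 0 \<Longrightarrow> b \<in> B \<Longrightarrow> c b = 0"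
    by (rule integral_basis; rule that; assumption)
  have fin: "finite B" using B(1) finite_diagrams by (rule finite_subset)
  define l where "l b = removed d b + removed (compose d b) (padded k r id)" for b
  have "has_character k (cell_module n k r cell_elem) d (\<Sum>b\<in>B. n ^ l b * of_rat (m b (compose d b)))" for n
  proof (rule has_character_additiveI[where g = cell_gen and m = "\<lambda>b' b. n ^ l b * of_rat (m b' (compose d b))"])
    let ?M = "cell_module n k r cell_elem"
    show "abelian_group ?M" by (rule left_moduleD(2)[OF left_module_cell_module[OF cell_elem_closed]])
    show "single (id_diagram (strands k)) c \<odot>\<^bsub>?M\<^esub> v = scale c v" if "v \<in> carrier ?M" for c v
      using that by (simp add: pmul_id_left cell_module_closed trunc_scale)
    show "scale c v \<in> carrier ?M" if "v \<in> carrier ?M" for c v using that by (rule cell_module_closed)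
    show "cell_gen b \<in> carrier ?M" if "b \<in> B" for b using that B(1) by (intro cell_gen_carrier) blast
    show "\<exists>c. v = (\<Sum>b\<in>B. scale (c b) (cell_gen b))" if v: "v \<in> carrier ?M" for v
    proof -
      obtain c where "v = (\<Sum>d\<in>diagrams k. scale (c d) (cell_gen d))" using v by (rule cell_module_expansion)
      also have "\<dots> = (\<Sum>d\<in>diagrams k. \<Sum>b\<in>B. scale (c d * of_rat (m b d)) (cell_gen b))"
        by (rule sum.cong[OF refl]) (subst ex, simp_all add: scale_sum)
      also have "\<dots> = (\<Sum>b\<in>B. scale (\<Sum>d\<in>diagrams k. c d * of_rat (m b d)) (cell_gen b))"
        by (subst sum.swap) (simp add: scale_sum_left)
      finally show ?thesis by (intro exI)
    qed
    show "single d 1 \<odot>\<^bsub>?M\<^esub> cell_gen b = (\<Sum>b'\<in>B. scale (n ^ l b * of_rat (m b' (compose d b))) (cell_gen b'))" if b: "b \<in> B" for b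
    proof -
      have bk: "b \<in> diagrams k" using b B(1) by blast
      have "single d 1 \<odot>\<^bsub>?M\<^esub> cell_gen b = scale (n ^ l b) (cell_gen (compose d b))"
        using act_cell_gen[OF d bk B(2)[OF b], of n] by (simp add: l_def)
      also have "\<dots> = scale (n ^ l b) (\<Sum>b'\<in>B. scale (of_rat (m b' (compose d b))) (cell_gen b'))"
        by (simp only: ex[OF compose_closed[OF d bk]])
      finally show ?thesis by (simp add: scale_sum)
    qed
  qed (use fin ind in simp_all)
  moreover have "(\<Sum>b\<in>B. n ^ l b * of_rat (m b (compose d b))) = poly (\<Sum>b\<in>B. monom (of_rat (m b (compose d b))) (l b)) n" for n :: complex
    by (simp add: poly_sum poly_monom mult.commute)
  ultimately show ?thesis by (intro exI[of _ "\<Sum>b\<in>B. monom (of_rat (m b (compose d b))) (l b)"] allI) (simp only:)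
qed

end

section \<open>Extension of scalars\<close>

locale specht_at = specht + fixes n :: complex
begin

abbreviation "F \<equiv> free_Abelian_group ((UNIV :: complex set) \<times> carrier S)"
abbreviation "MR \<equiv> restrict_to_scalars k S"
abbreviation "K \<equiv> tensor_relations (eval_at n) MR"
abbreviation "XZ \<equiv> cell_module X k r cell_elem"
abbreviation "XC \<equiv> cell_module n k r cell_elem"

text \<open>The specialization of a coset at \<open>n\<close>; truncation makes the choice of a
  representative immaterial.\<close>

definition ev :: "(diagram \<Rightarrow>\<^sub>0 int poly) set \<Rightarrow> (diagram \<Rightarrow>\<^sub>0 complex)" where
  "ev m = eval_coeffs n (trunc k r (SOME w. w \<in> m))"

lemma ev_fib:
  assumes "v \<in> diagram_span k"
  shows "ev (fib v) = eval_coeffs n (trunc k r v)"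
proof -
  have "(SOME w. w \<in> fib v) \<in> fib v" using mem_fib[OF assms] by (rule someI)
  then show ?thesis by (simp add: ev_def fib_def)
qed

lemma ev_fib_carrier: "v \<in> carrier XZ \<Longrightarrow> ev (fib v) = eval_coeffs n v"
  using ev_fib cell_module_closed(4,5) by metis

lemma carrier_cases:
  assumes "m \<in> carrier S"
  obtains v where "v \<in> carrier XZ" "m = fib v" "v \<in> diagram_span k"
  using assms cell_module_closed(4) unfolding specht_carrier by blast

lemma fib_carrier: "v \<in> carrier XZ \<Longrightarrow> fib v \<in> carrier S"
  unfolding specht_carrier by (rule imageI)

lemma MR_smult: "v \<in> diagram_span k \<Longrightarrow> c \<odot>\<^bsub>MR\<^esub> fib v = fib (scale c v)"
proof -
  assume v: "v \<in> diagram_span k"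
  have "single (id_diagram (strands k)) c \<in> diagram_span k"
    using ring.ring_simprules(6)[OF ring_partition_algebra[of X k]] by (auto simp: diagram_span_def split: if_splits)
  then show ?thesis using specht_smult[OF _ v] pmul_id_left[OF v] by simp
qed

text \<open>The map \<open>s \<otimes> m \<mapsto> s * ev m\<close> on the level of the free abelian
  group. The tensor product is understood once its kernel is shown to be exactly the subgroup
  \<open>K\<close> of tensor relations.\<close>

definition psi :: "(complex \<times> (diagram \<Rightarrow>\<^sub>0 int poly) set \<Rightarrow>\<^sub>0 int) \<Rightarrow> (diagram \<Rightarrow>\<^sub>0 complex)" where
  "psi t = (\<Sum>p\<in>keys t. scale (of_int (lookup t p) * fst p) (ev (snd p)))"

lemma psi_superset: "finite A \<Longrightarrow> keys t \<subseteq> A \<Longrightarrow> psi t = (\<Sum>p\<in>A. scale (of_int (lookup t p) * fst p) (ev (snd p)))"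
  unfolding psi_def by (rule sum.mono_neutral_left) (auto simp: in_keys_iff)

lemma psi_diff: "psi (t - t') = psi t - psi t'"
proof -
  let ?A = "keys t \<union> keys t'"
  have "keys (t - t') \<subseteq> ?A" by (rule keys_diff)
  then show ?thesis
    by (subst (1 2 3) psi_superset[of ?A])
      (auto simp: lookup_minus left_diff_distrib sum_subtractf[symmetric] poly_mapping_eq_iff fun_eq_iff lookup_sum intro!: sum.cong)
qed

lemma psi_0 [simp]: "psi 0 = 0"
  by (simp add: psi_def)

lemma psi_add: "psi (t + t') = psi t + psi t'"
  using psi_diff[of t "0 - t'"] psi_diff[of 0 t'] by simp

lemma psi_frag [simp]: "psi (frag_of (s, m)) = scale s (ev m)"
  by (simp add: psi_def)

lemma psi_sum: "psi (\<Sum>i\<in>I. f i) = (\<Sum>i\<in>I. psi (f i))"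
  by (induction I rule: infinite_finite_induct) (simp_all add: psi_add)

definition relators :: "(complex \<times> (diagram \<Rightarrow>\<^sub>0 int poly) set \<Rightarrow>\<^sub>0 int) set" where
  "relators = {frag_of (s + s', m) - frag_of (s, m) - frag_of (s', m) | s s' m. m \<in> carrier MR} \<union>
      {frag_of (s, m \<oplus>\<^bsub>MR\<^esub> m') - frag_of (s, m) - frag_of (s, m') | s m m'.
         m \<in> carrier MR \<and> m' \<in> carrier MR} \<union>
      {frag_of (s * eval_at n c, m) - frag_of (s, c \<odot>\<^bsub>MR\<^esub> m) | s c m. m \<in> carrier MR}"

lemma K_generate: "K = generate F relators"
  by (simp add: tensor_relations_def relators_def tensor_generators_def)

lemma specht_closed:
  assumes "m \<in> carrier S"
  shows "m' \<in> carrier S \<Longrightarrow> m \<oplus>\<^bsub>S\<^esub> m' \<in> carrier S" "c \<odot>\<^bsub>MR\<^esub> m \<in> carrier S"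
proof -
  obtain v where v: "v \<in> carrier XZ" "m = fib v" "v \<in> diagram_span k" using assms by (rule carrier_cases)
  show "c \<odot>\<^bsub>MR\<^esub> m \<in> carrier S"
    unfolding v(2) MR_smult[OF v(3)] by (rule fib_carrier[OF cell_module_closed(3)[OF v(1)]])
  assume "m' \<in> carrier S"
  then obtain v' where v': "v' \<in> carrier XZ" "m' = fib v'" "v' \<in> diagram_span k" by (rule carrier_cases)
  show "m \<oplus>\<^bsub>S\<^esub> m' \<in> carrier S"
    unfolding v(2) v'(2) specht_add[OF v(3) v'(3)] by (rule fib_carrier[OF cell_module_closed(2)[OF v(1) v'(1)]])
qed

lemma F_diff: "t \<in> carrier F \<Longrightarrow> t' \<in> carrier F \<Longrightarrow> t - t' \<in> carrier F"
  using keys_diff[of t t'] by auto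

lemma F_frag: "m \<in> carrier S \<Longrightarrow> frag_of (s, m) \<in> carrier F"
  by simp

lemma relators_F: "relators \<subseteq> carrier F"
  unfolding relators_def restrict_to_scalars_simps(1,3)
  using specht_closed by (intro Un_least subsetI; elim CollectE exE conjE; hypsubst; intro F_diff F_frag; blast)

lemma psi_relators: "t \<in> relators \<Longrightarrow> psi t = 0"
proof -
  have e2: "ev (m \<oplus>\<^bsub>S\<^esub> m') = ev m + ev m'" if m: "m \<in> carrier S" "m' \<in> carrier S" for m m'
  proof -
    obtain v where v: "v \<in> carrier XZ" "m = fib v" "v \<in> diagram_span k" using m(1) by (rule carrier_cases)
    obtain v' where v': "v' \<in> carrier XZ" "m' = fib v'" "v' \<in> diagram_span k" using m(2) by (rule carrier_cases)
    show ?thesis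
      unfolding v(2) v'(2) specht_add[OF v(3) v'(3)] ev_fib_carrier[OF v(1)] ev_fib_carrier[OF v'(1)]
        ev_fib_carrier[OF cell_module_closed(2)[OF v(1) v'(1)]] by (rule eval_coeffs_add)
  qed
  have e3: "ev (c \<odot>\<^bsub>MR\<^esub> m) = scale (eval_at n c) (ev m)" if m: "m \<in> carrier S" for m c
  proof -
    obtain v where v: "v \<in> carrier XZ" "m = fib v" "v \<in> diagram_span k" using m by (rule carrier_cases)
    show ?thesis
      unfolding v(2) MR_smult[OF v(3)] ev_fib_carrier[OF v(1)] ev_fib_carrier[OF cell_module_closed(3)[OF v(1)]]
      by (rule eval_coeffs_scale)
  qed
  show "t \<in> relators \<Longrightarrow> psi t = 0"
    unfolding relators_def restrict_to_scalars_simps(1,3)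
    by (elim UnE CollectE exE conjE; hypsubst; simp only: psi_diff psi_frag e2 e3)
      (simp_all add: scale_add_left scale_add_right mult.commute)
qed

lemma K_subgroup: "subgroup K F"
  unfolding K_generate by (rule group.generate_is_subgroup[OF group_free_Abelian_group relators_F])

lemma K_F: "t \<in> K \<Longrightarrow> t \<in> carrier F"
  using subgroup.subset[OF K_subgroup] by blast

lemma K_0: "0 \<in> K" using subgroup.one_closed[OF K_subgroup] by simp

lemma K_add: "t \<in> K \<Longrightarrow> t' \<in> K \<Longrightarrow> t + t' \<in> K"
  using subgroup.m_closed[OF K_subgroup, of t t'] by simp

lemma K_minus: "t \<in> K \<Longrightarrow> - t \<in> K"
  using subgroup.m_inv_closed[OF K_subgroup, of t] K_F[of t] by simp

lemma K_diff: "t \<in> K \<Longrightarrow> t' \<in> K \<Longrightarrow> t - t' \<in> K"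
  using K_add[of t "- t'"] K_minus[of t'] by simp

lemma K_sum: "(\<And>i. i \<in> I \<Longrightarrow> f i \<in> K) \<Longrightarrow> (\<Sum>i\<in>I. f i) \<in> K"
  by (induction I rule: infinite_finite_induct) (simp_all add: K_0 K_add)

lemma K_relators: "t \<in> relators \<Longrightarrow> t \<in> K"
  unfolding K_generate by (rule generate.incl)

lemma K_add_left: "m \<in> carrier S \<Longrightarrow> frag_of (s + s', m) - frag_of (s, m) - frag_of (s', m) \<in> K"
  by (rule K_relators) (unfold relators_def restrict_to_scalars_simps(1,3), rule UnI1, rule UnI1, blast)

lemma K_add_right: "m \<in> carrier S \<Longrightarrow> m' \<in> carrier S \<Longrightarrow> frag_of (s, m \<oplus>\<^bsub>S\<^esub> m') - frag_of (s, m) - frag_of (s, m') \<in> K"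
  by (rule K_relators) (unfold relators_def restrict_to_scalars_simps(1,3), rule UnI1, rule UnI2, blast)

lemma K_balance: "m \<in> carrier S \<Longrightarrow> frag_of (s * eval_at n c, m) - frag_of (s, c \<odot>\<^bsub>MR\<^esub> m) \<in> K"
  by (rule K_relators) (unfold relators_def restrict_to_scalars_simps(1,3), rule UnI2, blast)

lemma K_zero_left: "m \<in> carrier S \<Longrightarrow> frag_of (0, m) \<in> K"
  using K_minus[OF K_add_left[of m 0 0]] by simp

lemma psi_K: "t \<in> K \<Longrightarrow> psi t = 0"
  unfolding K_generate
proof (induction rule: generate.induct)
  case (inv h)
  then have "inv\<^bsub>F\<^esub> h = 0 - h" using relators_F by auto
  then show ?case using psi_relators[OF inv] by (simp only: psi_diff psi_0 diff_self)
next
  case (eng h1 h2)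
  then show ?case by (simp add: psi_add)
qed (simp_all add: psi_relators)

abbreviation "G d \<equiv> fib (cell_gen d)"

lemma G_carrier: "d \<in> diagrams k \<Longrightarrow> G d \<in> carrier S"
  by (intro fib_carrier cell_gen_carrier)

text \<open>Modulo the relations, additivity in the second factor splits the sum, and balancing
  moves the coefficients, specialized at \<open>n\<close>, into the complex factor.\<close>

lemma frag_expansion_G:
  assumes "finite D" "D \<subseteq> diagrams k"
  shows "frag_of (s, fib (\<Sum>d\<in>D. scale (c d) (cell_gen d))) - (\<Sum>d\<in>D. frag_of (s * eval_at n (c d), G d)) \<in> K"
  using assms
proof (induction D rule: finite_induct)
  case empty
  have z: "fib 0 \<in> carrier S" by (intro fib_carrier cell_module_closed)
  have "fib 0 \<oplus>\<^bsub>S\<^esub> fib 0 = fib 0" using specht_add[of 0 0] by simp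
  then show ?case using K_minus[OF K_add_right[OF z z, of s]] by simp
next
  case (insert d D)
  let ?v = "\<Sum>d\<in>D. scale (c d) (cell_gen d) :: diagram \<Rightarrow>\<^sub>0 int poly" and ?u = "scale (c d) (cell_gen d) :: diagram \<Rightarrow>\<^sub>0 int poly"
  have d: "d \<in> diagrams k" "D \<subseteq> diagrams k" using insert.prems by auto
  have g: "cell_gen d \<in> carrier XZ" by (rule cell_gen_carrier[OF d(1)])
  have v: "?v \<in> carrier XZ" by (rule cell_gen_comb_closed[OF d(2)])
  have u: "?u \<in> carrier XZ" by (rule cell_module_closed(3)[OF g])
  have 1: "frag_of (s, fib (?u + ?v)) - frag_of (s, fib ?u) - frag_of (s, fib ?v) \<in> K"
    using K_add_right[OF fib_carrier[OF u] fib_carrier[OF v]] specht_add[OF cell_module_closed(4)[OF u] cell_module_closed(4)[OF v]] by simp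
  have 2: "frag_of (s * eval_at n (c d), G d) - frag_of (s, fib ?u) \<in> K"
    using K_balance[OF fib_carrier[OF g]] MR_smult[OF cell_module_closed(4)[OF g]] by simp
  from K_add[OF K_diff[OF 1 2] insert.IH[OF d(2)]]
  show ?case using insert.hyps by (simp add: algebra_simps)
qed

lemma psi_closed:
  assumes "t \<in> carrier F"
  shows "psi t \<in> carrier XC"
proof -
  have "keys t \<subseteq> UNIV \<times> carrier S" using assms by simp
  then show ?thesis
  proof (induction rule: frag_induction)
    case zero
    then show ?case by (simp add: cell_module_closed)
  next
    case (one p)
    obtain s m where p: "p = (s, m)" "m \<in> carrier S" using one by blast
    obtain v where v: "v \<in> carrier XZ" "m = fib v" using p(2) by (rule carrier_cases)
    show ?case unfolding p(1) v(2) psi_frag ev_fib_carrier[OF v(1)]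
      by (intro cell_module_closed eval_coeffs_cell_module v(1))
  next
    case (diff a b)
    have "psi a + scale (- 1) (psi b) \<in> carrier XC" using diff by (intro cell_module_closed)
    then show ?case by (simp add: psi_diff scale_minus_one)
  qed
qed

lemma psi_surj:
  assumes "v \<in> carrier XC"
  obtains t where "t \<in> carrier F" "psi t = v"
proof -
  obtain c where c: "v = (\<Sum>d\<in>diagrams k. scale (c d) (cell_gen d))" using assms by (rule cell_module_expansion)
  let ?t = "\<Sum>d\<in>diagrams k. frag_of (c d, G d)"
  have "psi ?t = v"
    unfolding c psi_sum by (rule sum.cong[OF refl]) (simp add: ev_fib_carrier cell_gen_carrier eval_coeffs_cell_gen)
  moreover have "?t \<in> carrier F"
    unfolding carrier_free_Abelian_group_iff using G_carrier by (intro keys_sum_subset) simp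
  ultimately show thesis using that by blast
qed

text \<open>The quotient is spanned by the images of the integral basis: a relation over the integers
  \<open>q g\<^sub>d = \<Sum> c\<^sub>b g\<^sub>b\<close> can be divided by \<open>q\<close> in the complex factor of the tensor product.\<close>

lemma psi_kernel:
  assumes "t \<in> carrier F" "psi t = 0"
  shows "t \<in> K"
proof -
  obtain B and m :: "diagram \<Rightarrow> diagram \<Rightarrow> rat" where B: "B \<subseteq> diagrams k"
    and "\<And>b. b \<in> B \<Longrightarrow> removed b (padded k r id) = 0"
    and "\<And>d. d \<in> diagrams k \<Longrightarrow> (cell_gen d :: diagram \<Rightarrow>\<^sub>0 complex) = (\<Sum>b\<in>B. scale (of_rat (m b d)) (cell_gen b))"
    and ex: "\<And>d. d \<in> diagrams k \<Longrightarrow> \<exists>q c. q \<noteq> 0 \<and>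
       scale (of_int q) (cell_gen d :: diagram \<Rightarrow>\<^sub>0 int poly) = (\<Sum>b\<in>B. scale (of_int (c b)) (cell_gen b))"
    and ind: "\<And>c b. (\<Sum>b\<in>B. scale (c b) (cell_gen b :: diagram \<Rightarrow>\<^sub>0 complex)) = 0 \<Longrightarrow> b \<in> B \<Longrightarrow> c b = 0"
    by (rule integral_basis; rule that; assumption)
  have fin: "finite B" using B finite_diagrams by (rule finite_subset)
  have GB: "G b \<in> carrier S" if "b \<in> B" for b using that B G_carrier by blast
  \<comment> \<open>Congruence modulo \<open>K\<close> to a complex combination of the basis
    tensors. The property is closed under differences, as the induction over the free abelian group
    requires.\<close>
  define P where "P t \<longleftrightarrow> (\<exists>c. t - (\<Sum>b\<in>B. frag_of (c b, G b)) \<in> K)" for t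
  have P0: "P 0"
    unfolding P_def using K_minus[OF K_sum[of B "\<lambda>b. frag_of (0, G b)"]] K_zero_left GB by (intro exI[of _ "\<lambda>_. 0"]) simp
  have P_diff: "P (a - b)" if ab: "P a" "P b" for a b
  proof -
    obtain c c' where c: "a - (\<Sum>b\<in>B. frag_of (c b, G b)) \<in> K" "b - (\<Sum>b\<in>B. frag_of (c' b, G b)) \<in> K"
      using ab unfolding P_def by blast
    have "(\<Sum>b\<in>B. frag_of (c b - c' b + c' b, G b) - frag_of (c b - c' b, G b) - frag_of (c' b, G b)) \<in> K"
      by (intro K_sum K_add_left GB)
    from K_add[OF K_diff[OF c] this] show ?thesis
      unfolding P_def by (intro exI[of _ "\<lambda>b. c b - c' b"]) (simp add: sum_subtractf sum.distrib algebra_simps)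
  qed
  have P_add: "P (a + b)" if "P a" "P b" for a b
    using P_diff[OF that(1) P_diff[OF P0 that(2)]] by simp
  have P_sum: "P (\<Sum>i\<in>I. f i)" if "\<And>i. i \<in> I \<Longrightarrow> P (f i)" for I and f :: "diagram \<Rightarrow> _"
    using that by (induction I rule: infinite_finite_induct) (simp_all add: P0 P_add)
  have P_cong: "P a" if ab: "a - b \<in> K" "P b" for a b
  proof -
    obtain c where c: "b - (\<Sum>b\<in>B. frag_of (c b, G b)) \<in> K" using ab(2) unfolding P_def by blast
    show ?thesis unfolding P_def using K_add[OF ab(1) c] by (intro exI[of _ c]) simp
  qed
  have P_B: "P (frag_of (s, fib (\<Sum>b\<in>B. scale (c b) (cell_gen b))))" for s c
    unfolding P_def by (rule exI[of _ "\<lambda>b. s * eval_at n (c b)"]) (rule frag_expansion_G[OF fin B])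
  have P_G: "P (frag_of (s, G d))" if d: "d \<in> diagrams k" for s d
  proof -
    obtain q c where q: "q \<noteq> 0" "scale (of_int q) (cell_gen d :: diagram \<Rightarrow>\<^sub>0 int poly) = (\<Sum>b\<in>B. scale (of_int (c b)) (cell_gen b))"
      using ex[OF d] by blast
    have g: "cell_gen d \<in> carrier XZ" by (rule cell_gen_carrier[OF d])
    have "frag_of (s, G d) - frag_of (s / of_int q, fib (scale (of_int q) (cell_gen d))) \<in> K"
      using K_balance[OF fib_carrier[OF g], of "s / of_int q" "of_int q"] MR_smult[OF cell_module_closed(4)[OF g]] q(1) by simp
    then show ?thesis using P_B[of _ "\<lambda>b. of_int (c b)"] unfolding q(2) by (rule P_cong)
  qed
  have "keys t \<subseteq> UNIV \<times> carrier S" using assms(1) by simp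
  then have "P t"
  proof (induction rule: frag_induction)
    case (one p)
    obtain s m where p: "p = (s, m)" "m \<in> carrier S" using one by blast
    obtain v where v: "v \<in> carrier XZ" "m = fib v" using p(2) by (rule carrier_cases)
    obtain c where c: "v = (\<Sum>d\<in>diagrams k. scale (c d) (cell_gen d))" using v(1) by (rule cell_module_expansion)
    show ?case unfolding p(1) v(2) c
      by (rule P_cong[OF frag_expansion_G[OF finite_diagrams subset_refl] P_sum]) (rule P_G)
  qed (simp_all add: P0 P_diff)
  then obtain c where c: "t - (\<Sum>b\<in>B. frag_of (c b, G b)) \<in> K" unfolding P_def by blast
  \<comment> \<open>Applying \<open>psi\<close> to the combination gives a relation in the complex
    module, where independence of the basis makes all coefficients vanish.\<close>
  have "psi (\<Sum>b\<in>B. frag_of (c b, G b)) = (\<Sum>b\<in>B. scale (c b) (cell_gen b))"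
    unfolding psi_sum using B by (intro sum.cong refl) (auto simp: ev_fib_carrier cell_gen_carrier eval_coeffs_cell_gen)
  moreover have "psi (\<Sum>b\<in>B. frag_of (c b, G b)) = 0" using psi_K[OF c] assms(2) by (simp add: psi_diff)
  ultimately have "c b = 0" if "b \<in> B" for b using ind that by metis
  then have "(\<Sum>b\<in>B. frag_of (c b, G b)) \<in> K" using K_zero_left GB by (intro K_sum) simp
  from K_add[OF c this] show ?thesis by simp
qed

text \<open>Since \<open>K\<close> is the kernel of \<open>psi\<close>, the cosets that make up the
  tensor product are the fibres of \<open>psi\<close>. This gives the isomorphism starting from the
  concrete module, with no representatives to choose.\<close>

definition level :: "(diagram \<Rightarrow>\<^sub>0 complex) \<Rightarrow> (complex \<times> (diagram \<Rightarrow>\<^sub>0 int poly) set \<Rightarrow>\<^sub>0 int) set" where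
  "level v = {t \<in> carrier F. psi t = v}"

lemma K_level: "K = level 0"
  using psi_kernel psi_K K_F unfolding level_def by blast

lemma K_coset:
  assumes t: "t \<in> carrier F"
  shows "K #>\<^bsub>F\<^esub> t = level (psi t)"
proof -
  have "t' \<in> (\<Union>h\<in>K. {h + t}) \<longleftrightarrow> t' \<in> level (psi t)" for t'
  proof
    assume t': "t' \<in> level (psi t)"
    then have "t' - t \<in> K" unfolding K_level level_def using F_diff[OF _ t] by (simp add: psi_diff)
    then show "t' \<in> (\<Union>h\<in>K. {h + t})" by (intro UN_I[of "t' - t"]) simp_all
  next
    assume "t' \<in> (\<Union>h\<in>K. {h + t})"
    then obtain h where h: "h \<in> K" "t' = h + t" by blast
    then show "t' \<in> level (psi t)"
      using t K_F[OF h(1)] psi_K[OF h(1)] keys_add_subset[of h _ t] by (simp add: level_def psi_add)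
  qed
  then show ?thesis unfolding r_coset_def mult_free_Abelian_group by blast
qed

abbreviation "T \<equiv> specht_module_at k lam n"

lemma T_simps:
  "carrier T = rcosets\<^bsub>F\<^esub> K" "ring.zero T = K" "ring.add T = set_mult F"
  "smult T = (\<lambda>a Y. \<Union>t\<in>Y. K #>\<^bsub>F\<^esub> tensor_action S a t)"
  by (simp_all add: specht_module_at_def extend_scalars_def Let_def tensor_group_def tensor_generators_def FactGroup_def)

text \<open>Specialization respects products and truncation, so \<open>psi\<close> intertwines the
  actions; both sides are additive in \<open>t\<close>, which reduces the claim to
  generators.\<close>

lemma tensor_action_level:
  assumes a: "a \<in> diagram_span k" and t: "t \<in> carrier F"
  shows "tensor_action S a t \<in> carrier F \<and> psi (tensor_action S a t) = trunc k r (pmul n a (psi t))"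
proof -
  have "keys t \<subseteq> UNIV \<times> carrier S" using t by simp
  then show ?thesis
  proof (induction rule: frag_induction)
    case zero
    then show ?case by (simp add: tensor_action_def linear_map_zero[OF linear_pmul_right])
  next
    case (diff x y)
    have "tensor_action S a (x - y) = tensor_action S a x - tensor_action S a y"
      by (simp only: tensor_action_def frag_extend_diff)
    then show ?case using diff F_diff
      by (simp only: psi_diff linear_map_diff[OF linear_pmul_right] trunc_diff)
  next
    case (one p)
    obtain s m where p: "p = (s, m)" "m \<in> carrier S" using one by blast
    obtain v where v: "v \<in> carrier XZ" "m = fib v" "v \<in> diagram_span k" using p(2) by (rule carrier_cases)
    have ad: "d \<in> diagrams k" if "d \<in> keys a" for d using a that unfolding diagram_span_def by blast
    have act: "single d 1 \<odot>\<^bsub>S\<^esub> m = fib (trunc k r (pmul X (single d 1) v))" if "d \<in> keys a" for d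
      unfolding v(2) fib_trunc by (rule specht_smult[OF _ v(3)]) (simp add: ad[OF that])
    have cl: "trunc k r (pmul X (single d 1) v) \<in> carrier XZ" if "d \<in> keys a" for d
      by (rule cell_module_closed(6)[OF _ v(1)]) (simp add: ad[OF that])
    have eq: "tensor_action S a (frag_of p) =
        (\<Sum>d\<in>keys a. frag_of (lookup a d * s, fib (trunc k r (pmul X (single d 1) v))))"
      unfolding p(1) tensor_action_def by (simp add: act)
    have "tensor_action S a (frag_of p) \<in> carrier F"
      unfolding eq carrier_free_Abelian_group_iff using fib_carrier[OF cl] by (intro keys_sum_subset) simp
    moreover have "psi (tensor_action S a (frag_of p)) =
        (\<Sum>d\<in>keys a. scale (lookup a d) (trunc k r (pmul n (single d 1) (psi (frag_of p)))))"
      unfolding eq psi_sum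
      unfolding p(1) v(2)
      by (rule sum.cong[OF refl])
        (simp add: ev_fib_carrier[OF cl] ev_fib_carrier[OF v(1)] eval_coeffs_trunc eval_coeffs_pmul eval_coeffs_single
          linear_map_scale[OF linear_pmul_right] trunc_scale del: fib_trunc)
    moreover have "linear_map (\<lambda>a. trunc k r (pmul n a (psi (frag_of p))))"
      by (rule linear_map_comp[OF linear_trunc linear_pmul_left])
    ultimately show ?case using linear_map_expansion[of "\<lambda>a. trunc k r (pmul n a (psi (frag_of p)))" a] by simp
  qed
qed

lemma module_iso_level: "module_iso (partition_algebra n k) XC T level"
  unfolding module_iso_def T_simps
proof (intro conjI ballI)
  show "bij_betw level (carrier XC) (rcosets\<^bsub>F\<^esub> K)"
    unfolding bij_betw_def
  proof
    show "inj_on level (carrier XC)"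
    proof (rule inj_onI)
      fix x y assume x: "x \<in> carrier XC" and eq: "level x = level y"
      obtain t where "t \<in> carrier F" "psi t = x" using x by (rule psi_surj)
      then have "t \<in> level x" by (simp add: level_def)
      then have "t \<in> level y" using eq by simp
      then show "x = y" using \<open>psi t = x\<close> by (simp add: level_def)
    qed
    have "rcosets\<^bsub>F\<^esub> K = (\<lambda>t. K #>\<^bsub>F\<^esub> t) ` carrier F" unfolding RCOSETS_def by blast
    also have "\<dots> = (\<lambda>t. level (psi t)) ` carrier F" by (rule image_cong[OF refl K_coset])
    also have "\<dots> = level ` carrier XC"
    proof (intro equalityI subsetI)
      fix y assume "y \<in> level ` carrier XC"
      then obtain x where x: "x \<in> carrier XC" "y = level x" by blast
      obtain t where "t \<in> carrier F" "psi t = x" using x(1) by (rule psi_surj)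
      then show "y \<in> (\<lambda>t. level (psi t)) ` carrier F" using x(2) by blast
    qed (use psi_closed in blast)
    finally show "level ` carrier XC = rcosets\<^bsub>F\<^esub> K" by (rule sym)
  qed
  show "level \<zero>\<^bsub>XC\<^esub> = K" by (simp add: K_level)
  show "level (x \<oplus>\<^bsub>XC\<^esub> y) = level x <#>\<^bsub>F\<^esub> level y" if x: "x \<in> carrier XC" and y: "y \<in> carrier XC" for x y
  proof (intro equalityI subsetI)
    fix t assume t: "t \<in> level (x \<oplus>\<^bsub>XC\<^esub> y)"
    obtain t' where t': "t' \<in> carrier F" "psi t' = y" using y by (rule psi_surj)
    have "t - t' \<in> level x" "t' \<in> level y"
      using t t' F_diff by (simp_all add: level_def psi_diff)
    then have "(t - t') + t' \<in> level x <#>\<^bsub>F\<^esub> level y" unfolding set_mult_def mult_free_Abelian_group by blast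
    then show "t \<in> level x <#>\<^bsub>F\<^esub> level y" by simp
  next
    fix t assume "t \<in> level x <#>\<^bsub>F\<^esub> level y"
    then obtain t1 t2 where t: "t1 \<in> level x" "t2 \<in> level y" "t = t1 + t2"
      unfolding set_mult_def mult_free_Abelian_group by blast
    then show "t \<in> level (x \<oplus>\<^bsub>XC\<^esub> y)"
      using keys_add_subset[of t1 _ t2] by (simp add: level_def psi_add)
  qed
  show "level (a \<odot>\<^bsub>XC\<^esub> x) = (\<Union>t\<in>level x. K #>\<^bsub>F\<^esub> tensor_action S a t)"
    if a: "a \<in> carrier (partition_algebra n k)" and x: "x \<in> carrier XC" for a x
  proof -
    have a': "a \<in> diagram_span k" using a by simp
    have "(\<Union>t\<in>level x. K #>\<^bsub>F\<^esub> tensor_action S a t) = (\<Union>t\<in>level x. level (a \<odot>\<^bsub>XC\<^esub> x))"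
    proof (intro SUP_cong refl)
      fix t assume "t \<in> level x"
      then have t: "t \<in> carrier F" "psi t = x" by (simp_all add: level_def)
      show "K #>\<^bsub>F\<^esub> tensor_action S a t = level (a \<odot>\<^bsub>XC\<^esub> x)"
        using tensor_action_level[OF a' t(1)] t(2) K_coset[of "tensor_action S a t"] by simp
    qed
    moreover have "level x \<noteq> {}"
    proof -
      obtain t where "t \<in> carrier F" "psi t = x" using x by (rule psi_surj)
      then show ?thesis by (auto simp: level_def)
    qed
    ultimately show ?thesis by simp
  qed
qed

end

text \<open>An integer that is at most \<open>m + 1/2\<close> is at most \<open>m\<close>; this
  leaves the vertex \<open>m + 1\<close> to the padding.\<close>

lemma boxes_le_tensor_degree: "of_nat r \<le> hval k \<Longrightarrow> r \<le> tensor_degree k"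
proof (cases k)
  case (Half m)
  assume "of_nat r \<le> hval k"
  then have "(of_nat (2 * r) :: rat) \<le> of_nat (2 * m + 1)" using Half by simp
  then show ?thesis using Half unfolding of_nat_le_iff by simp
qed simp

theorem proposition2p43:
  fixes k :: half_integer and lam :: "nat list" and n :: complex
  assumes "hval k > 0"
    and "is_partition lam"
    and "of_nat (sum_list lam) \<le> hval k"
    and "semisimple_ring (complex_partition_algebra k n)"
  shows "is_irreducible_indexed_by k n (specht_module_at k lam n) lam"
proof -
  have r: "sum_list lam \<le> tensor_degree k" by (rule boxes_le_tensor_degree[OF assms(3)])
  interpret specht_at k lam n using assms(2) r by unfold_locales
  have mult: "multiplicity k lam N" if "N \<ge> word_bound k" "N \<ge> 1" for N
    using assms(2) r that by unfold_locales
  \<comment> \<open>The generator does not involve \<open>N\<close>, but it is available only once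
    an admissible \<open>N\<close> is supplied; \<open>max 1 (word_bound k)\<close> is one.\<close>
  have gen: "multiplicity.generator k lam = cell_elem"
    unfolding multiplicity.generator_def[OF mult[of "max 1 (word_bound k)", simplified]] cell_elem_complex ..
  have "trunc k r (cell_elem :: diagram \<Rightarrow>\<^sub>0 complex) \<noteq> 0"
    using multiplicity.trunc_generator_nonzero[OF mult[of "max 1 (word_bound k)"]] by (simp add: gen)
  then have "irreducible_module (partition_algebra n k) XC"
    using multiplicity.generator_rank_one[OF mult[of "max 1 (word_bound k)"]]
    by (intro irreducible_cell_module[OF assms(4) cell_elem_closed]) (simp_all add: gen)
  then have irr: "irreducible_module (partition_algebra n k) T"
    by (rule irreducible_module_iso[OF _ module_iso_level])
  have "\<exists>p. (\<forall>N::nat. of_nat N \<ge> 2 * hval k \<longrightarrow> has_character k (multiplicity_space k N lam) d (poly p (of_nat N))) \<and>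
      has_character k T d (poly p n)" if d: "d \<in> diagrams k" for d
  proof -
    obtain p where p: "\<And>n. has_character k (cell_module n k r cell_elem) d (poly p n)"
      using character_polynomial[OF d] by blast
    have "has_character k (multiplicity_space k N lam) d (poly p (of_nat N))" if N: "of_nat N \<ge> 2 * hval k" for N
    proof -
      \<comment> \<open>The positivity of \<open>k\<close> turns the lower bound on \<open>N\<close>
        into \<open>N \<ge> 1\<close>, as the constructions on tensor space require.\<close>
      have "(0::rat) < of_nat N" using N assms(1) by linarith
      then have m: "multiplicity k lam N" using N mult unfolding hval_word_bound by simp
      show ?thesis using multiplicity.has_character_multiplicity_space[OF m d] p by (simp add: gen)
    qed
    moreover have "has_character k T d (poly p n)"
      by (rule has_character_iso[OF left_module_cell_module[OF cell_elem_closed] module_iso_level d p])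
    ultimately show ?thesis by blast
  qed
  with irr show ?thesis unfolding is_irreducible_indexed_by_def by blast
qed

end
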